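(* Let $\alpha_1$ and $\alpha_2$ be the characteristic functions of subsets $A_1$ and $A_2$ of complex manifolds $X_1$ and $X_2$ respectively, and let $\alpha$ denote the characteristic function of $A=A_1\times A_2$ on the product manifold $X=X_1\times X_2$, so $\alpha(x)=\min\{\alpha_1(x_1),\alpha_2(x_2)\}$ for $x=(x_1,x_2)\in X$. Then for all $x=(x_1,x_2)\in X$, $$EH_L^{\alpha}(x)=\max\{EH_L^{\alpha_1}(x_1),\,EH_L^{\alpha_2}(x_2)\}.$$ If $EH_L^{\alpha_1}$ and $EH_L^{\alpha_2}$ are plurisubharmonic, then for all $x=(x_1,x_2)\in X$, $$G_{\alpha}(x)=\max\{G_{\alpha_1}(x_1),\,G_{\alpha_2}(x_2)\}.$$
   Context: Let $X$ be a complex manifold and $\mathbb D$ the open unit disc. $\mathcal A_X$ is the set of closed analytic discs in $X$: holomorphic maps $f:\mathbb D\to X$ that extend holomorphically to a neighbourhood of $\overline{\mathbb D}$. For a holomorphic map $f:\mathbb D\to X$ and $z\in\mathbb D$, the multiplicity $m_z(f)$ is $+\infty$ if $f$ is constant; otherwise, in local coordinates $\zeta$ on $X$ with $\zeta(f(z))=0$, it is the integer $m$ with $\zeta(f(w))=(w-z)^m g(w)$ near $z$, $g(z)\ne0$. For $\alpha:X\to[0,\infty)$ the Lelong functional is $$H_L^\alpha(f)=\sum_{z\in\mathbb D}\alpha(f(z))\,m_z(f)\,\log|z|,$$ where the (possibly uncountable) sum is the infimum of its finite partial sums, and terms with $\alpha(f(z))=0$ are $0$. Its envelope is $EH_L^\alpha(x)=\inf\{H_L^\alpha(f):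 f\in\mathcal A_X,\ f(0)=x\}$. $\mathrm{PSH}(X)$ is the class of plurisubharmonic functions on $X$, including the constant $-\infty$. The Lelong number of $u\in\mathrm{PSH}(X)$ at $a$ is, in local coordinates centred at $a$, $\nu_u(a)=\lim_{r\to0}\frac{\sup_{|z|=r}u(z)}{\log r}$. Finally, $G_\alpha=\sup\{u\in\mathrm{PSH}(X): u\le0,\ \nu_u\ge\alpha\}$. All these notions are used on $X_1$, $X_2$ and $X$ with $\alpha_1$, $\alpha_2$ and $\alpha$ respectively. *)

theory Defs
  imports "HOL-Complex_Analysis.Complex_Analysis"
begin

section \<open>Complex manifolds\<close>

text \<open>A map between open subsets of complex vector spaces is holomorphic if it is everywhere Frechet
  differentiable with complex-linear derivative.\<close>

definition holomorphic_map_on :: "(complex^'n \<Rightarrow> complex^'m) \<Rightarrow> (complex^'n) set \<Rightarrow> bool"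
    (infixl \<open>(holomorphic'_map'_on)\<close> 50)
  where "f holomorphic_map_on S \<longleftrightarrow>
    (\<forall>x\<in>S. \<exists>f'. (f has_derivative f') (at x within S) \<and> (\<forall>c v. f' (c *s v) = c *s f' v))"

text \<open>A chart is a pair (U, phi); the values of phi outside U are irrelevant. The complex
  dimension is the cardinality of the finite (nonempty) index type, hence at least one.\<close>

type_synonym ('a, 'n) chart = "'a set \<times> ('a \<Rightarrow> complex^'n)"

record ('a, 'n) manifold =
  mtop :: "'a topology"
  atlas :: "('a, 'n) chart set"

abbreviation points :: "('a, 'n::finite) manifold \<Rightarrow> 'a set"
  where "points M \<equiv> topspace (mtop M)"

definition complex_manifold :: "('a, 'n::finite) manifold \<Rightarrow> bool"
  where "complex_manifold M \<longleftrightarrow>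
    Hausdorff_space (mtop M) \<and> second_countable (mtop M) \<and>
    (\<Union>(U, \<phi>)\<in>atlas M. U) = points M \<and>
    (\<forall>(U, \<phi>)\<in>atlas M. openin (mtop M) U \<and> open (\<phi> ` U) \<and>
       homeomorphic_map (subtopology (mtop M) U) (top_of_set (\<phi> ` U)) \<phi>) \<and>
    (\<forall>(U, \<phi>)\<in>atlas M. \<forall>(V, \<psi>)\<in>atlas M.
       (\<psi> \<circ> inv_into U \<phi>) holomorphic_map_on \<phi> ` (U \<inter> V))"

text \<open>An arbitrary chart around a given point. The notions below that use it do not depend on
  the choice.\<close>

definition chart_at :: "('a, 'n::finite) manifold \<Rightarrow> 'a \<Rightarrow> ('a, 'n) chart"
  where "chart_at M a = (SOME c. c \<in> atlas M \<and> a \<in> fst c)"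

definition product_chart :: "('a, 'm::finite) chart \<Rightarrow> ('b, 'n::finite) chart \<Rightarrow> ('a \<times> 'b, 'm + 'n) chart"
  where "product_chart c d =
    (fst c \<times> fst d,
     \<lambda>(x, y). \<chi> i. case i of Inl j \<Rightarrow> snd c x $ j | Inr k \<Rightarrow> snd d y $ k)"

definition product_manifold ::
    "('a, 'm::finite) manifold \<Rightarrow> ('b, 'n::finite) manifold \<Rightarrow> ('a \<times> 'b, 'm + 'n) manifold"
  where "product_manifold M N =
    \<lparr>mtop = prod_topology (mtop M) (mtop N),
     atlas = {product_chart c d | c d. c \<in> atlas M \<and> d \<in> atlas N}\<rparr>"

section \<open>Analytic discs and the Lelong functional\<close>

definition holomorphic_into :: "('a, 'n::finite) manifold \<Rightarrow> (complex \<Rightarrow> 'a) \<Rightarrow> complex set \<Rightarrow> bool"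
  where "holomorphic_into M f S \<longleftrightarrow>
    continuous_map (top_of_set S) (mtop M) f \<and>
    (\<forall>(U, \<phi>)\<in>atlas M. \<forall>i. (\<lambda>z. \<phi> (f z) $ i) holomorphic_on {z\<in>S. f z \<in> U})"

text \<open>Discs are total functions of which only the restriction to the unit disc matters.\<close>

definition closed_discs :: "('a, 'n::finite) manifold \<Rightarrow> (complex \<Rightarrow> 'a) set"
  where "closed_discs M =
    {f. \<exists>g S. open S \<and> cball 0 1 \<subseteq> S \<and> holomorphic_into M g S \<and> (\<forall>z\<in>ball 0 1. f z = g z)}"

definition multiplicity_at :: "('a, 'n::finite) manifold \<Rightarrow> (complex \<Rightarrow> 'a) \<Rightarrow> complex \<Rightarrow> ereal"
  where "multiplicity_at M f z =
    (if f constant_on ball 0 1 then \<infinity>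
     else case chart_at M (f z) of (U, \<phi>) \<Rightarrow>
       ereal (real (THE m. \<exists>r>0. \<exists>g. ball z r \<subseteq> ball 0 1 \<and> f ` ball z r \<subseteq> U \<and>
         (\<forall>i. (\<lambda>w. g w $ i) holomorphic_on ball z r) \<and> g z \<noteq> 0 \<and>
         (\<forall>w\<in>ball z r. \<phi> (f w) - \<phi> (f z) = (w - z) ^ m *s g w))))"

text \<open>The library's real logarithm has the value 0 at 0.\<close>

definition log_norm :: "complex \<Rightarrow> ereal"
  where "log_norm z = (if z = 0 then -\<infinity> else ereal (ln (cmod z)))"

definition lelong_term :: "('a, 'n::finite) manifold \<Rightarrow> ('a \<Rightarrow> real) \<Rightarrow> (complex \<Rightarrow> 'a) \<Rightarrow> complex \<Rightarrow> ereal"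
  where "lelong_term M \<alpha> f z =
    (if \<alpha> (f z) = 0 then 0 else ereal (\<alpha> (f z)) * multiplicity_at M f z * log_norm z)"

definition lelong_functional :: "('a, 'n::finite) manifold \<Rightarrow> ('a \<Rightarrow> real) \<Rightarrow> (complex \<Rightarrow> 'a) \<Rightarrow> ereal"
  where "lelong_functional M \<alpha> f =
    (INF F\<in>{F. finite F \<and> F \<subseteq> ball 0 1}. \<Sum>z\<in>F. lelong_term M \<alpha> f z)"

definition lelong_envelope :: "('a, 'n::finite) manifold \<Rightarrow> ('a \<Rightarrow> real) \<Rightarrow> 'a \<Rightarrow> ereal"
  where "lelong_envelope M \<alpha> x = (INF f\<in>{f\<in>closed_discs M. f 0 = x}. lelong_functional M \<alpha> f)"

section \<open>Plurisubharmonic functions\<close>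

definition usc :: "'a topology \<Rightarrow> ('a \<Rightarrow> ereal) \<Rightarrow> bool"
  where "usc T u \<longleftrightarrow>
    (\<forall>x\<in>topspace T. u x \<noteq> \<infinity>) \<and> (\<forall>c. openin T {x\<in>topspace T. u x < c})"

text \<open>Mean value over a circle, with the Lebesgue integral of an extended real function written
  as the integral of its positive part minus that of its negative part. For upper semicontinuous
  functions the former is finite.\<close>

definition circle_mean :: "(complex \<Rightarrow> ereal) \<Rightarrow> complex \<Rightarrow> real \<Rightarrow> ereal"
  where "circle_mean v c r =
    (enn2ereal (\<integral>\<^sup>+\<theta>\<in>{0..2*pi}. e2ennreal (v (c + of_real r * cis \<theta>)) \<partial>lborel)
     - enn2ereal (\<integral>\<^sup>+\<theta>\<in>{0..2*pi}. e2ennreal (- v (c + of_real r * cis \<theta>)) \<partial>lborel))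
    / ereal (2 * pi)"

text \<open>The function that is identically minus infinity counts as (pluri)subharmonic.\<close>

definition subharmonic_on :: "(complex \<Rightarrow> ereal) \<Rightarrow> complex set \<Rightarrow> bool"
    (infixl \<open>(subharmonic'_on)\<close> 50)
  where "v subharmonic_on S \<longleftrightarrow>
    usc (top_of_set S) v \<and> (\<forall>c. \<forall>r>0. cball c r \<subseteq> S \<longrightarrow> v c \<le> circle_mean v c r)"

definition plurisubharmonic_on :: "(complex^'n \<Rightarrow> ereal) \<Rightarrow> (complex^'n) set \<Rightarrow> bool"
    (infixl \<open>(plurisubharmonic'_on)\<close> 50)
  where "v plurisubharmonic_on S \<longleftrightarrow>
    usc (top_of_set S) v \<and>
    (\<forall>a b. (\<lambda>t. v (a + t *s b)) subharmonic_on {t. a + t *s b \<in> S})"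

definition PSH :: "('a, 'n::finite) manifold \<Rightarrow> ('a \<Rightarrow> ereal) set"
  where "PSH M =
    {u. usc (mtop M) u \<and>
        (\<forall>(U, \<phi>)\<in>atlas M. (u \<circ> inv_into U \<phi>) plurisubharmonic_on \<phi> ` U)}"

text \<open>Instead of a chart centred at a, spheres around the image of a are used.\<close>

definition lelong_number :: "('a, 'n::finite) manifold \<Rightarrow> ('a \<Rightarrow> ereal) \<Rightarrow> 'a \<Rightarrow> ereal"
  where "lelong_number M u a =
    (case chart_at M a of (U, \<phi>) \<Rightarrow>
      Lim (at_right 0) (\<lambda>r. (SUP w\<in>sphere (\<phi> a) r. u (inv_into U \<phi> w)) / ereal (ln r)))"

definition green_function :: "('a, 'n::finite) manifold \<Rightarrow> ('a \<Rightarrow> real) \<Rightarrow> 'a \<Rightarrow> ereal"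
  where "green_function M \<alpha> x =
    (SUP u\<in>{u\<in>PSH M. (\<forall>y\<in>points M. u y \<le> 0) \<and>
                      (\<forall>a\<in>points M. ereal (\<alpha> a) \<le> lelong_number M u a)}. u x)"

end

theory Submission
  imports Defs
begin

text \<open>A disc in the product that meets \<open>A\<^sub>1 \<times> A\<^sub>2\<close> projects to a disc in each factor that meets \<open>A\<^sub>j\<close> at the same
points, with at least the same multiplicities. As all terms of the Lelong functional are nonpositive,
the envelope of the product is at least the maximum of the two envelopes
(\<open>lelong_envelope_projection\<close>).

For the other inequality, take discs \<open>g\<^sub>j\<close> centred at \<open>x\<^sub>j\<close> that meet \<open>A\<^sub>j\<close> at finitely many parameters
\<open>a \<noteq> 0\<close> with multiplicities \<open>k\<^sub>j(a)\<close>, with \<open>\<Sum> k\<^sub>j(a) ln \<bar>a\<bar> < \<beta>\<close>. It suffices to find maps \<open>h\<^sub>1\<close>, \<open>h\<^sub>2\<close>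
with \<open>h\<^sub>j(0) = 0\<close> that take values in the two finite sets at common points, so often and with so high multiplicity that
the logarithms of these points still sum up to less than \<open>\<beta>\<close>: then the disc \<open>(g\<^sub>1 \<circ> h\<^sub>1, g\<^sub>2 \<circ> h\<^sub>2)\<close> shows that the envelope of the product is below \<open>\<beta>\<close>. Let \<open>b\<^sub>j\<close> be
the Blaschke product with zeros \<open>a\<close> of order \<open>k\<^sub>j(a)\<close>. After a dilation of one of the discs
(\<open>rescale_points\<close>) and a rotation, \<open>b\<^sub>1(0) = b\<^sub>2(0) = c\<close> with \<open>ln \<bar>c\<bar> < \<beta>\<close>. If a self-map \<open>P\<close> of the disc
with \<open>P(0) = c\<close> lifts to \<open>P = b\<^sub>j \<circ> h\<^sub>j\<close> for both \<open>j\<close>, then the zeros of \<open>P\<close> are common hits, and if \<open>P\<close>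
is an inner function that is essentially a Blaschke product, then finitely many of them already sum
up to less than \<open>\<beta>\<close>. Only ramification of \<open>b\<^sub>j\<close> prevents a lift (\<open>lift_exists\<close>). Put \<open>P = U\<^sup>M\<close>, where
\<open>M\<close> is a multiple of all multiplicities, so that \<open>P\<close> ramifies enough over \<open>0\<close>, and let \<open>U\<close> be the
universal covering of the disc without the finitely many \<open>M\<close>-th roots of nonzero critical values
of \<open>b\<^sub>1\<close> and \<open>b\<^sub>2\<close>. A covering of a disc punctured at finitely many points other than \<open>0\<close> has
the required property of its zeros (\<open>avoiding_disc_with_many_zeros\<close>). If \<open>c\<close> is itself
a critical value, then the base point is moved slightly and moved back by a polynomial that fixes the
hits (\<open>interpolating_perturbation\<close>). The outcome is \<open>simultaneous_hits\<close>.

Now let \<open>u \<le> 0\<close> be plurisubharmonic with Lelong number at least \<open>1\<close> on \<open>A\<close>. Equivalently, \<open>u\<close> has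
logarithmic poles on \<open>A\<close> (\<open>lelong_number_ge_1_iff_log_pole\<close>). Along a disc that meets \<open>A\<close> at \<open>a\<close> with
multiplicities \<open>k(a)\<close>, the maximum principle compares \<open>u\<close> with \<open>c ln \<bar>b\<bar>\<close> for \<open>c < 1\<close> and the Blaschke
product \<open>b\<close> with zeros \<open>a\<close>; hence the Green function is at most the envelope of the Lelong functional
(\<open>green_function_le_lelong_envelope\<close>). Small affine discs in a chart show that the envelope has logarithmic
poles on \<open>A\<close>, so it is itself a competitor for the Green function as soon as it is plurisubharmonic, and then
both are equal. Finally, a competitor on a factor pulls back to a competitor on the product
(\<open>green_function_pullback\<close>). With \<open>G\<close> for Green functions and \<open>E\<close> for envelopes, this gives
\<open>G \<le> E = max E\<^sub>1 E\<^sub>2 \<le> max G\<^sub>1 G\<^sub>2 \<le> G\<close>.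

The maximum principle is applied to \<open>u \<circ> f\<close> for a holomorphic disc \<open>f\<close>. Instead of subharmonicity of \<open>u \<circ> f\<close>,
which would need smoothing of \<open>u\<close>, the weaker property \<open>no_harmonic_peak\<close> is used. It is inherited by
compositions with discs (\<open>plurisubharmonic_compose_disc\<close>) by a penalisation argument, and it is all
that the maximum principle uses.\<close>

section \<open>Coverings of open subsets of the disc\<close>

abbreviation mob :: "complex \<Rightarrow> complex \<Rightarrow> complex" where "mob \<equiv> Moebius_function 0"

definition self_disc :: "(complex \<Rightarrow> complex) \<Rightarrow> bool"
  where "self_disc f \<longleftrightarrow> f holomorphic_on ball 0 1 \<and> (\<forall>z\<in>ball 0 1. f z \<in> ball 0 1)"

lemma self_discD:
  assumes "self_disc f"
  shows "f holomorphic_on ball 0 1" "z \<in> ball 0 1 \<Longrightarrow> f z \<in> ball 0 1" "norm z < 1 \<Longrightarrow> norm (f z) < 1"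
  using assms by (auto simp: self_disc_def)

lemma mob_denominator: "norm a < 1 \<Longrightarrow> norm z \<le> 1 \<Longrightarrow> 1 - cnj a * z \<noteq> 0"
proof
  assume a: "norm a < 1" "norm z \<le> 1" and "1 - cnj a * z = 0"
  then have "norm (cnj a * z) = 1" by (metis eq_iff_diff_eq_0 norm_one)
  moreover have "norm a * norm z \<le> norm a * 1" using a by (intro mult_left_mono) auto
  ultimately show False using a by (simp add: norm_mult)
qed

lemma self_disc_mob: "norm a < 1 \<Longrightarrow> self_disc (mob a)"
  using Moebius_function_holomorphic Moebius_function_norm_lt_1 by (auto simp: self_disc_def)

lemma mob_inverse: "norm a < 1 \<Longrightarrow> norm z < 1 \<Longrightarrow> mob (- a) (mob a z) = z"
  using Moebius_function_compose[of a "- a" z] Moebius_function_compose[of "- a" a z] by simp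

lemma mob_inverse': "norm a < 1 \<Longrightarrow> norm z < 1 \<Longrightarrow> mob a (mob (- a) z) = z"
  using mob_inverse[of "- a" z] by simp

lemma mob_0 [simp]: "mob a 0 = - a" and mob_self [simp]: "mob a a = 0"
  by (simp_all add: Moebius_function_simple)

lemma mob_eq_0_iff: "norm a < 1 \<Longrightarrow> norm z \<le> 1 \<Longrightarrow> mob a z = 0 \<longleftrightarrow> z = a"
  using mob_denominator[of a z] by (auto simp: Moebius_function_simple)

lemma self_disc_compose: "self_disc f \<Longrightarrow> self_disc g \<Longrightarrow> self_disc (\<lambda>z. f (g z))"
  unfolding self_disc_def
  using holomorphic_on_compose_gen[of g "ball 0 1" f "ball 0 1"] by (auto simp: o_def image_subset_iff)

lemma disc_max_principle:
  assumes "g holomorphic_on ball 0 1" "\<And>z. z \<in> ball 0 1 \<Longrightarrow> norm (g z) \<le> 1"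
    and "z0 \<in> ball 0 1" "norm (g z0) < 1"
  shows "self_disc g"
  unfolding self_disc_def
proof (intro conjI ballI assms(1), rule ccontr)
  fix z assume z: "z \<in> ball 0 1" "g z \<notin> ball 0 1"
  then have "norm (g z) = 1" using assms(2)[OF z(1)] by simp
  then have "g constant_on ball 0 1"
    using assms(2) z(1) by (intro maximum_modulus_principle[OF assms(1), of "ball 0 1" z]) auto
  then have "g z0 = g z" using z(1) assms(3) by (auto simp: constant_on_def)
  then show False using \<open>norm (g z) = 1\<close> assms(4) by simp
qed

lemma montel_disc:
  fixes F :: "nat \<Rightarrow> complex \<Rightarrow> complex"
  assumes "\<And>n. F n holomorphic_on ball 0 1" "\<And>n z. z \<in> ball 0 1 \<Longrightarrow> norm (F n z) \<le> 1"
  obtains g r where "g holomorphic_on ball 0 1" "strict_mono (r :: nat \<Rightarrow> nat)"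
    "\<And>K. compact K \<Longrightarrow> K \<subseteq> ball 0 1 \<Longrightarrow> uniform_limit K (\<lambda>n. F (r n)) g sequentially"
    "\<And>z. z \<in> ball 0 1 \<Longrightarrow> norm (g z) \<le> 1"
proof -
  obtain g r where g: "g holomorphic_on ball 0 1" "strict_mono (r :: nat \<Rightarrow> nat)"
    and l: "\<And>x. x \<in> ball 0 1 \<Longrightarrow> ((\<lambda>n. F (r n) x) \<longlongrightarrow> g x) sequentially"
    and u: "\<And>K. compact K \<Longrightarrow> K \<subseteq> ball 0 1 \<Longrightarrow> uniform_limit K (F \<circ> r) g sequentially"
    using Montel[of "ball 0 1" "range F" F] assms by (smt (verit) image_iff open_ball order_refl subset_iff)
  have "norm (g z) \<le> 1" if "z \<in> ball 0 1" for z
    using tendsto_norm[OF l[OF that]] assms(2)[OF that]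
    by (intro Lim_bounded[where M = 0 and f = "\<lambda>n. norm (F (r n) z)"]) auto
  then show thesis using that g u by (simp add: o_def)
qed

lemma montel_self_disc:
  fixes F :: "nat \<Rightarrow> complex \<Rightarrow> complex"
  assumes "\<And>n. self_disc (F n)"
  obtains g r where "g holomorphic_on ball 0 1" "strict_mono (r :: nat \<Rightarrow> nat)"
    "\<And>K. compact K \<Longrightarrow> K \<subseteq> ball 0 1 \<Longrightarrow> uniform_limit K (\<lambda>n. F (r n)) g sequentially"
    "\<And>z. z \<in> ball 0 1 \<Longrightarrow> norm (g z) \<le> 1"
proof -
  have "F n holomorphic_on ball 0 1" for n using assms self_discD(1) by blast
  moreover have "norm (F n z) \<le> 1" if "z \<in> ball 0 1" for n z
    using self_discD(2)[OF assms that, of n] by simp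
  ultimately show thesis using montel_disc[of F] that by blast
qed

lemma uniform_limit_moving_point:
  fixes F :: "nat \<Rightarrow> complex \<Rightarrow> complex"
  assumes g: "continuous_on (ball 0 1) g"
    and u: "\<And>K. compact K \<Longrightarrow> K \<subseteq> ball 0 1 \<Longrightarrow> uniform_limit K F g sequentially"
    and x: "x \<longlonglongrightarrow> l" "l \<in> ball 0 1"
  shows "(\<lambda>n. F n (x n)) \<longlonglongrightarrow> g l"
proof -
  obtain e where e: "e > 0" "cball l e \<subseteq> ball 0 1" using x(2) open_contains_cball open_ball by blast
  have ev: "\<forall>\<^sub>F n in sequentially. x n \<in> cball l e"
    using tendstoD[OF x(1) e(1)] by eventually_elim (simp add: dist_commute less_imp_le)
  have ev': "\<forall>\<^sub>F n in sequentially. x n \<in> ball 0 1"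
    using ev by eventually_elim (use e(2) in blast)
  have gl: "(\<lambda>n. g (x n)) \<longlonglongrightarrow> g l"
    by (rule continuous_on_tendsto_compose[OF g x]) (rule ev')
  have "(\<lambda>n. dist (F n (x n)) (g (x n))) \<longlonglongrightarrow> 0"
  proof (rule tendstoI)
    fix d :: real assume "d > 0"
    from uniform_limitD[OF u[OF compact_cball e(2)] this] ev
    show "\<forall>\<^sub>F n in sequentially. dist (dist (F n (x n)) (g (x n))) 0 < d"
      by eventually_elim auto
  qed
  then have "(\<lambda>n. F n (x n) - g (x n)) \<longlonglongrightarrow> 0"
    by (simp add: dist_norm tendsto_norm_zero_iff)
  from tendsto_add[OF this gl] show ?thesis by simp
qed

text \<open>A form of the covering property that is stable under locally uniform limits: every disc in \<open>\<Omega>\<close> with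
centre \<open>Q z\<close>, parametrised affinely, lifts to a holomorphic map of the unit disc that starts at \<open>z\<close>.
Values of \<open>Q\<close> outside \<open>\<Omega>\<close> are allowed, so that automorphisms of the disc are examples, and the
covering of \<open>\<Omega>\<close> can be found by solving an extremal problem.\<close>

definition disc_lifting :: "complex set \<Rightarrow> (complex \<Rightarrow> complex) \<Rightarrow> bool"
  where "disc_lifting \<Omega> Q \<longleftrightarrow> self_disc Q \<and>
    (\<forall>z\<in>ball 0 1. \<forall>d>0. cball (Q z) d \<subseteq> \<Omega> \<longrightarrow>
      (\<exists>P. self_disc P \<and> P 0 = z \<and> (\<forall>w\<in>ball 0 1. Q (P w) = Q z + of_real d * w)))"

lemma disc_liftingD:
  assumes "disc_lifting \<Omega> Q"
  shows "self_disc Q"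
    and "z \<in> ball 0 1 \<Longrightarrow> d > 0 \<Longrightarrow> cball (Q z) d \<subseteq> \<Omega> \<Longrightarrow>
      \<exists>P. self_disc P \<and> P 0 = z \<and> (\<forall>w\<in>ball 0 1. Q (P w) = Q z + of_real d * w)"
  using assms by (auto simp: disc_lifting_def)

lemma scaled_in_cball: "d > 0 \<Longrightarrow> w \<in> ball 0 1 \<Longrightarrow> c + of_real d * w \<in> cball (c::complex) d"
  by (auto simp: dist_norm norm_mult)

lemma disc_lifting_mob:
  assumes "\<Omega> \<subseteq> ball 0 1" "norm q < 1"
  shows "disc_lifting \<Omega> (mob q)"
  unfolding disc_lifting_def
proof (intro conjI ballI allI impI)
  show "self_disc (mob q)" using assms self_disc_mob by simp
  fix z d assume z: "z \<in> ball (0::complex) 1" "0 < (d::real)" "cball (mob q z) d \<subseteq> \<Omega>"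
  have in1: "mob q z + of_real d * w \<in> ball 0 1" if "w \<in> ball 0 1" for w
    using scaled_in_cball[OF z(2) that] z(3) assms by blast
  have "self_disc (\<lambda>w. mob (- q) (mob q z + of_real d * w))"
    by (rule self_disc_compose[OF self_disc_mob])
       (use assms in1 in \<open>auto simp: self_disc_def intro!: holomorphic_intros\<close>)
  then show "\<exists>P. self_disc P \<and> P 0 = z \<and> (\<forall>w\<in>ball 0 1. mob q (P w) = mob q z + of_real d * w)"
    using assms(2) z(1) in1
    by (intro exI[of _ "\<lambda>w. mob (- q) (mob q z + of_real d * w)"]) (auto simp: mob_inverse mob_inverse')
qed

lemma disc_lifting_compose_mob:
  assumes "disc_lifting \<Omega> Q" "norm a < 1"
  shows "disc_lifting \<Omega> (\<lambda>z. Q (mob a z))"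
  unfolding disc_lifting_def
proof (intro conjI ballI allI impI)
  show "self_disc (\<lambda>z. Q (mob a z))" using assms self_disc_mob self_disc_compose disc_liftingD(1) by blast
  fix z d assume z: "z \<in> ball (0::complex) 1" "0 < (d::real)" "cball (Q (mob a z)) d \<subseteq> \<Omega>"
  obtain P where P: "self_disc P" "P 0 = mob a z" "\<forall>w\<in>ball 0 1. Q (P w) = Q (mob a z) + of_real d * w"
    using disc_liftingD(2)[OF assms(1) self_discD(2)[OF self_disc_mob[OF assms(2)] z(1)] z(2,3)] by blast
  have "self_disc (\<lambda>w. mob (- a) (P w))" using P(1) assms(2) self_disc_mob self_disc_compose by simp
  then show "\<exists>P. self_disc P \<and> P 0 = z \<and> (\<forall>w\<in>ball 0 1. Q (mob a (P w)) = Q (mob a z) + of_real d * w)"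
    using P z(1) assms(2) self_discD(3)[OF P(1)]
    by (intro exI[of _ "\<lambda>w. mob (- a) (P w)"]) (auto simp: mob_inverse mob_inverse')
qed

lemma self_disc_deriv:
  assumes "self_disc f" "norm z < 1"
  shows "(f has_field_derivative deriv f z) (at z)"
  using assms holomorphic_derivI self_disc_def by fastforce

text \<open>The Schwarz lemma bounds the derivative of the lift of a disc of radius \<open>d\<close> by \<open>1\<close>.\<close>

lemma disc_lifting_deriv_ge:
  assumes "disc_lifting \<Omega> Q" "d > 0" "cball (Q 0) d \<subseteq> \<Omega>"
  shows "d \<le> norm (deriv Q 0)"
proof -
  obtain P where P: "self_disc P" "P 0 = 0" and e: "\<forall>w\<in>ball 0 1. Q (P w) = Q 0 + of_real d * w"
    using disc_liftingD(2)[OF assms(1), of 0 d] assms by auto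
  have "((\<lambda>w. Q (P w)) has_field_derivative deriv Q 0 * deriv P 0) (at 0)"
    using DERIV_chain2[of Q "deriv Q 0" P 0 "deriv P 0" UNIV] P self_disc_deriv[OF P(1), of 0]
      self_disc_deriv[OF disc_liftingD(1)[OF assms(1)], of 0] by simp
  moreover have "((\<lambda>w. Q (P w)) has_field_derivative of_real d) (at 0)"
    by (rule has_field_derivative_transform_within_open[of "\<lambda>w. Q 0 + of_real d * w" _ _ "ball 0 1"])
       (use e in \<open>auto intro!: derivative_eq_intros\<close>)
  ultimately have "deriv Q 0 * deriv P 0 = of_real d" using DERIV_unique by blast
  then have "norm (deriv Q 0) * norm (deriv P 0) = d" using assms(2) by (metis abs_of_pos norm_mult norm_of_real)
  moreover have "norm (deriv P 0) \<le> 1"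
    using Schwarz_Lemma(2)[of P 0] P self_discD by simp
  ultimately show ?thesis by (metis mult_left_le norm_ge_zero)
qed

lemma deriv_compose_mob:
  assumes "self_disc Q" "norm a < 1"
  shows "deriv (\<lambda>z. Q (mob (- a) z)) 0 = deriv Q a * deriv (mob (- a)) 0"
  using assms DERIV_imp_deriv[OF DERIV_chain2[of Q "deriv Q a" "mob (- a)" 0 "deriv (mob (- a)) 0" UNIV]]
    self_disc_deriv[OF assms] self_disc_deriv[OF self_disc_mob[of "- a"], of 0] by simp

lemma disc_lifting_deriv_nonzero:
  assumes "disc_lifting \<Omega> Q" "open \<Omega>" "norm z < 1" "Q z \<in> \<Omega>"
  shows "deriv Q z \<noteq> 0"
proof -
  obtain d where d: "d > 0" "cball (Q z) d \<subseteq> \<Omega>" using assms(2,4) open_contains_cball by blast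
  have "d \<le> norm (deriv (\<lambda>w. Q (mob (- z) w)) 0)"
    using disc_lifting_deriv_ge[OF disc_lifting_compose_mob[OF assms(1), of "- z"] d(1)] assms(3) d(2) by simp
  then show ?thesis
    using deriv_compose_mob[OF disc_liftingD(1)[OF assms(1)] assms(3)] d(1) by auto
qed

text \<open>Montel's theorem applies to the lifts, which are self-maps of the disc. A limit of lifts cannot escape to the
unit circle, because all lifts start at the same point \<open>z\<close>.\<close>

lemma disc_lifting_limit:
  assumes F: "\<And>n. disc_lifting \<Omega> (F n)" and \<Omega>: "open \<Omega>"
    and g: "self_disc g"
    and u: "\<And>K. compact K \<Longrightarrow> K \<subseteq> ball 0 1 \<Longrightarrow> uniform_limit K F g sequentially"
  shows "disc_lifting \<Omega> g"
  unfolding disc_lifting_def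
proof (intro conjI ballI allI impI g)
  fix z d assume z: "z \<in> ball (0::complex) 1" "0 < (d::real)" "cball (g z) d \<subseteq> \<Omega>"
  have gc: "continuous_on (ball 0 1) g" using g self_disc_def holomorphic_on_imp_continuous_on by blast
  have lim: "(\<lambda>n. F n z) \<longlonglongrightarrow> g z" by (rule uniform_limit_moving_point[OF gc u _ z(1)]) auto
  obtain e where e: "e > 0" "\<And>x y. x \<in> cball (g z) d \<Longrightarrow> dist x y < e \<Longrightarrow> y \<in> \<Omega>"
  proof -
    obtain e where e: "e > 0" "{y. infdist y (cball (g z) d) \<le> e} \<subseteq> \<Omega>"
      using compact_in_open_separated[of "cball (g z) d" \<Omega>] z(2,3) \<Omega> by auto
    have "y \<in> \<Omega>" if "x \<in> cball (g z) d" "dist x y < e" for x y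
      using infdist_le[OF that(1), of y] that(2) e(2) by (auto simp: dist_commute)
    then show thesis using that e(1) by blast
  qed
  have "\<forall>\<^sub>F n in sequentially. cball (F n z) d \<subseteq> \<Omega>"
    using tendstoD[OF lim e(1)]
  proof eventually_elim
    case (elim n)
    show ?case
    proof
      fix y assume "y \<in> cball (F n z) d"
      then have "y - F n z + g z \<in> cball (g z) d" by (simp add: dist_norm norm_minus_commute)
      moreover have "dist (y - F n z + g z) y < e" using elim by (simp add: dist_norm norm_minus_commute)
      ultimately show "y \<in> \<Omega>" using e(2) by blast
    qed
  qed
  then obtain N where N: "\<And>n. n \<ge> N \<Longrightarrow> cball (F n z) d \<subseteq> \<Omega>" by (auto simp: eventually_sequentially)
  have "\<forall>n. \<exists>P. self_disc P \<and> P 0 = z \<and> (\<forall>w\<in>ball 0 1. F (n + N) (P w) = F (n + N) z + of_real d * w)"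
    using disc_liftingD(2)[OF F z(1,2)] N by simp
  then obtain P where P: "\<And>n. self_disc (P n)" "\<And>n. P n 0 = z"
    "\<And>n w. w \<in> ball 0 1 \<Longrightarrow> F (n + N) (P n w) = F (n + N) z + of_real d * w" by metis
  obtain p r where p: "p holomorphic_on ball 0 1" "strict_mono (r :: nat \<Rightarrow> nat)"
    "\<And>K. compact K \<Longrightarrow> K \<subseteq> ball 0 1 \<Longrightarrow> uniform_limit K (\<lambda>n. P (r n)) p sequentially"
    "\<And>z. z \<in> ball 0 1 \<Longrightarrow> norm (p z) \<le> 1"
    by (rule montel_self_disc[of P]) (use P(1) in auto)
  have pw: "(\<lambda>n. P (r n) w) \<longlonglongrightarrow> p w" if "w \<in> ball 0 1" for w
    by (rule uniform_limit_moving_point[OF _ p(3) _ that]) (use p(1) holomorphic_on_imp_continuous_on in auto)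
  have p0: "p 0 = z" using LIMSEQ_unique[OF pw[of 0]] P(2) by simp
  have sp: "self_disc p" by (rule disc_max_principle[OF p(1,4), of 0]) (use p0 z(1) in auto)
  have sm: "strict_mono (\<lambda>n. r n + N)" using p(2) by (auto simp: strict_mono_def)
  have "g (p w) = g z + of_real d * w" if w: "w \<in> ball 0 1" for w
  proof -
    have u': "uniform_limit K (\<lambda>n. F (r n + N)) g sequentially" if "compact K" "K \<subseteq> ball 0 1" for K
      using u[OF that] filterlim_subseq[OF sm] unfolding uniform_limit_iff
      by (auto simp: filterlim_iff)
    have "(\<lambda>n. F (r n + N) (P (r n) w)) \<longlonglongrightarrow> g (p w)"
      by (rule uniform_limit_moving_point[OF gc u' pw[OF w] self_discD(2)[OF sp w]])
    moreover have "(\<lambda>n. F (r n + N) z + of_real d * w) \<longlonglongrightarrow> g z + of_real d * w"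
      using LIMSEQ_subseq_LIMSEQ[OF lim sm] by (intro tendsto_intros) (simp add: o_def)
    ultimately show ?thesis using P(3)[OF w] LIMSEQ_unique by simp
  qed
  then show "\<exists>P. self_disc P \<and> P 0 = z \<and> (\<forall>w\<in>ball 0 1. g (P w) = g z + of_real d * w)"
    using sp p0 by blast
qed

lemma disc_sqrt:
  assumes P: "self_disc P" and nz: "\<And>w. w \<in> ball 0 1 \<Longrightarrow> P w \<noteq> 0" and s: "s\<^sup>2 = P 0"
  obtains R where "self_disc R" "R 0 = s" "\<And>w. w \<in> ball 0 1 \<Longrightarrow> (R w)\<^sup>2 = P w"
proof -
  obtain L where L: "L holomorphic_on ball 0 1" "\<And>z. z \<in> ball 0 1 \<Longrightarrow> P z = exp (L z)"
    using contractible_imp_holomorphic_log[OF self_discD(1)[OF P] convex_imp_contractible[OF convex_ball] nz] by blast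
  define c where "c = s / exp (L 0 / 2)"
  define R where "R w = c * exp (L w / 2)" for w
  have e2: "(exp (L w / 2))\<^sup>2 = exp (L w)" for w by (simp add: exp_double[symmetric])
  have c2: "c\<^sup>2 = 1" using s L(2)[of 0] by (simp add: c_def power_divide e2)
  have R2: "(R w)\<^sup>2 = P w" if "w \<in> ball 0 1" for w
    using L(2)[OF that] c2 by (simp add: R_def power_mult_distrib e2)
  have "norm (R w) < 1" if "w \<in> ball 0 1" for w
  proof -
    have "norm (R w) ^ 2 = norm (P w)" using R2[OF that] by (metis norm_power)
    moreover have "norm (P w) < 1" using self_discD(2)[OF P that] by simp
    ultimately show ?thesis by (metis norm_ge_zero one_power2 power2_less_imp_less zero_le_one)
  qed
  then have "self_disc R" unfolding self_disc_def R_def using L(1) by (auto intro!: holomorphic_intros)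
  then show thesis using that R2 by (simp add: R_def c_def)
qed

text \<open>Koebe's square root trick. The map \<open>\<phi>\<close> in the proof is the branched double covering of the disc by itself with
branch value \<open>z1\<close> and \<open>\<phi> 0 = 0\<close>. Lifts of discs in \<open>\<Omega>\<close> under \<open>Q\<close> avoid \<open>z1\<close>, since \<open>Q z1\<close> is not in \<open>\<Omega>\<close>;
hence they lift once more under \<open>\<phi>\<close>. As \<open>\<phi>\<close> is not injective, the Schwarz lemma is strict for it.\<close>

lemma koebe_step:
  assumes Q: "disc_lifting \<Omega> Q" and \<Omega>: "open \<Omega>" "Q 0 \<in> \<Omega>" and z1: "norm z1 < 1" "Q z1 \<notin> \<Omega>"
  obtains Q' where "disc_lifting \<Omega> Q'" "Q' 0 = Q 0" "norm (deriv Q' 0) < norm (deriv Q 0)"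
proof -
  define s where "s = csqrt (- z1)"
  have s2: "s\<^sup>2 = - z1" by (simp add: s_def)
  have ns: "norm s < 1"
    using z1(1) s2 by (metis norm_ge_zero norm_minus_cancel norm_power one_power2 power2_less_imp_less zero_le_one)
  define \<phi> where "\<phi> w = mob (- z1) ((mob (- s) w)\<^sup>2)" for w
  have sq: "self_disc (\<lambda>w. w\<^sup>2)" by (auto simp: self_disc_def norm_power power_less_one_iff intro!: holomorphic_intros)
  have s\<phi>: "self_disc \<phi>" unfolding \<phi>_def
    using z1(1) ns by (intro self_disc_compose[OF self_disc_mob] self_disc_compose[OF sq] self_disc_mob) auto
  have \<phi>0: "\<phi> 0 = 0" using z1(1) by (simp add: \<phi>_def s2)
  have "self_disc (\<lambda>w. Q (\<phi> w))" using self_disc_compose s\<phi> Q disc_liftingD by blast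
  moreover have "\<exists>P. self_disc P \<and> P 0 = z \<and> (\<forall>w\<in>ball 0 1. Q (\<phi> (P w)) = Q (\<phi> z) + of_real d * w)"
    if z: "z \<in> ball 0 1" "0 < (d::real)" "cball (Q (\<phi> z)) d \<subseteq> \<Omega>" for z d
  proof -
    obtain P where P: "self_disc P" "P 0 = \<phi> z" "\<And>w. w \<in> ball 0 1 \<Longrightarrow> Q (P w) = Q (\<phi> z) + of_real d * w"
      using disc_liftingD(2)[OF Q self_discD(2)[OF s\<phi> z(1)] z(2,3)] by blast
    have Pz1: "P w \<noteq> z1" if "w \<in> ball 0 1" for w
      using P(3)[OF that] scaled_in_cball[OF z(2) that] z(3) z1(2) by (metis subsetD)
    have m: "self_disc (\<lambda>w. mob z1 (P w))" using P(1) z1(1) self_disc_mob self_disc_compose by blast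
    obtain R where R: "self_disc R" "R 0 = mob (- s) z" "\<And>w. w \<in> ball 0 1 \<Longrightarrow> (R w)\<^sup>2 = mob z1 (P w)"
    proof (rule disc_sqrt[OF m, of "mob (- s) z"])
      show "mob z1 (P w) \<noteq> 0" if "w \<in> ball 0 1" for w
        using Pz1[OF that] mob_eq_0_iff[OF z1(1)] self_discD(2)[OF P(1) that] by simp
      show "(mob (- s) z)\<^sup>2 = mob z1 (P 0)"
        using P(2) z1(1) self_discD(2)[OF self_disc_compose[OF sq self_disc_mob[of "- s"]] z(1)] ns
        by (simp add: \<phi>_def mob_inverse')
    qed auto
    have "self_disc (\<lambda>w. mob s (R w))" using R(1) ns self_disc_mob self_disc_compose by blast
    moreover have "\<phi> (mob s (R w)) = P w" if "w \<in> ball 0 1" for w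
      using R(3)[OF that] self_discD(2)[OF R(1) that] self_discD(2)[OF P(1) that] ns z1(1)
      by (simp add: \<phi>_def mob_inverse)
    ultimately show ?thesis using P(3) R(2) ns z(1)
      by (intro exI[of _ "\<lambda>w. mob s (R w)"]) (auto simp: mob_inverse')
  qed
  ultimately have "disc_lifting \<Omega> (\<lambda>w. Q (\<phi> w))" by (auto simp: disc_lifting_def)
  moreover have "norm (deriv (\<lambda>w. Q (\<phi> w)) 0) < norm (deriv Q 0)"
  proof -
    have "norm (deriv \<phi> 0) \<le> 1" using Schwarz_Lemma(2)[of \<phi> 0] s\<phi> \<phi>0 self_discD by simp
    moreover have "norm (deriv \<phi> 0) \<noteq> 1"
    proof
      assume "norm (deriv \<phi> 0) = 1"
      then obtain a where a: "\<And>z. norm z < 1 \<Longrightarrow> \<phi> z = a * z" "norm a = 1"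
        using Schwarz_Lemma(3)[of \<phi> 0] s\<phi> \<phi>0 self_discD by auto
      define x where "x = mob s (1/2)" define y where "y = mob s (-1/2)"
      have xy: "norm x < 1" "norm y < 1"
        unfolding x_def y_def using self_discD(3)[OF self_disc_mob[OF ns]] by auto
      have m: "mob (- s) x = 1/2" "mob (- s) y = -(1/2)" using ns by (simp_all add: x_def y_def mob_inverse)
      have "x \<noteq> y" using m by auto
      moreover have "(mob (- s) x)\<^sup>2 = (mob (- s) y)\<^sup>2" unfolding m by simp
      ultimately have "x \<noteq> y" "\<phi> x = \<phi> y" by (auto simp: \<phi>_def)
      then show False using a xy by auto
    qed
    ultimately have "norm (deriv \<phi> 0) < 1" by simp
    moreover have "deriv (\<lambda>w. Q (\<phi> w)) 0 = deriv Q 0 * deriv \<phi> 0"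
      using DERIV_imp_deriv[OF DERIV_chain2[of Q "deriv Q 0" \<phi> 0 "deriv \<phi> 0" UNIV]] \<phi>0
        self_disc_deriv[OF s\<phi>, of 0] self_disc_deriv[OF disc_liftingD(1)[OF Q], of 0] by simp
    moreover have "deriv Q 0 \<noteq> 0" using disc_lifting_deriv_nonzero[OF Q \<Omega>(1) _ \<Omega>(2)] by simp
    ultimately show ?thesis by (simp add: norm_mult)
  qed
  ultimately show thesis using that \<phi>0 by simp
qed

text \<open>By Montel's theorem \<open>\<bar>Q' 0\<bar>\<close> attains its minimum among the maps with the lifting property and
\<open>Q 0 = q\<close>. By Koebe's construction a minimiser has no value outside \<open>\<Omega>\<close>.\<close>

theorem universal_disc_exists:
  assumes \<Omega>: "open \<Omega>" "\<Omega> \<subseteq> ball 0 1" and q: "q \<in> \<Omega>"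
  obtains U where "disc_lifting \<Omega> U" "U 0 = q" "\<And>z. z \<in> ball 0 1 \<Longrightarrow> U z \<in> \<Omega>"
proof -
  define G where "G = {Q. disc_lifting \<Omega> Q \<and> Q 0 = q}"
  define I where "I = (INF Q\<in>G. norm (deriv Q 0))"
  have nq: "norm q < 1" using assms by auto
  have ne: "G \<noteq> {}" using disc_lifting_mob[OF \<Omega>(2), of "- q"] nq by (auto simp: G_def)
  have bd: "bdd_below ((\<lambda>Q. norm (deriv Q 0)) ` G)" by (rule bdd_belowI2[of _ 0]) simp
  have "\<exists>Q\<in>G. norm (deriv Q 0) < I + 1 / Suc n" for n
    using cINF_less_iff[OF ne bd, of "I + 1 / Suc n"] by (simp add: I_def)
  then obtain F where F: "\<And>n. F n \<in> G" "\<And>n. norm (deriv (F n) 0) < I + 1 / Suc n" by metis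
  obtain g r where g: "g holomorphic_on ball 0 1" "strict_mono (r :: nat \<Rightarrow> nat)"
    "\<And>K. compact K \<Longrightarrow> K \<subseteq> ball 0 1 \<Longrightarrow> uniform_limit K (\<lambda>n. F (r n)) g sequentially"
    "\<And>z. z \<in> ball 0 1 \<Longrightarrow> norm (g z) \<le> 1"
    by (rule montel_self_disc[of F]) (use F(1) disc_liftingD(1) in \<open>unfold G_def, blast+\<close>)
  have "(\<lambda>n. F (r n) 0) \<longlonglongrightarrow> g 0"
    by (rule uniform_limit_moving_point[OF _ g(3)]) (use g(1) holomorphic_on_imp_continuous_on in auto)
  then have g0: "g 0 = q" using F(1) by (simp add: G_def LIMSEQ_const_iff)
  have sg: "self_disc g" by (rule disc_max_principle[OF g(1,4), of 0]) (use g0 nq in auto)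
  have dg: "disc_lifting \<Omega> g"
    by (rule disc_lifting_limit[OF _ \<Omega>(1) sg g(3)]) (use F(1) G_def in auto)
  have "uniform_limit (ball 0 (1/2)) (\<lambda>n. F (r n)) g sequentially"
    by (rule uniform_limit_on_subset[OF g(3)[of "cball 0 (1/2)"]]) auto
  then have "(\<lambda>n. deriv (F (r n)) 0) \<longlonglongrightarrow> deriv g 0"
  proof (rule deriv_complex_uniform_limit)
    have "F (r n) holomorphic_on ball 0 (1/2)" for n
    proof -
      have "disc_lifting \<Omega> (F (r n))" using F(1)[of "r n"] unfolding G_def by blast
      then show ?thesis
        by (intro holomorphic_on_subset[OF self_discD(1)[OF disc_liftingD(1)]]) auto
    qed
    then show "\<forall>\<^sub>F n in sequentially. F (r n) holomorphic_on ball 0 (1/2)" by simp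
  qed auto
  then have "(\<lambda>n. norm (deriv (F (r n)) 0)) \<longlonglongrightarrow> norm (deriv g 0)" by (rule tendsto_norm)
  moreover have "(\<lambda>n. I + 1 / Suc (r n)) \<longlonglongrightarrow> I + 0"
    using LIMSEQ_subseq_LIMSEQ[OF LIMSEQ_inverse_real_of_nat g(2)]
    by (intro tendsto_intros) (simp add: o_def inverse_eq_divide)
  ultimately have le: "norm (deriv g 0) \<le> I"
    using LIMSEQ_le[of "\<lambda>n. norm (deriv (F (r n)) 0)" _ "\<lambda>n. I + 1 / Suc (r n)" "I + 0"] F(2)
    by (auto simp: less_imp_le)
  have "g z \<in> \<Omega>" if z: "z \<in> ball 0 1" for z
  proof (rule ccontr)
    assume "g z \<notin> \<Omega>"
    then obtain Q' where "disc_lifting \<Omega> Q'" "Q' 0 = g 0" "norm (deriv Q' 0) < norm (deriv g 0)"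
      using koebe_step[OF dg \<Omega>(1), of z] g0 q z by auto
    then have "Q' \<in> G" "norm (deriv Q' 0) < I" using g0 le by (auto simp: G_def)
    then show False using cINF_lower[OF bd, of Q'] by (simp add: I_def)
  qed
  then show thesis using that dg g0 by blast
qed

section \<open>Zeros of the covering of a punctured disc\<close>

text \<open>The Schwarz lemma, with the zero moved from \<open>0\<close> to \<open>a\<close> by an automorphism.\<close>

lemma schwarz_factor:
  assumes S: "S holomorphic_on ball 0 1" "\<And>z. z \<in> ball 0 1 \<Longrightarrow> norm (S z) \<le> 1"
    and a: "norm a < 1" "S a = 0"
  obtains S' where "S' holomorphic_on ball 0 1" "\<And>z. z \<in> ball 0 1 \<Longrightarrow> norm (S' z) \<le> 1"
    "\<And>z. z \<in> ball 0 1 \<Longrightarrow> S z = mob a z * S' z"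
proof -
  have sS: "self_disc S" by (rule disc_max_principle[OF S, of a]) (use a in auto)
  define f where "f w = S (mob (- a) w)" for w
  have sf: "self_disc f" unfolding f_def by (intro self_disc_compose[OF sS] self_disc_mob) (use a in auto)
  have f0: "f 0 = 0" using a by (simp add: f_def)
  obtain h where h: "h holomorphic_on ball 0 1" "\<And>z. norm z < 1 \<Longrightarrow> f z = z * h z" "deriv f 0 = h 0"
    using Schwarz3[OF self_discD(1)[OF sf] f0] by blast
  have h1: "norm (h z) \<le> 1" if z: "norm z < 1" for z
  proof (cases "z = 0")
    case True
    then show ?thesis using Schwarz_Lemma(2)[OF self_discD(1)[OF sf] f0 self_discD(3)[OF sf] z] h(3) by simp
  next
    case False
    have "norm z * norm (h z) \<le> norm z * 1"
      using Schwarz_Lemma(1)[OF self_discD(1)[OF sf] f0 self_discD(3)[OF sf] z] h(2)[OF z]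
      by (simp add: norm_mult)
    then show ?thesis using False by simp
  qed
  have m: "self_disc (mob a)" using a self_disc_mob by blast
  show thesis
  proof (rule that[of "\<lambda>z. h (mob a z)"])
    show "(\<lambda>z. h (mob a z)) holomorphic_on ball 0 1"
      using holomorphic_on_compose_gen[OF self_discD(1)[OF m] h(1)] self_discD(2)[OF m] by (auto simp: o_def image_subset_iff)
    fix z :: complex assume z: "z \<in> ball 0 1"
    then have mz: "norm (mob a z) < 1" using self_discD[OF m] by auto
    show "norm (h (mob a z)) \<le> 1" by (rule h1[OF mz])
    show "S z = mob a z * h (mob a z)"
      using h(2)[OF mz] z a by (simp add: f_def mob_inverse)
  qed
qed

lemma blaschke_division:
  assumes U: "U holomorphic_on ball 0 1" "\<And>z. z \<in> ball 0 1 \<Longrightarrow> norm (U z) \<le> 1"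
    and Z: "finite Z" "Z \<subseteq> ball 0 1" "\<And>a. a \<in> Z \<Longrightarrow> U a = 0"
  shows "\<exists>S. S holomorphic_on ball 0 1 \<and> (\<forall>z\<in>ball 0 1. norm (S z) \<le> 1) \<and>
    (\<forall>z\<in>ball 0 1. U z = (\<Prod>a\<in>Z. mob a z) * S z)"
  using Z
proof (induction Z rule: finite_induct)
  case empty
  then show ?case using U by (intro exI[of _ U]) auto
next
  case (insert a Z)
  then obtain S where S: "S holomorphic_on ball 0 1" "\<forall>z\<in>ball 0 1. norm (S z) \<le> 1"
    "\<forall>z\<in>ball 0 1. U z = (\<Prod>a\<in>Z. mob a z) * S z" by auto
  have a: "norm a < 1" "U a = 0" using insert.prems by auto
  have "(\<Prod>b\<in>Z. mob b a) \<noteq> 0"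
    using insert.hyps insert.prems(1) a(1) mob_eq_0_iff by (fastforce simp: less_imp_le)
  then have "S a = 0" using S(3) a by simp
  then obtain S' where S': "S' holomorphic_on ball 0 1" "\<And>z. z \<in> ball 0 1 \<Longrightarrow> norm (S' z) \<le> 1"
    "\<And>z. z \<in> ball 0 1 \<Longrightarrow> S z = mob a z * S' z"
    using schwarz_factor[OF S(1) _ a(1)] S(2) by blast
  then show ?case using S(3) insert.hyps by (intro exI[of _ S']) auto
qed

text \<open>Applied to the quotient of \<open>U\<close> by the Blaschke product of its zeros, this says that \<open>U\<close> is a Blaschke product up
to a unimodular constant.

Let \<open>T\<close> be the Blaschke product with zero set \<open>C\<close> and suppose \<open>\<bar>S 0\<bar> < 1\<close>. For large \<open>N\<close> the infimum \<open>\<kappa>\<close> of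
\<open>\<bar>S\<bar>\<^sup>N / \<bar>T \<circ> U\<bar>\<close> is less than \<open>1\<close>. Along a minimising sequence \<open>U\<close> stays away from the unit circle, where
\<open>\<bar>S\<bar> \<ge> \<bar>U\<bar>\<close> makes the ratio at least nearly \<open>1\<close>, and from \<open>C\<close>, where \<open>\<bar>S\<bar> \<ge> \<bar>U\<bar>\<close> is bounded below and \<open>T\<close> vanishes.
Near a limit point of the values of \<open>U\<close>, the lifting property recentres the sequence; in the limit the ratio becomes
the modulus of a zero-free holomorphic function that attains its minimum \<open>\<kappa>\<close>, hence is constant. So all points
nearby are limit points of values of \<open>U\<close> along minimising sequences too. The set \<open>K\<close> of these limit points is
therefore nonempty, closed and open in the plane, but contained in the disc.\<close>

lemma zero_free_majorant_unimodular:
  assumes C: "finite C" "C \<subseteq> ball 0 1" "0 \<notin> C"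
    and U: "disc_lifting (ball 0 1 - C) U" "U 0 \<notin> C"
    and S: "S holomorphic_on ball 0 1" "\<And>z. z \<in> ball 0 1 \<Longrightarrow> S z \<noteq> 0"
      "\<And>z. z \<in> ball 0 1 \<Longrightarrow> norm (U z) \<le> norm (S z)" "\<And>z. z \<in> ball 0 1 \<Longrightarrow> norm (S z) \<le> 1"
  shows "norm (S 0) = 1"
proof (rule ccontr)
  assume "norm (S 0) \<noteq> 1"
  then have S0: "norm (S 0) < 1" using S(4)[of 0] by simp
  define \<Omega> where "\<Omega> = ball 0 1 - C"
  have \<Omega>: "open \<Omega>" unfolding \<Omega>_def using C(1) by (intro open_Diff finite_imp_closed) auto
  have sU: "self_disc U" using U(1) disc_liftingD by blast
  have cC: "norm c < 1" if "c \<in> C" for c using that C(2) by auto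
  define T where "T q = (\<Prod>c\<in>C. mob c q)" for q
  have T0: "T q \<noteq> 0" if "norm q < 1" "q \<notin> C" for q
    using that C(1) cC mob_eq_0_iff by (auto simp: T_def less_imp_le)
  have T1: "norm (T q) \<le> 1" if "norm q < 1" for q
    unfolding T_def prod_norm[symmetric]
    using that cC self_discD(3)[OF self_disc_mob] by (intro prod_le_1) (auto simp: less_imp_le)
  have Tc: "norm (T q) \<le> norm (mob c q)" if "norm q < 1" "c \<in> C" for q c
  proof -
    have "norm (T q) = norm (mob c q) * (\<Prod>c\<in>C - {c}. norm (mob c q))"
      using prod.remove[OF C(1) that(2), of "\<lambda>c. mob c q"] by (simp add: T_def prod_norm norm_mult)
    also have "\<dots> \<le> norm (mob c q) * 1"
      using that cC self_discD(3)[OF self_disc_mob]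
      by (intro mult_left_mono prod_le_1) (auto simp: less_imp_le)
    finally show ?thesis by simp
  qed
  have Thol: "T holomorphic_on ball 0 1" unfolding T_def
    using self_discD(1)[OF self_disc_mob] cC by (intro holomorphic_intros) auto
  have "norm (T (U 0)) > 0" using T0[OF self_discD(3)[OF sU] U(2)] by simp
  then obtain N where N: "norm (S 0) ^ N < norm (T (U 0))"
    using real_arch_pow_inv[OF _ S0] by blast
  define A where "A = {\<kappa>. \<forall>z\<in>ball 0 1. \<kappa> * norm (T (U z)) \<le> norm (S z) ^ N}"
  define \<kappa> where "\<kappa> = Sup A"
  have A0: "0 \<in> A" by (simp add: A_def)
  have AT: "k \<le> norm (S 0) ^ N / norm (T (U 0))" if "k \<in> A" for k
    using that \<open>norm (T (U 0)) > 0\<close> by (auto simp: A_def field_simps dest: bspec[of _ _ 0])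
  then have bA: "bdd_above A" by (rule bdd_aboveI)
  have \<kappa>1: "\<kappa> < 1"
  proof -
    have "\<kappa> \<le> norm (S 0) ^ N / norm (T (U 0))" unfolding \<kappa>_def using A0 AT by (intro cSup_least) auto
    also have "\<dots> < 1" using N \<open>norm (T (U 0)) > 0\<close> by simp
    finally show ?thesis .
  qed
  have \<kappa>0: "\<kappa> \<ge> 0" unfolding \<kappa>_def using A0 bA by (rule cSup_upper)
  have \<kappa>le: "\<kappa> * norm (T (U z)) \<le> norm (S z) ^ N" if z: "z \<in> ball 0 1" for z
  proof (cases "T (U z) = 0")
    case False
    have "\<kappa> \<le> norm (S z) ^ N / norm (T (U z))"
      unfolding \<kappa>_def
    proof (rule cSup_least)
      show "A \<noteq> {}" using A0 by blast
      show "k \<le> norm (S z) ^ N / norm (T (U z))" if "k \<in> A" for k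
        using that z False by (simp add: A_def field_simps)
    qed
    then show ?thesis using False by (simp add: field_simps)
  qed simp
  have near: "\<exists>z\<in>ball 0 1. norm (S z) ^ N < (\<kappa> + e) * norm (T (U z))" if "e > 0" for e
  proof (rule ccontr)
    assume "\<not> ?thesis"
    then have "\<kappa> + e \<in> A" by (auto simp: A_def not_less)
    then have "\<kappa> + e \<le> \<kappa>" unfolding \<kappa>_def using bA by (intro cSup_upper)
    then show False using that by simp
  qed
  \<comment> \<open>the limits of values of \<open>U\<close> along sequences on which the ratio tends to its infimum\<close>
  define K where "K = {q. \<forall>e>0. \<exists>z\<in>ball 0 1. norm (S z) ^ N < (\<kappa> + e) * norm (T (U z)) \<and> dist (U z) q < e}"
  have seq: "\<exists>z. (\<forall>n. z n \<in> ball 0 1) \<and> (\<lambda>n. U (z n)) \<longlonglongrightarrow> q \<and>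
      (\<forall>n. norm (S (z n)) ^ N < (\<kappa> + 1 / Suc n) * norm (T (U (z n))))" if "q \<in> K" for q
  proof -
    have "\<forall>n. \<exists>z\<in>ball 0 1. norm (S z) ^ N < (\<kappa> + 1 / Suc n) * norm (T (U z)) \<and> dist (U z) q < 1 / Suc n"
      using that by (simp add: K_def)
    then obtain z where z: "\<And>n. z n \<in> ball 0 1"
      "\<And>n. norm (S (z n)) ^ N < (\<kappa> + 1 / Suc n) * norm (T (U (z n)))" "\<And>n. dist (U (z n)) q < 1 / Suc n"
      by metis
    have "(\<lambda>n. dist (U (z n)) q) \<longlonglongrightarrow> 0"
      by (rule tendsto_sandwich[OF _ _ tendsto_const LIMSEQ_Suc[OF lim_1_over_n]])
         (use z(3) in \<open>auto simp: less_imp_le\<close>)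
    then have "(\<lambda>n. U (z n)) \<longlonglongrightarrow> q" by (simp add: tendsto_dist_iff[symmetric])
    then show ?thesis using z by blast
  qed
  have inf0: "(\<lambda>n. \<kappa> + 1 / Suc n) \<longlonglongrightarrow> \<kappa>"
    using tendsto_add[OF tendsto_const LIMSEQ_Suc[OF lim_1_over_n], of \<kappa>] by simp
  have K\<Omega>: "q \<in> \<Omega>" if q: "q \<in> K" for q
  proof -
    obtain z where z: "\<And>n. z n \<in> ball 0 1" and lim: "(\<lambda>n. U (z n)) \<longlonglongrightarrow> q"
      and lt: "\<And>n. norm (S (z n)) ^ N < (\<kappa> + 1 / Suc n) * norm (T (U (z n)))" using seq[OF q] by blast
    have Uz: "norm (U (z n)) < 1" for n using self_discD(2)[OF sU z] by simp
    have q1: "norm q \<le> 1"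
      by (rule Lim_bounded[OF tendsto_norm[OF lim], of 0]) (use Uz in \<open>auto simp: less_imp_le\<close>)
    have UT: "norm (U (z n)) ^ N \<le> (\<kappa> + 1 / Suc n) * norm (T (U (z n)))" for n
      using power_mono[OF S(3)[OF z[of n]], of N] lt[of n] by simp
    have limN: "(\<lambda>n. norm (U (z n)) ^ N) \<longlonglongrightarrow> norm q ^ N" by (intro tendsto_intros lim)
    have "norm q ^ N \<le> \<kappa>"
    proof (rule LIMSEQ_le[OF limN inf0])
      have "norm (U (z n)) ^ N \<le> \<kappa> + 1 / Suc n" for n
        using UT[of n] mult_left_mono[OF T1[OF Uz[of n]], of "\<kappa> + 1 / Suc n"] \<kappa>0 by simp
      then show "\<exists>M. \<forall>n\<ge>M. norm (U (z n)) ^ N \<le> \<kappa> + 1 / Suc n" by blast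
    qed
    then have "norm q \<noteq> 1" using \<kappa>1 by auto
    then have q1: "norm q < 1" using q1 by simp
    have "q \<notin> C"
    proof
      assume qC: "q \<in> C"
      have "isCont (mob q) q"
        using holomorphic_on_imp_continuous_on[OF self_discD(1)[OF self_disc_mob[OF q1]]] q1
        by (simp add: continuous_on_eq_continuous_at)
      then have "(\<lambda>n. norm (mob q (U (z n)))) \<longlonglongrightarrow> norm (mob q q)"
        by (intro tendsto_norm isCont_tendsto_compose[OF _ lim])
      from tendsto_mult[OF inf0 this] have "(\<lambda>n. (\<kappa> + 1 / Suc n) * norm (mob q (U (z n)))) \<longlonglongrightarrow> 0" by simp
      moreover have "norm (U (z n)) ^ N \<le> (\<kappa> + 1 / Suc n) * norm (mob q (U (z n)))" for n
        using UT[of n] mult_left_mono[OF Tc[OF Uz[of n] qC], of "\<kappa> + 1 / Suc n"] \<kappa>0 by simp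
      ultimately have "norm q ^ N \<le> 0" using LIMSEQ_le[OF limN] by blast
      then have "q = 0" by (metis norm_le_zero_iff zero_less_power norm_ge_zero not_le zero_less_norm_iff)
      then show False using qC C(3) by simp
    qed
    then show ?thesis using q1 by (simp add: \<Omega>_def)
  qed
  have "K \<noteq> {}"
  proof -
    obtain z where z: "\<And>n. z n \<in> ball 0 1"
      "\<And>n. norm (S (z n)) ^ N < (\<kappa> + 1 / Suc n) * norm (T (U (z n)))"
      using near[of "1 / Suc n" for n] by (metis of_nat_0_less_iff zero_less_Suc zero_less_divide_1_iff)
    have "\<And>n. U (z n) \<in> cball 0 1" using self_discD(2)[OF sU z(1)] by (auto simp: less_imp_le)
    then obtain q r where q: "strict_mono (r :: nat \<Rightarrow> nat)" "((\<lambda>n. U (z n)) \<circ> r) \<longlonglongrightarrow> q"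
      using compact_cball[of 0 1] unfolding compact_def by metis
    have "q \<in> K"
      unfolding K_def
    proof (intro CollectI allI impI)
      fix e :: real assume e: "e > 0"
      have "\<forall>\<^sub>F n in sequentially. dist (U (z (r n))) q < e"
        using tendstoD[OF q(2) e] by (simp add: o_def)
      moreover have "\<forall>\<^sub>F n in sequentially. 1 / real (Suc (r n)) < e"
        using order_tendstoD(2)[OF LIMSEQ_subseq_LIMSEQ[OF LIMSEQ_Suc[OF lim_1_over_n] q(1)] e] by (simp add: o_def)
      ultimately have "\<forall>\<^sub>F n in sequentially. dist (U (z (r n))) q < e \<and> 1 / real (Suc (r n)) < e"
        by eventually_elim simp
      then obtain n where n: "dist (U (z (r n))) q < e" "1 / real (Suc (r n)) < e"
        by (auto simp: eventually_sequentially)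
      have "norm (S (z (r n))) ^ N < (\<kappa> + e) * norm (T (U (z (r n))))"
        using z(2)[of "r n"] n(2)
          mult_right_mono[of "\<kappa> + 1 / real (Suc (r n))" "\<kappa> + e" "norm (T (U (z (r n))))"] by simp
      then show "\<exists>z\<in>ball 0 1. norm (S z) ^ N < (\<kappa> + e) * norm (T (U z)) \<and> dist (U z) q < e"
        using z(1) n(1) by blast
    qed
    then show ?thesis by blast
  qed
  have "closed K"
    unfolding closed_limpt
  proof (intro allI impI)
    fix q assume q: "q islimpt K"
    show "q \<in> K"
      unfolding K_def
    proof (intro CollectI allI impI)
      fix e :: real assume e: "e > 0"
      obtain q' where q': "q' \<in> K" "dist q' q < e / 2" using q e unfolding islimpt_approachable by (meson half_gt_zero)
      obtain z where z: "z \<in> ball 0 1" "norm (S z) ^ N < (\<kappa> + e / 2) * norm (T (U z))" "dist (U z) q' < e / 2"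
        using q'(1) e unfolding K_def by (smt (verit, best) half_gt_zero mem_Collect_eq)
      have "(\<kappa> + e / 2) * norm (T (U z)) \<le> (\<kappa> + e) * norm (T (U z))"
        using e by (intro mult_right_mono) auto
      moreover have "dist (U z) q < e" using dist_triangle_half_l[of "U z" q' e q] z(3) q'(2) by (simp add: dist_commute)
      ultimately show "\<exists>z\<in>ball 0 1. norm (S z) ^ N < (\<kappa> + e) * norm (T (U z)) \<and> dist (U z) q < e"
        using z by force
    qed
  qed
  moreover have "open K"
    unfolding open_contains_ball
  proof
    fix q assume q: "q \<in> K"
    obtain z where z: "\<And>n. z n \<in> ball 0 1" and lim: "(\<lambda>n. U (z n)) \<longlonglongrightarrow> q"
      and lt: "\<And>n. norm (S (z n)) ^ N < (\<kappa> + 1 / Suc n) * norm (T (U (z n)))" using seq[OF q] by blast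
    obtain d' where d': "d' > 0" "cball q d' \<subseteq> \<Omega>" using K\<Omega>[OF q] \<Omega> open_contains_cball by blast
    \<comment> \<open>half the radius leaves room for the lifts around the points \<open>U (z n)\<close>, which only converge to \<open>q\<close>\<close>
    define d where "d = d' / 2"
    have d: "d > 0" using d' by (simp add: d_def)
    have "\<forall>\<^sub>F n in sequentially. cball (U (z n)) d \<subseteq> \<Omega>"
      using tendstoD[OF lim d]
    proof eventually_elim
      case (elim n)
      then have "cball (U (z n)) d \<subseteq> cball q d'" by (auto simp: d_def cball_subset_cball_iff)
      then show ?case using d'(2) by blast
    qed
    then obtain M where M: "\<And>n. n \<ge> M \<Longrightarrow> cball (U (z n)) d \<subseteq> \<Omega>" by (auto simp: eventually_sequentially)
    have "\<forall>n. \<exists>P. self_disc P \<and> P 0 = z (n + M) \<and> (\<forall>w\<in>ball 0 1. U (P w) = U (z (n + M)) + of_real d * w)"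
      using disc_liftingD(2)[OF U(1) z d] M by (simp add: \<Omega>_def)
    then obtain P where P: "\<And>n. self_disc (P n)" "\<And>n. P n 0 = z (n + M)"
      "\<And>n w. w \<in> ball 0 1 \<Longrightarrow> U (P n w) = U (z (n + M)) + of_real d * w" by metis
    have SPhol: "(\<lambda>w. S (P n w)) holomorphic_on ball 0 1" for n
      using holomorphic_on_compose_gen[OF self_discD(1)[OF P(1)] S(1)] self_discD(2)[OF P(1)]
      by (auto simp: o_def image_subset_iff)
    have SP1: "norm (S (P n w)) \<le> 1" if "w \<in> ball 0 1" for n w
      using S(4) self_discD(2)[OF P(1) that] by blast
    obtain g r where g: "g holomorphic_on ball 0 1" "strict_mono (r :: nat \<Rightarrow> nat)"
      "\<And>K. compact K \<Longrightarrow> K \<subseteq> ball 0 1 \<Longrightarrow> uniform_limit K (\<lambda>n w. S (P (r n) w)) g sequentially"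
      "\<And>w. w \<in> ball 0 1 \<Longrightarrow> norm (g w) \<le> 1"
      using montel_disc[of "\<lambda>n w. S (P n w)", OF SPhol SP1] by blast
    have gl: "(\<lambda>n. S (P (r n) w)) \<longlonglongrightarrow> g w" if "w \<in> ball 0 1" for w
      by (rule uniform_limit_moving_point[OF _ g(3) _ that]) (use g(1) holomorphic_on_imp_continuous_on in auto)
    have sm: "strict_mono (\<lambda>n. r n + M)" using g(2) by (auto simp: strict_mono_def)
    have Ul: "(\<lambda>n. U (P (r n) w)) \<longlonglongrightarrow> q + of_real d * w" if "w \<in> ball 0 1" for w
      using LIMSEQ_subseq_LIMSEQ[OF lim sm] P(3)[OF that] by (auto simp: o_def intro!: tendsto_intros)
    have in\<Omega>: "q + of_real d * w \<in> \<Omega>" if "w \<in> ball 0 1" for w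
      using scaled_in_cball[OF d that, of q] d' d_def by (auto simp: subset_iff)
    have Tl: "(\<lambda>n. T (U (P (r n) w))) \<longlonglongrightarrow> T (q + of_real d * w)" if "w \<in> ball 0 1" for w
    proof (rule continuous_on_tendsto_compose[OF holomorphic_on_imp_continuous_on[OF Thol] Ul[OF that]])
      show "q + of_real d * w \<in> ball 0 1" using in\<Omega>[OF that] \<Omega>_def by auto
      show "\<forall>\<^sub>F n in sequentially. U (P (r n) w) \<in> ball 0 1"
        using self_discD(2)[OF sU self_discD(2)[OF P(1) that]] by simp
    qed
    have Tnz: "T (q + of_real d * w) \<noteq> 0" if "w \<in> ball 0 1" for w
      using in\<Omega>[OF that] T0 by (auto simp: \<Omega>_def)
    have gU: "norm (q + of_real d * w) \<le> norm (g w)" if "w \<in> ball 0 1" for w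
      using LIMSEQ_le[OF tendsto_norm[OF Ul[OF that]] tendsto_norm[OF gl[OF that]]]
        S(3) self_discD(2)[OF P(1) that] by blast
    have gT: "\<kappa> * norm (T (q + of_real d * w)) \<le> norm (g w) ^ N" if "w \<in> ball 0 1" for w
      using LIMSEQ_le[OF tendsto_mult[OF tendsto_const tendsto_norm[OF Tl[OF that]]]
          tendsto_power[OF tendsto_norm[OF gl[OF that]]]]
        \<kappa>le self_discD(2)[OF P(1) that] by blast
    have gT0: "norm (g 0) ^ N \<le> \<kappa> * norm (T q)"
    proof (rule LIMSEQ_le)
      show "(\<lambda>n. norm (S (P (r n) 0)) ^ N) \<longlonglongrightarrow> norm (g 0) ^ N" by (intro tendsto_intros gl) simp
      show "(\<lambda>n. (\<kappa> + 1 / Suc (r n + M)) * norm (T (U (P (r n) 0)))) \<longlonglongrightarrow> \<kappa> * norm (T q)"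
        using LIMSEQ_subseq_LIMSEQ[OF inf0 sm] Tl[of 0] by (intro tendsto_intros) (auto simp: o_def)
      show "\<exists>N'. \<forall>n\<ge>N'. norm (S (P (r n) 0)) ^ N \<le> (\<kappa> + 1 / Suc (r n + M)) * norm (T (U (P (r n) 0)))"
        unfolding P(2) by (intro exI[of _ 0] allI impI less_imp_le lt)
    qed
    have gnz: "g w \<noteq> 0" if w: "w \<in> ball 0 1" for w
    proof (cases "g constant_on ball 0 1")
      case True
      have "\<exists>w0\<in>ball 0 1. q + of_real d * w0 \<noteq> 0"
      proof (cases "q = 0")
        case True then show ?thesis using d by (intro bexI[of _ "1/2"]) auto
      next
        case False then show ?thesis by (intro bexI[of _ 0]) auto
      qed
      then obtain w0 where "w0 \<in> ball 0 1" "q + of_real d * w0 \<noteq> 0" by blast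
      then have "g w0 \<noteq> 0" using gU[of w0] by auto
      moreover have "g w = g w0" using True w \<open>w0 \<in> ball 0 1\<close> by (auto simp: constant_on_def)
      ultimately show ?thesis by simp
    next
      case False
      show ?thesis
        by (rule Hurwitz_no_zeros[of "ball 0 1" "\<lambda>n w. S (P (r n) w)" g w, OF _ _ SPhol g(1) g(3) False _ w])
           (use S(2) self_discD(2)[OF P(1)] in auto)
    qed
    \<comment> \<open>\<open>\<bar>f\<bar>\<close> is \<open>\<kappa>\<close> divided by the limit of the ratio, so it is at most \<open>1\<close>, with equality at \<open>0\<close>\<close>
    define f where "f w = of_real \<kappa> * T (q + of_real d * w) / g w ^ N" for w
    have nf: "norm (f w) = \<kappa> * norm (T (q + of_real d * w)) / norm (g w) ^ N" for w
      using \<kappa>0 by (simp add: f_def norm_mult norm_divide norm_power)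
    have "(\<lambda>w. T (q + of_real d * w)) holomorphic_on ball 0 1"
      using holomorphic_on_compose_gen[of "\<lambda>w. q + of_real d * w" "ball 0 1" T "ball 0 1", OF _ Thol] in\<Omega>
      unfolding o_def \<Omega>_def by (simp add: image_subset_iff holomorphic_intros)
    then have fhol: "f holomorphic_on ball 0 1"
      unfolding f_def using g(1) gnz by (intro holomorphic_intros) auto
    have f1: "norm (f w) \<le> 1" if "w \<in> ball 0 1" for w
      using gT[OF that] gnz[OF that] by (simp add: nf)
    have f01: "norm (f 0) = 1"
      using gT[of 0] gT0 gnz[of 0] by (simp add: nf)
    have fw: "norm (f w) = 1" if w: "w \<in> ball 0 1" for w
    proof (rule ccontr)
      assume "norm (f w) \<noteq> 1"
      then have "norm (f w) < 1" using f1[OF w] by simp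
      then have "self_disc f" using disc_max_principle[OF fhol f1 w] by blast
      then show False using f01 self_discD(2)[of f 0] by auto
    qed
    have "q + of_real d * w \<in> K" if w: "w \<in> ball 0 1" for w
      unfolding K_def
    proof (intro CollectI allI impI)
      fix e :: real assume e: "e > 0"
      have eq: "norm (g w) ^ N = \<kappa> * norm (T (q + of_real d * w))"
        using fw[OF w] gnz[OF w] by (simp add: nf)
      have "(\<lambda>n. (\<kappa> + e) * norm (T (U (P (r n) w))) - norm (S (P (r n) w)) ^ N)
          \<longlonglongrightarrow> (\<kappa> + e) * norm (T (q + of_real d * w)) - norm (g w) ^ N"
        by (intro tendsto_intros Tl gl w)
      moreover have "(\<kappa> + e) * norm (T (q + of_real d * w)) - norm (g w) ^ N > 0"
        using e Tnz[OF w] by (simp add: eq algebra_simps)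
      ultimately have "\<forall>\<^sub>F n in sequentially. (\<kappa> + e) * norm (T (U (P (r n) w))) - norm (S (P (r n) w)) ^ N > 0"
        by (rule order_tendstoD(1))
      moreover have "\<forall>\<^sub>F n in sequentially. dist (U (P (r n) w)) (q + of_real d * w) < e"
        by (rule tendstoD[OF Ul[OF w] e])
      ultimately have "\<forall>\<^sub>F n in sequentially. (\<kappa> + e) * norm (T (U (P (r n) w))) - norm (S (P (r n) w)) ^ N > 0 \<and>
          dist (U (P (r n) w)) (q + of_real d * w) < e" by eventually_elim simp
      then obtain n where "norm (S (P (r n) w)) ^ N < (\<kappa> + e) * norm (T (U (P (r n) w)))"
        "dist (U (P (r n) w)) (q + of_real d * w) < e" by (auto simp: eventually_sequentially)
      then show "\<exists>z\<in>ball 0 1. norm (S z) ^ N < (\<kappa> + e) * norm (T (U z)) \<and> dist (U z) (q + of_real d * w) < e"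
        using self_discD(2)[OF P(1) w] by blast
    qed
    moreover have "\<exists>w\<in>ball 0 1. x = q + of_real d * w" if "x \<in> ball q d" for x
      using that d by (intro bexI[of _ "(x - q) / of_real d"]) (auto simp: dist_norm norm_divide norm_minus_commute)
    ultimately have "ball q d \<subseteq> K" by blast
    then show "\<exists>e>0. ball q e \<subseteq> K" using d by blast
  qed
  ultimately have "K = UNIV" using \<open>K \<noteq> {}\<close> clopen by blast
  then have "1 \<in> \<Omega>" using K\<Omega> by blast
  then show False by (simp add: \<Omega>_def)
qed

text \<open>Let \<open>U\<close> be the covering of the punctured disc and divide it by the finite Blaschke products of its zeros in larger
and larger discs. If the products of \<open>\<bar>z\<bar>\<close> over finite sets of zeros were all at least \<open>\<tau>\<close>, then the quotients would
converge along a subsequence to a zero-free function \<open>S\<close> with \<open>\<bar>U\<bar> \<le> \<bar>S\<bar> \<le> 1\<close> and \<open>\<bar>S 0\<bar> \<le> \<bar>q\<bar> / \<tau> < 1\<close>.\<close>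

theorem avoiding_disc_with_many_zeros:
  assumes C: "finite C" "C \<subseteq> ball 0 1" "0 \<notin> C" and q: "norm q < 1" "q \<notin> C" "q \<noteq> 0" and \<tau>: "norm q < \<tau>"
  obtains U Z where "self_disc U" "U 0 = q" "\<And>z. z \<in> ball 0 1 \<Longrightarrow> U z \<notin> C \<and> deriv U z \<noteq> 0"
    "finite Z" "Z \<subseteq> ball 0 1" "\<And>z. z \<in> Z \<Longrightarrow> U z = 0" "(\<Prod>z\<in>Z. norm z) < \<tau>"
proof -
  define \<Omega> where "\<Omega> = ball 0 1 - C"
  have \<Omega>: "open \<Omega>" unfolding \<Omega>_def using C(1) by (intro open_Diff finite_imp_closed) auto
  obtain U where U: "disc_lifting \<Omega> U" "U 0 = q" "\<And>z. z \<in> ball 0 1 \<Longrightarrow> U z \<in> \<Omega>"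
    using universal_disc_exists[OF \<Omega>, of q] q by (auto simp: \<Omega>_def)
  have sU: "self_disc U" using U(1) disc_liftingD by blast
  have dU: "deriv U z \<noteq> 0" if "z \<in> ball 0 1" for z
    using disc_lifting_deriv_nonzero[OF U(1) \<Omega> _ U(3)[OF that]] that by simp
  have U1: "norm (U z) \<le> 1" if "z \<in> ball 0 1" for z using self_discD(2)[OF sU that] by simp
  have "\<exists>Z. finite Z \<and> Z \<subseteq> ball 0 1 \<and> (\<forall>z\<in>Z. U z = 0) \<and> (\<Prod>z\<in>Z. norm z) < \<tau>"
  proof (rule ccontr)
    assume "\<not> ?thesis"
    then have big: "(\<Prod>z\<in>Z. norm z) \<ge> \<tau>" if "finite Z" "Z \<subseteq> ball 0 1" "\<And>z. z \<in> Z \<Longrightarrow> U z = 0" for Z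
      using that by (meson not_le)
    define \<rho> where "\<rho> n = 1 - 1 / real (n + 2)" for n
    have \<rho>: "\<rho> n < 1" for n by (simp add: \<rho>_def)
    define Z where "Z n = {z \<in> cball 0 (\<rho> n). U z = 0}" for n
    have ZD: "Z n \<subseteq> ball 0 1" "\<And>z. z \<in> Z n \<Longrightarrow> U z = 0" for n
      using \<rho>[of n] by (auto simp: Z_def)
    have nc: "\<not> U constant_on ball 0 1"
    proof
      assume "U constant_on ball 0 1"
      then obtain c where "\<And>x. x \<in> ball 0 1 \<Longrightarrow> U x = c" by (auto simp: constant_on_def)
      then have "deriv U 0 = deriv (\<lambda>_. c) 0"
        by (intro deriv_cong_ev) (auto simp: eventually_nhds intro!: exI[of _ "ball 0 1"])
      then show False using dU[of 0] by simp
    qed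
    have Zf: "finite (Z n)" for n
      unfolding Z_def using \<rho>[of n]
      by (intro holomorphic_compact_finite_zeros[OF self_discD(1)[OF sU] open_ball connected_ball compact_cball _ nc]) auto
    define B where "B n z = (\<Prod>a\<in>Z n. mob a z)" for n z
    have "\<forall>n. \<exists>S. S holomorphic_on ball 0 1 \<and> (\<forall>z\<in>ball 0 1. norm (S z) \<le> 1) \<and> (\<forall>z\<in>ball 0 1. U z = B n z * S z)"
      unfolding B_def using blaschke_division[OF self_discD(1)[OF sU] U1 Zf ZD] by simp
    then obtain S where S: "\<And>n. S n holomorphic_on ball 0 1" "\<And>n z. z \<in> ball 0 1 \<Longrightarrow> norm (S n z) \<le> 1"
      "\<And>n z. z \<in> ball 0 1 \<Longrightarrow> U z = B n z * S n z" by metis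
    have Bhol: "B n holomorphic_on ball 0 1" for n
      unfolding B_def using self_discD(1)[OF self_disc_mob] ZD(1)[of n] by (intro holomorphic_intros) auto
    have B1: "norm (B n z) \<le> 1" if "z \<in> ball 0 1" for n z
      unfolding B_def prod_norm[symmetric]
      using that ZD(1)[of n] self_discD(2)[OF self_disc_mob that] by (intro prod_le_1) (force simp: less_imp_le)
    have SU: "norm (U z) \<le> norm (S n z)" if "z \<in> ball 0 1" for n z
      using mult_right_mono[OF B1[OF that, of n], of "norm (S n z)"] S(3)[OF that, of n] by (simp add: norm_mult)
    have Snz: "S n z \<noteq> 0" if "norm z \<le> \<rho> n" for n z
    proof
      assume 0: "S n z = 0"
      have z: "z \<in> ball 0 1" using that \<rho>[of n] by simp
      then have "z \<in> Z n" using that S(3)[OF z, of n] 0 by (simp add: Z_def)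
      then have B0: "B n z = 0" using Zf[of n] unfolding B_def by (intro prod_zero bexI[of _ z]) auto
      have "((\<lambda>z. B n z * S n z) has_field_derivative 0) (at z)"
        using DERIV_mult[OF holomorphic_derivI[OF Bhol[of n] open_ball z] holomorphic_derivI[OF S(1)[of n] open_ball z]]
        by (simp add: 0 B0)
      then have "(U has_field_derivative 0) (at z)"
        by (rule has_field_derivative_transform_within_open[OF _ open_ball z]) (use S(3) in auto)
      then show False using dU[OF z] DERIV_imp_deriv by blast
    qed
    have S0: "norm (S n 0) \<le> norm q / \<tau>" for n
    proof -
      have "norm (B n 0) = (\<Prod>a\<in>Z n. norm a)" by (simp add: B_def prod_norm[symmetric])
      then have "\<tau> \<le> norm (B n 0)" using big[OF Zf ZD] by simp
      then have "\<tau> * norm (S n 0) \<le> norm q"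
        using S(3)[of 0 n] U(2) by (simp add: norm_mult mult_right_mono)
      moreover have "\<tau> > 0" using \<tau> by (meson norm_ge_zero le_less_trans)
      ultimately show ?thesis by (simp add: field_simps)
    qed
    obtain g r where g: "g holomorphic_on ball 0 1" "strict_mono (r :: nat \<Rightarrow> nat)"
      "\<And>K. compact K \<Longrightarrow> K \<subseteq> ball 0 1 \<Longrightarrow> uniform_limit K (\<lambda>n. S (r n)) g sequentially"
      "\<And>z. z \<in> ball 0 1 \<Longrightarrow> norm (g z) \<le> 1"
      using montel_disc[of S, OF S(1,2)] by blast
    have gl: "(\<lambda>n. S (r n) z) \<longlonglongrightarrow> g z" if "z \<in> ball 0 1" for z
      by (rule uniform_limit_moving_point[OF _ g(3) _ that]) (use g(1) holomorphic_on_imp_continuous_on in auto)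
    have gU: "norm (U z) \<le> norm (g z)" if "z \<in> ball 0 1" for z
      by (rule LIMSEQ_le_const[OF tendsto_norm[OF gl[OF that]]]) (use SU[OF that] in blast)
    have gnz: "g z \<noteq> 0" if z: "z \<in> ball 0 1" for z
    proof -
      obtain s where s: "norm z < s" "s < 1" using z dense by auto
      have s0: "s > 0" using s(1) by (meson norm_ge_zero le_less_trans)
      show ?thesis
      proof (cases "g constant_on ball 0 s")
        case True
        then have "g z = g 0" using s(1) s0 by (auto simp: constant_on_def)
        then show ?thesis using gU[of 0] U(2) q(3) by auto
      next
        case False
        obtain M where M: "1 / (1 - s) < real M" using reals_Archimedean2 by blast
        have sub: "ball 0 s \<subseteq> ball (0::complex) 1" using s by auto
        have sr: "strict_mono (\<lambda>n. n + M)" by (simp add: strict_mono_def)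
        have \<rho>s: "s \<le> \<rho> (r (n + M))" for n
        proof -
          have "1 / (1 - s) \<le> real (r (n + M) + 2)"
            using M seq_suble[OF g(2), of "n + M"] by linarith
          then have "1 / real (r (n + M) + 2) \<le> 1 - s" using s(2) by (simp add: field_simps)
          then show ?thesis by (simp add: \<rho>_def)
        qed
        have ul: "uniform_limit K (\<lambda>n. S (r (n + M))) g sequentially" if "compact K" "K \<subseteq> ball 0 s" for K
          using that sub by (intro filterlim_compose[OF g(3) filterlim_subseq[OF sr]]) auto
        have nz: "S (r (n + M)) w \<noteq> 0" if "w \<in> ball 0 s" for n w
          using that \<rho>s[of n] by (intro Snz) auto
        have hol: "S (r (n + M)) holomorphic_on ball 0 s" for n
          using S(1) sub by (rule holomorphic_on_subset)
        show ?thesis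
          by (rule Hurwitz_no_zeros[of "ball 0 s" "\<lambda>n. S (r (n + M))" g z, OF _ _ hol _ ul False nz])
             (use s(1) holomorphic_on_subset[OF g(1) sub] in auto)
      qed
    qed
    have "norm (g 0) = 1"
      by (rule zero_free_majorant_unimodular[OF C U(1)[unfolded \<Omega>_def] _ g(1) gnz gU g(4)]) (use U(2) q in auto)
    moreover have "norm (g 0) \<le> norm q / \<tau>"
      by (rule LIMSEQ_le_const2[OF tendsto_norm[OF gl]]) (use S0 in auto)
    moreover have "norm q / \<tau> < 1" using \<tau> by (metis divide_less_eq_1 norm_ge_zero not_le order.strict_trans2)
    ultimately show False by simp
  qed
  then obtain Z where "finite Z" "Z \<subseteq> ball 0 1" "\<forall>z\<in>Z. U z = 0" "(\<Prod>z\<in>Z. norm z) < \<tau>" by blast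
  then show thesis using that[of U Z] sU U(2) dU U(3) by (auto simp: \<Omega>_def)
qed

section \<open>Lifting through ramified maps of the disc\<close>

definition lift_on :: "(complex \<Rightarrow> complex) \<Rightarrow> (complex \<Rightarrow> complex) \<Rightarrow> complex set \<Rightarrow> (complex \<Rightarrow> complex) \<Rightarrow> bool"
  where "lift_on b P V g \<longleftrightarrow> g holomorphic_on V \<and> (\<forall>z\<in>V. g z \<in> ball 0 1 \<and> b (g z) = P z)"

lemma lift_onD:
  assumes "lift_on b P V g"
  shows "g holomorphic_on V" "z \<in> V \<Longrightarrow> g z \<in> ball 0 1" "z \<in> V \<Longrightarrow> b (g z) = P z"
  using assms by (auto simp: lift_on_def)

lemma lift_on_subset: "lift_on b P V g \<Longrightarrow> W \<subseteq> V \<Longrightarrow> lift_on b P W g"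
  unfolding lift_on_def using holomorphic_on_subset by blast

text \<open>Otherwise every \<open>f i\<close> has only finitely many zeros in a small closed disc, which cannot cover it.\<close>

lemma holomorphic_prod_zero:
  assumes "finite I" "open V" "connected V" "V \<noteq> {}" "\<And>i. i \<in> I \<Longrightarrow> f i holomorphic_on V"
    and "\<And>v. v \<in> V \<Longrightarrow> \<exists>i\<in>I. f i v = (0::complex)"
  shows "\<exists>i\<in>I. \<forall>v\<in>V. f i v = 0"
proof (rule ccontr)
  assume "\<not> ?thesis"
  then have ne: "\<exists>v\<in>V. f i v \<noteq> 0" if "i \<in> I" for i using that by blast
  obtain v0 d where v0: "d > 0" "cball v0 d \<subseteq> V" using assms(2,4) open_contains_cball by blast
  have "finite {v \<in> cball v0 d. f i v = 0}" if i: "i \<in> I" for i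
  proof (cases "f i constant_on V")
    case True
    then have "f i v \<noteq> 0" if "v \<in> V" for v using ne[OF i] that by (auto simp: constant_on_def)
    then have "{v \<in> cball v0 d. f i v = 0} = {}" using v0(2) by blast
    then show ?thesis by (metis finite.emptyI)
  next
    case False
    then show ?thesis
      using holomorphic_compact_finite_zeros[OF assms(5)[OF i] assms(2,3) compact_cball v0(2)] by blast
  qed
  then have "finite (\<Union>i\<in>I. {v \<in> cball v0 d. f i v = 0})" using assms(1) by blast
  moreover have "cball v0 d \<subseteq> (\<Union>i\<in>I. {v \<in> cball v0 d. f i v = 0})" using assms(6) v0(2) by blast
  ultimately have "finite (cball v0 d)" using finite_subset by blast
  then have "finite (ball v0 d)" by (rule finite_subset[OF ball_subset_cball])
  then show False using v0(1) by (metis centre_in_ball empty_iff finite_imp_not_open open_ball)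
qed

text \<open>In the coordinate \<open>\<beta> w = (w - \<zeta>) h(w)\<^sup>1\<^sup>/\<^sup>m\<close>, with inverse \<open>\<gamma>\<close>, the function \<open>(w - \<zeta>)\<^sup>m h(w)\<close> is the \<open>m\<close>-th power map.\<close>

lemma power_chart:
  assumes h: "h holomorphic_on ball \<zeta> r" "h \<zeta> \<noteq> 0" "r > 0" and m: "m > 0" and W: "open W" "\<zeta> \<in> W"
  obtains N \<beta> \<gamma> \<rho> where "open N" "\<zeta> \<in> N" "N \<subseteq> W" "\<rho> > 0" "\<gamma> holomorphic_on ball 0 \<rho>"
    "\<And>u. u \<in> ball 0 \<rho> \<Longrightarrow> \<gamma> u \<in> N" "\<And>w. w \<in> N \<Longrightarrow> \<beta> w \<in> ball 0 \<rho>" "\<And>w. w \<in> N \<Longrightarrow> \<gamma> (\<beta> w) = w"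
    "\<And>u. u \<in> ball 0 \<rho> \<Longrightarrow> \<beta> (\<gamma> u) = u" "\<beta> \<zeta> = 0" "\<And>w. w \<in> N \<Longrightarrow> (\<beta> w) ^ m = (w - \<zeta>) ^ m * h w"
proof -
  have "isCont h \<zeta>"
    using holomorphic_on_imp_continuous_on[OF h(1)] h(3) by (simp add: continuous_on_eq_continuous_at)
  then obtain e where e: "e > 0" "\<And>w. dist w \<zeta> < e \<Longrightarrow> h w \<noteq> 0"
    using continuous_at_avoid[of \<zeta> h 0] h(2) by (auto simp: dist_commute)
  obtain e' where e': "e' > 0" "ball \<zeta> e' \<subseteq> W" using W openE by blast
  define s where "s = min r (min e e')"
  have s: "s > 0" "ball \<zeta> s \<subseteq> W" "ball \<zeta> s \<subseteq> ball \<zeta> r" "\<And>w. w \<in> ball \<zeta> s \<Longrightarrow> h w \<noteq> 0"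
    using h(3) e e' by (auto simp: s_def dist_commute)
  obtain L where L: "L holomorphic_on ball \<zeta> s" "\<And>w. w \<in> ball \<zeta> s \<Longrightarrow> h w = exp (L w)"
    using contractible_imp_holomorphic_log[OF holomorphic_on_subset[OF h(1) s(3)] convex_imp_contractible[OF convex_ball] s(4)] by blast
  define k where "k w = exp (L w / of_nat m)" for w
  have km: "k w ^ m = h w" if "w \<in> ball \<zeta> s" for w
    using L(2)[OF that] m by (simp add: k_def exp_of_nat_mult[symmetric])
  have khol: "k holomorphic_on ball \<zeta> s" unfolding k_def using L(1) m by (intro holomorphic_intros) auto
  define \<beta> where "\<beta> w = (w - \<zeta>) * k w" for w
  have bhol: "\<beta> holomorphic_on ball \<zeta> s" unfolding \<beta>_def using khol by (intro holomorphic_intros)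
  have zs: "\<zeta> \<in> ball \<zeta> s" using s(1) by simp
  have "(\<beta> has_field_derivative k \<zeta>) (at \<zeta>)"
    unfolding \<beta>_def using holomorphic_derivI[OF khol open_ball zs] by (auto intro!: derivative_eq_intros)
  then have "deriv \<beta> \<zeta> \<noteq> 0" by (simp add: DERIV_imp_deriv k_def)
  then obtain t where t: "t > 0" "ball \<zeta> t \<subseteq> ball \<zeta> s" "open (\<beta> ` ball \<zeta> t)" "inj_on \<beta> (ball \<zeta> t)"
    using has_complex_derivative_locally_invertible[OF bhol zs open_ball] by blast
  have bt: "\<beta> holomorphic_on ball \<zeta> t" using bhol t(2) by (rule holomorphic_on_subset)
  obtain \<gamma> where \<gamma>: "\<gamma> holomorphic_on \<beta> ` ball \<zeta> t" "\<And>w. w \<in> ball \<zeta> t \<Longrightarrow> \<gamma> (\<beta> w) = w"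
    using holomorphic_has_inverse[OF bt open_ball t(4)] by metis
  have b0: "\<beta> \<zeta> = 0" by (simp add: \<beta>_def)
  have "0 \<in> \<beta> ` ball \<zeta> t" using t(1) b0 by (metis centre_in_ball imageI)
  then obtain \<rho> where \<rho>: "\<rho> > 0" "ball 0 \<rho> \<subseteq> \<beta> ` ball \<zeta> t" using t(3) openE by blast
  define N where "N = ball \<zeta> t \<inter> \<beta> -` ball 0 \<rho>"
  have "open N" unfolding N_def
    using continuous_open_preimage[OF holomorphic_on_imp_continuous_on[OF bt] open_ball open_ball] .
  show thesis
  proof (rule that[of N \<rho> \<gamma> \<beta>])
    show "\<gamma> u \<in> N" "\<beta> (\<gamma> u) = u" if "u \<in> ball 0 \<rho>" for u
      using that \<rho>(2) \<gamma>(2) by (auto simp: N_def)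
    show "(\<beta> w) ^ m = (w - \<zeta>) ^ m * h w" if "w \<in> N" for w
      using that km[of w] t(2) by (auto simp: N_def \<beta>_def power_mult_distrib)
  qed (use \<open>open N\<close> t \<rho> \<gamma> b0 s(2) holomorphic_on_subset in \<open>auto simp: N_def\<close>)
qed

text \<open>The function \<open>b\<close> is a proper map of the disc to itself. By the last condition, if \<open>b\<close> has ramification order \<open>m\<close> at a
point of the fibre over \<open>P z\<close>, then \<open>P - P z\<close> is an \<open>m\<close>-th power near \<open>z\<close>, so that \<open>P\<close> lifts through
the local model \<open>u \<mapsto> u\<^sup>m\<close> of \<open>b\<close>.\<close>

locale ramified_lifting =
  fixes b P :: "complex \<Rightarrow> complex" and R :: real
  assumes R: "R > 1" and b: "b holomorphic_on ball 0 R"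
    and b_circle: "\<And>z. norm z = 1 \<Longrightarrow> norm (b z) = 1"
    and b_disc: "\<And>z. norm z < 1 \<Longrightarrow> norm (b z) < 1"
    and P: "self_disc P"
    and ramification: "\<And>z \<zeta>. norm z < 1 \<Longrightarrow> norm \<zeta> < 1 \<Longrightarrow> b \<zeta> = P z \<Longrightarrow>
      \<exists>m r h s Q. m > 0 \<and> r > 0 \<and> h holomorphic_on ball \<zeta> r \<and> h \<zeta> \<noteq> 0 \<and>
        (\<forall>w\<in>ball \<zeta> r. b w - b \<zeta> = (w - \<zeta>) ^ m * h w) \<and>
        s > 0 \<and> Q holomorphic_on ball z s \<and> (\<forall>w\<in>ball z s. P w - P z = Q w ^ m)"
begin

text \<open>For \<open>\<zeta>\<close> in the finite fibre \<open>F\<close> over \<open>P z0\<close>, \<open>b\<close> is the power \<open>u\<^sup>m\<close> in a local coordinate and \<open>P\<close> is \<open>Q\<^sup>m\<close>, so \<open>\<omega> Q\<close> is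
a lift for every \<open>m\<close>-th root of unity \<open>\<omega>\<close>. These finitely many lifts \<open>G \<zeta> \<omega>\<close> exhaust the fibres over all values
of \<open>P\<close> near \<open>z0\<close>, because \<open>b\<close> is proper. So at every point an arbitrary lift on a connected subset agrees with
one of them, hence it agrees with one and the same on the whole subset, and extends.\<close>

lemma local_sections:
  assumes z0: "norm z0 < 1"
  shows "\<exists>\<delta>>0. ball z0 \<delta> \<subseteq> ball 0 1 \<and>
    (\<forall>\<zeta>. norm \<zeta> < 1 \<and> b \<zeta> = P z0 \<longrightarrow> (\<exists>G. lift_on b P (ball z0 \<delta>) G \<and> G z0 = \<zeta>)) \<and>
    (\<forall>V g. open V \<and> connected V \<and> V \<noteq> {} \<and> V \<subseteq> ball z0 \<delta> \<and> lift_on b P V g \<longrightarrow>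
       (\<exists>G. lift_on b P (ball z0 \<delta>) G \<and> (\<forall>v\<in>V. G v = g v)))"
proof -
  define F where "F = {\<zeta> \<in> cball 0 1. b \<zeta> - P z0 = 0}"
  have sub: "cball 0 1 \<subseteq> ball (0::complex) R" using R by auto
  have Pz0: "norm (P z0) < 1" using self_discD(3)[OF P z0] .
  have F1: "norm \<zeta> < 1" if "\<zeta> \<in> F" for \<zeta>
    using that b_circle[of \<zeta>] Pz0 by (cases "norm \<zeta> = 1") (auto simp: F_def)
  have Feq: "\<zeta> \<in> F \<longleftrightarrow> norm \<zeta> < 1 \<and> b \<zeta> = P z0" for \<zeta> using F1[of \<zeta>] by (auto simp: F_def)
  have "finite F"
    unfolding F_def
  proof (rule holomorphic_compact_finite_zeros[of _ "ball 0 R"])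
    show "\<not> (\<lambda>\<zeta>. b \<zeta> - P z0) constant_on ball 0 R"
    proof
      assume "(\<lambda>\<zeta>. b \<zeta> - P z0) constant_on ball 0 R"
      then have "b 1 - P z0 = b 0 - P z0" using R unfolding constant_on_def by (metis centre_in_ball mem_ball_0 norm_one order.strict_trans zero_less_one)
      then show False using b_circle[of 1] b_disc[of 0] by auto
    qed
  qed (use b sub in \<open>auto intro!: holomorphic_intros\<close>)
  define sec :: "complex \<Rightarrow> nat \<Rightarrow> complex set \<Rightarrow> (complex \<Rightarrow> complex) \<Rightarrow> (complex \<Rightarrow> complex) \<Rightarrow> real \<Rightarrow>
      (complex \<Rightarrow> complex) \<Rightarrow> real \<Rightarrow> bool"
    where "sec \<zeta> m N \<beta> \<gamma> \<rho> Q s \<longleftrightarrow> m > 0 \<and> open N \<and> \<zeta> \<in> N \<and> N \<subseteq> ball 0 1 \<and> \<rho> > 0 \<and> \<gamma> holomorphic_on ball 0 \<rho> \<and>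
    (\<forall>u\<in>ball 0 \<rho>. \<gamma> u \<in> N \<and> \<beta> (\<gamma> u) = u) \<and> (\<forall>w\<in>N. \<beta> w \<in> ball 0 \<rho> \<and> \<gamma> (\<beta> w) = w \<and> (\<beta> w) ^ m = b w - P z0) \<and>
    \<beta> \<zeta> = 0 \<and> s > 0 \<and> Q holomorphic_on ball z0 s \<and> (\<forall>w\<in>ball z0 s. P w - P z0 = Q w ^ m)" for \<zeta> m N \<beta> \<gamma> \<rho> Q s
  have "\<exists>m N \<beta> \<gamma> \<rho> Q s. sec \<zeta> m N \<beta> \<gamma> \<rho> Q s" if "\<zeta> \<in> F" for \<zeta>
  proof -
    from that have \<zeta>: "norm \<zeta> < 1" "b \<zeta> = P z0" using Feq by auto
    obtain m r h s Q where q: "m > (0::nat)" "r > 0" "h holomorphic_on ball \<zeta> r" "h \<zeta> \<noteq> 0"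
      "\<And>w. w \<in> ball \<zeta> r \<Longrightarrow> b w - b \<zeta> = (w - \<zeta>) ^ m * h w"
      "s > 0" "Q holomorphic_on ball z0 s" "\<forall>w\<in>ball z0 s. P w - P z0 = Q w ^ m"
      using ramification[OF z0 \<zeta>] by blast
    have W: "open (ball 0 1 \<inter> ball \<zeta> r)" "\<zeta> \<in> ball 0 1 \<inter> ball \<zeta> r" using \<zeta> q(2) by auto
    show "\<exists>m N \<beta> \<gamma> \<rho> Q s. sec \<zeta> m N \<beta> \<gamma> \<rho> Q s"
    proof (rule power_chart[OF q(3,4,2,1) W])
    fix N \<beta> \<gamma> \<rho> assume n: "open N" "\<zeta> \<in> N" "N \<subseteq> ball 0 1 \<inter> ball \<zeta> r" "\<rho> > 0" "\<gamma> holomorphic_on ball 0 \<rho>"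
      "\<And>u. u \<in> ball 0 \<rho> \<Longrightarrow> \<gamma> u \<in> N" "\<And>w. w \<in> N \<Longrightarrow> \<beta> w \<in> ball 0 \<rho>" "\<And>w. w \<in> N \<Longrightarrow> \<gamma> (\<beta> w) = w"
      "\<And>u. u \<in> ball 0 \<rho> \<Longrightarrow> \<beta> (\<gamma> u) = u" "\<beta> \<zeta> = 0" "\<And>w. w \<in> N \<Longrightarrow> (\<beta> w) ^ m = (w - \<zeta>) ^ m * h w"
    have c1: "N \<subseteq> ball 0 1" using n(3) by blast
    have c2: "(\<beta> w) ^ m = b w - P z0" if "w \<in> N" for w
      using n(11)[OF that] q(5)[of w] n(3) that \<zeta>(2) by auto
    have c3: "\<forall>u\<in>ball 0 \<rho>. \<gamma> u \<in> N \<and> \<beta> (\<gamma> u) = u" using n(6,9) by blast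
    have c4: "\<forall>w\<in>N. \<beta> w \<in> ball 0 \<rho> \<and> \<gamma> (\<beta> w) = w \<and> (\<beta> w) ^ m = b w - P z0" using n(7,8) c2 by blast
    have "sec \<zeta> m N \<beta> \<gamma> \<rho> Q s"
      unfolding sec_def by (intro conjI) (fact q(1) n(1) n(2) c1 n(4) n(5) c3 c4 n(10) q(6) q(7) q(8))+
    then show "\<exists>m N \<beta> \<gamma> \<rho> Q s. sec \<zeta> m N \<beta> \<gamma> \<rho> Q s" by blast
    qed
  qed
  then obtain m N \<beta> \<gamma> \<rho> Q s where sec: "\<And>\<zeta>. \<zeta> \<in> F \<Longrightarrow> sec \<zeta> (m \<zeta>) (N \<zeta>) (\<beta> \<zeta>) (\<gamma> \<zeta>) (\<rho> \<zeta>) (Q \<zeta>) (s \<zeta>)"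
    by metis
  then have m: "\<And>\<zeta>. \<zeta> \<in> F \<Longrightarrow> m \<zeta> > (0::nat)"
    and N: "\<And>\<zeta>. \<zeta> \<in> F \<Longrightarrow> open (N \<zeta>) \<and> \<zeta> \<in> N \<zeta> \<and> N \<zeta> \<subseteq> ball 0 1"
    and \<rho>: "\<And>\<zeta>. \<zeta> \<in> F \<Longrightarrow> \<rho> \<zeta> > 0" and \<gamma>: "\<And>\<zeta>. \<zeta> \<in> F \<Longrightarrow> \<gamma> \<zeta> holomorphic_on ball 0 (\<rho> \<zeta>)"
    and \<gamma>N: "\<And>\<zeta> u. \<zeta> \<in> F \<Longrightarrow> u \<in> ball 0 (\<rho> \<zeta>) \<Longrightarrow> \<gamma> \<zeta> u \<in> N \<zeta> \<and> \<beta> \<zeta> (\<gamma> \<zeta> u) = u"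
    and \<beta>N: "\<And>\<zeta> w. \<zeta> \<in> F \<Longrightarrow> w \<in> N \<zeta> \<Longrightarrow> \<beta> \<zeta> w \<in> ball 0 (\<rho> \<zeta>) \<and> \<gamma> \<zeta> (\<beta> \<zeta> w) = w \<and> (\<beta> \<zeta> w) ^ m \<zeta> = b w - P z0"
    and \<beta>0: "\<And>\<zeta>. \<zeta> \<in> F \<Longrightarrow> \<beta> \<zeta> \<zeta> = 0"
    and s: "\<And>\<zeta>. \<zeta> \<in> F \<Longrightarrow> s \<zeta> > 0" and Q: "\<And>\<zeta>. \<zeta> \<in> F \<Longrightarrow> Q \<zeta> holomorphic_on ball z0 (s \<zeta>)"
    and PQ: "\<And>\<zeta> w. \<zeta> \<in> F \<Longrightarrow> w \<in> ball z0 (s \<zeta>) \<Longrightarrow> P w - P z0 = Q \<zeta> w ^ m \<zeta>"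
    unfolding sec_def by blast+
  have Q0: "Q \<zeta> z0 = 0" if "\<zeta> \<in> F" for \<zeta>
    using PQ[OF that, of z0] s[OF that] m[OF that] by simp
  define K where "K = cball 0 1 - (\<Union>\<zeta>\<in>F. N \<zeta>)"
  have bc: "continuous_on (cball 0 1) b" using holomorphic_on_imp_continuous_on[OF b] sub continuous_on_subset by blast
  \<comment> \<open>outside the neighbourhoods \<open>N\<close> of the fibre, \<open>b\<close> keeps a positive distance from \<open>P z0\<close>\<close>
  obtain \<eta> where \<eta>: "\<eta> > 0" "\<And>w. w \<in> K \<Longrightarrow> \<eta> \<le> norm (b w - P z0)"
  proof (cases "K = {}")
    case False
    have "compact K" unfolding K_def using N by (intro compact_diff open_UN) auto
    moreover have "continuous_on K (\<lambda>w. norm (b w - P z0))"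
      by (intro continuous_intros continuous_on_subset[OF bc]) (auto simp: K_def)
    ultimately obtain w0 where w0: "w0 \<in> K" "\<And>w. w \<in> K \<Longrightarrow> norm (b w0 - P z0) \<le> norm (b w - P z0)"
      using continuous_attains_inf[OF _ False] by blast
    have "w0 \<notin> F" using w0(1) N by (auto simp: K_def)
    then have "norm (b w0 - P z0) > 0" using w0(1) by (auto simp: F_def K_def)
    then show thesis using that w0(2) by blast
  qed (use that[of 1] in auto)
  have evQ: "\<forall>\<^sub>F w in nhds z0. Q \<zeta> w \<in> ball 0 (\<rho> \<zeta>)" if "\<zeta> \<in> F" for \<zeta>
  proof -
    have "isCont (Q \<zeta>) z0"
      using holomorphic_on_imp_continuous_on[OF Q[OF that]] s[OF that] by (simp add: continuous_on_eq_continuous_at)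
    then have "(Q \<zeta> \<longlongrightarrow> Q \<zeta> z0) (nhds z0)" by (simp add: isCont_def tendsto_at_iff_tendsto_nhds)
    then have "(Q \<zeta> \<longlongrightarrow> 0) (nhds z0)" by (simp add: Q0[OF that])
    then show ?thesis using tendstoD[OF _ \<rho>[OF that], of "Q \<zeta>" 0 "nhds z0"] by simp
  qed
  have evs: "\<forall>\<^sub>F w in nhds z0. w \<in> ball z0 (s \<zeta>)" if "\<zeta> \<in> F" for \<zeta>
    using s[OF that] by (intro eventually_nhds_in_open) auto
  have evP: "\<forall>\<^sub>F w in nhds z0. dist (P w) (P z0) < \<eta>"
  proof -
    have "isCont P z0" using holomorphic_on_imp_continuous_on[OF self_discD(1)[OF P]] z0
      by (simp add: continuous_on_eq_continuous_at)
    then have "(P \<longlongrightarrow> P z0) (nhds z0)" by (simp add: isCont_def tendsto_at_iff_tendsto_nhds)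
    then show ?thesis using tendstoD \<eta>(1) by blast
  qed
  have ev1: "\<forall>\<^sub>F w in nhds z0. w \<in> ball 0 1" using z0 by (intro eventually_nhds_in_open) auto
  have "\<forall>\<^sub>F w in nhds z0. w \<in> ball 0 1 \<and> dist (P w) (P z0) < \<eta> \<and> (\<forall>\<zeta>\<in>F. Q \<zeta> w \<in> ball 0 (\<rho> \<zeta>) \<and> w \<in> ball z0 (s \<zeta>))"
    by (intro eventually_conj ev1 evP eventually_ball_finite[OF \<open>finite F\<close>] ballI evQ evs)
  then obtain \<delta> where \<delta>: "\<delta> > 0"
    and d: "\<And>w. w \<in> ball z0 \<delta> \<Longrightarrow> w \<in> ball 0 1 \<and> dist (P w) (P z0) < \<eta> \<and> (\<forall>\<zeta>\<in>F. Q \<zeta> w \<in> ball 0 (\<rho> \<zeta>) \<and> w \<in> ball z0 (s \<zeta>))"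
    unfolding eventually_nhds_metric by (auto simp: dist_commute)
  define G where "G \<zeta> \<omega> w = \<gamma> \<zeta> (\<omega> * Q \<zeta> w)" for \<zeta> \<omega> w
  have liftG: "lift_on b P (ball z0 \<delta>) (G \<zeta> \<omega>)" if \<zeta>: "\<zeta> \<in> F" and \<omega>: "\<omega> ^ m \<zeta> = 1" for \<zeta> \<omega>
  proof -
    have n\<omega>: "norm \<omega> = 1" using \<omega> m[OF \<zeta>] by (metis norm_power norm_one norm_ge_zero power_eq_1_iff less_numeral_extra(3))
    have in\<rho>: "\<omega> * Q \<zeta> w \<in> ball 0 (\<rho> \<zeta>)" if "w \<in> ball z0 \<delta>" for w
      using d[OF that] \<zeta> n\<omega> by (auto simp: norm_mult)
    have "(\<lambda>w. \<omega> * Q \<zeta> w) holomorphic_on ball z0 \<delta>"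
      using d \<zeta> by (intro holomorphic_intros holomorphic_on_subset[OF Q[OF \<zeta>]]) blast
    then have "G \<zeta> \<omega> holomorphic_on ball z0 \<delta>"
      unfolding G_def using holomorphic_on_compose_gen[OF _ \<gamma>[OF \<zeta>]] in\<rho> by (auto simp: o_def image_subset_iff)
    moreover have "G \<zeta> \<omega> w \<in> ball 0 1" "b (G \<zeta> \<omega> w) = P w" if w: "w \<in> ball z0 \<delta>" for w
    proof -
      have g: "G \<zeta> \<omega> w \<in> N \<zeta>" "\<beta> \<zeta> (G \<zeta> \<omega> w) = \<omega> * Q \<zeta> w" using \<gamma>N[OF \<zeta> in\<rho>[OF w]] by (auto simp: G_def)
      then show "G \<zeta> \<omega> w \<in> ball 0 1" using N[OF \<zeta>] by blast
      have "b (G \<zeta> \<omega> w) - P z0 = (\<omega> * Q \<zeta> w) ^ m \<zeta>" using \<beta>N[OF \<zeta> g(1)] g(2) by simp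
      also have "\<dots> = P w - P z0" using PQ[OF \<zeta>, of w] d[OF w] \<zeta> \<omega> by (simp add: power_mult_distrib)
      finally show "b (G \<zeta> \<omega> w) = P w" by simp
    qed
    ultimately show ?thesis by (auto simp: lift_on_def)
  qed
  show ?thesis
  proof (intro exI[of _ \<delta>] conjI allI impI)
    show "\<delta> > 0" "ball z0 \<delta> \<subseteq> ball 0 1" using \<delta> d by auto
  next
    fix \<zeta> assume "norm \<zeta> < 1 \<and> b \<zeta> = P z0"
    then have \<zeta>: "\<zeta> \<in> F" using Feq by blast
    have "G \<zeta> 1 z0 = \<zeta>" using Q0[OF \<zeta>] \<beta>N[OF \<zeta>, of \<zeta>] N[OF \<zeta>] \<beta>0[OF \<zeta>] by (auto simp: G_def)
    then show "\<exists>G. lift_on b P (ball z0 \<delta>) G \<and> G z0 = \<zeta>" using liftG[OF \<zeta>, of 1] by auto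
  next
    fix V g assume A: "open V \<and> connected V \<and> V \<noteq> {} \<and> V \<subseteq> ball z0 \<delta> \<and> lift_on b P V g"
    then have g: "lift_on b P V g" and V: "V \<subseteq> ball z0 \<delta>" by auto
    define I where "I = Sigma F (\<lambda>\<zeta>. {\<omega>::complex. \<omega> ^ m \<zeta> = 1})"
    have "finite I"
      unfolding I_def using m by (intro finite_SigmaI \<open>finite F\<close> finite_roots_unity) (simp add: Suc_leI)
    have "\<exists>i\<in>I. \<forall>v\<in>V. g v - G (fst i) (snd i) v = 0"
    proof (rule holomorphic_prod_zero[OF \<open>finite I\<close>])
      show "(\<lambda>v. g v - G (fst i) (snd i) v) holomorphic_on V" if "i \<in> I" for i
      proof -
        have "G (fst i) (snd i) holomorphic_on V"
          using that by (intro holomorphic_on_subset[OF lift_onD(1)[OF liftG] V]) (auto simp: I_def)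
        then show ?thesis using lift_onD(1)[OF g] by (intro holomorphic_intros)
      qed
      fix v assume v: "v \<in> V"
      have gv: "g v \<in> ball 0 1" "b (g v) = P v" using lift_onD[OF g] v by auto
      have dv: "v \<in> ball z0 \<delta>" using v V by blast
      have "g v \<notin> K" using \<eta>(2)[of "g v"] d[OF dv] gv(2) by (auto simp: dist_norm)
      then obtain \<zeta> where \<zeta>: "\<zeta> \<in> F" "g v \<in> N \<zeta>" using gv(1) by (auto simp: K_def)
      have e: "\<beta> \<zeta> (g v) ^ m \<zeta> = Q \<zeta> v ^ m \<zeta>" using \<beta>N[OF \<zeta>] PQ[OF \<zeta>(1)] d[OF dv] \<zeta>(1) gv(2) by simp
      define \<omega> where "\<omega> = (if Q \<zeta> v = 0 then 1 else \<beta> \<zeta> (g v) / Q \<zeta> v)"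
      have "\<omega> ^ m \<zeta> = 1" using e by (auto simp: \<omega>_def power_divide)
      moreover have "\<omega> * Q \<zeta> v = \<beta> \<zeta> (g v)" using e m[OF \<zeta>(1)] by (auto simp: \<omega>_def zero_power)
      then have "G \<zeta> \<omega> v = g v" using \<beta>N[OF \<zeta>] by (simp add: G_def)
      ultimately show "\<exists>i\<in>I. g v - G (fst i) (snd i) v = 0" using \<zeta>(1) by (intro bexI[of _ "(\<zeta>, \<omega>)"]) (auto simp: I_def)
    qed (use A in auto)
    then obtain \<zeta> \<omega> where "\<zeta> \<in> F" "\<omega> ^ m \<zeta> = 1" "\<forall>v\<in>V. G \<zeta> \<omega> v = g v" by (auto simp: I_def)
    then show "\<exists>G. lift_on b P (ball z0 \<delta>) G \<and> (\<forall>v\<in>V. G v = g v)" using liftG by blast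
  qed
qed

text \<open>By compactness of the circle, the lift continues to discs of a fixed radius \<open>e\<close> around all points of the circle. Any
two such discs that meet do so inside the disc of radius \<open>r\<close>, at the midpoint of their centres; so the continuations fit together.\<close>

lemma lift_extends:
  assumes r: "0 < r" "r < 1" and g: "lift_on b P (ball 0 r) g"
  obtains r' G where "r < r'" "r' \<le> 1" "lift_on b P (ball 0 r') G" "\<And>z. z \<in> ball 0 r \<Longrightarrow> G z = g z"
proof -
  define \<G> where "\<G> = {ball z0 \<delta> | z0 \<delta>. norm z0 < 1 \<and> \<delta> > 0 \<and> ball z0 \<delta> \<subseteq> ball 0 1 \<and>
    (\<forall>V g. open V \<and> connected V \<and> V \<noteq> {} \<and> V \<subseteq> ball z0 \<delta> \<and> lift_on b P V g \<longrightarrow>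
       (\<exists>G. lift_on b P (ball z0 \<delta>) G \<and> (\<forall>v\<in>V. G v = g v)))}"
  have "sphere 0 r \<subseteq> \<Union>\<G>"
  proof
    fix z :: complex assume "z \<in> sphere 0 r"
    then have z: "norm z < 1" using r by simp
    obtain \<delta> where \<delta>: "\<delta> > 0" "ball z \<delta> \<subseteq> ball 0 1" "\<forall>V g. open V \<and> connected V \<and> V \<noteq> {} \<and> V \<subseteq> ball z \<delta> \<and> lift_on b P V g \<longrightarrow>
       (\<exists>G. lift_on b P (ball z \<delta>) G \<and> (\<forall>v\<in>V. G v = g v))"
      using local_sections[OF z] by (elim exE conjE) (rule that; assumption)
    have "ball z \<delta> \<in> \<G>"
      unfolding \<G>_def using z \<delta> by (intro CollectI exI[of _ z] exI[of _ \<delta>] conjI refl)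
    then show "z \<in> \<Union>\<G>" using \<delta>(1) by (meson UnionI centre_in_ball)
  qed
  moreover have "open B" if "B \<in> \<G>" for B using that unfolding \<G>_def by (elim CollectE exE conjE) simp
  ultimately obtain e where e: "e > 0" "\<And>x. x \<in> sphere 0 r \<Longrightarrow> \<exists>B\<in>\<G>. ball x e \<subseteq> B"
    using Heine_Borel_lemma[OF compact_sphere[of "0::complex" r], of \<G>] by metis
  have "\<exists>G. lift_on b P (ball x e) G \<and> (\<forall>v\<in>ball x e \<inter> ball 0 r. G v = g v)" if x: "x \<in> sphere 0 r" for x
  proof -
    obtain z0 \<delta> where z0: "ball x e \<subseteq> ball z0 \<delta>"
      and ext: "\<And>V g. open V \<and> connected V \<and> V \<noteq> {} \<and> V \<subseteq> ball z0 \<delta> \<and> lift_on b P V g \<Longrightarrow>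
       (\<exists>G. lift_on b P (ball z0 \<delta>) G \<and> (\<forall>v\<in>V. G v = g v))"
      using e(2)[OF x] unfolding \<G>_def by blast
    have "x \<in> closure (ball 0 r)" using x r by simp
    then have "ball x e \<inter> ball 0 r \<noteq> {}"
      using e(1) open_Int_closure_eq_empty[OF open_ball, of x e "ball 0 r"] by (metis IntI centre_in_ball empty_iff)
    moreover have "connected (ball x e \<inter> ball 0 r)" by (intro convex_connected convex_Int convex_ball)
    moreover have "lift_on b P (ball x e \<inter> ball 0 r) g" using g by (rule lift_on_subset) auto
    ultimately obtain G where "lift_on b P (ball z0 \<delta>) G" "\<forall>v\<in>ball x e \<inter> ball 0 r. G v = g v"
      using ext[of "ball x e \<inter> ball 0 r" g] z0 by (metis Int_lower1 open_Int open_ball order_trans)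
    then show ?thesis using lift_on_subset z0 by blast
  qed
  then obtain E where E: "\<And>x. x \<in> sphere 0 r \<Longrightarrow> lift_on b P (ball x e) (E x)"
    "\<And>x v. x \<in> sphere 0 r \<Longrightarrow> v \<in> ball x e \<Longrightarrow> v \<in> ball 0 r \<Longrightarrow> E x v = g v" by (metis IntI)
  \<comment> \<open>beyond the circle, \<open>G\<close> is the continuation from the radial projection \<open>p w\<close>\<close>
  define p where "p w = of_real (r / norm w) * w" for w :: complex
  define G where "G w = (if norm w < r then g w else E (p w) w)" for w
  have ps: "p w \<in> sphere 0 r" if "r \<le> norm w" for w
  proof -
    have "w \<noteq> 0" using that r by auto
    then show ?thesis using r by (simp add: p_def norm_mult norm_divide)
  qed
  have pd: "w \<in> ball (p w) e" if "r \<le> norm w" "norm w < r + e" for w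
  proof -
    have "p w - w = of_real (r / norm w - 1) * w" by (simp add: p_def algebra_simps)
    then have "norm (p w - w) = \<bar>r / norm w - 1\<bar> * norm w" by (metis norm_mult norm_of_real)
    also have "\<dots> = norm w - r" using that r by (auto simp: abs_if field_simps)
    finally show ?thesis using that by (simp add: dist_norm)
  qed
  have GE: "G w = E x w" if x: "x \<in> sphere 0 r" and w: "w \<in> ball x e" "norm w < r + e" for x w
  proof (cases "norm w < r")
    case True then show ?thesis using E(2)[OF x w(1)] by (simp add: G_def)
  next
    case False
    then have y: "p w \<in> sphere 0 r" "w \<in> ball (p w) e" using ps pd w(2) by auto
    show ?thesis
    proof (cases "p w = x")
      case True then show ?thesis using False by (simp add: G_def)
    next
      case ne: False
      define V where "V = ball x e \<inter> ball (p w) e"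
      have V: "open V" "connected V" unfolding V_def by (auto intro!: convex_connected convex_Int)
      have "E (p w) w = E x w"
      proof (rule analytic_continuation_open[of "V \<inter> ball 0 r" V "E (p w)" "E x" w])
        define c where "c = (x + p w) / 2"
        have "norm c < r"
        proof -
          have "dist 0 (midpoint x (p w)) < r"
          proof (rule ccontr)
            assume "\<not> ?thesis"
            moreover have "(norm (x + p w))\<^sup>2 + (norm (x - p w))\<^sup>2 = 4 * r\<^sup>2"
            proof -
              have "(norm (x + p w))\<^sup>2 + (norm (x - p w))\<^sup>2 = 2 * (norm x)\<^sup>2 + 2 * (norm (p w))\<^sup>2"
                unfolding cmod_power2 by (simp add: algebra_simps power2_eq_square)
              then show ?thesis using x y by simp
            qed
            moreover have "norm (x - p w) > 0" using ne by simp
            then have "(norm (x - p w))\<^sup>2 > 0" by simp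
            ultimately have "(norm (x + p w))\<^sup>2 < 4 * r\<^sup>2" by linarith
            then have "(norm (x + p w))\<^sup>2 < (2 * r)\<^sup>2" by (simp add: power_mult_distrib)
            then have "norm (x + p w) < 2 * r" using r by (meson power2_less_imp_less less_imp_le mult_nonneg_nonneg zero_le_numeral)
            then show False using \<open>\<not> dist 0 (midpoint x (p w)) < r\<close> by (simp add: midpoint_def)
          qed
          then show ?thesis by (simp add: c_def midpoint_def scaleR_conv_of_real)
        qed
        moreover have "dist x (p w) < 2 * e"
          using dist_triangle_less_add[of x w e "p w" e] w(1) y(2) by (simp add: dist_commute)
        then have "c \<in> V"
          unfolding V_def c_def by (auto simp: dist_norm norm_divide field_simps norm_minus_commute)
        ultimately show "V \<inter> ball 0 r \<noteq> {}" by auto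
        show "E (p w) holomorphic_on V" "E x holomorphic_on V"
          using lift_onD(1)[OF E(1)[OF y(1)]] lift_onD(1)[OF E(1)[OF x]] unfolding V_def
          by (auto intro: holomorphic_on_subset)
        show "E (p w) z = E x z" if "z \<in> V \<inter> ball 0 r" for z
          using that E(2)[OF x] E(2)[OF y(1)] by (simp add: V_def)
        show "w \<in> V" using w(1) y(2) by (simp add: V_def)
      qed (use V in auto)
      then show ?thesis using False by (simp add: G_def)
    qed
  qed
  define r' where "r' = min 1 (r + e)"
  have "lift_on b P (ball 0 r') G"
    unfolding lift_on_def
  proof (intro conjI ballI)
    have "G field_differentiable at w" if w: "norm w < r + e" for w
    proof (cases "norm w < r")
      case True
      have "g field_differentiable at w"
        using lift_onD(1)[OF g] True by (simp add: holomorphic_on_imp_differentiable_at)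
      then obtain f' where "(g has_field_derivative f') (at w)" by (auto simp: field_differentiable_def)
      then have "(G has_field_derivative f') (at w)"
        by (rule has_field_derivative_transform_within_open[of _ _ _ "ball 0 r"]) (use True in \<open>auto simp: G_def\<close>)
      then show ?thesis by (auto simp: field_differentiable_def)
    next
      case False
      then have y: "p w \<in> sphere 0 r" "w \<in> ball (p w) e" using ps pd w by auto
      have "E (p w) field_differentiable at w"
        using lift_onD(1)[OF E(1)[OF y(1)]] y(2) holomorphic_on_imp_differentiable_at open_ball by blast
      then obtain f' where "(E (p w) has_field_derivative f') (at w)" by (auto simp: field_differentiable_def)
      then have "(G has_field_derivative f') (at w)"
        by (rule has_field_derivative_transform_within_open[of _ _ _ "ball (p w) e \<inter> ball 0 (r + e)"])
           (use GE[OF y(1)] y(2) w in auto)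
      then show ?thesis by (auto simp: field_differentiable_def)
    qed
    note fd = this
    show "G holomorphic_on ball 0 r'"
      unfolding holomorphic_on_def
    proof
      fix w :: complex assume "w \<in> ball 0 r'"
      then have "norm w < r + e" by (simp add: r'_def)
      then show "G field_differentiable at w within ball 0 r'" by (rule field_differentiable_at_within[OF fd])
    qed
    fix w :: complex assume "w \<in> ball 0 r'"
    then have w: "norm w < r + e" by (simp add: r'_def)
    show "G w \<in> ball 0 1" "b (G w) = P w"
    proof -
      show "G w \<in> ball 0 1"
        using lift_onD(2)[OF g, of w] lift_onD(2)[OF E(1)[OF ps] pd[OF _ w]] by (auto simp: G_def not_less)
      show "b (G w) = P w"
        using lift_onD(3)[OF g, of w] lift_onD(3)[OF E(1)[OF ps] pd[OF _ w]] by (auto simp: G_def not_less)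
    qed
  qed
  moreover have "r < r'" "r' \<le> 1" using r e(1) by (auto simp: r'_def)
  moreover have "G z = g z" if "z \<in> ball 0 r" for z using that by (simp add: G_def)
  ultimately show thesis using that by blast
qed

text \<open>Two lifts agree near \<open>0\<close>, where \<open>b\<close> is injective on a neighbourhood of their common value.\<close>

lemma lift_unique:
  assumes g: "lift_on b P (ball 0 r) g" "lift_on b P (ball 0 r) g'" and e: "g 0 = g' 0"
    and d: "deriv b (g 0) \<noteq> 0" and z: "norm z < r"
  shows "g z = g' z"
proof -
  have r: "r > 0" using z by (meson norm_ge_zero le_less_trans)
  have g0R: "g 0 \<in> ball 0 R" using lift_onD(2)[OF g(1), of 0] r R by simp
  obtain s where s: "s > 0" "inj_on b (ball (g 0) s)"
    by (rule has_complex_derivative_locally_injective[OF b g0R open_ball d])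
  have "open (ball 0 r \<inter> g -` ball (g 0) s)" "open (ball 0 r \<inter> g' -` ball (g 0) s)"
    using g[THEN lift_onD(1), THEN holomorphic_on_imp_continuous_on] by (auto intro!: continuous_open_preimage)
  then have o: "open ((ball 0 r \<inter> g -` ball (g 0) s) \<inter> (ball 0 r \<inter> g' -` ball (g 0) s))" by blast
  show ?thesis
  proof (rule analytic_continuation_open[OF o, of "ball 0 r" g g' z])
    show "(ball 0 r \<inter> g -` ball (g 0) s) \<inter> (ball 0 r \<inter> g' -` ball (g 0) s) \<noteq> {}"
    proof -
      have "0 \<in> (ball 0 r \<inter> g -` ball (g 0) s) \<inter> (ball 0 r \<inter> g' -` ball (g 0) s)"
        using r s(1) e by auto
      then show ?thesis by blast
    qed
    fix w assume w: "w \<in> (ball 0 r \<inter> g -` ball (g 0) s) \<inter> (ball 0 r \<inter> g' -` ball (g 0) s)"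
    then have "b (g w) = b (g' w)" using lift_onD(3)[OF g(1)] lift_onD(3)[OF g(2)] by simp
    then show "g w = g' w" using inj_onD[OF s(2)] w by simp
  qed (use g lift_onD(1) z in auto)
qed

text \<open>By uniqueness the lifts on smaller discs combine to a lift on the largest possible disc, and lifts on a
disc of radius less than \<open>1\<close> extend.\<close>

theorem lift_exists:
  assumes p: "norm p < 1" "b p = P 0" "deriv b p \<noteq> 0"
  obtains g where "lift_on b P (ball 0 1) g" "g 0 = p"
proof -
  define T where "T = {r. 0 < r \<and> r \<le> 1 \<and> (\<exists>g. lift_on b P (ball 0 r) g \<and> g 0 = p)}"
  obtain \<delta> G where \<delta>: "\<delta> > 0" "lift_on b P (ball 0 \<delta>) G" "G 0 = p"
    using local_sections[of 0] p by auto
  have "min \<delta> 1 \<in> T"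
    using \<delta> lift_on_subset[OF \<delta>(2), of "ball 0 (min \<delta> 1)"] unfolding T_def
    by (intro CollectI conjI exI[of _ G]) (simp_all add: subset_ball)
  then have ne: "T \<noteq> {}" by blast
  have bd: "bdd_above T" by (rule bdd_aboveI[of _ 1]) (simp add: T_def)
  define \<sigma> where "\<sigma> = Sup T"
  have \<sigma>: "0 < \<sigma>" "\<sigma> \<le> 1"
    using cSup_upper[OF \<open>min \<delta> 1 \<in> T\<close> bd] \<delta>(1) cSup_least[OF ne, of 1] by (auto simp: \<sigma>_def T_def)
  have "\<forall>r\<in>T. \<exists>g. lift_on b P (ball 0 r) g \<and> g 0 = p" by (simp add: T_def)
  then obtain f where f: "\<And>r. r \<in> T \<Longrightarrow> lift_on b P (ball 0 r) (f r)" "\<And>r. r \<in> T \<Longrightarrow> f r 0 = p" by metis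
  have rr: "\<exists>r\<in>T. norm z < r" if "norm z < \<sigma>" for z :: complex
    using less_cSup_iff[OF ne bd] that by (simp add: \<sigma>_def)
  define g where "g z = f (SOME r. r \<in> T \<and> norm z < r) z" for z
  have gf: "g z = f r z" if r: "r \<in> T" "norm z < r" for r z
  proof -
    define t where "t = (SOME r. r \<in> T \<and> norm z < r)"
    have t: "t \<in> T" "norm z < t" using someI[of "\<lambda>r. r \<in> T \<and> norm z < r" r] r unfolding t_def by auto
    have "f t z = f r z"
    proof (rule lift_unique[of "min t r" "f t" "f r" z])
      show "lift_on b P (ball 0 (min t r)) (f t)" "lift_on b P (ball 0 (min t r)) (f r)"
        using f(1)[OF t(1)] f(1)[OF r(1)] by (auto intro: lift_on_subset)
    qed (use f(2) t r p in auto)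
    then show ?thesis by (simp add: g_def t_def)
  qed
  have lg: "lift_on b P (ball 0 \<sigma>) g"
    unfolding lift_on_def
  proof (intro conjI ballI)
    show "g holomorphic_on ball 0 \<sigma>"
      unfolding holomorphic_on_def
    proof
      fix z :: complex assume "z \<in> ball 0 \<sigma>"
      then obtain r where r: "r \<in> T" "norm z < r" using rr[of z] by auto
      have "f r field_differentiable at z"
        using lift_onD(1)[OF f(1)[OF r(1)]] r(2) by (simp add: holomorphic_on_imp_differentiable_at)
      then obtain f' where "(f r has_field_derivative f') (at z)" by (auto simp: field_differentiable_def)
      then have "(g has_field_derivative f') (at z)"
        by (rule has_field_derivative_transform_within_open[of _ _ _ "ball 0 r"]) (use r gf in auto)
      then show "g field_differentiable at z within ball 0 \<sigma>"
        by (auto simp: field_differentiable_def intro: has_field_derivative_at_within)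
    qed
    fix z :: complex assume "z \<in> ball 0 \<sigma>"
    then obtain r where r: "r \<in> T" "norm z < r" using rr[of z] by auto
    show "g z \<in> ball 0 1" "b (g z) = P z" using lift_onD(2,3)[OF f(1)[OF r(1)], of z] r gf by auto
  qed
  have g0: "g 0 = p" using gf[OF \<open>min \<delta> 1 \<in> T\<close>, of 0] f(2)[OF \<open>min \<delta> 1 \<in> T\<close>] \<delta>(1) by simp
  have "\<sigma> = 1"
  proof (rule ccontr)
    assume "\<sigma> \<noteq> 1"
    then have "\<sigma> < 1" using \<sigma> by simp
    from lift_extends[OF \<sigma>(1) this lg] obtain r' G' where r': "\<sigma> < r'" "r' \<le> 1" "lift_on b P (ball 0 r') G'"
      "\<And>z. z \<in> ball 0 \<sigma> \<Longrightarrow> G' z = g z" by blast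
    then have "r' \<in> T" using \<sigma>(1) g0 by (auto simp: T_def intro!: exI[of _ G'])
    then show False using cSup_upper[OF _ bd] r'(1) by (force simp: \<sigma>_def)
  qed
  then show thesis using that lg g0 by simp
qed

end

section \<open>Blaschke products and orders of contact of their lifts\<close>

definition weighted_points :: "complex set \<Rightarrow> (complex \<Rightarrow> nat) \<Rightarrow> bool"
  where "weighted_points F k \<longleftrightarrow> finite F \<and> F \<subseteq> ball 0 1 - {0} \<and> F \<noteq> {} \<and> (\<forall>a\<in>F. k a > 0)"

text \<open>Thus \<open>h z = a\<close> for a point \<open>a\<close> of \<open>F\<close>, and the order of \<open>h - a\<close> at \<open>z\<close>, multiplied with the weight of \<open>a\<close>, is
at least \<open>M\<close>. A disc that meets a set at \<open>a\<close> with multiplicity \<open>k a\<close> meets it at \<open>z\<close> with multiplicity at least \<open>M\<close>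
after composition with \<open>h\<close>.\<close>

definition hits :: "(complex \<Rightarrow> complex) \<Rightarrow> complex set \<Rightarrow> (complex \<Rightarrow> nat) \<Rightarrow> complex \<Rightarrow> nat \<Rightarrow> bool"
  where "hits h F k z M \<longleftrightarrow> h z \<in> F \<and>
    (\<exists>C. \<forall>\<^sub>F w in at z. norm (h w - h z) ^ k (h z) \<le> C * norm (w - z) ^ M)"

definition blaschke :: "complex set \<Rightarrow> (complex \<Rightarrow> nat) \<Rightarrow> complex \<Rightarrow> complex"
  where "blaschke F k z = (\<Prod>a\<in>F. mob a z ^ k a)"

lemma weighted_pointsD:
  assumes "weighted_points F k"
  shows "finite F" "F \<noteq> {}" "a \<in> F \<Longrightarrow> norm a < 1" "a \<in> F \<Longrightarrow> a \<noteq> 0" "a \<in> F \<Longrightarrow> k a > 0" "0 \<notin> F"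
  using assms by (auto simp: weighted_points_def)

lemma norm_mob_circle: "norm a < 1 \<Longrightarrow> norm z = 1 \<Longrightarrow> norm (mob a z) = 1"
proof -
  assume a: "norm a < 1" and z: "norm z = 1"
  have "z * cnj z = 1" using z by (simp add: complex_norm_square[symmetric])
  then have "1 - cnj a * z = z * cnj (z - a)" by (simp add: algebra_simps)
  then have "norm (1 - cnj a * z) = norm (z - a)" using z by (metis complex_mod_cnj mult_1 norm_mult)
  moreover have "z \<noteq> a" using a z by auto
  ultimately show ?thesis using mob_denominator[of a z] a z by (simp add: Moebius_function_simple norm_divide)
qed

lemma blaschke_holomorphic:
  assumes "weighted_points F k"
  obtains R where "R > 1" "blaschke F k holomorphic_on ball 0 R"
    "\<And>a. a \<in> F \<Longrightarrow> mob a holomorphic_on ball 0 R"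
proof -
  define s where "s = Max (norm ` F)"
  have s: "s < 1" "0 \<le> s" "\<And>a. a \<in> F \<Longrightarrow> norm a \<le> s"
  proof -
    have fin: "finite (norm ` F)" "norm ` F \<noteq> {}" using weighted_pointsD[OF assms] by auto
    show "s < 1" unfolding s_def using weighted_pointsD(3)[OF assms] by (simp add: Max_less_iff[OF fin])
    show le: "norm a \<le> s" if "a \<in> F" for a unfolding s_def using fin that by simp
    obtain a where "a \<in> F" using weighted_pointsD(2)[OF assms] by blast
    then show "0 \<le> s" using le norm_ge_zero order_trans by blast
  qed
  define R where "R = 2 / (1 + s)"
  have R: "R > 1" "s * R < 1" using s(1,2) by (auto simp: R_def field_simps)
  have hol: "mob a holomorphic_on ball 0 R" if a: "a \<in> F" for a
    unfolding Moebius_function_simple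
  proof (intro holomorphic_intros)
    fix z :: complex assume "z \<in> ball 0 R"
    then have "norm (cnj a * z) \<le> s * R" using s(2) s(3)[OF a] by (auto simp: norm_mult intro!: mult_mono)
    then have "norm (cnj a * z) < norm (1::complex)" using R(2) by simp
    then show "1 - cnj a * z \<noteq> 0" by auto
  qed
  then have "blaschke F k holomorphic_on ball 0 R" unfolding blaschke_def by (intro holomorphic_intros)
  then show thesis using that R(1) hol by blast
qed

lemma blaschke_norm:
  assumes "weighted_points F k"
  shows "norm z = 1 \<Longrightarrow> norm (blaschke F k z) = 1"
    and "norm z < 1 \<Longrightarrow> norm (blaschke F k z) < 1"
    and "norm z < 1 \<Longrightarrow> blaschke F k z = 0 \<longleftrightarrow> z \<in> F"
    and "norm (blaschke F k 0) = (\<Prod>a\<in>F. norm a ^ k a)"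
proof -
  note w = weighted_pointsD[OF assms]
  show "norm z = 1 \<Longrightarrow> norm (blaschke F k z) = 1"
    using w(3) norm_mob_circle by (simp add: blaschke_def prod_norm[symmetric] norm_power)
  show "norm (blaschke F k 0) = (\<Prod>a\<in>F. norm a ^ k a)"
    by (simp add: blaschke_def prod_norm[symmetric] norm_power)
  assume z: "norm z < 1"
  have m: "norm (mob a z) < 1" if "a \<in> F" for a using self_discD(3)[OF self_disc_mob[OF w(3)[OF that]] z] .
  show "blaschke F k z = 0 \<longleftrightarrow> z \<in> F"
    using w(1,3,5) z mob_eq_0_iff by (auto simp: blaschke_def less_imp_le)
  obtain a where a: "a \<in> F" using w(2) by blast
  have "norm (blaschke F k z) = norm (mob a z) ^ k a * (\<Prod>b\<in>F - {a}. norm (mob b z) ^ k b)"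
    using prod.remove[OF w(1) a, of "\<lambda>b. norm (mob b z) ^ k b"] by (simp add: blaschke_def prod_norm[symmetric] norm_power)
  also have "\<dots> \<le> norm (mob a z) ^ k a * 1"
    using m by (intro mult_left_mono prod_le_1) (auto intro!: power_le_one simp: less_imp_le)
  also have "\<dots> < 1" using m[OF a] w(5)[OF a] by (simp add: power_less_one_iff)
  finally show "norm (blaschke F k z) < 1" .
qed

lemma blaschke_factor:
  assumes w: "weighted_points F k" and a: "a \<in> F"
  obtains h r where "r > 0" "h holomorphic_on ball a r" "h a \<noteq> 0"
    "\<And>z. z \<in> ball a r \<Longrightarrow> blaschke F k z = (z - a) ^ k a * h z"
proof -
  note wp = weighted_pointsD[OF w]
  obtain R where R: "R > 1" "\<And>a. a \<in> F \<Longrightarrow> mob a holomorphic_on ball 0 R"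
    using blaschke_holomorphic[OF w] by metis
  define r where "r = 1 - norm a"
  have sub: "ball a r \<subseteq> ball 0 1"
  proof
    fix z assume "z \<in> ball a r"
    then show "z \<in> ball 0 1" using norm_triangle_sub[of z a] by (simp add: r_def dist_norm norm_minus_commute)
  qed
  have r: "r > 0" using wp(3)[OF a] by (simp add: r_def)
  define h where "h z = (1 / (1 - cnj a * z)) ^ k a * (\<Prod>b\<in>F - {a}. mob b z ^ k b)" for z
  have den: "1 - cnj a * z \<noteq> 0" if "z \<in> ball a r" for z
    using mob_denominator[OF wp(3)[OF a], of z] that sub by force
  show thesis
  proof (rule that[OF r, of h])
    show "h holomorphic_on ball a r" unfolding h_def
    proof (intro holomorphic_on_mult holomorphic_on_prod)
      show "(\<lambda>z. (1 / (1 - cnj a * z)) ^ k a) holomorphic_on ball a r"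
        using den by (intro holomorphic_intros) auto
      show "(\<lambda>z. mob b z ^ k b) holomorphic_on ball a r" if "b \<in> F - {a}" for b
      proof -
        have "mob b holomorphic_on ball a r"
          using that by (intro holomorphic_on_subset[OF self_discD(1)[OF self_disc_mob[OF wp(3)]] sub]) auto
        then show ?thesis by (intro holomorphic_intros)
      qed
    qed
    show "h a \<noteq> 0"
      using den[of a] r wp(1,3) a mob_eq_0_iff by (auto simp: h_def less_imp_le)
    fix z assume "z \<in> ball a r"
    show "blaschke F k z = (z - a) ^ k a * h z"
      using prod.remove[OF wp(1) a, of "\<lambda>b. mob b z ^ k b"]
      by (simp add: blaschke_def h_def Moebius_function_simple[of a] power_divide power_mult_distrib)
  qed
qed

lemma holomorphic_first_order_bound:
  fixes f :: "complex \<Rightarrow> complex"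
  assumes "f holomorphic_on S" "open S" "z \<in> S"
  obtains C where "C > 0" "\<forall>\<^sub>F w in at z. norm (f w - f z) \<le> C * norm (w - z)"
proof -
  have "(f has_field_derivative deriv f z) (at z)" using holomorphic_derivI[OF assms] .
  then have "((\<lambda>w. (f w - f z) / (w - z)) \<longlongrightarrow> deriv f z) (at z)" by (simp add: has_field_derivative_iff)
  then have "\<forall>\<^sub>F w in at z. norm ((f w - f z) / (w - z)) < norm (deriv f z) + 1"
    by (intro order_tendstoD(2)[OF tendsto_norm]) auto
  then have "\<forall>\<^sub>F w in at z. norm (f w - f z) \<le> (norm (deriv f z) + 1) * norm (w - z)"
    using eventually_neq_at_within[of z]
  proof eventually_elim
    case (elim w)
    then show ?case by (simp add: norm_divide field_simps)
  qed
  then show thesis using that[of "norm (deriv f z) + 1"] by (simp add: add_nonneg_pos)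
qed

text \<open>Over a zero of \<open>b\<close>, the ramification order divides \<open>M\<close>, and \<open>U\<^sup>M\<close> is the power with that order of a power
of \<open>U\<close>. Every other point of the fibre over a value of \<open>U\<^sup>M\<close> is unramified by assumption.\<close>

lemma lift_through_blaschke:
  assumes w: "weighted_points F k" and u: "norm u = 1" and b: "\<And>z. b z = u * blaschke F k z"
    and M: "M > 0" "\<And>a. a \<in> F \<Longrightarrow> k a dvd M" and U: "self_disc U"
    and crit: "\<And>z \<zeta>. norm z < 1 \<Longrightarrow> norm \<zeta> < 1 \<Longrightarrow> deriv b \<zeta> = 0 \<Longrightarrow> b \<zeta> \<noteq> 0 \<Longrightarrow> U z ^ M \<noteq> b \<zeta>"
    and p: "norm p < 1" "b p = U 0 ^ M" "deriv b p \<noteq> 0"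
  shows "\<exists>g. self_disc g \<and> g 0 = p \<and> (\<forall>z. norm z < 1 \<longrightarrow> b (g z) = U z ^ M)"
proof -
  note wp = weighted_pointsD[OF w]
  obtain R where R: "R > 1" "blaschke F k holomorphic_on ball 0 R" using blaschke_holomorphic[OF w] by metis
  have bhol: "b holomorphic_on ball 0 R" unfolding b using R(2) by (intro holomorphic_intros)
  have Phol: "(\<lambda>z. U z ^ M) holomorphic_on ball 0 1" using self_discD(1)[OF U] by (intro holomorphic_intros)
  have P: "self_disc (\<lambda>z. U z ^ M)"
    unfolding self_disc_def using Phol self_discD(2)[OF U] M(1) by (auto simp: norm_power power_less_one_iff)
  have pc: "\<exists>h. h holomorphic_on ball \<zeta> r \<and> h \<zeta> = deriv f \<zeta> \<and> (\<forall>w\<in>ball \<zeta> r. f w - f \<zeta> = (w - \<zeta>) ^ 1 * h w)"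
    if "f holomorphic_on ball \<zeta> r" "r > 0" for f \<zeta> r
  proof (intro exI conjI ballI)
    show "(\<lambda>w. if w = \<zeta> then deriv f \<zeta> else (f w - f \<zeta>) / (w - \<zeta>)) holomorphic_on ball \<zeta> r"
      using pole_theorem_open[of "\<lambda>w. f w - f \<zeta>" "ball \<zeta> r" \<zeta>] that by (auto intro!: pole_lemma_open)
  qed auto
  interpret ramified_lifting b "\<lambda>z. U z ^ M" R
  proof
    show "R > 1" "b holomorphic_on ball 0 R" by fact+
    show "norm z = 1 \<Longrightarrow> norm (b z) = 1" "norm z < 1 \<Longrightarrow> norm (b z) < 1" for z
      using blaschke_norm(1,2)[OF w] u by (simp_all add: b norm_mult)
    show "self_disc (\<lambda>z. U z ^ M)" by fact
    fix z \<zeta> assume z: "norm z < 1" and \<zeta>: "norm \<zeta> < 1" and e: "b \<zeta> = U z ^ M"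
    show "\<exists>m r h s Q. m > 0 \<and> r > 0 \<and> h holomorphic_on ball \<zeta> r \<and> h \<zeta> \<noteq> 0 \<and>
        (\<forall>w\<in>ball \<zeta> r. b w - b \<zeta> = (w - \<zeta>) ^ m * h w) \<and>
        s > 0 \<and> Q holomorphic_on ball z s \<and> (\<forall>w\<in>ball z s. U w ^ M - U z ^ M = Q w ^ m)"
    proof (cases "b \<zeta> = 0")
      case True
      then have "\<zeta> \<in> F" using blaschke_norm(3)[OF w \<zeta>] u by (auto simp: b)
      then obtain h r where h: "r > 0" "h holomorphic_on ball \<zeta> r" "h \<zeta> \<noteq> 0"
        "\<And>z. z \<in> ball \<zeta> r \<Longrightarrow> blaschke F k z = (z - \<zeta>) ^ k \<zeta> * h z" using blaschke_factor[OF w] by metis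
      obtain n where n: "M = k \<zeta> * n" using M(2)[OF \<open>\<zeta> \<in> F\<close>] by (auto simp: dvd_def)
      have sub: "ball z (1 - norm z) \<subseteq> ball 0 1"
      proof
        fix w assume "w \<in> ball z (1 - norm z)"
        then show "w \<in> ball 0 1" using norm_triangle_sub[of w z] by (simp add: dist_norm norm_minus_commute)
      qed
      have "U z ^ M = 0" using e True by simp
      then show ?thesis
        using h True u z n wp(5)[OF \<open>\<zeta> \<in> F\<close>]
        by (intro exI[of _ "k \<zeta>"] exI[of _ r] exI[of _ "\<lambda>w. u * h w"] exI[of _ "1 - norm z"] exI[of _ "\<lambda>w. U w ^ n"])
           (auto simp: b power_mult[symmetric] mult.commute intro!: holomorphic_intros holomorphic_on_subset[OF self_discD(1)[OF U] sub])
    next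
      case False
      then have d: "deriv b \<zeta> \<noteq> 0" using crit[OF z \<zeta>] e by auto
      define r where "r = 1 - norm \<zeta>" define s where "s = 1 - norm z"
      have sub: "ball z s \<subseteq> ball 0 1"
      proof
        fix w assume "w \<in> ball z s"
        then show "w \<in> ball 0 1" using norm_triangle_sub[of w z] by (simp add: s_def dist_norm norm_minus_commute)
      qed
      have sub': "ball \<zeta> r \<subseteq> ball 0 R"
      proof
        fix w assume "w \<in> ball \<zeta> r"
        then show "w \<in> ball 0 R" using R(1) norm_triangle_sub[of w \<zeta>] by (simp add: r_def dist_norm norm_minus_commute)
      qed
      have rs: "r > 0" "s > 0" using z \<zeta> by (auto simp: r_def s_def)
      obtain h where "h holomorphic_on ball \<zeta> r" "h \<zeta> = deriv b \<zeta>" "\<forall>w\<in>ball \<zeta> r. b w - b \<zeta> = (w - \<zeta>) ^ 1 * h w"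
        using pc[OF holomorphic_on_subset[OF bhol sub'] rs(1)] by blast
      then show ?thesis using d rs holomorphic_on_subset[OF Phol sub]
        by (intro exI[of _ 1] exI[of _ r] exI[of _ h] exI[of _ s] exI[of _ "\<lambda>w. U w ^ M - U z ^ M"])
           (auto intro!: holomorphic_intros)
    qed
  qed
  obtain g where g: "lift_on b (\<lambda>z. U z ^ M) (ball 0 1) g" "g 0 = p" using lift_exists[OF p] by blast
  then show ?thesis by (intro exI[of _ g]) (auto simp: lift_on_def self_disc_def)
qed

text \<open>With \<open>a = g z\<close>, the quantity \<open>\<bar>g w - a\<bar>\<close> to the power \<open>k a\<close> is comparable to \<open>\<bar>b (g w)\<bar> = \<bar>U w\<bar>\<^sup>M\<close>, which is of
size \<open>\<bar>w - z\<bar>\<^sup>M\<close> at most.\<close>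

lemma lift_hits:
  assumes w: "weighted_points F k" and u: "norm u = 1"
    and U: "self_disc U" and M: "M > 0" and g: "self_disc g" "\<And>z. norm z < 1 \<Longrightarrow> u * blaschke F k (g z) = U z ^ M"
    and z: "norm z < 1" "U z = 0"
  shows "hits g F k z M"
proof -
  define a where "a = g z"
  have gz: "norm (g z) < 1" using self_discD(3)[OF g(1) z(1)] .
  have "blaschke F k (g z) = 0" using g(2)[OF z(1)] z(2) M u by (auto simp: zero_power)
  then have a: "a \<in> F" using blaschke_norm(3)[OF w gz] by (simp add: a_def)
  obtain h r where h: "r > 0" "h holomorphic_on ball a r" "h a \<noteq> 0"
    "\<And>z. z \<in> ball a r \<Longrightarrow> blaschke F k z = (z - a) ^ k a * h z" using blaschke_factor[OF w a] by metis
  have hc: "isCont h a" using holomorphic_on_imp_continuous_on[OF h(2)] h(1) by (simp add: continuous_on_eq_continuous_at)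
  have gc: "(g \<longlongrightarrow> a) (at z)"
    using holomorphic_on_imp_continuous_on[OF self_discD(1)[OF g(1)]] z(1)
    by (simp add: continuous_on_eq_continuous_at isCont_def a_def)
  have "((\<lambda>w. norm (h (g w))) \<longlongrightarrow> norm (h a)) (at z)"
    using tendsto_norm[OF isCont_tendsto_compose[OF hc gc]] .
  then have e1: "\<forall>\<^sub>F w in at z. norm (h (g w)) > norm (h a) / 2"
    by (rule order_tendstoD(1)) (use h(3) in auto)
  have e2: "\<forall>\<^sub>F w in at z. g w \<in> ball a r" using tendstoD[OF gc h(1)] by (simp add: dist_commute)
  have e3: "\<forall>\<^sub>F w in at z. w \<in> ball 0 1" using z(1) by (intro eventually_at_in_open') auto
  obtain C where C: "C > 0" "\<forall>\<^sub>F w in at z. norm (U w - U z) \<le> C * norm (w - z)"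
    using holomorphic_first_order_bound[OF self_discD(1)[OF U] open_ball, of z] z(1) by auto
  have "\<forall>\<^sub>F w in at z. norm (g w - a) ^ k a \<le> (C ^ M / (norm (h a) / 2)) * norm (w - z) ^ M"
    using e1 e2 e3 C(2)
  proof eventually_elim
    case (elim w)
    have "norm (g w - a) ^ k a * (norm (h a) / 2) \<le> norm (g w - a) ^ k a * norm (h (g w))"
      using elim(1) by (intro mult_left_mono) auto
    also have "\<dots> = norm (u * blaschke F k (g w))" using h(4)[OF elim(2)] u by (simp add: norm_mult norm_power)
    also have "\<dots> = norm (U w) ^ M" using g(2)[of w] elim(3) by (simp add: norm_power)
    also have "\<dots> \<le> (C * norm (w - z)) ^ M" using elim(4) z(2) by (intro power_mono) auto
    finally show ?case using h(3) by (simp add: field_simps power_mult_distrib)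
  qed
  then show ?thesis using a unfolding hits_def a_def by blast
qed

text \<open>Let \<open>q\<close> be the monic polynomial with simple zeros on \<open>F\<close>. For small \<open>p\<close> the polynomial \<open>z - (p / q p) q z\<close> is close
to the identity.\<close>

lemma interpolating_perturbation:
  assumes w: "weighted_points F k" and \<eta>: "\<eta> > 0"
  obtains \<epsilon> where "\<epsilon> > 0" "\<And>p. norm (p::complex) < \<epsilon> \<Longrightarrow> \<exists>\<nu>. \<nu> holomorphic_on UNIV \<and> \<nu> p = 0 \<and> (\<forall>a\<in>F. \<nu> a = a) \<and>
    (\<forall>z\<in>ball 0 1. norm (\<nu> z) < 1 + \<eta>)"
proof -
  note wp = weighted_pointsD[OF w]
  define q where "q z = (\<Prod>a\<in>F. z - a)" for z
  have q0: "q 0 \<noteq> 0" using wp(1,4) by (auto simp: q_def)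
  have qc: "isCont q 0" unfolding q_def by (intro continuous_intros)
  have "((\<lambda>p. norm p / norm (q p) * 2 ^ card F) \<longlongrightarrow> norm (0::complex) / norm (q 0) * 2 ^ card F) (nhds 0)"
    using qc q0 by (intro tendsto_intros filterlim_ident) (auto simp: isCont_def tendsto_at_iff_tendsto_nhds)
  then have e1: "\<forall>\<^sub>F p in nhds 0. norm p / norm (q p) * 2 ^ card F < \<eta>"
    by (rule order_tendstoD(2)) (use \<eta> in simp)
  have "(q \<longlongrightarrow> q 0) (nhds 0)" using qc by (simp add: isCont_def tendsto_at_iff_tendsto_nhds)
  then have e2: "\<forall>\<^sub>F p in nhds 0. q p \<noteq> 0" using q0 by (rule tendsto_imp_eventually_ne)
  have "\<forall>\<^sub>F p in nhds 0. norm p / norm (q p) * 2 ^ card F < \<eta> \<and> q p \<noteq> 0"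
    using e1 e2 by eventually_elim simp
  then obtain \<epsilon> where \<epsilon>: "\<epsilon> > 0"
    and d: "\<And>p. norm (p::complex) < \<epsilon> \<Longrightarrow> norm p / norm (q p) * 2 ^ card F < \<eta> \<and> q p \<noteq> 0"
    unfolding eventually_nhds_metric by auto
  show thesis
  proof (rule that[OF \<epsilon>])
    fix p :: complex assume p: "norm p < \<epsilon>"
    define \<nu> where "\<nu> z = z - p / q p * q z" for z
    have "\<nu> holomorphic_on UNIV" unfolding \<nu>_def q_def by (intro holomorphic_intros)
    moreover have "\<nu> p = 0" using d[OF p] by (simp add: \<nu>_def)
    moreover have "\<nu> a = a" if "a \<in> F" for a using that wp(1) by (auto simp: \<nu>_def q_def)
    moreover have "norm (\<nu> z) < 1 + \<eta>" if z: "z \<in> ball 0 1" for z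
    proof -
      have "norm (q z) \<le> (\<Prod>a\<in>F. 2)"
        unfolding q_def prod_norm[symmetric]
      proof (intro prod_mono conjI)
        fix a assume "a \<in> F"
        then show "norm (z - a) \<le> 2" using norm_triangle_ineq4[of z a] wp(3)[of a] z by simp
      qed auto
      then have "norm (p / q p * q z) \<le> norm p / norm (q p) * 2 ^ card F"
        unfolding norm_mult norm_divide by (intro mult_left_mono) auto
      also have "\<dots> < \<eta>" using d[OF p] by blast
      finally show ?thesis using norm_triangle_ineq4[of z "p / q p * q z"] z by (simp add: \<nu>_def)
    qed
    ultimately show "\<exists>\<nu>. \<nu> holomorphic_on UNIV \<and> \<nu> p = 0 \<and> (\<forall>a\<in>F. \<nu> a = a) \<and> (\<forall>z\<in>ball 0 1. norm (\<nu> z) < 1 + \<eta>)"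
      by blast
  qed
qed

lemma perturbed_rescaled_hits:
  assumes w: "weighted_points F k" and g: "self_disc g" and \<nu>: "\<nu> holomorphic_on UNIV" "\<And>a. a \<in> F \<Longrightarrow> \<nu> a = a"
    and r: "0 < r" "r < 1" and z: "norm z < 1" "hits g F k z M"
  shows "hits (\<lambda>w. \<nu> (g (of_real r * w))) F k (z / of_real r) M"
proof -
  define a where "a = g z"
  obtain C where a: "a \<in> F" and C: "\<forall>\<^sub>F w in at z. norm (g w - a) ^ k a \<le> C * norm (w - z) ^ M"
    using z(2) by (auto simp: hits_def a_def)
  obtain D where D: "D > 0" "\<forall>\<^sub>F v in at a. norm (\<nu> v - \<nu> a) \<le> D * norm (v - a)"
    using holomorphic_first_order_bound[OF \<nu>(1), of a] by auto
  have ev\<nu>: "\<forall>\<^sub>F v in nhds a. norm (\<nu> v - a) \<le> D * norm (v - a)"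
    using D \<nu>(2)[OF a] by (auto simp: eventually_nhds_conv_at)
  have gc: "(g \<longlongrightarrow> a) (at z)"
    using holomorphic_on_imp_continuous_on[OF self_discD(1)[OF g]] z(1)
    by (simp add: continuous_on_eq_continuous_at isCont_def a_def)
  have e: "\<forall>\<^sub>F w in at z. norm (\<nu> (g w) - a) \<le> D * norm (g w - a)"
    using eventually_compose_filterlim[OF ev\<nu> gc] .
  have bd: "\<forall>\<^sub>F w in at z. norm (\<nu> (g w) - a) ^ k a \<le> (D ^ k a * C) * norm (w - z) ^ M"
    using e C
  proof eventually_elim
    case (elim w)
    have "norm (\<nu> (g w) - a) ^ k a \<le> (D * norm (g w - a)) ^ k a" using elim(1) by (intro power_mono) auto
    also have "\<dots> \<le> D ^ k a * (C * norm (w - z) ^ M)"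
      unfolding power_mult_distrib using elim(2) D(1) by (intro mult_left_mono) auto
    finally show ?case by (simp add: mult.assoc)
  qed
  have fl: "filterlim (\<lambda>w. of_real r * w) (at z) (at (z / of_real r))"
    unfolding filterlim_at
  proof
    have "((\<lambda>w. of_real r * w) \<longlongrightarrow> of_real r * (z / of_real r)) (at (z / of_real r))" by (intro tendsto_intros)
    then show "((\<lambda>w. of_real r * w) \<longlongrightarrow> z) (at (z / of_real r))" using r by simp
    show "\<forall>\<^sub>F w in at (z / of_real r). of_real r * w \<in> UNIV \<and> of_real r * w \<noteq> z"
      using eventually_neq_at_within[of "z / of_real r"] r by (auto elim!: eventually_mono simp: field_simps)
  qed
  have "\<forall>\<^sub>F w in at (z / of_real r). norm (\<nu> (g (of_real r * w)) - a) ^ k a \<le> (D ^ k a * C) * norm (of_real r * w - z) ^ M"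
    using eventually_compose_filterlim[OF bd fl] .
  then have "\<forall>\<^sub>F w in at (z / of_real r). norm (\<nu> (g (of_real r * w)) - a) ^ k a \<le> (D ^ k a * C * r ^ M) * norm (w - z / of_real r) ^ M"
  proof eventually_elim
    case (elim w)
    have "of_real r * w - z = of_real r * (w - z / of_real r)" using r by (simp add: field_simps)
    then have "norm (of_real r * w - z) = r * norm (w - z / of_real r)" using r by (metis abs_of_pos norm_mult norm_of_real)
    then show ?case using elim by (simp add: power_mult_distrib mult.assoc)
  qed
  moreover have eq: "\<nu> (g (of_real r * (z / of_real r))) = a" using r \<nu>(2)[OF a] by (simp add: a_def)
  ultimately show ?thesis unfolding hits_def eq using a by blast
qed

section \<open>Simultaneous hits\<close>

lemma finite_critical_points:
  assumes b: "b holomorphic_on ball 0 R" "R > 1" "\<not> b constant_on ball 0 R"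
  shows "finite {\<zeta> \<in> cball 0 1. deriv b \<zeta> = 0}"
proof (cases "deriv b constant_on ball 0 R")
  case True
  then obtain c where c: "\<And>z. z \<in> ball 0 R \<Longrightarrow> deriv b z = c" unfolding constant_on_def by blast
  have sub: "z \<in> ball 0 R" if "z \<in> cball 0 1" for z :: complex using that b(2) by simp
  show ?thesis
  proof (cases "c = 0")
    case True
    have "\<exists>d. \<forall>z\<in>ball 0 R. b z = d"
    proof (rule has_field_derivative_zero_constant[OF convex_ball])
      fix z :: complex assume z: "z \<in> ball 0 R"
      show "(b has_field_derivative 0) (at z within ball 0 R)"
        using holomorphic_derivI[OF b(1) open_ball z] c[OF z] True has_field_derivative_at_within by metis
    qed
    then show ?thesis using b(3) unfolding constant_on_def by blast
  next
    case False
    then have "{\<zeta> \<in> cball 0 1. deriv b \<zeta> = 0} = {}" using c sub by blast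
    then show ?thesis by (metis finite.emptyI)
  qed
next
  case False
  have "deriv b holomorphic_on ball 0 R" using b(1) by (intro holomorphic_deriv) auto
  then show ?thesis
    by (rule holomorphic_compact_finite_zeros[OF _ open_ball connected_ball compact_cball _ False]) (use b(2) in auto)
qed

lemma open_image_small_disc:
  assumes b: "b holomorphic_on ball 0 R" "R > 1" "\<not> b constant_on ball 0 R" and e: "e \<le> 1"
  shows "open (b ` ball 0 e)"
proof -
  have "ball 0 e \<subseteq> ball (0::complex) R" using b(2) e by (simp add: subset_ball)
  then show ?thesis by (rule open_mapping_thm[OF b(1) open_ball connected_ball open_ball _ b(3)])
qed

text \<open>The equality of the two products means that, after a rotation of one of them, the Blaschke products have the same value
\<open>c0\<close> at \<open>0\<close>. A nearby value \<open>c1\<close> is regular for both. The zeros of a power \<open>U\<^sup>M\<close> with value \<open>c1\<close> at \<open>0\<close> that lifts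
through both Blaschke products become common hits of the two lifts, and the multiplicity \<open>M\<close> is the same everywhere.
Dilation by a factor \<open>r < 1\<close> makes the lifts holomorphic beyond the closed disc.\<close>

lemma simultaneous_hits_balanced:
  assumes w1: "weighted_points F1 k1" and w2: "weighted_points F2 k2" and \<eta>: "\<eta> > 0"
    and eq: "(\<Prod>a\<in>F1. norm a ^ k1 a) = (\<Prod>a\<in>F2. norm a ^ k2 a)"
    and \<kappa>: "(\<Prod>a\<in>F1. norm a ^ k1 a) < \<kappa>" "\<kappa> \<le> 1"
  obtains h1 h2 \<rho> Z M where "\<rho> > 1" "h1 holomorphic_on ball 0 \<rho>" "h2 holomorphic_on ball 0 \<rho>"
    "\<And>z. z \<in> ball 0 \<rho> \<Longrightarrow> norm (h1 z) < 1 + \<eta> \<and> norm (h2 z) < 1 + \<eta>" "h1 0 = 0" "h2 0 = 0"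
    "finite Z" "Z \<subseteq> ball 0 1 - {0}" "(\<Prod>z\<in>Z. norm z ^ M) < \<kappa>"
    "\<And>z. z \<in> Z \<Longrightarrow> hits h1 F1 k1 z M \<and> hits h2 F2 k2 z M"
proof -
  note wp1 = weighted_pointsD[OF w1] and wp2 = weighted_pointsD[OF w2]
  define c0 where "c0 = blaschke F1 k1 0"
  have B0: "blaschke F1 k1 0 \<noteq> 0" "blaschke F2 k2 0 \<noteq> 0"
    using blaschke_norm(3)[OF w1, of 0] blaschke_norm(3)[OF w2, of 0] wp1(6) wp2(6) by auto
  define u where "u = c0 / blaschke F2 k2 0"
  have "norm (blaschke F2 k2 0) = norm (blaschke F1 k1 0)" using eq blaschke_norm(4)[OF w1] blaschke_norm(4)[OF w2] by simp
  then have u: "norm u = 1" using B0 by (simp add: u_def c0_def norm_divide)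
  define b1 where "b1 z = 1 * blaschke F1 k1 z" for z
  define b2 where "b2 z = u * blaschke F2 k2 z" for z
  have b0: "b1 0 = c0" "b2 0 = c0" using B0 by (auto simp: b1_def b2_def c0_def u_def)
  have nc0: "norm c0 < \<kappa>" using \<kappa>(1) blaschke_norm(4)[OF w1] by (simp add: c0_def)
  obtain R1 where R1': "R1 > 1" "blaschke F1 k1 holomorphic_on ball 0 R1"
    using blaschke_holomorphic[OF w1] by metis
  have R1: "R1 > 1" "b1 holomorphic_on ball 0 R1"
    unfolding b1_def using R1' by (auto intro!: holomorphic_intros)
  obtain R2 where R2': "R2 > 1" "blaschke F2 k2 holomorphic_on ball 0 R2"
    using blaschke_holomorphic[OF w2] by metis
  have R2: "R2 > 1" "b2 holomorphic_on ball 0 R2"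
    unfolding b2_def using R2' by (auto intro!: holomorphic_intros)
  have circ: "norm (b1 1) = 1" "norm (b2 1) = 1" using blaschke_norm(1)[OF w1] blaschke_norm(1)[OF w2] u
    by (auto simp: b1_def b2_def norm_mult)
  have nc: "\<not> b constant_on ball 0 R" if "R > 1" "norm (b 1) = 1" "norm (b 0) < 1" for b :: "complex \<Rightarrow> complex" and R
  proof
    assume "b constant_on ball 0 R"
    then obtain c where c: "\<And>z. z \<in> ball 0 R \<Longrightarrow> b z = c" unfolding constant_on_def by blast
    have "b 1 = c" "b 0 = c" using that(1) by (auto intro: c)
    then show False using that(2,3) by simp
  qed
  have "norm (b1 0) < 1" "norm (b2 0) < 1" using nc0 \<kappa>(2) b0 by auto
  then have nc1: "\<not> b1 constant_on ball 0 R1" and nc2: "\<not> b2 constant_on ball 0 R2"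
    using nc R1(1) R2(1) circ by blast+
  have k1: "finite {\<zeta> \<in> cball 0 1. deriv b1 \<zeta> = 0}" "\<And>e. e \<le> 1 \<Longrightarrow> open (b1 ` ball 0 e)"
    using finite_critical_points[OF R1(2,1) nc1] open_image_small_disc[OF R1(2,1) nc1] by blast+
  have k2: "finite {\<zeta> \<in> cball 0 1. deriv b2 \<zeta> = 0}" "\<And>e. e \<le> 1 \<Longrightarrow> open (b2 ` ball 0 e)"
    using finite_critical_points[OF R2(2,1) nc2] open_image_small_disc[OF R2(2,1) nc2] by blast+
  obtain \<epsilon>1 where \<epsilon>1: "\<epsilon>1 > 0" "\<And>p. norm p < \<epsilon>1 \<Longrightarrow> \<exists>\<nu>. \<nu> holomorphic_on UNIV \<and> \<nu> p = 0 \<and> (\<forall>a\<in>F1. \<nu> a = a) \<and>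
    (\<forall>z\<in>ball 0 1. norm (\<nu> z) < 1 + \<eta>)" using interpolating_perturbation[OF w1 \<eta>] by blast
  obtain \<epsilon>2 where \<epsilon>2: "\<epsilon>2 > 0" "\<And>p. norm p < \<epsilon>2 \<Longrightarrow> \<exists>\<nu>. \<nu> holomorphic_on UNIV \<and> \<nu> p = 0 \<and> (\<forall>a\<in>F2. \<nu> a = a) \<and>
    (\<forall>z\<in>ball 0 1. norm (\<nu> z) < 1 + \<eta>)" using interpolating_perturbation[OF w2 \<eta>] by blast
  \<comment> \<open>a common tolerance for the base points \<open>p1\<close> and \<open>p2\<close> that replace \<open>0\<close>\<close>
  define \<epsilon> where "\<epsilon> = min 1 (min \<epsilon>1 \<epsilon>2)"
  have \<epsilon>: "\<epsilon> > 0" "\<epsilon> \<le> 1" "\<epsilon> \<le> \<epsilon>1" "\<epsilon> \<le> \<epsilon>2" using \<epsilon>1(1) \<epsilon>2(1) by (auto simp: \<epsilon>_def)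
  define X where "X = b1 ` {\<zeta> \<in> cball 0 1. deriv b1 \<zeta> = 0} \<union> b2 ` {\<zeta> \<in> cball 0 1. deriv b2 \<zeta> = 0}"
  have X: "finite X" using k1(1) k2(1) by (simp add: X_def)
  define Ob where "Ob = b1 ` ball 0 \<epsilon> \<inter> b2 ` ball 0 \<epsilon> \<inter> ball 0 \<kappa>"
  have "c0 \<in> Ob" unfolding Ob_def using b0 \<epsilon>(1) nc0
    by (auto simp: image_iff intro!: bexI[of _ 0])
  moreover have "open Ob" unfolding Ob_def using k1(2) k2(2) \<epsilon>(2) by (intro open_Int) auto
  ultimately have "infinite Ob" using finite_imp_not_open by blast
  then have "\<not> Ob \<subseteq> insert 0 X" using X finite_subset by blast
  \<comment> \<open>a value near \<open>c0\<close> that is regular for both maps and not \<open>0\<close>\<close>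
  then obtain c1 where c1: "c1 \<in> Ob" "c1 \<noteq> 0" "c1 \<notin> X" by blast
  obtain p1 where p1: "norm p1 < \<epsilon>" "b1 p1 = c1" using c1(1) by (auto simp: Ob_def)
  obtain p2 where p2: "norm p2 < \<epsilon>" "b2 p2 = c1" using c1(1) by (auto simp: Ob_def)
  have c1\<kappa>: "norm c1 < \<kappa>" using c1(1) by (simp add: Ob_def)
  obtain \<nu>1 where \<nu>1: "\<nu>1 holomorphic_on UNIV" "\<nu>1 p1 = 0" "\<And>a. a \<in> F1 \<Longrightarrow> \<nu>1 a = a"
    "\<And>z. z \<in> ball 0 1 \<Longrightarrow> norm (\<nu>1 z) < 1 + \<eta>" using \<epsilon>1(2)[of p1] p1(1) \<epsilon>(3) by auto
  obtain \<nu>2 where \<nu>2: "\<nu>2 holomorphic_on UNIV" "\<nu>2 p2 = 0" "\<And>a. a \<in> F2 \<Longrightarrow> \<nu>2 a = a"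
    "\<And>z. z \<in> ball 0 1 \<Longrightarrow> norm (\<nu>2 z) < 1 + \<eta>" using \<epsilon>2(2)[of p2] p2(1) \<epsilon>(4) by auto
  define M where "M = (\<Prod>a\<in>F1. k1 a) * (\<Prod>a\<in>F2. k2 a)"
  have M: "M > 0" "\<And>a. a \<in> F1 \<Longrightarrow> k1 a dvd M" "\<And>a. a \<in> F2 \<Longrightarrow> k2 a dvd M"
  proof -
    show "M > 0" unfolding M_def using wp1(5) wp2(5) by (intro mult_pos_pos prod_pos) auto
    show "k1 a dvd M" if "a \<in> F1" for a unfolding M_def using dvd_prodI[OF wp1(1) that, of k1] by simp
    show "k2 a dvd M" if "a \<in> F2" for a unfolding M_def using dvd_prodI[OF wp2(1) that, of k2] by simp
  qed
  obtain q where q: "q ^ M = c1" by (rule exists_complex_root[of M c1]) (use M(1) in auto)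
  have nq: "norm q ^ M = norm c1" using q by (metis norm_power)
  have q1: "norm q < 1"
  proof (rule ccontr)
    assume "\<not> norm q < 1"
    then have "1 \<le> norm q ^ M" by (intro one_le_power) simp
    then show False using nq c1\<kappa> \<kappa>(2) by simp
  qed
  \<comment> \<open>the values that \<open>U\<close> has to omit for \<open>U\<^sup>M\<close> to omit the nonzero critical values\<close>
  define C where "C = {z. \<exists>x\<in>X - {0}. z ^ M = x} \<inter> ball 0 1"
  have "finite C"
  proof -
    have "{z. \<exists>x\<in>X - {0}. z ^ M = x} = (\<Union>x\<in>X - {0}. {z. z ^ M = x})" by blast
    moreover have "finite {z::complex. z ^ M = x}" if "x \<noteq> 0" for x
      using M(1) that by (intro finite_nth_roots)
    ultimately show ?thesis using X by (simp add: C_def)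
  qed
  have "0 \<notin> C" using M(1) by (auto simp: C_def)
  have "q \<notin> C" using c1(3) q by (auto simp: C_def)
  have "q \<noteq> 0" using q c1(2) M(1) by auto
  \<comment> \<open>strictly between \<open>\<bar>q\<bar>\<close> and the \<open>M\<close>-th root of \<open>\<kappa>\<close>\<close>
  define \<tau> where "\<tau> = root M ((norm c1 + \<kappa>) / 2)"
  have \<tau>: "\<tau> ^ M = (norm c1 + \<kappa>) / 2" "\<tau> \<ge> 0"
    using M(1) c1\<kappa> norm_ge_zero[of c1] unfolding \<tau>_def by (auto intro!: real_root_pow_pos2 real_root_ge_zero simp del: norm_ge_zero)
  have "norm q ^ M < \<tau> ^ M" using nq \<tau>(1) c1\<kappa> by simp
  then have "norm q < \<tau>" using \<tau>(2) by (rule power_less_imp_less_base)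
  obtain U Z where U: "self_disc U" "U 0 = q" "\<And>z. z \<in> ball 0 1 \<Longrightarrow> U z \<notin> C \<and> deriv U z \<noteq> 0"
    and Z: "finite Z" "Z \<subseteq> ball 0 1" "\<And>z. z \<in> Z \<Longrightarrow> U z = 0" "(\<Prod>z\<in>Z. norm z) < \<tau>"
    using avoiding_disc_with_many_zeros[OF \<open>finite C\<close> _ \<open>0 \<notin> C\<close> q1 \<open>q \<notin> C\<close> \<open>q \<noteq> 0\<close> \<open>norm q < \<tau>\<close>]
    unfolding C_def by blast
  have UX: "U z ^ M \<noteq> x" if "norm z < 1" "x \<in> X" "x \<noteq> 0" for z x
    using U(3)[of z] self_discD(2)[OF U(1), of z] that by (auto simp: C_def)
  have "\<exists>g. self_disc g \<and> g 0 = p1 \<and> (\<forall>z. norm z < 1 \<longrightarrow> b1 (g z) = U z ^ M)"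
  proof (rule lift_through_blaschke[where u = "1::complex" and k = k1 and F = F1])
    show "weighted_points F1 k1" "norm (1::complex) = 1" "self_disc U" "M > 0" "norm p1 < 1" using w1 u U(1) M(1) p1 \<epsilon>(2) by auto
    show "b1 z = (1::complex) * blaschke F1 k1 z" for z by (rule b1_def)
    show "k1 a dvd M" if "a \<in> F1" for a using M that by blast
    show "U z ^ M \<noteq> b1 \<zeta>" if "norm z < 1" "norm \<zeta> < 1" "deriv b1 \<zeta> = 0" "b1 \<zeta> \<noteq> 0" for z \<zeta>
      using that by (intro UX) (auto simp: X_def)
    show "b1 p1 = U 0 ^ M" using p1 U(2) q by simp
    show "deriv b1 p1 \<noteq> 0" using c1(3) p1 \<epsilon>(2) by (auto simp: X_def)
  qed
  then obtain g1 where g1: "self_disc g1" "g1 0 = p1" "\<And>z. norm z < 1 \<Longrightarrow> b1 (g1 z) = U z ^ M" by blast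
  have "\<exists>g. self_disc g \<and> g 0 = p2 \<and> (\<forall>z. norm z < 1 \<longrightarrow> b2 (g z) = U z ^ M)"
  proof (rule lift_through_blaschke[where u = u and k = k2 and F = F2])
    show "weighted_points F2 k2" "norm u = 1" "self_disc U" "M > 0" "norm p2 < 1" using w2 u U(1) M(1) p2 \<epsilon>(2) by auto
    show "b2 z = u * blaschke F2 k2 z" for z by (rule b2_def)
    show "k2 a dvd M" if "a \<in> F2" for a using M that by blast
    show "U z ^ M \<noteq> b2 \<zeta>" if "norm z < 1" "norm \<zeta> < 1" "deriv b2 \<zeta> = 0" "b2 \<zeta> \<noteq> 0" for z \<zeta>
      using that by (intro UX) (auto simp: X_def)
    show "b2 p2 = U 0 ^ M" using p2 U(2) q by simp
    show "deriv b2 p2 \<noteq> 0" using c1(3) p2 \<epsilon>(2) by (auto simp: X_def)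
  qed
  then obtain g2 where g2: "self_disc g2" "g2 0 = p2" "\<And>z. norm z < 1 \<Longrightarrow> b2 (g2 z) = U z ^ M" by blast
  have "(\<Prod>z\<in>Z. norm z) ^ M < \<tau> ^ M" using Z(4) M(1) by (intro power_strict_mono prod_nonneg) auto
  then have Z\<kappa>: "(\<Prod>z\<in>Z. norm z) ^ M < \<kappa>" using \<tau>(1) c1\<kappa> by simp
  obtain r where r: "0 < r" "r < 1" "\<And>z. z \<in> Z \<Longrightarrow> norm z < r" "(\<Prod>z\<in>Z. norm z / r) ^ M < \<kappa>"
  proof -
    have "isCont (\<lambda>r. (\<Prod>z\<in>Z. norm z / r) ^ M) (1::real)" by (intro continuous_intros) auto
    then have "((\<lambda>r. (\<Prod>z\<in>Z. norm z / r) ^ M) \<longlongrightarrow> (\<Prod>z\<in>Z. norm z / 1) ^ M) (at_left (1::real))"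
      unfolding isCont_def by (rule tendsto_mono[OF at_le, rotated]) simp
    then have "\<forall>\<^sub>F r in at_left 1. (\<Prod>z\<in>Z. norm z / r) ^ M < \<kappa>"
      by (rule order_tendstoD(2)) (use Z\<kappa> in simp)
    moreover have "\<forall>\<^sub>F r in at_left (1::real). \<forall>z\<in>Z. norm z < r"
    proof (rule eventually_ball_finite[OF Z(1)], rule ballI)
      fix z assume "z \<in> Z"
      then have "norm z < 1" using Z(2) by auto
      from eventually_at_left_real[OF this] show "\<forall>\<^sub>F r in at_left 1. norm z < r" by eventually_elim simp
    qed
    moreover have "\<forall>\<^sub>F r in at_left (1::real). r \<in> {0<..<1}" by (rule eventually_at_left_real) simp
    ultimately have "\<forall>\<^sub>F r in at_left 1. (\<Prod>z\<in>Z. norm z / r) ^ M < \<kappa> \<and> (\<forall>z\<in>Z. norm z < r) \<and> r \<in> {0<..<1}"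
      by eventually_elim simp
    then obtain r where "(\<Prod>z\<in>Z. norm z / r) ^ M < \<kappa> \<and> (\<forall>z\<in>Z. norm z < r) \<and> r \<in> {0<..<1}"
      using eventually_happens'[OF trivial_limit_at_left_real] by blast
    then show thesis using that by auto
  qed
  have in1: "of_real r * z \<in> ball 0 1" if "z \<in> ball 0 (1 / r)" for z :: complex
    using that r(1) by (simp add: norm_mult field_simps)
  have hol: "(\<lambda>w. \<nu> (g (of_real r * w))) holomorphic_on ball 0 (1 / r)"
    if "\<nu> holomorphic_on UNIV" "self_disc g" for \<nu> g
  proof -
    have "(\<lambda>w. g (of_real r * w)) holomorphic_on ball 0 (1 / r)"
      using holomorphic_on_compose_gen[of "\<lambda>w. of_real r * w" "ball 0 (1 / r)" g "ball 0 1"] self_discD(1)[OF that(2)] in1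
      by (simp add: o_def image_subset_iff holomorphic_intros)
    from holomorphic_on_compose_gen[OF this that(1)] show ?thesis by (simp add: o_def)
  qed
  show thesis
  proof (rule that[of "1 / r" "\<lambda>w. \<nu>1 (g1 (of_real r * w))" "\<lambda>w. \<nu>2 (g2 (of_real r * w))" "(\<lambda>z. z / of_real r) ` Z" M])
    show "1 / r > 1" using r by simp
    show "norm (\<nu>1 (g1 (of_real r * z))) < 1 + \<eta> \<and> norm (\<nu>2 (g2 (of_real r * z))) < 1 + \<eta>" if "z \<in> ball 0 (1 / r)" for z
      using \<nu>1(4)[OF self_discD(2)[OF g1(1) in1[OF that]]] \<nu>2(4)[OF self_discD(2)[OF g2(1) in1[OF that]]] by simp
    show "(\<lambda>z. z / of_real r) ` Z \<subseteq> ball 0 1 - {0}"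
      using r(1,3) Z(3) U(2) \<open>q \<noteq> 0\<close> by (auto simp: norm_divide)
    have "inj_on (\<lambda>z. z / complex_of_real r) Z" using r(1) by (intro inj_onI) simp
    then have "(\<Prod>z\<in>(\<lambda>z. z / of_real r) ` Z. norm z ^ M) = (\<Prod>z\<in>Z. norm z / r) ^ M"
      using r(1) by (simp add: prod.reindex norm_divide prod_power_distrib)
    then show "(\<Prod>z\<in>(\<lambda>z. z / of_real r) ` Z. norm z ^ M) < \<kappa>" using r(4) by simp
    fix z assume "z \<in> (\<lambda>z. z / complex_of_real r) ` Z"
    then obtain z' where z': "z' \<in> Z" "z = z' / of_real r" by blast
    have n: "norm z' < 1" using z'(1) Z(2) by auto
    have "hits g1 F1 k1 z' M"
      by (rule lift_hits[OF w1 _ U(1) M(1) g1(1), of 1]) (use g1(3) n Z(3)[OF z'(1)] b1_def in auto)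
    moreover have "hits g2 F2 k2 z' M"
      by (rule lift_hits[OF w2 u U(1) M(1) g2(1)]) (use g2(3) n Z(3)[OF z'(1)] b2_def in auto)
    ultimately show "hits (\<lambda>w. \<nu>1 (g1 (of_real r * w))) F1 k1 z M \<and> hits (\<lambda>w. \<nu>2 (g2 (of_real r * w))) F2 k2 z M"
      unfolding z'(2) using perturbed_rescaled_hits[OF w1 g1(1) \<nu>1(1,3) r(1,2) n] perturbed_rescaled_hits[OF w2 g2(1) \<nu>2(1,3) r(1,2) n]
      by blast
  qed (use hol \<nu>1(1,2) \<nu>2(1,2) g1(1,2) g2(1,2) Z(1) in auto)
qed

text \<open>The points of \<open>F\<close> are multiplied with \<open>1 / r\<close>, and those that leave the disc are dropped. As \<open>r\<close> decreases from
\<open>1\<close>, the product increases continuously to the value \<open>1\<close> of the empty product.\<close>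

lemma rescale_points:
  assumes w: "weighted_points F k" and \<tau>: "(\<Prod>a\<in>F. norm a ^ k a) \<le> \<tau>" "\<tau> < 1"
  obtains r F' where "0 < r" "r \<le> 1" "weighted_points F' (\<lambda>a. k (of_real r * a))"
    "\<And>a. a \<in> F' \<Longrightarrow> of_real r * a \<in> F" "(\<Prod>a\<in>F'. norm a ^ k (of_real r * a)) = \<tau>"
proof -
  note wp = weighted_pointsD[OF w]
  define s where "s = Min (norm ` F)"
  have fin: "finite (norm ` F)" "norm ` F \<noteq> {}" using wp by auto
  have sle: "s \<le> norm a" if "a \<in> F" for a using fin that by (simp add: s_def)
  have s0: "0 < s" using wp(4) by (simp add: s_def Min_gr_iff[OF fin])
  have s1: "s \<le> 1" using sle wp(2,3) by (metis all_not_in_conv less_imp_le order_trans)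
  \<comment> \<open>points that leave the disc contribute a factor \<open>1\<close>, which makes \<open>f\<close> continuous\<close>
  define f where "f r = (\<Prod>a\<in>F. min 1 (norm a / r) ^ k a)" for r
  have "f s = 1" unfolding f_def using s0 sle by (intro prod.neutral) (auto simp: min_def field_simps)
  moreover have "f 1 = (\<Prod>a\<in>F. norm a ^ k a)" unfolding f_def using wp(3) by (intro prod.cong refl) (simp add: min_absorb2 less_imp_le)
  moreover have "continuous_on {s..1} f" unfolding f_def using s0 by (intro continuous_intros) auto
  ultimately obtain r where r: "s \<le> r" "r \<le> 1" "f r = \<tau>" using IVT2'[of f 1 \<tau> s] \<tau> s1 by auto
  have r0: "r > 0" using r(1) s0 by simp
  define G where "G = {a \<in> F. norm a < r}"
  define F' where "F' = (\<lambda>a. a / of_real r) ` G"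
  have "inj_on (\<lambda>a. a / complex_of_real r) G" using r0 by (intro inj_onI) simp
  then have "(\<Prod>a\<in>F'. norm a ^ k (of_real r * a)) = (\<Prod>a\<in>G. (norm a / r) ^ k a)"
    using r0 by (simp add: F'_def prod.reindex norm_divide)
  also have "\<dots> = f r"
    unfolding f_def
    by (rule prod.mono_neutral_cong_left) (use wp(1) r0 in \<open>auto simp: G_def min_def field_simps\<close>)
  finally have eq: "(\<Prod>a\<in>F'. norm a ^ k (of_real r * a)) = \<tau>" using r(3) by simp
  then have "F' \<noteq> {}" using \<tau>(2) by auto
  then have "weighted_points F' (\<lambda>a. k (of_real r * a))"
    unfolding weighted_points_def F'_def using wp r0 by (auto simp: G_def norm_divide)
  moreover have "of_real r * a \<in> F" if "a \<in> F'" for a using that r0 by (auto simp: F'_def G_def)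
  ultimately show thesis using that r0 r(2) eq by blast
qed

text \<open>The configuration with the smaller product is rescaled until the products are equal. The rescaling is undone by
multiplying the corresponding map with \<open>r \<le> 1\<close>, which keeps it in the disc of radius \<open>1 + \<eta>\<close>.\<close>

theorem simultaneous_hits:
  assumes w1: "weighted_points F1 k1" and w2: "weighted_points F2 k2" and \<eta>: "\<eta> > 0"
    and \<kappa>: "(\<Prod>a\<in>F1. norm a ^ k1 a) < \<kappa>" "(\<Prod>a\<in>F2. norm a ^ k2 a) < \<kappa>" "\<kappa> \<le> 1"
  obtains h1 h2 \<rho> Z M where "\<rho> > 1" "h1 holomorphic_on ball 0 \<rho>" "h2 holomorphic_on ball 0 \<rho>"
    "\<And>z. z \<in> ball 0 \<rho> \<Longrightarrow> norm (h1 z) < 1 + \<eta> \<and> norm (h2 z) < 1 + \<eta>" "h1 0 = 0" "h2 0 = 0"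
    "finite Z" "Z \<subseteq> ball 0 1 - {0}" "(\<Prod>z\<in>Z. norm z ^ M) < \<kappa>"
    "\<And>z. z \<in> Z \<Longrightarrow> hits h1 F1 k1 z M \<and> hits h2 F2 k2 z M"
proof -
  define \<tau> where "\<tau> = max (\<Prod>a\<in>F1. norm a ^ k1 a) (\<Prod>a\<in>F2. norm a ^ k2 a)"
  have \<tau>: "\<tau> < \<kappa>" "\<tau> < 1" using \<kappa> by (auto simp: \<tau>_def)
  obtain r1 G1 where r1: "0 < r1" "r1 \<le> 1" "weighted_points G1 (\<lambda>a. k1 (of_real r1 * a))"
    "\<And>a. a \<in> G1 \<Longrightarrow> of_real r1 * a \<in> F1" "(\<Prod>a\<in>G1. norm a ^ k1 (of_real r1 * a)) = \<tau>"
    using rescale_points[OF w1 _ \<tau>(2)] by (auto simp: \<tau>_def)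
  obtain r2 G2 where r2: "0 < r2" "r2 \<le> 1" "weighted_points G2 (\<lambda>a. k2 (of_real r2 * a))"
    "\<And>a. a \<in> G2 \<Longrightarrow> of_real r2 * a \<in> F2" "(\<Prod>a\<in>G2. norm a ^ k2 (of_real r2 * a)) = \<tau>"
    using rescale_points[OF w2 _ \<tau>(2)] by (auto simp: \<tau>_def)
  have scaled: "hits (\<lambda>w. of_real r * h w) F k z M"
    if r: "0 < r" "r \<le> 1" and G: "\<And>a. a \<in> G \<Longrightarrow> of_real r * a \<in> F" and hh: "hits h G (\<lambda>a. k (of_real r * a)) z M"
    for r F G h k z M
  proof -
    obtain C where C: "\<forall>\<^sub>F w in at z. norm (h w - h z) ^ k (of_real r * h z) \<le> C * norm (w - z) ^ M" and hz: "h z \<in> G"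
      using hh by (auto simp: hits_def)
    have "\<forall>\<^sub>F w in at z. norm (of_real r * h w - of_real r * h z) ^ k (of_real r * h z) \<le> C * norm (w - z) ^ M"
      using C
    proof eventually_elim
      case (elim w)
      have "norm (of_real r * h w - of_real r * h z) = r * norm (h w - h z)"
        using r(1) by (metis abs_of_pos norm_mult norm_of_real right_diff_distrib)
      also have "\<dots> \<le> norm (h w - h z)" using r by (intro mult_left_le_one_le) auto
      finally have "norm (of_real r * h w - of_real r * h z) ^ k (of_real r * h z) \<le> norm (h w - h z) ^ k (of_real r * h z)"
        by (intro power_mono) auto
      then show ?case using elim by linarith
    qed
    then show ?thesis using G[OF hz] unfolding hits_def by blast
  qed
  have bd: "norm (of_real r * x) < 1 + \<eta>" if "0 < r" "r \<le> 1" "norm x < 1 + \<eta>" for r and x :: complex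
    using that mult_left_le_one_le[of "norm x" r] by (simp add: norm_mult)
  show thesis
  proof (rule simultaneous_hits_balanced[OF r1(3) r2(3) \<eta>, of \<kappa>])
    show "(\<Prod>a\<in>G1. norm a ^ k1 (of_real r1 * a)) = (\<Prod>a\<in>G2. norm a ^ k2 (of_real r2 * a))"
      "(\<Prod>a\<in>G1. norm a ^ k1 (of_real r1 * a)) < \<kappa>" "\<kappa> \<le> 1"
      using r1(5) r2(5) \<tau>(1) \<kappa>(3) by simp_all
    fix h1 h2 \<rho> Z M
    assume h: "\<rho> > 1" "h1 holomorphic_on ball 0 \<rho>" "h2 holomorphic_on ball 0 \<rho>"
      "\<And>z. z \<in> ball 0 \<rho> \<Longrightarrow> norm (h1 z) < 1 + \<eta> \<and> norm (h2 z) < 1 + \<eta>" "h1 0 = 0" "h2 0 = 0"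
      "finite Z" "Z \<subseteq> ball 0 1 - {0}" "(\<Prod>z\<in>Z. norm z ^ M) < \<kappa>"
      "\<And>z. z \<in> Z \<Longrightarrow> hits h1 G1 (\<lambda>a. k1 (of_real r1 * a)) z M \<and> hits h2 G2 (\<lambda>a. k2 (of_real r2 * a)) z M"
    show thesis
    proof (rule that[of \<rho> "\<lambda>w. of_real r1 * h1 w" "\<lambda>w. of_real r2 * h2 w" Z M])
      show "(\<lambda>w. of_real r1 * h1 w) holomorphic_on ball 0 \<rho>" "(\<lambda>w. of_real r2 * h2 w) holomorphic_on ball 0 \<rho>"
        using h(2,3) by (auto intro!: holomorphic_intros)
      show "norm (of_real r1 * h1 z) < 1 + \<eta> \<and> norm (of_real r2 * h2 z) < 1 + \<eta>" if "z \<in> ball 0 \<rho>" for z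
        using bd[OF r1(1,2)] bd[OF r2(1,2)] h(4)[OF that] by blast
      show "hits (\<lambda>w. of_real r1 * h1 w) F1 k1 z M \<and> hits (\<lambda>w. of_real r2 * h2 w) F2 k2 z M" if "z \<in> Z" for z
        using scaled[of r1 G1 F1 h1 k1 z M, OF r1(1,2,4) conjunct1[OF h(10)[OF that]]]
          scaled[of r2 G2 F2 h2 k2 z M, OF r2(1,2,4) conjunct2[OF h(10)[OF that]]] ..
    qed (use h in simp_all)
  qed
qed

section \<open>Subharmonic functions and the maximum principle\<close>

lemma mean_value_holomorphic:
  assumes G: "G holomorphic_on ball c R" and r: "0 < r" "r < R"
  shows "((\<lambda>t. G (c + of_real r * cis t)) has_integral (2 * of_real pi * G c)) {0..2*pi}"
proof -
  have sub: "cball c r \<subseteq> ball c R" using r by auto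
  have "((\<lambda>u. G u / (u - c)) has_contour_integral (2 * of_real pi * \<i> * G c)) (circlepath c r)"
    using r
    by (intro Cauchy_integral_circlepath continuous_on_subset[OF holomorphic_on_imp_continuous_on[OF G] sub]
        holomorphic_on_subset[OF G]) (simp_all add: subset_ball)
  then have "((\<lambda>t. G (c + of_real r * cis t) / (c + of_real r * cis t - c) * of_real r * \<i> * cis t) has_integral (2 * of_real pi * \<i> * G c)) {0..2*pi}"
    unfolding circlepath_def by (subst (asm) has_contour_integral_part_circlepath_iff) auto
  then have "((\<lambda>t. \<i> * G (c + of_real r * cis t)) has_integral (2 * of_real pi * \<i> * G c)) {0..2*pi}"
    using r by (simp add: mult.commute)
  from has_integral_mult_right[OF this, of "- \<i>"] show ?thesis by (simp add: mult.assoc mult.left_commute)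
qed

text \<open>The integrals of the positive and of the negative part are compared separately, since \<open>v\<close> need not be integrable.\<close>

lemma circle_mean_le_Re:
  assumes G: "G holomorphic_on ball c R" and r: "0 < r" "r < R"
    and le: "\<And>z. z \<in> sphere c r \<Longrightarrow> v z \<le> ereal (Re (G z))"
  shows "circle_mean v c r \<le> ereal (Re (G c))"
proof -
  define g where "g t = Re (G (c + of_real r * cis t))" for t
  define f where "f t = indicator {0..2*pi} t *\<^sub>R g t" for t
  have onc: "c + of_real r * cis t \<in> sphere c r" for t using r by (simp add: dist_norm norm_mult)
  have "continuous_on {0..2*pi} (\<lambda>t. G (c + of_real r * cis t))"
    by (rule continuous_on_compose2[OF holomorphic_on_imp_continuous_on[OF G]])
       (use r in \<open>auto intro!: continuous_intros simp: dist_norm norm_mult\<close>)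
  then have "continuous_on {0..2*pi} g" unfolding g_def by (intro continuous_intros)
  then have si: "set_integrable lborel {0..2*pi} g" by (rule borel_integrable_atLeastAtMost')
  then have fi: "integrable lborel f" unfolding set_integrable_def f_def .
  have "(g has_integral Re (2 * of_real pi * G c)) {0..2*pi}"
    unfolding g_def by (intro has_integral_Re mean_value_holomorphic[OF G r])
  from integral_unique[OF this] have "integral\<^sup>L lborel f = 2 * pi * Re (G c)"
    using set_borel_integral_eq_integral(2)[OF si]
    unfolding set_lebesgue_integral_def f_def by simp
  define p where "p = (\<integral>\<^sup>+t. ennreal (f t) \<partial>lborel)"
  define n where "n = (\<integral>\<^sup>+t. ennreal (- f t) \<partial>lborel)"
  have fin: "p < \<infinity>" "n < \<infinity>" using fi unfolding p_def n_def real_integrable_def by (auto simp: less_top)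
  have pn: "enn2real p - enn2real n = 2 * pi * Re (G c)"
    using real_lebesgue_integral_def[OF fi] \<open>integral\<^sup>L lborel f = 2 * pi * Re (G c)\<close> by (simp add: p_def n_def)
  define a where "a = (\<integral>\<^sup>+t\<in>{0..2*pi}. e2ennreal (v (c + of_real r * cis t)) \<partial>lborel)"
  define b where "b = (\<integral>\<^sup>+t\<in>{0..2*pi}. e2ennreal (- v (c + of_real r * cis t)) \<partial>lborel)"
  have "a \<le> p" unfolding a_def p_def
  proof (rule nn_integral_mono)
    fix t
    show "e2ennreal (v (c + of_real r * cis t)) * indicator {0..2*pi} t \<le> ennreal (f t)"
      using e2ennreal_mono[OF le[OF onc[of t]]] by (auto simp: f_def g_def indicator_def)
  qed
  have "n \<le> b" unfolding b_def n_def
  proof (rule nn_integral_mono)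
    fix t
    have "ereal (- g t) \<le> - v (c + of_real r * cis t)"
      using le[OF onc[of t]] by (metis ereal_minus_le_minus g_def uminus_ereal.simps(1))
    from e2ennreal_mono[OF this]
    show "ennreal (- f t) \<le> e2ennreal (- v (c + of_real r * cis t)) * indicator {0..2*pi} t"
      by (auto simp: f_def indicator_def)
  qed
  have "enn2ereal a - enn2ereal b \<le> enn2ereal p - enn2ereal n"
    using \<open>a \<le> p\<close> \<open>n \<le> b\<close> by (intro ereal_minus_mono) (auto simp: less_eq_ennreal.rep_eq)
  also have "\<dots> = ereal (enn2real p - enn2real n)"
    using fin by (cases p; cases n) (auto simp: enn2ereal_ennreal)
  finally have "enn2ereal a - enn2ereal b \<le> ereal (2 * pi * Re (G c))" using pn by simp
  then have "(enn2ereal a - enn2ereal b) / ereal (2 * pi) \<le> ereal (2 * pi * Re (G c)) / ereal (2 * pi)"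
    by (intro ereal_divide_right_mono) auto
  also have "\<dots> = ereal (Re (G c))" by simp
  finally show ?thesis unfolding circle_mean_def a_def b_def .
qed

lemma subharmonic_sub_mean:
  assumes v: "v subharmonic_on S" "cball c r \<subseteq> S" and G: "G holomorphic_on ball c R" and r: "0 < r" "r < R"
    and le: "\<And>z. z \<in> sphere c r \<Longrightarrow> v z \<le> ereal (Re (G z))"
  shows "v c \<le> ereal (Re (G c))"
proof -
  have "v c \<le> circle_mean v c r" using v r(1) by (auto simp: subharmonic_on_def)
  also have "\<dots> \<le> ereal (Re (G c))" by (rule circle_mean_le_Re[OF G r le])
  finally show ?thesis .
qed

text \<open>Stated with distances on a subset, for maximisation over compact sets.\<close>

definition usc_on :: "'a::metric_space set \<Rightarrow> ('a \<Rightarrow> ereal) \<Rightarrow> bool"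
  where "usc_on K w \<longleftrightarrow> (\<forall>x\<in>K. w x \<noteq> \<infinity>) \<and> (\<forall>x\<in>K. \<forall>c. w x < c \<longrightarrow> (\<exists>d>0. \<forall>y\<in>K. dist y x < d \<longrightarrow> w y < c))"

lemma usc_imp_usc_on:
  assumes "usc (top_of_set S) v" "K \<subseteq> S"
  shows "usc_on K v"
  unfolding usc_on_def
proof (intro conjI ballI allI impI)
  show "v x \<noteq> \<infinity>" if "x \<in> K" for x using that assms by (auto simp: usc_def)
  fix x c assume x: "x \<in> K" "v x < c"
  have "openin (top_of_set S) {x \<in> S. v x < c}" using assms(1) by (auto simp: usc_def)
  moreover have "x \<in> {x \<in> S. v x < c}" using x assms(2) by blast
  ultimately obtain d where "d > 0" "ball x d \<inter> S \<subseteq> {x \<in> S. v x < c}"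
    unfolding openin_contains_ball by blast
  have "v y < c" if "y \<in> K" "dist y x < d" for y
  proof -
    have "y \<in> ball x d \<inter> S" using that assms(2) by (auto simp: dist_commute)
    then show ?thesis using \<open>ball x d \<inter> S \<subseteq> {x \<in> S. v x < c}\<close> by blast
  qed
  then show "\<exists>d>0. \<forall>y\<in>K. dist y x < d \<longrightarrow> v y < c" using \<open>d > 0\<close> by blast
qed

lemma usc_on_compose:
  assumes "usc_on L u" "continuous_on K p" "p ` K \<subseteq> L"
  shows "usc_on K (\<lambda>x. u (p x))"
  unfolding usc_on_def
proof (intro conjI ballI allI impI)
  show "u (p x) \<noteq> \<infinity>" if "x \<in> K" for x using that assms by (auto simp: usc_on_def)
  fix x c assume x: "x \<in> K" "u (p x) < c"
  then obtain d where d: "d > 0" "\<And>y. y \<in> L \<Longrightarrow> dist y (p x) < d \<Longrightarrow> u y < c"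
    using assms(1,3) unfolding usc_on_def by blast
  obtain e where "e > 0" "\<And>y. y \<in> K \<Longrightarrow> dist y x < e \<Longrightarrow> dist (p y) (p x) < d"
    using assms(2) x(1) d(1) unfolding continuous_on_iff by blast
  then show "\<exists>d>0. \<forall>y\<in>K. dist y x < d \<longrightarrow> u (p y) < c" using d(2) assms(3) by blast
qed

lemma usc_on_add_continuous:
  assumes u: "usc_on K u" and g: "continuous_on K g"
  shows "usc_on K (\<lambda>x. u x + ereal (g x))"
  unfolding usc_on_def
proof (intro conjI ballI allI impI)
  show "u x + ereal (g x) \<noteq> \<infinity>" if "x \<in> K" for x using that u by (cases "u x") (auto simp: usc_on_def)
  fix x c assume x: "x \<in> K" "u x + ereal (g x) < c"
  have "\<exists>s. u x < ereal s \<and> ereal (s + g x) < c"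
  proof (cases c)
    case (real c')
    have "u x < ereal (c' - g x)" using x(2) real by (cases "u x") auto
    then obtain s where "u x < ereal s" "ereal s < ereal (c' - g x)" using ereal_dense2 by blast
    then show ?thesis using real by (intro exI[of _ s]) auto
  next
    case PInf
    have "u x < \<infinity>" using u x(1) by (auto simp: usc_on_def)
    then obtain s where "u x < ereal s" using ereal_dense2 by blast
    then show ?thesis using PInf by auto
  qed (use x in auto)
  then obtain s where s: "u x < ereal s" "ereal (s + g x) < c" by blast
  obtain t where t: "ereal (s + g x) < ereal t" "ereal t < c" using ereal_dense2[OF s(2)] by blast
  obtain d1 where d1: "d1 > 0" "\<And>y. y \<in> K \<Longrightarrow> dist y x < d1 \<Longrightarrow> u y < ereal s"
    using u x(1) s(1) unfolding usc_on_def by blast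
  obtain d2 where d2: "d2 > 0" "\<And>y. y \<in> K \<Longrightarrow> dist y x < d2 \<Longrightarrow> dist (g y) (g x) < t - (s + g x)"
    using g x(1) t(1) unfolding continuous_on_iff by (metis diff_gt_0_iff_gt less_ereal.simps(1))
  have "u y + ereal (g y) < c" if y: "y \<in> K" "dist y x < min d1 d2" for y
  proof -
    have "u y + ereal (g y) \<le> ereal s + ereal (g y)" using d1(2)[of y] y by (intro add_right_mono) auto
    also have "\<dots> \<le> ereal t" using d2(2)[of y] y by (auto simp: dist_real_def)
    finally show ?thesis using t(2) by simp
  qed
  then show "\<exists>d>0. \<forall>y\<in>K. dist y x < d \<longrightarrow> u y + ereal (g y) < c"
    using d1(1) d2(1) by (intro exI[of _ "min d1 d2"]) auto
qed

lemma usc_on_attains_max: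
  assumes K: "compact K" "K \<noteq> {}" and w: "usc_on K w"
  obtains x where "x \<in> K" "\<And>y. y \<in> K \<Longrightarrow> w y \<le> w x"
proof (rule ccontr)
  assume "\<not> thesis"
  then have lt: "\<exists>y\<in>K. w x < w y" if "x \<in> K" for x using that \<open>\<not> thesis\<close> \<open>\<And>x. \<lbrakk>x \<in> K; \<And>y. y \<in> K \<Longrightarrow> w y \<le> w x\<rbrakk> \<Longrightarrow> thesis\<close> by (meson not_le)
  have "\<exists>y d. y \<in> K \<and> d > 0 \<and> (\<forall>z\<in>K. dist z x < d \<longrightarrow> w z < w y)" if x: "x \<in> K" for x
    using lt[OF x] w x unfolding usc_on_def by blast
  then obtain Y D where YD: "\<And>x. x \<in> K \<Longrightarrow> Y x \<in> K \<and> D x > 0 \<and> (\<forall>z\<in>K. dist z x < D x \<longrightarrow> w z < w (Y x))" by metis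
  have "K \<subseteq> (\<Union>x\<in>K. ball x (D x))" using YD by force
  then obtain K' where K': "K' \<subseteq> K" "finite K'" "K \<subseteq> (\<Union>x\<in>K'. ball x (D x))"
    using compactE_image[OF K(1), of K "\<lambda>x. ball x (D x)"] by auto
  have "K' \<noteq> {}" using K' K(2) by auto
  have "Max ((\<lambda>x. w (Y x)) ` K') \<in> (\<lambda>x. w (Y x)) ` K'" using K'(2) \<open>K' \<noteq> {}\<close> by (intro Max_in) auto
  then obtain x0 where x0: "x0 \<in> K'" "w (Y x0) = Max ((\<lambda>x. w (Y x)) ` K')" by force
  have "Y x0 \<in> K" using YD x0(1) K'(1) by blast
  then obtain x1 where x1: "x1 \<in> K'" "dist (Y x0) x1 < D x1" using K'(3) by (auto simp: dist_commute)
  then have "w (Y x0) < w (Y x1)" using YD[of x1] K'(1) \<open>Y x0 \<in> K\<close> by blast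
  moreover have "w (Y x1) \<le> w (Y x0)" unfolding x0(2) using K'(2) x1(1) by simp
  ultimately show False by simp
qed

text \<open>At no point \<open>z0\<close> is \<open>v\<close> touched from above by \<open>Re H - \<epsilon> \<bar>z - z0\<bar>\<^sup>2\<close> plus a constant, with \<open>H\<close> holomorphic. This is
subharmonicity in the viscosity sense, for a special class of test functions. It speaks about pointwise bounds
only, so no integrals have to be controlled when \<open>v\<close> is a composition.\<close>

definition no_harmonic_peak :: "(complex \<Rightarrow> ereal) \<Rightarrow> complex set \<Rightarrow> bool"
  where "no_harmonic_peak v S \<longleftrightarrow>
    (\<forall>z0 \<rho> H \<epsilon>. \<rho> > 0 \<longrightarrow> ball z0 \<rho> \<subseteq> S \<longrightarrow> H holomorphic_on ball z0 \<rho> \<longrightarrow> \<epsilon> > 0 \<longrightarrow> \<bar>v z0\<bar> \<noteq> \<infinity> \<longrightarrow>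
      \<not> (\<forall>z\<in>ball z0 \<rho>. v z \<le> v z0 + ereal (Re (H z) - Re (H z0) - \<epsilon> * (cmod (z - z0))\<^sup>2)))"

lemma no_harmonic_peakD:
  assumes "no_harmonic_peak v S" "\<rho> > 0" "ball z0 \<rho> \<subseteq> S" "H holomorphic_on ball z0 \<rho>" "\<epsilon> > 0" "\<bar>v z0\<bar> \<noteq> \<infinity>"
    "\<And>z. z \<in> ball z0 \<rho> \<Longrightarrow> v z \<le> v z0 + ereal (Re (H z) - Re (H z0) - \<epsilon> * (cmod (z - z0))\<^sup>2)"
  shows False
  using assms(1)[unfolded no_harmonic_peak_def, rule_format, OF assms(2-6)] assms(7) by blast

lemma no_harmonic_peakI:
  assumes "\<And>z0 \<rho> H \<epsilon>. \<rho> > 0 \<Longrightarrow> ball z0 \<rho> \<subseteq> S \<Longrightarrow> H holomorphic_on ball z0 \<rho> \<Longrightarrow> \<epsilon> > 0 \<Longrightarrow> \<bar>v z0\<bar> \<noteq> \<infinity> \<Longrightarrow>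
    (\<And>z. z \<in> ball z0 \<rho> \<Longrightarrow> v z \<le> v z0 + ereal (Re (H z) - Re (H z0) - \<epsilon> * (cmod (z - z0))\<^sup>2)) \<Longrightarrow> False"
  shows "no_harmonic_peak v S"
  unfolding no_harmonic_peak_def
proof (intro allI impI notI)
  fix z0 \<rho> H \<epsilon>
  assume a: "0 < (\<rho>::real)" "ball z0 \<rho> \<subseteq> S" "H holomorphic_on ball z0 \<rho>" "0 < (\<epsilon>::real)" "\<bar>v z0\<bar> \<noteq> \<infinity>"
    and le: "\<forall>z\<in>ball z0 \<rho>. v z \<le> v z0 + ereal (Re (H z) - Re (H z0) - \<epsilon> * (cmod (z - z0))\<^sup>2)"
  show False by (rule assms[OF a bspec[OF le]])
qed

lemma no_harmonic_peak_subset: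
  assumes "no_harmonic_peak v S" "U \<subseteq> S"
  shows "no_harmonic_peak v U"
proof (rule no_harmonic_peakI)
  fix z0 \<rho> H \<epsilon>
  assume a: "\<rho> > 0" "ball z0 \<rho> \<subseteq> U" "H holomorphic_on ball z0 \<rho>" "\<epsilon> > 0" "\<bar>v z0\<bar> \<noteq> \<infinity>"
    "\<And>z. z \<in> ball z0 \<rho> \<Longrightarrow> v z \<le> v z0 + ereal (Re (H z) - Re (H z0) - \<epsilon> * (cmod (z - z0))\<^sup>2)"
  show False by (rule no_harmonic_peakD[OF assms(1) a(1) order_trans[OF a(2) assms(2)] a(3-6)])
qed

lemma subharmonic_no_harmonic_peak:
  assumes v: "v subharmonic_on S"
  shows "no_harmonic_peak v S"
proof (rule no_harmonic_peakI)
  fix z0 \<rho> H \<epsilon>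
  assume \<rho>: "0 < (\<rho>::real)" "ball z0 \<rho> \<subseteq> S" and H: "H holomorphic_on ball z0 \<rho>" and \<epsilon>: "0 < (\<epsilon>::real)"
    and fin: "\<bar>v z0\<bar> \<noteq> \<infinity>" and le: "\<And>z. z \<in> ball z0 \<rho> \<Longrightarrow> v z \<le> v z0 + ereal (Re (H z) - Re (H z0) - \<epsilon> * (cmod (z - z0))\<^sup>2)"
  obtain m where m: "v z0 = ereal m" using fin by (cases "v z0") auto
  define r where "r = \<rho> / 2"
  have r: "0 < r" "r < \<rho>" using \<rho> by (auto simp: r_def)
  define G where "G z = of_real (m - \<epsilon> * r\<^sup>2) + (H z - H z0)" for z
  have "v z0 \<le> ereal (Re (G z0))"
  proof (rule subharmonic_sub_mean[OF v _ _ r])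
    show "cball z0 r \<subseteq> S" using \<rho>(2) r by (intro order_trans[OF _ \<rho>(2)]) auto
    show "G holomorphic_on ball z0 \<rho>" unfolding G_def using H by (intro holomorphic_intros)
    show "v z \<le> ereal (Re (G z))" if "z \<in> sphere z0 r" for z
    proof -
      have n: "cmod (z - z0) = r" using that by (simp add: dist_norm norm_minus_commute)
      then have "z \<in> ball z0 \<rho>" using r by (simp add: dist_norm norm_minus_commute)
      from le[OF this] show ?thesis using n m by (simp add: G_def algebra_simps)
    qed
  qed
  then have "\<epsilon> * r\<^sup>2 \<le> 0" using m by (simp add: G_def)
  moreover have "\<epsilon> * r\<^sup>2 > 0" using \<epsilon> r(1) by simp
  ultimately show False by simp
qed

text \<open>If \<open>v - h\<close> were positive somewhere, then \<open>v - h + \<epsilon> \<bar>z\<bar>\<^sup>2\<close> would have its maximum over \<open>K\<close> at a point \<open>z0\<close> of \<open>U\<close> for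
small \<open>\<epsilon>\<close>. Since \<open>\<bar>z\<bar>\<^sup>2\<close> is \<open>\<bar>z - z0\<bar>\<^sup>2\<close> plus a harmonic function, this is a harmonic peak of \<open>v\<close>.\<close>

lemma maximum_principle:
  assumes K: "compact K" and O: "U \<subseteq> K" and v: "usc_on K v" "no_harmonic_peak v U"
    and h: "continuous_on K h"
    and harm: "\<And>z0. z0 \<in> U \<Longrightarrow> \<exists>\<rho>>0. ball z0 \<rho> \<subseteq> U \<and> (\<exists>H. H holomorphic_on ball z0 \<rho> \<and> (\<forall>z\<in>ball z0 \<rho>. h z = Re (H z)))"
    and bd: "\<And>z. z \<in> K - U \<Longrightarrow> v z \<le> ereal (h z)" and z1: "z1 \<in> K"
  shows "v z1 \<le> ereal (h z1)"
proof (rule ccontr)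
  assume "\<not> v z1 \<le> ereal (h z1)"
  then have "ereal (h z1) < v z1" by simp
  then obtain t where t: "ereal (h z1) < ereal t" "ereal t < v z1" using ereal_dense2 by blast
  define \<eta> where "\<eta> = t - h z1"
  have \<eta>: "\<eta> > 0" "ereal (h z1 + \<eta>) < v z1" using t by (auto simp: \<eta>_def)
  obtain B where B: "\<And>z. z \<in> K \<Longrightarrow> (cmod z)\<^sup>2 \<le> B" "B \<ge> 0"
  proof -
    obtain b where "\<And>z. z \<in> K \<Longrightarrow> cmod z \<le> b" using compact_imp_bounded[OF K] bounded_iff by blast
    then have "(cmod z)\<^sup>2 \<le> b\<^sup>2" if "z \<in> K" for z using that by (intro power_mono) auto
    then show thesis using that[of "b\<^sup>2"] by simp
  qed
  define \<epsilon> where "\<epsilon> = \<eta> / (B + 1)"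
  have \<epsilon>: "\<epsilon> > 0" using \<eta> B(2) by (simp add: \<epsilon>_def)
  have \<epsilon>B: "\<epsilon> * (cmod z)\<^sup>2 < \<eta>" if "z \<in> K" for z
  proof -
    have "\<epsilon> * (cmod z)\<^sup>2 \<le> \<epsilon> * B" using B(1)[OF that] \<epsilon> by (intro mult_left_mono) auto
    also have "\<dots> < \<epsilon> * (B + 1)" using \<epsilon> by simp
    also have "\<dots> = \<eta>" using B(2) by (simp add: \<epsilon>_def)
    finally show ?thesis .
  qed
  define w where "w z = v z + ereal (\<epsilon> * (cmod z)\<^sup>2 - h z)" for z
  have "usc_on K w" unfolding w_def by (intro usc_on_add_continuous v(1) continuous_intros h)
  then obtain z0 where z0: "z0 \<in> K" "\<And>z. z \<in> K \<Longrightarrow> w z \<le> w z0"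
    using usc_on_attains_max[OF K] z1 by blast
  have "ereal \<eta> < w z1"
  proof -
    have "ereal \<eta> = ereal (h z1 + \<eta>) + ereal (- h z1)" by simp
    also have "\<dots> < v z1 + ereal (- h z1)" using \<eta>(2) by (cases "v z1") auto
    also have "\<dots> \<le> w z1" unfolding w_def using \<epsilon> by (intro add_left_mono) auto
    finally show ?thesis .
  qed
  then have big: "ereal \<eta> < w z0" using z0(2)[OF z1] by simp
  have z0U: "z0 \<in> U"
  proof (rule ccontr)
    assume "z0 \<notin> U"
    then have "w z0 \<le> ereal (h z0) + ereal (\<epsilon> * (cmod z0)\<^sup>2 - h z0)"
      unfolding w_def using bd z0(1) by (intro add_right_mono) auto
    then have "w z0 \<le> ereal (\<epsilon> * (cmod z0)\<^sup>2)" by simp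
    from less_le_trans[OF big this] show False using \<epsilon>B[OF z0(1)] by simp
  qed
  obtain m where m: "v z0 = ereal m"
    using big v(1) z0(1) unfolding w_def usc_on_def by (cases "v z0") auto
  obtain \<rho> H where \<rho>: "\<rho> > 0" "ball z0 \<rho> \<subseteq> U" "H holomorphic_on ball z0 \<rho>" "\<And>z. z \<in> ball z0 \<rho> \<Longrightarrow> h z = Re (H z)"
    using harm[OF z0U] by blast
  \<comment> \<open>\<open>2 \<epsilon> Re (cnj z0 z)\<close> is the harmonic part of \<open>\<epsilon> \<bar>z\<bar>\<^sup>2\<close> at \<open>z0\<close>\<close>
  define H' where "H' z = H z - of_real (2 * \<epsilon>) * cnj z0 * z" for z
  have hol: "H' holomorphic_on ball z0 \<rho>" unfolding H'_def using \<rho>(3) by (intro holomorphic_intros)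
  have le: "v z \<le> v z0 + ereal (Re (H' z) - Re (H' z0) - \<epsilon> * (cmod (z - z0))\<^sup>2)" if z: "z \<in> ball z0 \<rho>" for z
  proof -
    have "w z \<le> w z0" using z0(2) z \<rho>(2) O by blast
    then have "v z \<le> ereal (m + (\<epsilon> * (cmod z0)\<^sup>2 - h z0) - (\<epsilon> * (cmod z)\<^sup>2 - h z))"
      unfolding w_def m by (cases "v z") auto
    moreover
    have "(cmod z)\<^sup>2 - (cmod z0)\<^sup>2 = (cmod (z - z0))\<^sup>2 + 2 * Re (cnj z0 * z) - 2 * Re (cnj z0 * z0)"
      unfolding cmod_power2 by (simp add: power2_eq_square algebra_simps)
    then have "\<epsilon> * (cmod z)\<^sup>2 - \<epsilon> * (cmod z0)\<^sup>2 = \<epsilon> * (cmod (z - z0))\<^sup>2 + 2 * \<epsilon> * Re (cnj z0 * z) - 2 * \<epsilon> * Re (cnj z0 * z0)"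
      by (metis (no_types, opaque_lifting) distrib_left mult.assoc mult.left_commute right_diff_distrib')
    then have "m + (\<epsilon> * (cmod z0)\<^sup>2 - h z0) - (\<epsilon> * (cmod z)\<^sup>2 - h z) =
        m + (Re (H' z) - Re (H' z0) - \<epsilon> * (cmod (z - z0))\<^sup>2)"
      using \<rho>(1) \<rho>(4)[OF z] \<rho>(4)[of z0] by (simp add: H'_def algebra_simps)
    ultimately show ?thesis unfolding m by simp
  qed
  have fin: "\<bar>v z0\<bar> \<noteq> \<infinity>" using m by simp
  show False by (rule no_harmonic_peakD[OF v(2) \<rho>(1,2) hol \<epsilon> fin le])
qed

lemma log_norm_harmonic:
  assumes "q holomorphic_on ball z0 \<rho>" "\<And>z. z \<in> ball z0 \<rho> \<Longrightarrow> q z \<noteq> 0"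
  obtains H where "H holomorphic_on ball z0 \<rho>" "\<And>z. z \<in> ball z0 \<rho> \<Longrightarrow> ln (cmod (q z)) = Re (H z)"
proof -
  obtain L where "L holomorphic_on ball z0 \<rho>" "\<And>z. z \<in> ball z0 \<rho> \<Longrightarrow> q z = exp (L z)"
    using contractible_imp_holomorphic_log[OF assms(1) convex_imp_contractible[OF convex_ball] assms(2)] by blast
  then show thesis using that by simp
qed

lemma subharmonic_disc_bound:
  assumes v: "v subharmonic_on S" "cball 0 s \<subseteq> S" and le: "\<And>z. cmod z = s \<Longrightarrow> v z \<le> ereal A" and z: "cmod z \<le> s"
  shows "v z \<le> ereal A"
proof (rule maximum_principle[of "cball 0 s" "ball 0 s" v "\<lambda>_. A" z])
  show "usc_on (cball 0 s) v" using v by (auto simp: subharmonic_on_def intro: usc_imp_usc_on)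
  have "ball 0 s \<subseteq> S" using v(2) by auto
  then show "no_harmonic_peak v (ball 0 s)"
    by (intro no_harmonic_peak_subset[OF subharmonic_no_harmonic_peak[OF v(1)]])
  show "\<exists>\<rho>>0. ball z0 \<rho> \<subseteq> ball 0 s \<and> (\<exists>H. H holomorphic_on ball z0 \<rho> \<and> (\<forall>z\<in>ball z0 \<rho>. A = Re (H z)))"
    if z0: "z0 \<in> ball 0 s" for z0 :: complex
  proof -
    obtain \<rho> where "\<rho> > 0" "ball z0 \<rho> \<subseteq> ball 0 s" by (rule openE[OF open_ball z0])
    then show ?thesis by (intro exI[of _ \<rho>] conjI exI[of _ "\<lambda>_. of_real A"]) auto
  qed
qed (use le z in auto)

text \<open>Hadamard's inequality: the bound is harmonic on the annulus, \<open>0\<close> on the outer and \<open>- k\<close> on the inner circle.\<close>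

lemma two_circles:
  assumes v: "v subharmonic_on S" "cball 0 R \<subseteq> S" and s: "0 < s" "s < R"
    and le0: "\<And>z. cmod z = R \<Longrightarrow> v z \<le> 0" and les: "\<And>z. cmod z = s \<Longrightarrow> v z \<le> ereal (- k)"
    and z: "s \<le> cmod z" "cmod z \<le> R"
  shows "v z \<le> ereal (- k * (ln (R / cmod z) / ln (R / s)))"
proof (rule maximum_principle[of "cball 0 R - ball 0 s" "ball 0 R - cball 0 s" v "\<lambda>z. - k * (ln (R / cmod z) / ln (R / s))" z])
  have c: "ln (R / s) > 0" using s by simp
  show "compact (cball 0 R - ball (0::complex) s)" by (intro compact_diff) auto
  show "usc_on (cball 0 R - ball 0 s) v"
    using v by (auto simp: subharmonic_on_def intro: usc_imp_usc_on)
  have "ball 0 R - cball 0 s \<subseteq> S" using v(2) by auto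
  then show "no_harmonic_peak v (ball 0 R - cball 0 s)"
    by (intro no_harmonic_peak_subset[OF subharmonic_no_harmonic_peak[OF v(1)]])
  show "continuous_on (cball 0 R - ball 0 s) (\<lambda>z::complex. - k * (ln (R / cmod z) / ln (R / s)))"
    using s c by (intro continuous_intros) auto
  show "\<exists>\<rho>>0. ball z0 \<rho> \<subseteq> ball 0 R - cball 0 s \<and>
      (\<exists>H. H holomorphic_on ball z0 \<rho> \<and> (\<forall>z\<in>ball z0 \<rho>. - k * (ln (R / cmod z) / ln (R / s)) = Re (H z)))"
    if "z0 \<in> ball 0 R - cball 0 s" for z0 :: complex
  proof -
    have "open (ball 0 R - cball (0::complex) s)" by auto
    from openE[OF this that] obtain \<rho> where \<rho>: "\<rho> > 0" "ball z0 \<rho> \<subseteq> ball 0 R - cball 0 s" by blast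
    have nz: "z \<noteq> 0" if "z \<in> ball z0 \<rho>" for z using subsetD[OF \<rho>(2) that] s(1) by auto
    obtain H where H: "H holomorphic_on ball z0 \<rho>" "\<And>z. z \<in> ball z0 \<rho> \<Longrightarrow> ln (cmod z) = Re (H z)"
      using log_norm_harmonic[of "\<lambda>z. z" z0 \<rho>] nz by (auto intro: holomorphic_intros)
    have "- k * (ln (R / cmod z) / ln (R / s)) = Re (of_real (- k / ln (R / s)) * (of_real (ln R) - H z))" if "z \<in> ball z0 \<rho>" for z
      using H(2)[OF that] nz[OF that] s by (simp add: ln_div)
    moreover have "(\<lambda>z. of_real (- k / ln (R / s)) * (of_real (ln R) - H z)) holomorphic_on ball z0 \<rho>"
      using H(1) by (intro holomorphic_intros)
    ultimately show ?thesis using \<rho> by blast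
  qed
  show "v z \<le> ereal (- k * (ln (R / cmod z) / ln (R / s)))" if "z \<in> cball 0 R - ball 0 s - (ball 0 R - cball 0 s)" for z
  proof -
    have "cmod z = R \<or> cmod z = s" using that by auto
    then show ?thesis
    proof
      assume "cmod z = R"
      then show ?thesis using le0[of z] s by (simp add: zero_ereal_def)
    next
      assume zs: "cmod z = s"
      have "ln (R / cmod z) / ln (R / s) = 1" unfolding zs using c by simp
      then show ?thesis using les[OF zs] by simp
    qed
  qed
qed (use z in auto)

section \<open>Plurisubharmonic functions along holomorphic discs\<close>

lemma holomorphic_second_order_remainder:
  assumes f: "f holomorphic_on S" "open S" "z \<in> S"
  obtains k r C where "r > 0" "ball z r \<subseteq> S" "k holomorphic_on ball 0 r" "\<And>t. cmod t < r \<Longrightarrow> cmod (k t) \<le> C"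
    "\<And>t. cmod t < r \<Longrightarrow> f (z + t) = f z + t * deriv f z + t\<^sup>2 * k t"
proof -
  define g1 where "g1 w = (if w = z then deriv f z else (f w - f z) / (w - z))" for w
  have g1: "g1 holomorphic_on S" unfolding g1_def using pole_theorem_open[of "\<lambda>w. f w - f z" S z] f
    by (auto intro: pole_lemma_open)
  define g2 where "g2 w = (if w = z then deriv g1 z else (g1 w - g1 z) / (w - z))" for w
  have g2: "g2 holomorphic_on S" unfolding g2_def using g1 f by (auto intro: pole_lemma_open)
  obtain R where R: "R > 0" "cball z R \<subseteq> S" using f(2,3) open_contains_cball by blast
  have "compact (g2 ` cball z R)"
    by (intro compact_continuous_image holomorphic_on_imp_continuous_on holomorphic_on_subset[OF g2] R) auto
  then obtain C where C: "\<And>w. w \<in> cball z R \<Longrightarrow> cmod (g2 w) \<le> C"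
    using compact_imp_bounded bounded_iff by (metis imageI)
  show thesis
  proof (rule that[of R "\<lambda>t. g2 (z + t)" C])
    show "ball z R \<subseteq> S" using R(2) ball_subset_cball by blast
    show "(\<lambda>t. g2 (z + t)) holomorphic_on ball 0 R"
    proof -
      have "(\<lambda>t. z + t) holomorphic_on ball 0 R" by (intro holomorphic_intros)
      from holomorphic_on_compose_gen[OF this g2] R(2) show ?thesis
        unfolding o_def by (auto simp: image_subset_iff dist_norm subset_iff)
    qed
    show "cmod (g2 (z + t)) \<le> C" if "cmod t < R" for t using C[of "z + t"] that by (simp add: dist_norm)
    show "f (z + t) = f z + t * deriv f z + t\<^sup>2 * g2 (z + t)" for t
    proof (cases "t = 0")
      case False
      then have "g2 (z + t) = (g1 (z + t) - deriv f z) / t" "g1 (z + t) = (f (z + t) - f z) / t"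
        by (auto simp: g2_def g1_def)
      then have "g1 (z + t) = deriv f z + t * g2 (z + t)" "f (z + t) = f z + t * g1 (z + t)"
        using False by (simp_all add: field_simps)
      then show ?thesis by (simp add: power2_eq_square algebra_simps)
    qed simp
  qed (use R in auto)
qed

lemma norm_vec_cmod: "(norm (x :: complex ^ 'n))\<^sup>2 = (\<Sum>i\<in>UNIV. (cmod (x $ i))\<^sup>2)"
  by (simp add: norm_vec_def L2_set_def sum_nonneg)

text \<open>Doubling of variables. Suppose that \<open>u \<circ> f\<close> has a peak at \<open>z0\<close>, with test function \<open>\<psi>\<close>, and maximise
\<open>u x - \<psi> z - N \<bar>x - f z\<bar>\<^sup>2\<close> over a compact neighbourhood of \<open>(f z0, z0)\<close>. As \<open>N\<close> tends to infinity, the maximum points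
converge to \<open>(f z0, z0)\<close>; so for some \<open>N\<close> there is an interior one, \<open>(x1, z1)\<close>. Move \<open>z\<close> to \<open>z1 + t\<close> and at the
same time \<open>x\<close> along the complex line \<open>x1 + t f'(z1)\<close>, on which \<open>u\<close> is subharmonic. The difference \<open>x - f z\<close> changes
by \<open>t\<^sup>2 k(t)\<close> with \<open>k\<close> holomorphic, so the penalty changes by a harmonic function of \<open>t\<close> and an error of order
\<open>\<bar>t\<bar>\<^sup>4\<close>. For small \<open>\<bar>t\<bar>\<close> this error is smaller than the gain \<open>\<epsilon> \<bar>t\<bar>\<^sup>2 / 2\<close> in \<open>\<psi>\<close>, against the mean value inequality.\<close>

lemma plurisubharmonic_compose_disc:
  fixes f :: "complex \<Rightarrow> complex ^ 'n"
  assumes u: "u plurisubharmonic_on W" "open W"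
    and f: "\<And>i. (\<lambda>z. f z $ i) holomorphic_on S" "open S" "f ` S \<subseteq> W"
  shows "no_harmonic_peak (\<lambda>z. u (f z)) S"
proof (rule no_harmonic_peakI)
  fix z0 \<rho> H \<epsilon>
  assume \<rho>: "0 < (\<rho>::real)" "ball z0 \<rho> \<subseteq> S" and H: "H holomorphic_on ball z0 \<rho>" and \<epsilon>: "0 < (\<epsilon>::real)"
    and fin: "\<bar>u (f z0)\<bar> \<noteq> \<infinity>"
    and le: "\<And>z. z \<in> ball z0 \<rho> \<Longrightarrow> u (f z) \<le> u (f z0) + ereal (Re (H z) - Re (H z0) - \<epsilon> * (cmod (z - z0))\<^sup>2)"
  obtain m0 where m0: "u (f z0) = ereal m0" using fin by (cases "u (f z0)") auto
  define \<rho>1 where "\<rho>1 = \<rho> / 2"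
  have \<rho>1: "\<rho>1 > 0" "cball z0 \<rho>1 \<subseteq> ball z0 \<rho>" using \<rho>(1) by (auto simp: \<rho>1_def)
  have fc: "continuous_on S f"
    using continuous_on_vec_lambda[of S "\<lambda>i z. f z $ i"] holomorphic_on_imp_continuous_on[OF f(1)]
    by (simp add: vec_lambda_eta)
  have fc1: "continuous_on (cball z0 \<rho>1) f" using fc \<rho>1(2) \<rho>(2) continuous_on_subset by blast
  have Hc: "continuous_on (cball z0 \<rho>1) H" using holomorphic_on_imp_continuous_on[OF H] \<rho>1(2) continuous_on_subset by blast
  have "z0 \<in> S" using \<rho> by auto
  then have "f z0 \<in> W" using f(3) by blast
  then obtain R where R: "R > 0" "cball (f z0) R \<subseteq> W" using u(2) open_contains_cball by blast
  have uscW: "usc (top_of_set W) u" using u(1) by (auto simp: plurisubharmonic_on_def)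
  have uK: "usc_on (cball (f z0) R) u" by (rule usc_imp_usc_on[OF uscW R(2)])
  obtain xm where xm: "xm \<in> cball (f z0) R" "\<And>x. x \<in> cball (f z0) R \<Longrightarrow> u x \<le> u xm"
    using usc_on_attains_max[OF compact_cball _ uK] R(1) by (metis cball_eq_empty not_less_iff_gr_or_eq)
  have "ereal m0 \<le> u xm" using xm(2)[of "f z0"] R(1) m0 by simp
  then obtain B where B: "u xm = ereal B" using uK xm(1) by (cases "u xm") (auto simp: usc_on_def)
  \<comment> \<open>half of the quadratic term makes \<open>z0\<close> a strict maximum of \<open>u \<circ> f - \<psi>\<close>, the other half is kept for the contradiction\<close>
  define \<psi> where "\<psi> z = Re (H z) - Re (H z0) - \<epsilon> / 2 * (cmod (z - z0))\<^sup>2" for z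
  have \<psi>c: "continuous_on (cball z0 \<rho>1) \<psi>" unfolding \<psi>_def by (intro continuous_intros Hc)
  have \<psi>0: "\<psi> z0 = 0" by (simp add: \<psi>_def)
  define K where "K = cball (f z0) R \<times> cball z0 \<rho>1"
  have K: "compact K" "(f z0, z0) \<in> K" using R(1) \<rho>1(1) by (auto simp: K_def compact_Times)
  define \<Phi> where "\<Phi> N p = u (fst p) + ereal (- \<psi> (snd p) - real N * (norm (fst p - f (snd p)))\<^sup>2)" for N p
  have usc\<Phi>: "usc_on K (\<Phi> N)" for N
    unfolding \<Phi>_def
  proof (rule usc_on_add_continuous)
    show "usc_on K (\<lambda>p. u (fst p))" by (rule usc_on_compose[OF uK]) (auto simp: K_def intro!: continuous_intros)
    have "continuous_on K (\<lambda>p. \<psi> (snd p))" "continuous_on K (\<lambda>p. f (snd p))"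
      by (rule continuous_on_compose2[OF \<psi>c] continuous_on_compose2[OF fc1]; auto simp: K_def intro!: continuous_intros)+
    then show "continuous_on K (\<lambda>p. - \<psi> (snd p) - real N * (norm (fst p - f (snd p)))\<^sup>2)"
      by (intro continuous_intros)
  qed
  have "\<forall>N. \<exists>p. p \<in> K \<and> (\<forall>y\<in>K. \<Phi> N y \<le> \<Phi> N p)"
    using usc_on_attains_max[OF K(1) _ usc\<Phi>] K(2) by (metis empty_iff)
  then obtain p where p: "\<And>N. p N \<in> K" "\<And>N y. y \<in> K \<Longrightarrow> \<Phi> N y \<le> \<Phi> N (p N)" by metis
  have \<Phi>0: "\<Phi> N (f z0, z0) = ereal m0" for N by (simp add: \<Phi>_def m0 \<psi>0)
  have low: "ereal m0 \<le> \<Phi> N (p N)" for N using p(2)[OF K(2), of N] \<Phi>0 by simp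
  have fin: "\<exists>m. u (fst (p N)) = ereal m \<and> m \<le> B \<and> m0 \<le> m - \<psi> (snd (p N)) - real N * (norm (fst (p N) - f (snd (p N))))\<^sup>2" for N
  proof -
    have "u (fst (p N)) \<le> ereal B" using xm(2) p(1)[of N] B by (auto simp: K_def)
    then show ?thesis using low[of N] unfolding \<Phi>_def by (cases "u (fst (p N))") auto
  qed
  obtain L where L: "\<And>z. z \<in> cball z0 \<rho>1 \<Longrightarrow> \<bar>\<psi> z\<bar> \<le> L"
    using compact_imp_bounded[OF compact_continuous_image[OF \<psi>c compact_cball]] bounded_iff
    by (metis imageI real_norm_def)
  \<comment> \<open>the penalty stays bounded at the maximum points, so \<open>x - f z\<close> tends to \<open>0\<close> along them\<close>
  have pen: "real N * (norm (fst (p N) - f (snd (p N))))\<^sup>2 \<le> B + L - m0" for N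
  proof -
    have "snd (p N) \<in> cball z0 \<rho>1" using p(1)[of N] by (auto simp: K_def)
    then show ?thesis using fin[of N] L[of "snd (p N)"] by auto
  qed
  obtain ps r where r: "ps \<in> K" "strict_mono (r :: nat \<Rightarrow> nat)" "(p \<circ> r) \<longlonglongrightarrow> ps"
    using K(1) p(1) unfolding compact_def by metis
  have lx: "(\<lambda>n. fst (p (r n))) \<longlonglongrightarrow> fst ps" and lz: "(\<lambda>n. snd (p (r n))) \<longlonglongrightarrow> snd ps"
    using tendsto_fst[OF r(3)] tendsto_snd[OF r(3)] by (simp_all add: o_def)
  have psz: "snd ps \<in> cball z0 \<rho>1" "fst ps \<in> cball (f z0) R" using r(1) by (auto simp: K_def)
  have pz: "\<forall>\<^sub>F n in sequentially. snd (p (r n)) \<in> cball z0 \<rho>1"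
    using p(1) unfolding K_def by (intro always_eventually allI) (metis mem_Times_iff)
  have lf: "(\<lambda>n. f (snd (p (r n)))) \<longlonglongrightarrow> f (snd ps)" by (rule continuous_on_tendsto_compose[OF fc1 lz psz(1) pz])
  have l\<psi>: "(\<lambda>n. \<psi> (snd (p (r n)))) \<longlonglongrightarrow> \<psi> (snd ps)" by (rule continuous_on_tendsto_compose[OF \<psi>c lz psz(1) pz])
  have "(\<lambda>n. (norm (fst (p (r n)) - f (snd (p (r n)))))\<^sup>2) \<longlonglongrightarrow> 0"
  proof (rule tendsto_sandwich[OF _ _ tendsto_const])
    have "(\<lambda>n. (B + L - m0) * (1 / real n)) \<longlonglongrightarrow> (B + L - m0) * 0" by (intro tendsto_intros lim_1_over_n)
    from LIMSEQ_subseq_LIMSEQ[OF this r(2)] show "(\<lambda>n. (B + L - m0) * (1 / real (r n))) \<longlonglongrightarrow> 0" by (simp add: o_def)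
    show "\<forall>\<^sub>F n in sequentially. (norm (fst (p (r n)) - f (snd (p (r n)))))\<^sup>2 \<le> (B + L - m0) * (1 / real (r n))"
      using eventually_gt_at_top[of 0]
    proof eventually_elim
      case (elim n)
      then have "r n > 0" using seq_suble[OF r(2), of n] by linarith
      then show ?case using pen[of "r n"] by (simp add: field_simps)
    qed
  qed auto
  moreover have "(\<lambda>n. (norm (fst (p (r n)) - f (snd (p (r n)))))\<^sup>2) \<longlonglongrightarrow> (norm (fst ps - f (snd ps)))\<^sup>2"
    by (intro tendsto_intros lx lf)
  ultimately have "(norm (fst ps - f (snd ps)))\<^sup>2 = 0" using LIMSEQ_unique by blast
  then have psf: "fst ps = f (snd ps)" by simp
  have "ereal (m0 + \<psi> (snd ps)) \<le> u (fst ps)"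
  proof (rule ccontr)
    assume "\<not> ?thesis"
    then have "u (fst ps) < ereal (m0 + \<psi> (snd ps))" by simp
    then obtain t where t: "u (fst ps) < ereal t" "ereal t < ereal (m0 + \<psi> (snd ps))" using ereal_dense2 by blast
    obtain d where d: "d > 0" "\<And>y. y \<in> cball (f z0) R \<Longrightarrow> dist y (fst ps) < d \<Longrightarrow> u y < ereal t"
      using uK psz(2) t(1) unfolding usc_on_def by blast
    have "\<forall>\<^sub>F n in sequentially. m0 \<le> t - \<psi> (snd (p (r n)))"
      using tendstoD[OF lx d(1)]
    proof eventually_elim
      case (elim n)
      have "fst (p (r n)) \<in> cball (f z0) R" using p(1)[of "r n"] by (auto simp: K_def)
      from d(2)[OF this elim] obtain m where "u (fst (p (r n))) = ereal m" "m < t"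
        "m0 \<le> m - \<psi> (snd (p (r n))) - real (r n) * (norm (fst (p (r n)) - f (snd (p (r n)))))\<^sup>2" using fin[of "r n"] by auto
      moreover have "real (r n) * (norm (fst (p (r n)) - f (snd (p (r n)))))\<^sup>2 \<ge> 0" by simp
      ultimately show ?case by linarith
    qed
    then have "m0 \<le> t - \<psi> (snd ps)"
      by (intro tendsto_lowerbound[OF tendsto_diff[OF tendsto_const l\<psi>]]) auto
    then show False using t(2) by simp
  qed
  also have "u (fst ps) \<le> ereal (m0 + \<psi> (snd ps) - \<epsilon> / 2 * (cmod (snd ps - z0))\<^sup>2)"
  proof -
    have "snd ps \<in> ball z0 \<rho>" using psz(1) \<rho>1(2) by blast
    from le[OF this] show ?thesis unfolding psf m0 \<psi>_def by (simp add: algebra_simps)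
  qed
  finally have "\<epsilon> / 2 * (cmod (snd ps - z0))\<^sup>2 \<le> 0" by simp
  then have "snd ps = z0" using \<epsilon> by (simp add: mult_le_0_iff)
  then have ps: "ps = (f z0, z0)" using psf by (metis prod.collapse)
  have "\<forall>\<^sub>F n in sequentially. dist (fst (p (r n))) (f z0) < R \<and> dist (snd (p (r n))) z0 < \<rho>1"
    using tendstoD[OF lx R(1)] tendstoD[OF lz \<rho>1(1)] ps by (auto intro: eventually_conj)
  then obtain n where n: "dist (fst (p (r n))) (f z0) < R" "dist (snd (p (r n))) z0 < \<rho>1"
    by (auto simp: eventually_sequentially)
  define N where "N = r n"
  define x1 where "x1 = fst (p N)"
  define z1 where "z1 = snd (p N)"
  have x1: "dist x1 (f z0) < R" and z1: "dist z1 z0 < \<rho>1" using n by (auto simp: x1_def z1_def N_def)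
  obtain m where m: "u x1 = ereal m" using fin[of N] by (auto simp: x1_def)
  have z1\<rho>: "z1 \<in> ball z0 \<rho>" by (rule subsetD[OF \<rho>1(2)]) (use z1 in \<open>simp add: dist_commute\<close>)
  then have z1S: "z1 \<in> S" using \<rho>(2) by blast
  have "\<forall>i. \<exists>k r C. r > 0 \<and> k holomorphic_on ball 0 r \<and> (\<forall>t. cmod t < r \<longrightarrow> cmod (k t) \<le> C) \<and>
    (\<forall>t. cmod t < r \<longrightarrow> f (z1 + t) $ i = f z1 $ i + t * deriv (\<lambda>z. f z $ i) z1 + t\<^sup>2 * k t)"
    using holomorphic_second_order_remainder[OF f(1) f(2) z1S] by metis
  then obtain k rr C where k: "\<And>i. rr i > 0" "\<And>i. k i holomorphic_on ball 0 (rr i)" "\<And>i t. cmod t < rr i \<Longrightarrow> cmod (k i t) \<le> C i"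
    "\<And>i t. cmod t < rr i \<Longrightarrow> f (z1 + t) $ i = f z1 $ i + t * deriv (\<lambda>z. f z $ i) z1 + t\<^sup>2 * k i t" by metis
  define b where "b = (\<chi> i. deriv (\<lambda>z. f z $ i) z1)"
  define Q where "Q = (\<Sum>i\<in>UNIV. (C i)\<^sup>2)"
  have Q: "Q \<ge> 0" unfolding Q_def by (intro sum_nonneg) auto
  define r0 where "r0 = Min (range rr)"
  have r0: "r0 > 0" "\<And>i. r0 \<le> rr i" using k(1) by (auto simp: r0_def)
  define s where "s = Min {r0, (R - dist x1 (f z0)) / (norm b + 1), \<rho>1 - dist z1 z0, \<epsilon> / (4 * (real N * Q + 1)), 1} / 2"
  have s: "0 < s" "s < r0" "s * (norm b + 1) < R - dist x1 (f z0)" "s < \<rho>1 - dist z1 z0" "s < \<epsilon> / (4 * (real N * Q + 1))" "s < 1"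
  proof -
    define T where "T = {r0, (R - dist x1 (f z0)) / (norm b + 1), \<rho>1 - dist z1 z0, \<epsilon> / (4 * (real N * Q + 1)), 1}"
    have nb: "norm b + 1 > 0" "real N * Q + 1 > 0" using Q by (auto simp: add_nonneg_pos)
    have T: "finite T" "T \<noteq> {}" "\<And>x. x \<in> T \<Longrightarrow> x > 0" unfolding T_def using r0(1) x1 z1 \<epsilon> nb by auto
    have sT: "s = Min T / 2" by (simp add: s_def T_def)
    have "Min T > 0" using T by simp
    then show s0: "s > 0" by (simp add: sT)
    have lt: "s < x" if "x \<in> T" for x
      using Min_le[OF T(1) that] \<open>Min T > 0\<close> by (simp add: sT)
    show "s < r0" "s < \<rho>1 - dist z1 z0" "s < \<epsilon> / (4 * (real N * Q + 1))" "s < 1" by (rule lt; simp add: T_def)+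
    have "s < (R - dist x1 (f z0)) / (norm b + 1)" by (rule lt) (simp add: T_def)
    then show "s * (norm b + 1) < R - dist x1 (f z0)" using nb by (simp add: pos_less_divide_eq)
  qed
  define e where "e t = x1 + t *s b - f (z1 + t)" for t
  \<comment> \<open>a holomorphic function whose real part bounds \<open>u (x1 + t f'(z1))\<close> on the circle \<open>\<bar>t\<bar> = s\<close>; its constant term is less than \<open>u x1\<close>\<close>
  define G where "G t = of_real (m - \<epsilon> / 2 * s\<^sup>2 + real N * Q * s ^ 4) + (H (z1 + t) - H z1) - of_real \<epsilon> * cnj (z1 - z0) * t
      + of_real (2 * real N) * (\<Sum>i\<in>UNIV. cnj (e 0 $ i) * (- (t\<^sup>2 * k i t)))" for t
  have nts: "norm (t *s b) = cmod t * norm b" for t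
    by (simp add: norm_vec_def norm_mult L2_set_right_distrib)
  have "u x1 \<le> ereal (Re (G 0))"
  proof -
    have line: "(\<lambda>t. u (x1 + t *s b)) subharmonic_on {t. x1 + t *s b \<in> W}"
      using u(1) by (auto simp: plurisubharmonic_on_def)
    have inR: "x1 + t *s b \<in> cball (f z0) R" if "cmod t \<le> s" for t
    proof -
      have "norm (t *s b) \<le> s * (norm b + 1)" unfolding nts using that s(1) by (intro mult_mono) auto
      then have "dist (x1 + t *s b) x1 < R - dist x1 (f z0)" using s(3) by (simp add: dist_norm)
      then show ?thesis using dist_triangle[of "x1 + t *s b" "f z0" x1] by (simp add: dist_commute)
    qed
    have sub: "cball 0 s \<subseteq> {t. x1 + t *s b \<in> W}" using inR R(2) by (auto simp: subset_iff)
    have inz: "z1 + t \<in> cball z0 \<rho>1" if "cmod t < \<rho>1 - dist z1 z0" for t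
      using that dist_triangle[of "z1 + t" z0 z1] by (simp add: dist_commute dist_norm norm_minus_commute)
    define R' where "R' = min r0 (\<rho>1 - dist z1 z0)"
    have Hh: "(\<lambda>t. H (z1 + t)) holomorphic_on ball 0 R'"
    proof -
      have "(\<lambda>t. z1 + t) holomorphic_on ball 0 R'" by (intro holomorphic_intros)
      moreover have "(\<lambda>t. z1 + t) ` ball 0 R' \<subseteq> ball z0 \<rho>"
      proof
        fix y assume "y \<in> (\<lambda>t. z1 + t) ` ball 0 R'"
        then obtain t where t: "t \<in> ball 0 R'" "y = z1 + t" by blast
        have "cmod t < \<rho>1 - dist z1 z0" using t(1) by (simp add: R'_def)
        with t(2) show "y \<in> ball z0 \<rho>" using inz[of t] \<rho>1(2) by blast
      qed
      ultimately show ?thesis using holomorphic_on_compose_gen[OF _ H] by (simp add: o_def)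
    qed
    have kh: "k i holomorphic_on ball 0 R'" for i
      using r0(2)[of i] by (intro holomorphic_on_subset[OF k(2)]) (auto simp: R'_def)
    have Gh: "G holomorphic_on ball 0 R'" unfolding G_def by (intro holomorphic_intros Hh kh)
    have le1: "u (x1 + t *s b) \<le> ereal (Re (G t))" if t: "t \<in> sphere 0 s" for t
    proof -
      have ct: "cmod t = s" using t by simp
      have t2: "(x1 + t *s b, z1 + t) \<in> K" using inR[of t] inz[of t] ct s(4) by (simp add: K_def)
      have "\<Phi> N (x1 + t *s b, z1 + t) \<le> \<Phi> N (x1, z1)" using p(2)[OF t2, of N] by (simp add: x1_def z1_def)
      then have u1: "u (x1 + t *s b) \<le> ereal (m + (\<psi> (z1 + t) - \<psi> z1) + real N * ((norm (e t))\<^sup>2 - (norm (e 0))\<^sup>2))"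
        unfolding \<Phi>_def by (cases "u (x1 + t *s b)") (auto simp: m e_def algebra_simps)
      have ei: "e t $ i = e 0 $ i - t\<^sup>2 * k i t" for i
        using k(4)[of t i] ct s(2) r0(2)[of i] by (simp add: e_def b_def)
      have "(norm (e t))\<^sup>2 \<le> (\<Sum>i\<in>UNIV. (cmod (e 0 $ i))\<^sup>2 + 2 * Re (cnj (e 0 $ i) * (- (t\<^sup>2 * k i t))) + s ^ 4 * (C i)\<^sup>2)"
        unfolding norm_vec_cmod
      proof (rule sum_mono)
        fix i
        have "(cmod (e t $ i))\<^sup>2 = (cmod (e 0 $ i))\<^sup>2 + 2 * Re (cnj (e 0 $ i) * (- (t\<^sup>2 * k i t))) + (cmod (t\<^sup>2 * k i t))\<^sup>2"
          unfolding ei cmod_power2 by (simp add: power2_eq_square algebra_simps)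
        moreover have "(cmod (t\<^sup>2 * k i t))\<^sup>2 \<le> s ^ 4 * (C i)\<^sup>2"
        proof -
          have "(cmod (t\<^sup>2 * k i t))\<^sup>2 = s ^ 4 * (cmod (k i t))\<^sup>2" using ct by (simp add: norm_mult norm_power power_mult_distrib power_mult[symmetric])
          also have "\<dots> \<le> s ^ 4 * (C i)\<^sup>2"
            using k(3)[of t i] ct s(2) r0(2)[of i] by (intro mult_left_mono power_mono) auto
          finally show ?thesis .
        qed
        ultimately show "(cmod (e t $ i))\<^sup>2 \<le> (cmod (e 0 $ i))\<^sup>2 + 2 * Re (cnj (e 0 $ i) * (- (t\<^sup>2 * k i t))) + s ^ 4 * (C i)\<^sup>2" by simp
      qed
      also have "\<dots> = (norm (e 0))\<^sup>2 + 2 * Re (\<Sum>i\<in>UNIV. cnj (e 0 $ i) * (- (t\<^sup>2 * k i t))) + s ^ 4 * Q"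
        unfolding norm_vec_cmod Q_def sum.distrib by (simp add: sum_distrib_left Re_sum)
      finally have "real N * ((norm (e t))\<^sup>2 - (norm (e 0))\<^sup>2) \<le> real N * (2 * Re (\<Sum>i\<in>UNIV. cnj (e 0 $ i) * (- (t\<^sup>2 * k i t))) + s ^ 4 * Q)"
        by (intro mult_left_mono) auto
      moreover have "\<psi> (z1 + t) - \<psi> z1 = Re (H (z1 + t) - H z1) - \<epsilon> / 2 * s\<^sup>2 - Re (of_real \<epsilon> * cnj (z1 - z0) * t)"
      proof -
        have "(cmod (z1 + t - z0))\<^sup>2 - (cmod (z1 - z0))\<^sup>2 = s\<^sup>2 + 2 * Re (cnj (z1 - z0) * t)"
          unfolding ct[symmetric] cmod_power2 by (simp add: power2_eq_square algebra_simps)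
        from arg_cong[OF this, of "\<lambda>x. \<epsilon> / 2 * x"]
        have "\<epsilon> / 2 * (cmod (z1 + t - z0))\<^sup>2 - \<epsilon> / 2 * (cmod (z1 - z0))\<^sup>2 = \<epsilon> / 2 * s\<^sup>2 + \<epsilon> * Re (cnj (z1 - z0) * t)"
          unfolding right_diff_distrib distrib_left by simp
        moreover have "Re (of_real \<epsilon> * cnj (z1 - z0) * t) = \<epsilon> * Re (cnj (z1 - z0) * t)"
          unfolding mult.assoc by simp
        ultimately show ?thesis unfolding \<psi>_def minus_complex.sel by linarith
      qed
      ultimately have "m + (\<psi> (z1 + t) - \<psi> z1) + real N * ((norm (e t))\<^sup>2 - (norm (e 0))\<^sup>2) \<le> Re (G t)"
        unfolding G_def by (simp add: algebra_simps)
      then show ?thesis using u1 by (meson ereal_less_eq(3) order_trans)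
    qed
    have "u (x1 + 0 *s b) \<le> ereal (Re (G 0))"
      by (rule subharmonic_sub_mean[OF line sub Gh s(1) _ le1]) (use s R'_def in auto)
    then show ?thesis by simp
  qed
  then have "\<epsilon> / 2 * s\<^sup>2 \<le> real N * Q * s ^ 4" by (simp add: m G_def)
  moreover have "real N * Q * s ^ 4 < \<epsilon> / 2 * s\<^sup>2"
  proof -
    have pos: "4 * (real N * Q + 1) > 0" using Q by (simp add: add_nonneg_pos)
    have "s * (4 * (real N * Q + 1)) < \<epsilon>" using s(5) pos by (simp add: pos_less_divide_eq)
    moreover have "real N * Q * s \<le> s * (4 * (real N * Q + 1)) / 4" using s(1) by (simp add: algebra_simps)
    ultimately have a: "real N * Q * s < \<epsilon> / 4" by simp
    have "real N * Q * s ^ 4 = (real N * Q * s) * s * s\<^sup>2" by (simp add: power2_eq_square power4_eq_xxxx)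
    also have "\<dots> \<le> (real N * Q * s) * 1 * s\<^sup>2" using s(1,6) Q by (intro mult_right_mono mult_left_mono) auto
    also have "\<dots> < \<epsilon> / 2 * s\<^sup>2" using a \<epsilon> s(1) by (intro mult_strict_right_mono) auto
    finally show ?thesis .
  qed
  ultimately show False by simp
qed

section \<open>Charts, orders of contact and the Lelong functional\<close>

definition charted :: "('a, 'n::finite) manifold \<Rightarrow> bool"
  where "charted M \<longleftrightarrow> (\<Union>(U, \<phi>)\<in>atlas M. U) = points M \<and>
    (\<forall>(U, \<phi>)\<in>atlas M. openin (mtop M) U \<and> open (\<phi> ` U) \<and>
       homeomorphic_map (subtopology (mtop M) U) (top_of_set (\<phi> ` U)) \<phi>) \<and>
    (\<forall>(U, \<phi>)\<in>atlas M. \<forall>(V, \<psi>)\<in>atlas M. (\<psi> \<circ> inv_into U \<phi>) holomorphic_map_on \<phi> ` (U \<inter> V))"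

lemma complex_manifold_charted: "complex_manifold M \<Longrightarrow> charted M"
  by (simp add: complex_manifold_def charted_def)

context
  fixes M :: "('a, 'n::finite) manifold"
  assumes M: "charted M"
begin

lemma chartD:
  assumes "(U, \<phi>) \<in> atlas M"
  shows chart_openin: "openin (mtop M) U" and chart_open_image: "open (\<phi> ` U)"
    and chart_homeomorphic: "homeomorphic_map (subtopology (mtop M) U) (top_of_set (\<phi> ` U)) \<phi>"
    and chart_inj: "inj_on \<phi> U" and chart_subset: "U \<subseteq> points M"
proof -
  show 1: "openin (mtop M) U" and "open (\<phi> ` U)"
    and 2: "homeomorphic_map (subtopology (mtop M) U) (top_of_set (\<phi> ` U)) \<phi>"
    using M assms by (auto simp: charted_def)
  show sub: "U \<subseteq> points M" using openin_subset[OF 1] .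
  have "inj_on \<phi> (topspace (subtopology (mtop M) U))" using 2 unfolding homeomorphic_map_def by blast
  moreover have "topspace (subtopology (mtop M) U) = U" using sub by (simp add: topspace_subtopology Int_absorb1)
  ultimately show "inj_on \<phi> U" by simp
qed

lemma chart_inv:
  assumes "(U, \<phi>) \<in> atlas M"
  shows "x \<in> U \<Longrightarrow> inv_into U \<phi> (\<phi> x) = x" "w \<in> \<phi> ` U \<Longrightarrow> \<phi> (inv_into U \<phi> w) = w"
    "w \<in> \<phi> ` U \<Longrightarrow> inv_into U \<phi> w \<in> U"
  using chart_inj[OF assms] by (auto intro: inv_into_into f_inv_into_f)

lemma chart_transition:
  assumes "(U, \<phi>) \<in> atlas M" "(V, \<psi>) \<in> atlas M"
  shows "(\<psi> \<circ> inv_into U \<phi>) holomorphic_map_on \<phi> ` (U \<inter> V)"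
proof -
  have "\<forall>(U, \<phi>)\<in>atlas M. \<forall>(V, \<psi>)\<in>atlas M. (\<psi> \<circ> inv_into U \<phi>) holomorphic_map_on \<phi> ` (U \<inter> V)"
    using M unfolding charted_def by blast
  from bspec[OF this assms(1)]
  have "\<forall>(V, \<psi>)\<in>atlas M. (\<psi> \<circ> inv_into U \<phi>) holomorphic_map_on \<phi> ` (U \<inter> V)" by simp
  from bspec[OF this assms(2)] show ?thesis by simp
qed

lemma chart_exists:
  assumes "a \<in> points M"
  obtains U \<phi> where "(U, \<phi>) \<in> atlas M" "a \<in> U"
proof -
  have "a \<in> (\<Union>(U, \<phi>)\<in>atlas M. U)" using M assms unfolding charted_def by simp
  then obtain c where "c \<in> atlas M" "a \<in> fst c" by (auto simp: case_prod_beta)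
  then show thesis using that[of "fst c" "snd c"] by simp
qed

lemma chart_at_in_atlas:
  assumes "a \<in> points M" "chart_at M a = (U, \<phi>)"
  shows "(U, \<phi>) \<in> atlas M" "a \<in> U"
proof -
  obtain U' \<phi>' where "(U', \<phi>') \<in> atlas M" "a \<in> U'" using chart_exists[OF assms(1)] .
  then have "chart_at M a \<in> atlas M \<and> a \<in> fst (chart_at M a)"
    unfolding chart_at_def by (intro someI[of "\<lambda>c. c \<in> atlas M \<and> a \<in> fst c" "(U', \<phi>')"]) simp
  then show "(U, \<phi>) \<in> atlas M" "a \<in> U" using assms(2) by auto
qed

lemma chart_image_open:
  assumes "(U, \<phi>) \<in> atlas M" "openin (mtop M) W"
  shows "open (\<phi> ` (U \<inter> W))"
proof -
  have "openin (subtopology (mtop M) U) (U \<inter> W)" using assms(2) by (metis inf_commute openin_subtopology_Int)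
  then have "openin (top_of_set (\<phi> ` U)) (\<phi> ` (U \<inter> W))"
    using homeomorphic_imp_open_map[OF chart_homeomorphic[OF assms(1)]] unfolding open_map_def by blast
  then show ?thesis using chart_open_image[OF assms(1)] openin_open_trans by blast
qed

text \<open>Transition maps are differentiable. This makes orders of contact and logarithmic poles independent of the chart.\<close>

lemma chart_change_bound:
  assumes c: "(U, \<phi>) \<in> atlas M" "(V, \<psi>) \<in> atlas M" and a: "a \<in> U" "a \<in> V"
  obtains C \<rho> where "C > 0" "\<rho> > 0"
    "\<And>x. x \<in> U \<Longrightarrow> norm (\<phi> x - \<phi> a) < \<rho> \<Longrightarrow> x \<in> V \<and> norm (\<psi> x - \<psi> a) \<le> C * norm (\<phi> x - \<phi> a)"
proof -
  define \<tau> where "\<tau> = \<psi> \<circ> inv_into U \<phi>"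
  have "open (\<phi> ` (U \<inter> V))" using chart_image_open[OF c(1) chart_openin[OF c(2)]] .
  moreover have "\<phi> a \<in> \<phi> ` (U \<inter> V)" using a by blast
  ultimately obtain r where r: "r > 0" "ball (\<phi> a) r \<subseteq> \<phi> ` (U \<inter> V)" by (rule openE)
  obtain D where D: "(\<tau> has_derivative D) (at (\<phi> a) within \<phi> ` (U \<inter> V))"
    using chart_transition[OF c] \<open>\<phi> a \<in> \<phi> ` (U \<inter> V)\<close> unfolding holomorphic_map_on_def \<tau>_def by blast
  have bl: "bounded_linear D" using D has_derivative_bounded_linear by blast
  obtain B where B: "\<And>v. norm (D v) \<le> norm v * B" "B > 0" using bounded_linear.pos_bounded[OF bl] by auto
  obtain d where d: "d > 0" "\<And>y. y \<in> \<phi> ` (U \<inter> V) \<Longrightarrow> norm (y - \<phi> a) < d \<Longrightarrow> norm (\<tau> y - \<tau> (\<phi> a) - D (y - \<phi> a)) \<le> norm (y - \<phi> a)"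
    using D unfolding has_derivative_within_alt by (metis mult_1 zero_less_one)
  show thesis
  proof (rule that[of "B + 1" "min r d"])
    fix x assume x: "x \<in> U" "norm (\<phi> x - \<phi> a) < min r d"
    then have "\<phi> x \<in> ball (\<phi> a) r" by (simp add: dist_norm norm_minus_commute)
    then obtain y where "y \<in> U" "y \<in> V" "\<phi> y = \<phi> x" using r(2) by auto
    then have xV: "x \<in> V" using inj_onD[OF chart_inj[OF c(1)]] x(1) by metis
    have t: "\<tau> (\<phi> x) = \<psi> x" "\<tau> (\<phi> a) = \<psi> a" using chart_inv(1)[OF c(1)] x(1) a(1) by (auto simp: \<tau>_def)
    have "norm (\<psi> x - \<psi> a) \<le> norm (\<psi> x - \<psi> a - D (\<phi> x - \<phi> a)) + norm (D (\<phi> x - \<phi> a))"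
      using norm_triangle_ineq[of "\<psi> x - \<psi> a - D (\<phi> x - \<phi> a)" "D (\<phi> x - \<phi> a)"] by simp
    also have "\<dots> \<le> norm (\<phi> x - \<phi> a) + norm (\<phi> x - \<phi> a) * B"
      using d(2)[of "\<phi> x"] x xV t B(1) by (intro add_mono) auto
    finally show "x \<in> V \<and> norm (\<psi> x - \<psi> a) \<le> (B + 1) * norm (\<phi> x - \<phi> a)" using xV by (simp add: algebra_simps)
  qed (use r d B in auto)
qed

end

text \<open>The multiplicity of a disc enters through lower bounds only. Stated as an estimate, such a bound is inherited by
compositions, projections and pairs of discs, and it holds for constant discs with every \<open>k\<close>.\<close>

definition contact_at_least :: "('a, 'n::finite) manifold \<Rightarrow> (complex \<Rightarrow> 'a) \<Rightarrow> complex \<Rightarrow> nat \<Rightarrow> bool"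
  where "contact_at_least M f z k \<longleftrightarrow> (\<exists>(U, \<phi>)\<in>atlas M. f z \<in> U \<and>
    (\<exists>C. \<forall>\<^sub>F w in nhds z. f w \<in> U \<and> norm (\<phi> (f w) - \<phi> (f z)) \<le> C * cmod (w - z) ^ k))"

lemma contact_at_least_in_chart:
  assumes M: "charted M" and c: "contact_at_least M f z k" and k: "k > 0"
    and V: "(V, \<psi>) \<in> atlas M" "f z \<in> V"
  shows "\<exists>C. \<forall>\<^sub>F w in nhds z. f w \<in> V \<and> norm (\<psi> (f w) - \<psi> (f z)) \<le> C * cmod (w - z) ^ k"
proof -
  obtain U \<phi> C where U: "(U, \<phi>) \<in> atlas M" "f z \<in> U"
    and C: "\<forall>\<^sub>F w in nhds z. f w \<in> U \<and> norm (\<phi> (f w) - \<phi> (f z)) \<le> C * cmod (w - z) ^ k"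
    using c by (auto simp: contact_at_least_def)
  obtain D \<rho> where D: "D > 0" "\<rho> > 0" "\<And>x. x \<in> U \<Longrightarrow> norm (\<phi> x - \<phi> (f z)) < \<rho> \<Longrightarrow> x \<in> V \<and> norm (\<psi> x - \<psi> (f z)) \<le> D * norm (\<phi> x - \<phi> (f z))"
    using chart_change_bound[OF M U(1) V(1) U(2) V(2)] by metis
  have "((\<lambda>w. C * cmod (w - z) ^ k) \<longlongrightarrow> C * cmod (z - z) ^ k) (nhds z)"
    by (intro tendsto_intros filterlim_ident)
  then have "\<forall>\<^sub>F w in nhds z. C * cmod (w - z) ^ k < \<rho>"
    by (rule order_tendstoD(2)) (use k D(2) in \<open>simp add: power_0_left\<close>)
  with C have "\<forall>\<^sub>F w in nhds z. f w \<in> V \<and> norm (\<psi> (f w) - \<psi> (f z)) \<le> (D * C) * cmod (w - z) ^ k"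
  proof eventually_elim
    case (elim w)
    then have "f w \<in> V \<and> norm (\<psi> (f w) - \<psi> (f z)) \<le> D * norm (\<phi> (f w) - \<phi> (f z))"
      using D(3)[of "f w"] by auto
    moreover have "D * norm (\<phi> (f w) - \<phi> (f z)) \<le> D * (C * cmod (w - z) ^ k)" using elim D(1) by (intro mult_left_mono) auto
    ultimately show ?case by (auto simp: mult.assoc)
  qed
  then show ?thesis by blast
qed

lemma holomorphic_into_subset:
  assumes "holomorphic_into M f S" "T \<subseteq> S"
  shows "holomorphic_into M f T"
  unfolding holomorphic_into_def
proof (intro conjI)
  show "continuous_map (top_of_set T) (mtop M) f"
    using assms continuous_map_from_subtopology_mono unfolding holomorphic_into_def by blast
  show "\<forall>(U, \<phi>)\<in>atlas M. \<forall>i. (\<lambda>z. \<phi> (f z) $ i) holomorphic_on {z \<in> T. f z \<in> U}"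
  proof (clarify)
    fix U \<phi> i assume "(U, \<phi>) \<in> atlas M"
    then have "(\<lambda>z. \<phi> (f z) $ i) holomorphic_on {z \<in> S. f z \<in> U}" using assms(1) by (auto simp: holomorphic_into_def)
    then show "(\<lambda>z. \<phi> (f z) $ i) holomorphic_on {z \<in> T. f z \<in> U}"
      by (rule holomorphic_on_subset) (use assms(2) in auto)
  qed
qed

lemma holomorphic_into_cong:
  assumes "holomorphic_into M g S" "\<And>z. z \<in> S \<Longrightarrow> f z = g z"
  shows "holomorphic_into M f S"
  unfolding holomorphic_into_def
proof (intro conjI)
  show "continuous_map (top_of_set S) (mtop M) f"
    using assms continuous_map_eq[of "top_of_set S" "mtop M" g f] unfolding holomorphic_into_def by auto
  show "\<forall>(U, \<phi>)\<in>atlas M. \<forall>i. (\<lambda>z. \<phi> (f z) $ i) holomorphic_on {z \<in> S. f z \<in> U}"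
  proof (clarify)
    fix U \<phi> i assume "(U, \<phi>) \<in> atlas M"
    then have "(\<lambda>z. \<phi> (g z) $ i) holomorphic_on {z \<in> S. g z \<in> U}" using assms(1) by (auto simp: holomorphic_into_def)
    then have "(\<lambda>z. \<phi> (f z) $ i) holomorphic_on {z \<in> S. g z \<in> U}"
      by (rule holomorphic_transform) (use assms(2) in auto)
    moreover have "{z \<in> S. f z \<in> U} = {z \<in> S. g z \<in> U}" using assms(2) by auto
    ultimately show "(\<lambda>z. \<phi> (f z) $ i) holomorphic_on {z \<in> S. f z \<in> U}" by simp
  qed
qed

lemma holomorphic_into_points: "holomorphic_into M f S \<Longrightarrow> z \<in> S \<Longrightarrow> f z \<in> points M"
  unfolding holomorphic_into_def continuous_map_def by auto

lemma holomorphic_into_open_preimage: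
  assumes "holomorphic_into M f S" "open S" "openin (mtop M) U"
  shows "open {z \<in> S. f z \<in> U}"
proof -
  have "continuous_map (top_of_set S) (mtop M) f" using assms(1) by (simp add: holomorphic_into_def)
  from openin_continuous_map_preimage[OF this assms(3)]
  have "openin (top_of_set S) {z \<in> S. f z \<in> U}" by simp
  then show ?thesis using assms(2) openin_open_trans by blast
qed

lemma holomorphic_into_chart_ball:
  fixes M :: "('a, 'n::finite) manifold" and \<phi> :: "'a \<Rightarrow> complex ^ 'n"
  assumes M: "charted M" and f: "holomorphic_into M f S" "open S" and U: "(U, \<phi>) \<in> atlas M" and z: "z \<in> S" "f z \<in> U"
  obtains r where "r > 0" "ball z r \<subseteq> S" "\<And>w. w \<in> ball z r \<Longrightarrow> f w \<in> U"
    "\<And>i. (\<lambda>w. \<phi> (f w) $ i) holomorphic_on ball z r"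
proof -
  have "open {w \<in> S. f w \<in> U}" using holomorphic_into_open_preimage[OF f chart_openin[OF M U]] .
  then obtain r where r: "r > 0" "ball z r \<subseteq> {w \<in> S. f w \<in> U}" using z unfolding open_contains_ball by blast
  have "(\<lambda>w. \<phi> (f w) $ i) holomorphic_on {w \<in> S. f w \<in> U}" for i
    using f(1) U by (auto simp: holomorphic_into_def)
  then have "(\<lambda>w. \<phi> (f w) $ i) holomorphic_on ball z r" for i using r(2) holomorphic_on_subset by blast
  then show thesis using that[of r] r by blast
qed

text \<open>The set of points near which \<open>f\<close> is constant is open and, by the identity theorem for the coordinate functions
in a chart, also closed.\<close>

lemma holomorphic_into_identity:
  assumes M: "charted M" and f: "holomorphic_into M f S" "open S" "connected S"
    and W: "open W" "W \<noteq> {}" "W \<subseteq> S" "f constant_on W"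
  shows "f constant_on S"
proof (rule locally_constant_imp_constant[OF f(3)])
  define E where "E = {w \<in> S. \<exists>e>0. ball w e \<subseteq> S \<and> (\<forall>y\<in>ball w e. f y = f w)}"
  have oE: "open E"
    unfolding open_contains_ball
  proof
    fix w assume "w \<in> E"
    then obtain e where e: "e > 0" "ball w e \<subseteq> S" "\<forall>y\<in>ball w e. f y = f w" by (auto simp: E_def)
    have "y \<in> E" if yb: "y \<in> ball w e" for y
    proof -
      obtain d where "d > 0" "ball y d \<subseteq> ball w e" using open_contains_ball[THEN iffD1, OF open_ball, THEN bspec, OF yb] by blast
      then have "ball y d \<subseteq> S" "\<forall>x\<in>ball y d. f x = f y" "y \<in> S" using e(2,3) yb by auto
      then show ?thesis using \<open>d > 0\<close> unfolding E_def by blast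
    qed
    then show "\<exists>e>0. ball w e \<subseteq> E" using e(1) by blast
  qed
  have key: "w \<in> E" if w: "w \<in> S" "\<And>e. e > 0 \<Longrightarrow> \<exists>y\<in>E. dist w y < e" for w
  proof -
    obtain U \<phi> where U: "(U, \<phi>) \<in> atlas M" "f w \<in> U" using chart_exists[OF M holomorphic_into_points[OF f(1) w(1)]] .
    obtain r where r: "r > 0" "ball w r \<subseteq> S" "\<And>y. y \<in> ball w r \<Longrightarrow> f y \<in> U"
      "\<And>i. (\<lambda>w. \<phi> (f w) $ i) holomorphic_on ball w r" using holomorphic_into_chart_ball[OF M f(1,2) U(1) w(1) U(2)] by metis
    obtain y where y: "y \<in> E" "y \<in> ball w r" using w(2)[OF r(1)] by auto
    then obtain e where e: "e > 0" "\<forall>x\<in>ball y e. f x = f y" by (auto simp: E_def)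
    have "\<phi> (f x) $ i = \<phi> (f y) $ i" if x: "x \<in> ball w r" for x i
    proof (rule analytic_continuation_open[of "ball w r \<inter> ball y e" "ball w r" "\<lambda>x. \<phi> (f x) $ i" "\<lambda>_. \<phi> (f y) $ i" x])
      show "ball w r \<inter> ball y e \<noteq> {}" using y(2) e(1) by (metis IntI centre_in_ball empty_iff)
    qed (use r(4) e(2) x in auto)
    then have "\<phi> (f x) = \<phi> (f y)" if "x \<in> ball w r" for x using that by (simp add: vec_eq_iff)
    then have "f x = f y" if "x \<in> ball w r" for x
      using inj_onD[OF chart_inj[OF M U(1)]] r(3) that y(2) by metis
    then have fy: "f x = f y" if "x \<in> ball w r" for x using that by blast
    have "f x = f w" if "x \<in> ball w r" for x using fy[OF that] fy[of w] r(1) by simp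
    then show "w \<in> E" using w(1) r(1,2) unfolding E_def by blast
  qed
  have WE: "W \<subseteq> E"
  proof
    fix w assume w: "w \<in> W"
    obtain e where "e > 0" "ball w e \<subseteq> W" using W(1) w unfolding open_contains_ball by blast
    moreover from this have "ball w e \<subseteq> S" "\<forall>x\<in>ball w e. f x = f w" using W(3,4) w unfolding constant_on_def by auto
    ultimately show "w \<in> E" using W(3) w unfolding E_def by blast
  qed
  have "E = S"
  proof (rule ccontr)
    assume "E \<noteq> S"
    have "open (S - E)"
      unfolding open_contains_ball
    proof
      fix w assume w: "w \<in> S - E"
      then obtain e where e: "e > 0" "\<And>y. y \<in> E \<Longrightarrow> \<not> dist w y < e" using key by blast
      obtain d where d: "d > 0" "ball w d \<subseteq> S" using f(2) w unfolding open_contains_ball by blast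
      have "ball w (min d e) \<subseteq> S - E" using d e by auto
      then show "\<exists>e>0. ball w e \<subseteq> S - E" using d(1) e(1) by (intro exI[of _ "min d e"]) auto
    qed
    moreover have "E \<subseteq> S" by (auto simp: E_def)
    ultimately show False
      using connectedD[OF f(3) oE, of "S - E"] WE W(2) \<open>E \<noteq> S\<close> by blast
  qed
  then show "\<exists>T. openin (top_of_set S) T \<and> a \<in> T \<and> (\<forall>x\<in>T. f x = f a)" if a: "a \<in> S" for a
  proof -
    have "a \<in> E" using a \<open>E = S\<close> by simp
    then have "\<exists>e>0. ball a e \<subseteq> S \<and> (\<forall>y\<in>ball a e. f y = f a)" unfolding E_def mem_Collect_eq by (rule conjunct2)
    then obtain e where e: "e > 0 \<and> ball a e \<subseteq> S \<and> (\<forall>y\<in>ball a e. f y = f a)" ..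
    have "openin (top_of_set S) (ball a e)" unfolding openin_open_eq[OF f(2)] using conjunct1[OF conjunct2[OF e]] by simp
    moreover have "a \<in> ball a e" using conjunct1[OF e] by simp
    ultimately show ?thesis using conjunct2[OF conjunct2[OF e]] by (intro exI[of _ "ball a e"] conjI)
  qed
qed

lemma norm_vector_smult: "norm (c *s (x :: complex ^ 'n)) = cmod c * norm x"
  by (simp add: norm_vec_def norm_mult L2_set_right_distrib)

lemma vanishing_order_unique_bound:
  fixes F g :: "complex \<Rightarrow> complex ^ 'n"
  assumes r: "r > 0" and g: "\<And>i. (\<lambda>w. g w $ i) holomorphic_on ball z r" "g z \<noteq> 0"
    and F: "\<And>w. w \<in> ball z r \<Longrightarrow> F w = (w - z) ^ m *s g w"
  shows "(\<exists>C. \<forall>\<^sub>F w in nhds z. norm (F w) \<le> C * cmod (w - z) ^ k) \<longleftrightarrow> k \<le> m"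
proof -
  have "continuous_on (ball z r) (\<lambda>w. \<chi> i. g w $ i)"
    by (intro continuous_on_vec_lambda holomorphic_on_imp_continuous_on g)
  then have "continuous_on (ball z r) g" by (simp add: vec_lambda_eta)
  then have "isCont g z" using r by (simp add: continuous_on_eq_continuous_at)
  then have gl': "((\<lambda>w. norm (g w)) \<longlongrightarrow> norm (g z)) (at z)" by (intro tendsto_norm) (simp add: isCont_def)
  from \<open>isCont g z\<close> have gl: "((\<lambda>w. norm (g w)) \<longlongrightarrow> norm (g z)) (nhds z)"
    by (intro tendsto_norm) (simp add: isCont_def tendsto_at_iff_tendsto_nhds)
  have evr: "\<forall>\<^sub>F w in nhds z. w \<in> ball z r" using r by (intro eventually_nhds_in_open) auto
  show ?thesis
  proof
    assume km: "k \<le> m"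
    have "\<forall>\<^sub>F w in nhds z. norm (g w) < norm (g z) + 1" using gl by (rule order_tendstoD) simp
    moreover have "\<forall>\<^sub>F w in nhds z. w \<in> ball z 1" by (intro eventually_nhds_in_open) auto
    ultimately have "\<forall>\<^sub>F w in nhds z. norm (F w) \<le> (norm (g z) + 1) * cmod (w - z) ^ k"
      using evr
    proof eventually_elim
      case (elim w)
      have "norm (F w) = cmod (w - z) ^ m * norm (g w)" by (simp add: F[OF elim(3)] norm_vector_smult norm_power)
      also have "\<dots> \<le> cmod (w - z) ^ k * (norm (g z) + 1)"
        using elim km by (intro mult_mono power_decreasing) (auto simp: dist_norm norm_minus_commute)
      finally show ?case by (simp add: mult.commute)
    qed
    then show "\<exists>C. \<forall>\<^sub>F w in nhds z. norm (F w) \<le> C * cmod (w - z) ^ k" by blast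
  next
    assume "\<exists>C. \<forall>\<^sub>F w in nhds z. norm (F w) \<le> C * cmod (w - z) ^ k"
    then obtain C where C: "\<forall>\<^sub>F w in nhds z. norm (F w) \<le> C * cmod (w - z) ^ k" by blast
    show "k \<le> m"
    proof (rule ccontr)
      assume "\<not> k \<le> m"
      then obtain j where j: "k = m + j" "j > 0" by (metis less_imp_add_positive not_le)
      have "\<forall>\<^sub>F w in at z. norm (g w) \<le> C * cmod (w - z) ^ j"
        using eventually_nhds_conv_at[THEN iffD1, OF C, THEN conjunct1] eventually_nhds_conv_at[THEN iffD1, OF evr, THEN conjunct1]
          eventually_neq_at_within[of z]
      proof eventually_elim
        case (elim w)
        have "cmod (w - z) ^ m * norm (g w) \<le> cmod (w - z) ^ m * (C * cmod (w - z) ^ j)"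
          using elim(1) by (simp add: F[OF elim(2)] norm_vector_smult norm_power j(1) power_add mult.left_commute)
        then show ?case using elim(3) by simp
      qed
      moreover have "((\<lambda>w. C * cmod (w - z) ^ j) \<longlongrightarrow> C * cmod (z - z) ^ j) (at z)" by (intro tendsto_intros)
      ultimately have "norm (g z) \<le> C * cmod (z - z) ^ j" using tendsto_le[OF trivial_limit_at _ gl'] by blast
      then show False using g(2) j(2) by (simp add: power_0_left)
    qed
  qed
qed

text \<open>The common factor \<open>(w - z)\<^sup>m\<close> of the coordinates of \<open>\<phi> (f w) - \<phi> (f z)\<close> has as exponent \<open>m\<close> the least vanishing order of those
coordinates that are not constant. The estimates \<open>contact_at_least\<close> determine \<open>m\<close>, which shows the uniqueness that the definite description needs.\<close>

lemma multiplicity_at_nonconstant: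
  fixes M :: "('a, 'n::finite) manifold"
  assumes M: "charted M" and f: "holomorphic_into M f (ball 0 1)" "\<not> f constant_on ball 0 1" and z: "z \<in> ball 0 1"
  obtains m where "m > 0" "multiplicity_at M f z = ereal (real m)" "\<And>k. k > 0 \<Longrightarrow> contact_at_least M f z k \<longleftrightarrow> k \<le> m"
proof -
  obtain U \<phi> where ca: "chart_at M (f z) = (U, \<phi>)" by (cases "chart_at M (f z)")
  have U: "(U, \<phi>) \<in> atlas M" "f z \<in> U"
    using chart_at_in_atlas[OF M holomorphic_into_points[OF f(1) z] ca] by auto
  obtain r0 where r0: "r0 > 0" "ball z r0 \<subseteq> ball 0 1" "\<And>w. w \<in> ball z r0 \<Longrightarrow> f w \<in> U"
    "\<And>i. (\<lambda>w. \<phi> (f w) $ i) holomorphic_on ball z r0" using holomorphic_into_chart_ball[OF M f(1) open_ball U(1) z U(2)] by metis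
  define F where "F i w = \<phi> (f w) $ i - \<phi> (f z) $ i" for i w
  have Fh: "F i holomorphic_on ball z r0" for i unfolding F_def using r0(4) by (intro holomorphic_intros)
  have Fz: "F i z = 0" for i by (simp add: F_def)
  have zr: "z \<in> ball z r0" using r0(1) by simp
  define P where "P m \<longleftrightarrow> (\<exists>r>0. \<exists>g. ball z r \<subseteq> ball 0 1 \<and> f ` ball z r \<subseteq> U \<and>
         (\<forall>i. (\<lambda>w. g w $ i) holomorphic_on ball z r) \<and> g z \<noteq> 0 \<and>
         (\<forall>w\<in>ball z r. \<phi> (f w) - \<phi> (f z) = (w - z) ^ m *s g w))" for m
  have contact: "contact_at_least M f z k \<longleftrightarrow> k \<le> m" if "P m" "k > 0" for m k
  proof -
    obtain r and g :: "complex \<Rightarrow> complex ^ 'n" where r: "r > 0" "ball z r \<subseteq> ball 0 1" "f ` ball z r \<subseteq> U" and g': "\<forall>i. (\<lambda>w. g w $ i) holomorphic_on ball z r" "g z \<noteq> 0"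
      "\<forall>w\<in>ball z r. \<phi> (f w) - \<phi> (f z) = (w - z) ^ m *s g w" using \<open>P m\<close> unfolding P_def by blast
    have evr: "\<forall>\<^sub>F w in nhds z. w \<in> ball z r" using r by (intro eventually_nhds_in_open) auto
    have e1: "\<forall>\<^sub>F w in nhds z. f w \<in> U" using evr by eventually_elim (use r(3) in blast)
    have "(\<exists>C. \<forall>\<^sub>F w in nhds z. norm (\<phi> (f w) - \<phi> (f z)) \<le> C * cmod (w - z) ^ k) \<longleftrightarrow> k \<le> m"
      by (rule vanishing_order_unique_bound[OF r(1) spec[OF g'(1)] g'(2) bspec[OF g'(3)]])
    moreover have "contact_at_least M f z k \<longleftrightarrow> (\<exists>C. \<forall>\<^sub>F w in nhds z. norm (\<phi> (f w) - \<phi> (f z)) \<le> C * cmod (w - z) ^ k)"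
    proof
      assume c: "contact_at_least M f z k"
      from contact_at_least_in_chart[OF M c that(2) U]
      show "\<exists>C. \<forall>\<^sub>F w in nhds z. norm (\<phi> (f w) - \<phi> (f z)) \<le> C * cmod (w - z) ^ k"
        by (auto elim: eventually_mono)
    next
      assume "\<exists>C. \<forall>\<^sub>F w in nhds z. norm (\<phi> (f w) - \<phi> (f z)) \<le> C * cmod (w - z) ^ k"
      then obtain C where "\<forall>\<^sub>F w in nhds z. norm (\<phi> (f w) - \<phi> (f z)) \<le> C * cmod (w - z) ^ k" by blast
      with e1 have "\<forall>\<^sub>F w in nhds z. f w \<in> U \<and> norm (\<phi> (f w) - \<phi> (f z)) \<le> C * cmod (w - z) ^ k"
        by eventually_elim simp
      then show "contact_at_least M f z k" using U unfolding contact_at_least_def by blast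
    qed
    ultimately show ?thesis by blast
  qed
  have pos: "m > 0" if "P m" for m
  proof (rule ccontr)
    assume "\<not> m > 0"
    then obtain r g where "r > 0" "g z \<noteq> 0" "\<forall>w\<in>ball z r. \<phi> (f w) - \<phi> (f z) = (w - z) ^ 0 *s g w"
      using \<open>P m\<close> unfolding P_def by auto
    then have "g z = 0" by (metis centre_in_ball diff_self power_0 vector_smult_lid)
    then show False using \<open>g z \<noteq> 0\<close> by simp
  qed
  have uniq: "m = m'" if "P m" "P m'" for m m'
    using contact[OF that(1), of m] contact[OF that(2), of m] contact[OF that(1), of m'] contact[OF that(2), of m'] pos that
    by (meson antisym order_refl)
  have "\<exists>m. P m"
  proof -
    \<comment> \<open>coordinates \<open>F i\<close> that are constant vanish identically and impose no condition on the order\<close>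
    define I where "I = {i. \<not> F i constant_on ball z r0}"
    have "I \<noteq> {}"
    proof
      assume "I = {}"
      then have cst: "F i constant_on ball z r0" for i by (auto simp: I_def)
      have "\<phi> (f w) = \<phi> (f z)" if w: "w \<in> ball z r0" for w
      proof -
        have "F i w = F i z" for i using cst[of i] w zr unfolding constant_on_def by metis
        then show ?thesis by (simp add: F_def vec_eq_iff)
      qed
      then have "f w = f z" if "w \<in> ball z r0" for w using inj_onD[OF chart_inj[OF M U(1)]] r0(3) that U(2) by metis
      then have "f constant_on ball z r0" by (auto simp: constant_on_def)
      then show False using holomorphic_into_identity[OF M f(1) open_ball connected_ball open_ball _ r0(2)] zr f(2) by blast
    qed
    have "\<exists>n r g. 0 < n \<and> 0 < r \<and> ball z r \<subseteq> ball z r0 \<and> g holomorphic_on ball z r \<and>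
        (\<forall>w\<in>ball z r. F i w = (w - z) ^ n * g w) \<and> g z \<noteq> 0" if "i \<in> I" for i
    proof -
      have "\<not> F i constant_on ball z r0" using that by (simp add: I_def)
      from holomorphic_factor_zero_nonconstant[OF Fh open_ball connected_ball zr Fz this]
      obtain g r n where "0 < n" "0 < r" "ball z r \<subseteq> ball z r0" "g holomorphic_on ball z r"
        "\<And>w. w \<in> ball z r \<Longrightarrow> F i w = (w - z) ^ n * g w" "\<And>w. w \<in> ball z r \<Longrightarrow> g w \<noteq> 0" by metis
      then show ?thesis by (metis centre_in_ball)
    qed
    then obtain n r g where n: "\<And>i. i \<in> I \<Longrightarrow> 0 < n i \<and> 0 < r i \<and> ball z (r i) \<subseteq> ball z r0 \<and> g i holomorphic_on ball z (r i) \<and>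
        (\<forall>w\<in>ball z (r i). F i w = (w - z) ^ n i * g i w) \<and> g i z \<noteq> (0::complex)" by metis
    define m where "m = Min (n ` I)"
    have fin: "finite (n ` I)" "n ` I \<noteq> {}" using \<open>I \<noteq> {}\<close> by auto
    have mle: "m \<le> n i" if "i \<in> I" for i using fin that by (simp add: m_def)
    obtain i0 where i0: "i0 \<in> I" "n i0 = m" using Min_in[OF fin] by (auto simp: m_def)
    define R where "R = Min (insert r0 (r ` I))"
    have R: "R > 0" "R \<le> r0" "\<And>i. i \<in> I \<Longrightarrow> R \<le> r i" using n r0(1) by (auto simp: R_def)
    define G :: "complex \<Rightarrow> complex ^ 'n" where "G w = (\<chi> i. if i \<in> I then (w - z) ^ (n i - m) * g i w else 0)" for w
    have "P m"
      unfolding P_def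
    proof (intro exI[of _ R] exI[of _ G] conjI allI ballI)
      show "R > 0" by (rule R)
      have sub: "ball z R \<subseteq> ball z r0" using R(2) by (rule subset_ball)
      show "ball z R \<subseteq> ball 0 1" using sub r0(2) by blast
      show "f ` ball z R \<subseteq> U" using sub r0(3) by blast
      show "(\<lambda>w. G w $ i) holomorphic_on ball z R" for i
      proof (cases "i \<in> I")
        case True
        have "g i holomorphic_on ball z R" using n[OF True] subset_ball[OF R(3)[OF True]] holomorphic_on_subset by blast
        then show ?thesis using True by (auto simp: G_def intro!: holomorphic_intros)
      qed (simp add: G_def)
      have "G z $ i0 \<noteq> 0" using n[OF i0(1)] i0 by (simp add: G_def)
      then show "G z \<noteq> 0" by auto
      fix w assume w: "w \<in> ball z R"
      show "\<phi> (f w) - \<phi> (f z) = (w - z) ^ m *s G w"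
      proof (subst vec_eq_iff, rule allI)
        fix i
        show "(\<phi> (f w) - \<phi> (f z)) $ i = ((w - z) ^ m *s G w) $ i"
        proof (cases "i \<in> I")
          case True
          have "F i w = (w - z) ^ n i * g i w" using n[OF True] w R(3)[OF True] by auto
          also have "\<dots> = (w - z) ^ m * ((w - z) ^ (n i - m) * g i w)"
            using mle[OF True] by (simp add: mult.assoc[symmetric] power_add[symmetric])
          finally show ?thesis using True by (simp add: F_def G_def)
        next
          case False
          then have "F i constant_on ball z r0" by (simp add: I_def)
          then have "F i w = F i z" using w sub zr unfolding constant_on_def by (metis subsetD)
          then show ?thesis using False by (simp add: F_def G_def)
        qed
      qed
    qed
    then show ?thesis by blast
  qed
  then obtain m where m: "P m" by blast
  have "(THE m. P m) = m" using m uniq by blast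
  then have "multiplicity_at M f z = ereal (real m)" using f(2) ca by (simp add: multiplicity_at_def P_def)
  then show thesis using that[of m] pos[OF m] contact[OF m] by blast
qed

lemma multiplicity_at_constant: "f constant_on ball 0 1 \<Longrightarrow> multiplicity_at M f z = \<infinity>"
  by (simp add: multiplicity_at_def)

lemma lelong_term_nonpos:
  assumes M: "charted M" and f: "holomorphic_into M f (ball 0 1)" and z: "z \<in> ball 0 1"
  shows "lelong_term M (indicator A) f z \<le> 0"
proof (cases "f z \<in> A")
  case True
  have "multiplicity_at M f z \<ge> 0"
  proof (cases "f constant_on ball 0 1")
    case False
    then show ?thesis using multiplicity_at_nonconstant[OF M f False z] by (metis ereal_less_eq(5) of_nat_0_le_iff)
  qed (simp add: multiplicity_at_constant)
  moreover have "log_norm z \<le> 0" using z by (auto simp: log_norm_def ln_le_zero_iff less_imp_le)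
  ultimately show ?thesis using True by (auto simp: lelong_term_def one_ereal_def[symmetric] ereal_mult_le_0_iff)
qed (simp add: lelong_term_def)

lemma lelong_term_le:
  assumes M: "charted M" and f: "holomorphic_into M f (ball 0 1)" and z: "z \<in> ball 0 1" "z \<noteq> 0" "f z \<in> A"
    and c: "contact_at_least M f z k" "k > 0"
  shows "lelong_term M (indicator A) f z \<le> ereal (real k * ln (cmod z))"
proof -
  have l: "ln (cmod z) < 0" using z by simp
  show ?thesis
  proof (cases "f constant_on ball 0 1")
    case True
    then show ?thesis using z l by (simp add: lelong_term_def multiplicity_at_constant log_norm_def one_ereal_def[symmetric])
  next
    case False
    obtain m where m: "multiplicity_at M f z = ereal (real m)" "k \<le> m"
      using multiplicity_at_nonconstant[OF M f False z(1)] c by metis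
    have "real m * ln (cmod z) \<le> real k * ln (cmod z)" using m(2) l by (intro mult_right_mono_neg) auto
    then show ?thesis using z m(1) by (simp add: lelong_term_def log_norm_def one_ereal_def[symmetric])
  qed
qed

lemma lelong_term_at_0:
  assumes M: "charted M" and f: "holomorphic_into M f (ball 0 1)" and z: "f 0 \<in> A"
  shows "lelong_term M (indicator A) f 0 = -\<infinity>"
proof (cases "f constant_on ball 0 1")
  case True
  then show ?thesis using z by (simp add: lelong_term_def multiplicity_at_constant log_norm_def one_ereal_def[symmetric])
next
  case False
  obtain m where "multiplicity_at M f 0 = ereal (real m)" "m > 0"
    using multiplicity_at_nonconstant[OF M f False, of 0] by auto
  then show ?thesis using z by (simp add: lelong_term_def log_norm_def one_ereal_def[symmetric])
qed

lemma lelong_term_nonconstant: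
  assumes M: "charted M" and f: "holomorphic_into M f (ball 0 1)" "\<not> f constant_on ball 0 1" and z: "z \<in> ball 0 1" "z \<noteq> 0" "f z \<in> A"
  obtains k where "k > 0" "contact_at_least M f z k" "lelong_term M (indicator A) f z = ereal (real k * ln (cmod z))"
proof -
  obtain m where m: "m > 0" "multiplicity_at M f z = ereal (real m)" "\<And>k. k > 0 \<Longrightarrow> contact_at_least M f z k \<longleftrightarrow> k \<le> m"
    using multiplicity_at_nonconstant[OF M f z(1)] by metis
  show thesis using that[of m] m z by (simp add: lelong_term_def log_norm_def one_ereal_def[symmetric])
qed

lemma closed_discs_holomorphic_into: "f \<in> closed_discs M \<Longrightarrow> holomorphic_into M f (ball 0 1)"
proof -
  assume "f \<in> closed_discs M"
  then obtain g S where g: "cball 0 1 \<subseteq> S" "holomorphic_into M g S" "\<And>z. z \<in> ball 0 1 \<Longrightarrow> f z = g z"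
    by (auto simp: closed_discs_def)
  then have "holomorphic_into M g (ball 0 1)" using holomorphic_into_subset ball_subset_cball by blast
  then show ?thesis using g(3) by (rule holomorphic_into_cong)
qed

lemma lelong_envelope_le_sum:
  assumes g: "holomorphic_into M g S" "open S" "cball 0 1 \<subseteq> S" "g 0 = x" and F: "finite F" "F \<subseteq> ball 0 1"
  shows "lelong_envelope M \<alpha> x \<le> (\<Sum>z\<in>F. lelong_term M \<alpha> g z)"
proof -
  have "g \<in> {f \<in> closed_discs M. f 0 = x}" using g by (auto simp: closed_discs_def)
  then have "lelong_envelope M \<alpha> x \<le> lelong_functional M \<alpha> g" unfolding lelong_envelope_def by (rule INF_lower)
  also have "\<dots> \<le> (\<Sum>z\<in>F. lelong_term M \<alpha> g z)" unfolding lelong_functional_def using F by (intro INF_lower) auto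
  finally show ?thesis .
qed

lemma lelong_envelope_le_hits:
  assumes M: "charted M" and g: "holomorphic_into M g S" "open S" "cball 0 1 \<subseteq> S" "g 0 = x"
    and F: "finite F" "F \<subseteq> ball 0 1 - {0}" "\<And>z. z \<in> F \<Longrightarrow> g z \<in> A \<and> k z > 0 \<and> contact_at_least M g z (k z)"
  shows "lelong_envelope M (indicator A) x \<le> ereal (\<Sum>z\<in>F. real (k z) * ln (cmod z))"
proof -
  have gb: "holomorphic_into M g (ball 0 1)" using g holomorphic_into_subset ball_subset_cball by blast
  have "lelong_envelope M (indicator A) x \<le> (\<Sum>z\<in>F. lelong_term M (indicator A) g z)"
    by (rule lelong_envelope_le_sum[OF g F(1)]) (use F(2) in auto)
  also have "\<dots> \<le> (\<Sum>z\<in>F. ereal (real (k z) * ln (cmod z)))"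
    using F(2,3) by (intro sum_mono lelong_term_le[OF M gb]) auto
  finally show ?thesis by simp
qed

lemma holomorphic_into_const: "x \<in> points M \<Longrightarrow> holomorphic_into M (\<lambda>_. x) S"
  by (auto simp: holomorphic_into_def)

lemma contact_at_least_const:
  assumes "charted M" "x \<in> points M"
  shows "contact_at_least M (\<lambda>_. x) z k"
proof -
  obtain U \<phi> where "(U, \<phi>) \<in> atlas M" "x \<in> U" using chart_exists[OF assms] .
  then show ?thesis unfolding contact_at_least_def by (intro bexI[of _ "(U, \<phi>)"]) (auto intro!: exI[of _ 0])
qed

lemma lelong_envelope_nonpos: "x \<in> points M \<Longrightarrow> lelong_envelope M \<alpha> x \<le> 0"
  using lelong_envelope_le_sum[OF holomorphic_into_const, of x M UNIV x "{}" \<alpha>] by simp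

lemma lelong_envelope_on_set:
  assumes M: "charted M" and x: "x \<in> points M" "x \<in> A"
  shows "lelong_envelope M (indicator A) x = -\<infinity>"
proof -
  have "lelong_envelope M (indicator A) x \<le> (\<Sum>z\<in>{0}. lelong_term M (indicator A) (\<lambda>_. x) z)"
    by (rule lelong_envelope_le_sum[OF holomorphic_into_const[OF x(1)], of UNIV]) auto
  also have "\<dots> = -\<infinity>" using lelong_term_at_0[OF M holomorphic_into_const[OF x(1)], of A] x(2) by simp
  finally show ?thesis by simp
qed

lemma contact_at_least_cong:
  assumes c: "contact_at_least M f z k" and e: "\<forall>\<^sub>F w in nhds z. f w = g w"
  shows "contact_at_least M g z k"
proof -
  have fz: "f z = g z" by (rule eventually_nhds_x_imp_x[OF e])
  obtain U \<phi> C where U: "(U, \<phi>) \<in> atlas M" "f z \<in> U"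
    and C: "\<forall>\<^sub>F w in nhds z. f w \<in> U \<and> norm (\<phi> (f w) - \<phi> (f z)) \<le> C * cmod (w - z) ^ k"
    using c unfolding contact_at_least_def by auto
  have "\<forall>\<^sub>F w in nhds z. g w \<in> U \<and> norm (\<phi> (g w) - \<phi> (g z)) \<le> C * cmod (w - z) ^ k"
    using C e by eventually_elim (simp add: fz)
  then show ?thesis unfolding contact_at_least_def using U fz by (intro bexI[OF _ U(1)]) auto
qed

text \<open>A disc through \<open>x\<close>, which is not in \<open>A\<close>, with a negative Lelong functional cannot be constant; so all multiplicities are finite.\<close>

lemma lelong_envelope_less_hits:
  assumes M: "charted M" and x: "x \<notin> A" and less: "lelong_envelope M (indicator A) x < ereal \<beta>" "\<beta> \<le> 0"
  obtains g S F k where "holomorphic_into M g S" "open S" "cball 0 1 \<subseteq> S" "g 0 = x"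
    "finite F" "F \<subseteq> ball 0 1 - {0}" "\<And>z. z \<in> F \<Longrightarrow> g z \<in> A \<and> k z > 0 \<and> contact_at_least M g z (k z)"
    "(\<Sum>z\<in>F. real (k z) * ln (cmod z)) < \<beta>"
proof -
  obtain f where f: "f \<in> closed_discs M" "f 0 = x" "lelong_functional M (indicator A) f < ereal \<beta>"
    using less(1) unfolding lelong_envelope_def INF_less_iff by auto
  obtain g S where g: "open S" "cball 0 1 \<subseteq> S" "holomorphic_into M g S" "\<And>z. z \<in> ball 0 1 \<Longrightarrow> f z = g z"
    using f(1) by (auto simp: closed_discs_def)
  obtain F where F: "finite F" "F \<subseteq> ball 0 1" "(\<Sum>z\<in>F. lelong_term M (indicator A) f z) < ereal \<beta>"
    using f(3) unfolding lelong_functional_def INF_less_iff by auto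
  have fh: "holomorphic_into M f (ball 0 1)" using closed_discs_holomorphic_into[OF f(1)] .
  define F' where "F' = {z \<in> F. f z \<in> A}"
  have "(\<Sum>z\<in>F. lelong_term M (indicator A) f z) = (\<Sum>z\<in>F'. lelong_term M (indicator A) f z)"
    unfolding F'_def using F(1) by (intro sum.mono_neutral_right) (auto simp: lelong_term_def)
  with F(3) have less': "(\<Sum>z\<in>F'. lelong_term M (indicator A) f z) < ereal \<beta>" by simp
  then have "F' \<noteq> {}" using less(2) by auto
  then obtain z1 where z1: "z1 \<in> F" "f z1 \<in> A" by (auto simp: F'_def)
  have nc: "\<not> f constant_on ball 0 1"
  proof
    assume "f constant_on ball 0 1"
    then have "f z1 = f 0" using z1(1) F(2) unfolding constant_on_def by (metis centre_in_ball subsetD zero_less_one)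
    then show False using z1(2) f(2) x by simp
  qed
  have F'0: "z \<in> ball 0 1" "z \<noteq> 0" "f z \<in> A" if "z \<in> F'" for z
    using that F(2) f(2) x by (auto simp: F'_def)
  have "\<exists>k. k > 0 \<and> contact_at_least M f z k \<and> lelong_term M (indicator A) f z = ereal (real k * ln (cmod z))" if "z \<in> F'" for z
    using lelong_term_nonconstant[OF M fh nc F'0[OF that]] by metis
  then obtain k where k: "\<And>z. z \<in> F' \<Longrightarrow> k z > 0 \<and> contact_at_least M f z (k z) \<and> lelong_term M (indicator A) f z = ereal (real (k z) * ln (cmod z))"
    by metis
  have contact: "contact_at_least M g z j" if c: "contact_at_least M f z j" and z: "z \<in> ball 0 1" for z j
  proof (rule contact_at_least_cong[OF c])
    have "\<forall>\<^sub>F w in nhds z. w \<in> ball 0 1" using z by (intro eventually_nhds_in_open) auto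
    then show "\<forall>\<^sub>F w in nhds z. f w = g w" by eventually_elim (rule g(4))
  qed
  have "ereal (\<Sum>z\<in>F'. real (k z) * ln (cmod z)) = (\<Sum>z\<in>F'. lelong_term M (indicator A) f z)" using k by simp
  with less' have lt: "(\<Sum>z\<in>F'. real (k z) * ln (cmod z)) < \<beta>" by (metis less_ereal.simps(1))
  show thesis
  proof (rule that[OF g(3,1,2)])
    show "g 0 = x" using g(4)[of 0] f(2) by simp
    show "finite F'" using F(1) by (simp add: F'_def)
    show "F' \<subseteq> ball 0 1 - {0}" using F'0 by blast
    show "g z \<in> A \<and> k z > 0 \<and> contact_at_least M g z (k z)" if "z \<in> F'" for z
      using k[OF that] F'0[OF that] g(4) contact by simp
  qed (rule lt)
qed

section \<open>The Lelong envelope on a product\<close>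

lemma holomorphic_into_compose:
  assumes g: "holomorphic_into M g S" and h: "h holomorphic_on T" "\<And>z. z \<in> T \<Longrightarrow> h z \<in> S"
  shows "holomorphic_into M (\<lambda>z. g (h z)) T"
  unfolding holomorphic_into_def
proof (intro conjI)
  have "continuous_map (top_of_set T) (top_of_set S) h"
    using holomorphic_on_imp_continuous_on[OF h(1)] h(2) by (auto simp: continuous_map_in_subtopology)
  moreover have "continuous_map (top_of_set S) (mtop M) g" using g by (simp add: holomorphic_into_def)
  ultimately have "continuous_map (top_of_set T) (mtop M) (g \<circ> h)" by (rule continuous_map_compose)
  then show "continuous_map (top_of_set T) (mtop M) (\<lambda>z. g (h z))" by (simp add: o_def)
  show "\<forall>(U, \<phi>)\<in>atlas M. \<forall>i. (\<lambda>z. \<phi> (g (h z)) $ i) holomorphic_on {z \<in> T. g (h z) \<in> U}"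
  proof (clarify)
    fix U \<phi> i assume "(U, \<phi>) \<in> atlas M"
    then have "(\<lambda>z. \<phi> (g z) $ i) holomorphic_on {z \<in> S. g z \<in> U}" using g by (auto simp: holomorphic_into_def)
    moreover have "h holomorphic_on {z \<in> T. g (h z) \<in> U}" using h(1) by (rule holomorphic_on_subset) auto
    moreover have "h ` {z \<in> T. g (h z) \<in> U} \<subseteq> {z \<in> S. g z \<in> U}" using h(2) by auto
    ultimately show "(\<lambda>z. \<phi> (g (h z)) $ i) holomorphic_on {z \<in> T. g (h z) \<in> U}"
      using holomorphic_on_compose_gen[of h _ "\<lambda>z. \<phi> (g z) $ i"] unfolding o_def by blast
  qed
qed

text \<open>Orders multiply: the distance of \<open>g (h w)\<close> to \<open>g (h z)\<close> is at most a multiple of \<open>\<bar>h w - h z\<bar>\<^sup>k\<close>.\<close>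

lemma contact_at_least_compose:
  assumes c: "contact_at_least M g (h z) k" and h: "isCont h z"
    and C: "\<forall>\<^sub>F w in at z. cmod (h w - h z) ^ k \<le> C * cmod (w - z) ^ N"
  shows "contact_at_least M (\<lambda>w. g (h w)) z N"
proof -
  obtain U \<phi> D where U: "(U, \<phi>) \<in> atlas M" "g (h z) \<in> U"
    and D: "\<forall>\<^sub>F v in nhds (h z). g v \<in> U \<and> norm (\<phi> (g v) - \<phi> (g (h z))) \<le> D * cmod (v - h z) ^ k"
    using c by (auto simp: contact_at_least_def)
  have "filterlim h (nhds (h z)) (at z)" using h by (simp add: isCont_def)
  from eventually_compose_filterlim[OF D this]
  have "\<forall>\<^sub>F w in at z. g (h w) \<in> U \<and> norm (\<phi> (g (h w)) - \<phi> (g (h z))) \<le> D * cmod (h w - h z) ^ k" .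
  with C have ev: "\<forall>\<^sub>F w in at z. g (h w) \<in> U \<and> norm (\<phi> (g (h w)) - \<phi> (g (h z))) \<le> (\<bar>D\<bar> * C) * cmod (w - z) ^ N"
  proof eventually_elim
    case (elim w)
    have "D * cmod (h w - h z) ^ k \<le> \<bar>D\<bar> * cmod (h w - h z) ^ k" by (intro mult_right_mono) auto
    also have "\<dots> \<le> \<bar>D\<bar> * (C * cmod (w - z) ^ N)" using elim(1) by (intro mult_left_mono) auto
    finally show ?case using elim(2) by (auto simp: mult.assoc)
  qed
  define E where "E = \<bar>\<bar>D\<bar> * C\<bar>"
  have "\<forall>\<^sub>F w in at z. g (h w) \<in> U \<and> norm (\<phi> (g (h w)) - \<phi> (g (h z))) \<le> E * cmod (w - z) ^ N"
    using ev
  proof eventually_elim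
    case (elim w)
    have "(\<bar>D\<bar> * C) * cmod (w - z) ^ N \<le> E * cmod (w - z) ^ N" unfolding E_def by (intro mult_right_mono) auto
    then show ?case using elim by linarith
  qed
  moreover have "g (h z) \<in> U \<and> norm (\<phi> (g (h z)) - \<phi> (g (h z))) \<le> E * cmod (z - z) ^ N" using U by (simp add: E_def)
  ultimately have "\<forall>\<^sub>F w in nhds z. g (h w) \<in> U \<and> norm (\<phi> (g (h w)) - \<phi> (g (h z))) \<le> E * cmod (w - z) ^ N"
    unfolding eventually_nhds_conv_at by blast
  then show ?thesis using U unfolding contact_at_least_def by blast
qed

text \<open>Pairs of vectors as vectors indexed by the disjoint union, with their two components, describe the charts of a product.\<close>

definition vec_pair :: "complex ^ 'm \<Rightarrow> complex ^ 'n \<Rightarrow> complex ^ ('m::finite + 'n::finite)"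
  where "vec_pair x y = (\<chi> i. case i of Inl j \<Rightarrow> x $ j | Inr k \<Rightarrow> y $ k)"

definition vec_fst :: "complex ^ ('m::finite + 'n::finite) \<Rightarrow> complex ^ 'm"
  where "vec_fst w = (\<chi> j. w $ Inl j)"

definition vec_snd :: "complex ^ ('m::finite + 'n::finite) \<Rightarrow> complex ^ 'n"
  where "vec_snd w = (\<chi> j. w $ Inr j)"

lemma vec_pair_simps [simp]:
  "vec_fst (vec_pair x y) = x" "vec_snd (vec_pair x y) = y" "vec_pair (vec_fst w) (vec_snd w) = w"
  "vec_pair x y $ Inl j = x $ j" "vec_pair x y $ Inr k = y $ k"
  by (auto simp: vec_pair_def vec_fst_def vec_snd_def vec_eq_iff split: sum.split)

lemma vec_pair_diff: "vec_pair x y - vec_pair x' y' = vec_pair (x - x') (y - y')"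
  and vec_pair_smult: "c *s vec_pair x y = vec_pair (c *s x) (c *s y)"
  by (auto simp: vec_pair_def vec_eq_iff split: sum.split)

lemma norm_vec_pair: "(norm (vec_pair x y))\<^sup>2 = (norm x)\<^sup>2 + (norm y)\<^sup>2"
  unfolding norm_vec_cmod UNIV_Plus_UNIV[symmetric] by (subst sum.Plus) auto

lemma norm_vec_pair_bounds:
  "norm x \<le> norm (vec_pair x y)" "norm y \<le> norm (vec_pair x y)" "norm (vec_pair x y) \<le> norm x + norm y"
proof -
  show "norm x \<le> norm (vec_pair x y)" "norm y \<le> norm (vec_pair x y)"
    by (rule power2_le_imp_le; simp add: norm_vec_pair)+
  show "norm (vec_pair x y) \<le> norm x + norm y"
    by (rule power2_le_imp_le) (simp_all add: norm_vec_pair power2_sum)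
qed

lemma bounded_linear_vec_fst: "bounded_linear vec_fst" and bounded_linear_vec_snd: "bounded_linear vec_snd"
  by (rule linear_conv_bounded_linear[THEN iffD1], rule linearI; simp add: vec_fst_def vec_snd_def vec_eq_iff)+

lemma bounded_linear_vec_pair: "bounded_linear (\<lambda>p. vec_pair (fst p) (snd p))"
  by (rule linear_conv_bounded_linear[THEN iffD1], rule linearI) (auto simp: vec_pair_def vec_eq_iff split: sum.split)

lemma continuous_vec_pair: "continuous_on UNIV (\<lambda>p. vec_pair (fst p) (snd p))"
  and continuous_vec_fst: "continuous_on S vec_fst" and continuous_vec_snd: "continuous_on T vec_snd"
  using bounded_linear_vec_pair bounded_linear_vec_fst bounded_linear_vec_snd
  by (auto intro: linear_continuous_on)

lemma product_chart_eq: "product_chart (U, \<phi>) (V, \<psi>) = (U \<times> V, \<lambda>(x, y). vec_pair (\<phi> x) (\<psi> y))"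
  by (auto simp: product_chart_def vec_pair_def fun_eq_iff vec_eq_iff split: sum.split)

lemma product_atlas:
  "(W, \<Phi>) \<in> atlas (product_manifold M N) \<longleftrightarrow>
    (\<exists>U \<phi> V \<psi>. (U, \<phi>) \<in> atlas M \<and> (V, \<psi>) \<in> atlas N \<and> W = U \<times> V \<and> \<Phi> = (\<lambda>(x, y). vec_pair (\<phi> x) (\<psi> y)))"
proof
  assume "(W, \<Phi>) \<in> atlas (product_manifold M N)"
  then obtain c d where "c \<in> atlas M" "d \<in> atlas N" "(W, \<Phi>) = product_chart c d" by (auto simp: product_manifold_def)
  then show "\<exists>U \<phi> V \<psi>. (U, \<phi>) \<in> atlas M \<and> (V, \<psi>) \<in> atlas N \<and> W = U \<times> V \<and> \<Phi> = (\<lambda>(x, y). vec_pair (\<phi> x) (\<psi> y))"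
    using product_chart_eq[of "fst c" "snd c" "fst d" "snd d"]
    by (intro exI[of _ "fst c"] exI[of _ "snd c"] exI[of _ "fst d"] exI[of _ "snd d"]) auto
next
  assume "\<exists>U \<phi> V \<psi>. (U, \<phi>) \<in> atlas M \<and> (V, \<psi>) \<in> atlas N \<and> W = U \<times> V \<and> \<Phi> = (\<lambda>(x, y). vec_pair (\<phi> x) (\<psi> y))"
  then obtain U \<phi> V \<psi> where "(U, \<phi>) \<in> atlas M" "(V, \<psi>) \<in> atlas N" "(W, \<Phi>) = product_chart (U, \<phi>) (V, \<psi>)"
    unfolding product_chart_eq by blast
  then show "(W, \<Phi>) \<in> atlas (product_manifold M N)" unfolding product_manifold_def by force
qed

lemma product_atlasI:
  "(U, \<phi>) \<in> atlas M \<Longrightarrow> (V, \<psi>) \<in> atlas N \<Longrightarrow> (U \<times> V, \<lambda>(x, y). vec_pair (\<phi> x) (\<psi> y)) \<in> atlas (product_manifold M N)"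
  unfolding product_atlas by (intro exI[of _ U] exI[of _ \<phi>] exI[of _ V] exI[of _ \<psi>]) simp

lemma mtop_product [simp]: "mtop (product_manifold M N) = prod_topology (mtop M) (mtop N)"
  by (simp add: product_manifold_def)

lemma product_chart_image: "(\<lambda>(x, y). vec_pair (\<phi> x) (\<psi> y)) ` (U \<times> V) = {w. vec_fst w \<in> \<phi> ` U \<and> vec_snd w \<in> \<psi> ` V}"
proof (intro set_eqI iffI)
  fix w assume "w \<in> {w. vec_fst w \<in> \<phi> ` U \<and> vec_snd w \<in> \<psi> ` V}"
  then obtain x y where "x \<in> U" "y \<in> V" "vec_fst w = \<phi> x" "vec_snd w = \<psi> y" by auto
  then have "w = vec_pair (\<phi> x) (\<psi> y)" by (metis vec_pair_simps(3))
  then show "w \<in> (\<lambda>(x, y). vec_pair (\<phi> x) (\<psi> y)) ` (U \<times> V)" using \<open>x \<in> U\<close> \<open>y \<in> V\<close> by force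
qed auto

lemma vec_pair_eq_iff: "vec_pair x y = vec_pair x' y' \<longleftrightarrow> x = x' \<and> y = y'"
  by (metis vec_pair_simps(1,2))

lemma product_chart_inj:
  assumes "inj_on \<phi> U" "inj_on \<psi> V"
  shows "inj_on (\<lambda>(x, y). vec_pair (\<phi> x) (\<psi> y)) (U \<times> V)"
  using assms by (auto simp: inj_on_def vec_pair_eq_iff)

lemma product_chart_inv:
  assumes "inj_on \<phi> U" "inj_on \<psi> V" and w: "vec_fst w \<in> \<phi> ` U" "vec_snd w \<in> \<psi> ` V"
  shows "inv_into (U \<times> V) (\<lambda>(x, y). vec_pair (\<phi> x) (\<psi> y)) w = (inv_into U \<phi> (vec_fst w), inv_into V \<psi> (vec_snd w))"
  by (rule inv_into_f_eq[OF product_chart_inj[OF assms(1,2)]])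
     (use w in \<open>auto simp: inv_into_into f_inv_into_f simp del: image_iff\<close>)

lemma holomorphic_map_vec_pair:
  assumes f: "f holomorphic_map_on S" and g: "g holomorphic_map_on T"
  shows "(\<lambda>w. vec_pair (f (vec_fst w)) (g (vec_snd w))) holomorphic_map_on {w. vec_fst w \<in> S \<and> vec_snd w \<in> T}"
  unfolding holomorphic_map_on_def
proof
  fix w assume w: "w \<in> {w. vec_fst w \<in> S \<and> vec_snd w \<in> T}"
  define R where "R = {w. vec_fst w \<in> S \<and> vec_snd w \<in> T}"
  obtain f' where f': "(f has_derivative f') (at (vec_fst w) within S)" "\<And>c v. f' (c *s v) = c *s f' v"
    using f w unfolding holomorphic_map_on_def by blast
  obtain g' where g': "(g has_derivative g') (at (vec_snd w) within T)" "\<And>c v. g' (c *s v) = c *s g' v"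
    using g w unfolding holomorphic_map_on_def by blast
  have "(f has_derivative f') (at (vec_fst w) within vec_fst ` R)" "(g has_derivative g') (at (vec_snd w) within vec_snd ` R)"
    by (rule has_derivative_subset[OF f'(1)], force simp: R_def, rule has_derivative_subset[OF g'(1)], force simp: R_def)
  from has_derivative_in_compose[OF bounded_linear.has_derivative[OF bounded_linear_vec_fst has_derivative_ident] this(1)]
    has_derivative_in_compose[OF bounded_linear.has_derivative[OF bounded_linear_vec_snd has_derivative_ident] this(2)]
  have "((\<lambda>w. f (vec_fst w)) has_derivative (\<lambda>v. f' (vec_fst v))) (at w within R)"
    "((\<lambda>w. g (vec_snd w)) has_derivative (\<lambda>v. g' (vec_snd v))) (at w within R)" .
  then have "((\<lambda>w. (f (vec_fst w), g (vec_snd w))) has_derivative (\<lambda>v. (f' (vec_fst v), g' (vec_snd v)))) (at w within R)"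
    by (rule has_derivative_Pair)
  from bounded_linear.has_derivative[OF bounded_linear_vec_pair this]
  have "((\<lambda>w. vec_pair (f (vec_fst w)) (g (vec_snd w))) has_derivative (\<lambda>v. vec_pair (f' (vec_fst v)) (g' (vec_snd v)))) (at w within R)"
    by simp
  moreover have "vec_fst (c *s v) = c *s vec_fst v" "vec_snd (c *s v) = c *s vec_snd v" for c and v :: "complex ^ ('a + 'c)"
    by (auto simp: vec_fst_def vec_snd_def vec_eq_iff)
  then have "\<forall>c v. vec_pair (f' (vec_fst (c *s v))) (g' (vec_snd (c *s v))) = c *s vec_pair (f' (vec_fst v)) (g' (vec_snd v))"
    by (simp add: f'(2) g'(2) vec_pair_smult)
  ultimately show "\<exists>h'. ((\<lambda>w. vec_pair (f (vec_fst w)) (g (vec_snd w))) has_derivative h') (at w within {w. vec_fst w \<in> S \<and> vec_snd w \<in> T})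
      \<and> (\<forall>c v. h' (c *s v) = c *s h' v)" unfolding R_def by blast
qed

lemma charted_product:
  fixes M :: "('a, 'm::finite) manifold" and N :: "('b, 'n::finite) manifold"
  assumes M: "charted M" and N: "charted N"
  shows "charted (product_manifold M N)"
proof -
  let ?X = "product_manifold M N"
  have cover: "(\<Union>(W, \<Phi>)\<in>atlas ?X. W) = points ?X"
  proof
    show "(\<Union>(W, \<Phi>)\<in>atlas ?X. W) \<subseteq> points ?X"
    proof
      fix p assume "p \<in> (\<Union>(W, \<Phi>)\<in>atlas ?X. W)"
      then obtain W \<Phi> where "(W, \<Phi>) \<in> atlas ?X" "p \<in> W" by auto
      then show "p \<in> points ?X" unfolding product_atlas using chart_subset[OF M] chart_subset[OF N] by fastforce
    qed
    show "points ?X \<subseteq> (\<Union>(W, \<Phi>)\<in>atlas ?X. W)"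
    proof
      fix p assume "p \<in> points ?X"
      then obtain x y where p: "p = (x, y)" "x \<in> points M" "y \<in> points N" by (cases p) auto
      obtain U \<phi> where U: "(U, \<phi>) \<in> atlas M" "x \<in> U" using chart_exists[OF M p(2)] .
      obtain V \<psi> where V: "(V, \<psi>) \<in> atlas N" "y \<in> V" using chart_exists[OF N p(3)] .
      have "(U \<times> V, \<lambda>(x, y). vec_pair (\<phi> x) (\<psi> y)) \<in> atlas ?X" by (rule product_atlasI[OF U(1) V(1)])
      then show "p \<in> (\<Union>(W, \<Phi>)\<in>atlas ?X. W)" by (rule UN_I) (use p U V in simp)
    qed
  qed
  have charts: "openin (mtop ?X) W \<and> open (\<Phi> ` W) \<and> homeomorphic_map (subtopology (mtop ?X) W) (top_of_set (\<Phi> ` W)) \<Phi>"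
    if c: "(W, \<Phi>) \<in> atlas ?X" for W \<Phi>
  proof -
    obtain U \<phi> V \<psi> where U: "(U, \<phi>) \<in> atlas M" and V: "(V, \<psi>) \<in> atlas N" and W: "W = U \<times> V"
      and \<Phi>: "\<Phi> = (\<lambda>(x, y). vec_pair (\<phi> x) (\<psi> y))" using c unfolding product_atlas by blast
    have im: "\<Phi> ` W = {w. vec_fst w \<in> \<phi> ` U \<and> vec_snd w \<in> \<psi> ` V}" unfolding \<Phi> W by (rule product_chart_image)
    have 1: "openin (mtop ?X) W" unfolding W mtop_product using chart_openin[OF M U] chart_openin[OF N V] by (simp add: openin_prod_Times_iff)
    have "open (vec_fst -` (\<phi> ` U) :: (complex ^ ('m + 'n)) set)" "open (vec_snd -` (\<psi> ` V) :: (complex ^ ('m + 'n)) set)"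
      using chart_open_image[OF M U] chart_open_image[OF N V] continuous_vec_fst continuous_vec_snd by (auto intro: open_vimage)
    then have 2: "open (\<Phi> ` W)" unfolding im using open_Int[of "vec_fst -` (\<phi> ` U)" "vec_snd -` (\<psi> ` V)"]
      by (simp add: vimage_def Collect_conj_eq)
    obtain \<phi>' where \<phi>': "homeomorphic_maps (subtopology (mtop M) U) (top_of_set (\<phi> ` U)) \<phi> \<phi>'"
      using chart_homeomorphic[OF M U] homeomorphic_map_maps by blast
    obtain \<psi>' where \<psi>': "homeomorphic_maps (subtopology (mtop N) V) (top_of_set (\<psi> ` V)) \<psi> \<psi>'"
      using chart_homeomorphic[OF N V] homeomorphic_map_maps by blast
    have tU: "topspace (subtopology (mtop M) U) = U" using chart_subset[OF M U] by (simp add: topspace_subtopology Int_absorb1)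
    have tV: "topspace (subtopology (mtop N) V) = V" using chart_subset[OF N V] by (simp add: topspace_subtopology Int_absorb1)
    have sub: "subtopology (mtop ?X) W = prod_topology (subtopology (mtop M) U) (subtopology (mtop N) V)"
      unfolding W mtop_product by (simp add: subtopology_Times)
    have "homeomorphic_maps (subtopology (mtop ?X) W) (top_of_set (\<Phi> ` W)) \<Phi> (\<lambda>w. (\<phi>' (vec_fst w), \<psi>' (vec_snd w)))"
      unfolding homeomorphic_maps_def
    proof (intro conjI ballI)
      have c\<phi>: "continuous_map (subtopology (mtop M) U) euclidean \<phi>" and c\<psi>: "continuous_map (subtopology (mtop N) V) euclidean \<psi>"
        using \<phi>' \<psi>' by (auto simp: homeomorphic_maps_def continuous_map_in_subtopology)
      have "continuous_map (subtopology (mtop ?X) W) (prod_topology euclidean euclidean) (\<lambda>p. (\<phi> (fst p), \<psi> (snd p)))"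
        unfolding sub continuous_map_pairwise o_def fst_conv snd_conv
        using continuous_map_compose[OF continuous_map_fst c\<phi>] continuous_map_compose[OF continuous_map_snd c\<psi>]
        by (auto simp: o_def)
      then have "continuous_map (subtopology (mtop ?X) W) euclidean (\<lambda>p. (\<phi> (fst p), \<psi> (snd p)))"
        by (simp add: euclidean_product_topology)
      moreover have "continuous_map euclidean euclidean (\<lambda>p. vec_pair (fst p) (snd p))" using continuous_vec_pair by simp
      ultimately have "continuous_map (subtopology (mtop ?X) W) euclidean ((\<lambda>p. vec_pair (fst p) (snd p)) \<circ> (\<lambda>p. (\<phi> (fst p), \<psi> (snd p))))"
        by (rule continuous_map_compose)
      then have "continuous_map (subtopology (mtop ?X) W) euclidean \<Phi>" by (simp add: o_def \<Phi> case_prod_beta')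
      then show "continuous_map (subtopology (mtop ?X) W) (top_of_set (\<Phi> ` W)) \<Phi>"
        using 1 by (auto simp: continuous_map_in_subtopology topspace_subtopology)
      have e1: "continuous_map (top_of_set (\<Phi> ` W)) (top_of_set (\<phi> ` U)) vec_fst"
        using continuous_vec_fst im by (auto simp: continuous_map_in_subtopology)
      have e2: "continuous_map (top_of_set (\<Phi> ` W)) (top_of_set (\<psi> ` V)) vec_snd"
        using continuous_vec_snd im by (auto simp: continuous_map_in_subtopology)
      have i1: "continuous_map (top_of_set (\<phi> ` U)) (subtopology (mtop M) U) \<phi>'"
        and i2: "continuous_map (top_of_set (\<psi> ` V)) (subtopology (mtop N) V) \<psi>'"
        using \<phi>' \<psi>' unfolding homeomorphic_maps_def by blast+
      show "continuous_map (top_of_set (\<Phi> ` W)) (subtopology (mtop ?X) W) (\<lambda>w. (\<phi>' (vec_fst w), \<psi>' (vec_snd w)))"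
        unfolding sub continuous_map_pairwise o_def fst_conv snd_conv
        using continuous_map_compose[OF e1 i1] continuous_map_compose[OF e2 i2] by (auto simp: o_def)
      show "(\<lambda>w. (\<phi>' (vec_fst w), \<psi>' (vec_snd w))) (\<Phi> p) = p" if "p \<in> topspace (subtopology (mtop ?X) W)" for p
        using that \<phi>' \<psi>' tU tV unfolding sub homeomorphic_maps_def \<Phi> by auto
      show "\<Phi> (\<phi>' (vec_fst w), \<psi>' (vec_snd w)) = w" if "w \<in> topspace (top_of_set (\<Phi> ` W))" for w
      proof -
        have "vec_fst w \<in> \<phi> ` U" "vec_snd w \<in> \<psi> ` V" using that im by auto
        then have "\<phi> (\<phi>' (vec_fst w)) = vec_fst w" "\<psi> (\<psi>' (vec_snd w)) = vec_snd w"
          using \<phi>' \<psi>' unfolding homeomorphic_maps_def by auto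
        then show ?thesis by (simp add: \<Phi>)
      qed
    qed
    then show ?thesis using 1 2 homeomorphic_map_maps by blast
  qed
  have trans: "(\<Psi> \<circ> inv_into W \<Phi>) holomorphic_map_on \<Phi> ` (W \<inter> W')"
    if c: "(W, \<Phi>) \<in> atlas ?X" and c': "(W', \<Psi>) \<in> atlas ?X" for W \<Phi> W' \<Psi>
  proof -
    obtain U \<phi> V \<psi> where U: "(U, \<phi>) \<in> atlas M" and V: "(V, \<psi>) \<in> atlas N" and W: "W = U \<times> V"
      and \<Phi>: "\<Phi> = (\<lambda>(x, y). vec_pair (\<phi> x) (\<psi> y))" using c unfolding product_atlas by blast
    obtain U' \<phi>' V' \<psi>' where U': "(U', \<phi>') \<in> atlas M" and V': "(V', \<psi>') \<in> atlas N" and W': "W' = U' \<times> V'"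
      and \<Psi>: "\<Psi> = (\<lambda>(x, y). vec_pair (\<phi>' x) (\<psi>' y))" using c' unfolding product_atlas by blast
    have im: "\<Phi> ` (W \<inter> W') = {w. vec_fst w \<in> \<phi> ` (U \<inter> U') \<and> vec_snd w \<in> \<psi> ` (V \<inter> V')}"
      unfolding W W' \<Phi> Times_Int_Times by (rule product_chart_image)
    have eq: "(\<Psi> \<circ> inv_into W \<Phi>) w = vec_pair ((\<phi>' \<circ> inv_into U \<phi>) (vec_fst w)) ((\<psi>' \<circ> inv_into V \<psi>) (vec_snd w))"
      if "w \<in> \<Phi> ` (W \<inter> W')" for w
    proof -
      have "vec_fst w \<in> \<phi> ` U" "vec_snd w \<in> \<psi> ` V" using that im by auto
      then show ?thesis using product_chart_inv[OF chart_inj[OF M U] chart_inj[OF N V]] by (simp add: W \<Phi> \<Psi>)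
    qed
    have "(\<lambda>w. vec_pair ((\<phi>' \<circ> inv_into U \<phi>) (vec_fst w)) ((\<psi>' \<circ> inv_into V \<psi>) (vec_snd w))) holomorphic_map_on \<Phi> ` (W \<inter> W')"
      unfolding im by (rule holomorphic_map_vec_pair[OF chart_transition[OF M U U'] chart_transition[OF N V V']])
    then have h: "\<exists>f'. ((\<lambda>w. vec_pair ((\<phi>' \<circ> inv_into U \<phi>) (vec_fst w)) ((\<psi>' \<circ> inv_into V \<psi>) (vec_snd w))) has_derivative f') (at w within \<Phi> ` (W \<inter> W'))
        \<and> (\<forall>c v. f' (c *s v) = c *s f' v)" if "w \<in> \<Phi> ` (W \<inter> W')" for w
      using that unfolding holomorphic_map_on_def by blast
    show ?thesis
      unfolding holomorphic_map_on_def
    proof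
      fix w assume w: "w \<in> \<Phi> ` (W \<inter> W')"
      from h[OF w] obtain f' where f': "((\<lambda>w. vec_pair ((\<phi>' \<circ> inv_into U \<phi>) (vec_fst w)) ((\<psi>' \<circ> inv_into V \<psi>) (vec_snd w))) has_derivative f') (at w within \<Phi> ` (W \<inter> W'))"
        "\<forall>c v. f' (c *s v) = c *s f' v" by (elim exE conjE)
      have "((\<Psi> \<circ> inv_into W \<Phi>) has_derivative f') (at w within \<Phi> ` (W \<inter> W'))"
        by (rule has_derivative_transform[OF w eq f'(1)])
      then show "\<exists>f'. ((\<Psi> \<circ> inv_into W \<Phi>) has_derivative f') (at w within \<Phi> ` (W \<inter> W')) \<and> (\<forall>c v. f' (c *s v) = c *s f' v)"
        using f'(2) by (intro exI[of _ f'] conjI)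
    qed
  qed
  show ?thesis
    unfolding charted_def
  proof (intro conjI)
    show "(\<Union>(W, \<Phi>)\<in>atlas ?X. W) = points ?X" by (rule cover)
    show "\<forall>(W, \<Phi>)\<in>atlas ?X. openin (mtop ?X) W \<and> open (\<Phi> ` W) \<and>
        homeomorphic_map (subtopology (mtop ?X) W) (top_of_set (\<Phi> ` W)) \<Phi>"
    proof
      fix c assume "c \<in> atlas ?X"
      then show "case c of (W, \<Phi>) \<Rightarrow> openin (mtop ?X) W \<and> open (\<Phi> ` W) \<and>
        homeomorphic_map (subtopology (mtop ?X) W) (top_of_set (\<Phi> ` W)) \<Phi>"
        using charts[of "fst c" "snd c"] by (cases c) simp
    qed
    show "\<forall>(W, \<Phi>)\<in>atlas ?X. \<forall>(W', \<Psi>)\<in>atlas ?X. (\<Psi> \<circ> inv_into W \<Phi>) holomorphic_map_on \<Phi> ` (W \<inter> W')"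
    proof (intro ballI)
      fix c assume c: "c \<in> atlas ?X"
      show "case c of (W, \<Phi>) \<Rightarrow> \<forall>(W', \<Psi>)\<in>atlas ?X. (\<Psi> \<circ> inv_into W \<Phi>) holomorphic_map_on \<Phi> ` (W \<inter> W')"
      proof (cases c)
        case (Pair W \<Phi>)
        have "case d of (W', \<Psi>) \<Rightarrow> (\<Psi> \<circ> inv_into W \<Phi>) holomorphic_map_on \<Phi> ` (W \<inter> W')" if "d \<in> atlas ?X" for d
          using trans[of W \<Phi> "fst d" "snd d"] c that Pair by (cases d) simp
        then show ?thesis unfolding Pair by simp
      qed
    qed
  qed
qed

lemma holomorphic_into_fst:
  fixes M :: "('a, 'm::finite) manifold" and N :: "('b, 'n::finite) manifold"
  assumes M: "charted M" "charted N" and f: "holomorphic_into (product_manifold M N) f S" "open S"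
  shows "holomorphic_into M (\<lambda>z. fst (f z)) S" "holomorphic_into N (\<lambda>z. snd (f z)) S"
proof -
  have X: "charted (product_manifold M N)" using charted_product M by blast
  have c: "continuous_map (top_of_set S) (prod_topology (mtop M) (mtop N)) f" using f(1) by (simp add: holomorphic_into_def)
  have c1: "continuous_map (top_of_set S) (mtop M) (\<lambda>z. fst (f z))" and c2: "continuous_map (top_of_set S) (mtop N) (\<lambda>z. snd (f z))"
    using c unfolding continuous_map_pairwise o_def by auto
  have loc: "\<exists>r>0. ball z r \<subseteq> S \<and> (\<forall>i. (\<lambda>w. \<phi> (fst (f w)) $ i) holomorphic_on ball z r) \<and> (\<forall>j. (\<lambda>w. \<psi> (snd (f w)) $ j) holomorphic_on ball z r)"
    if U: "(U, \<phi>) \<in> atlas M" and V: "(V, \<psi>) \<in> atlas N" and z: "z \<in> S" "fst (f z) \<in> U" "snd (f z) \<in> V"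
    for U V z and \<phi> :: "'a \<Rightarrow> complex ^ 'm" and \<psi> :: "'b \<Rightarrow> complex ^ 'n"
  proof -
    define \<Phi> where "\<Phi> = (\<lambda>(x, y). vec_pair (\<phi> x) (\<psi> y))"
    have W: "(U \<times> V, \<Phi>) \<in> atlas (product_manifold M N)" unfolding \<Phi>_def by (rule product_atlasI[OF U V])
    have fz: "f z \<in> U \<times> V" using z by (auto simp: mem_Times_iff)
    obtain r where r: "r > 0" "ball z r \<subseteq> S" "\<And>i. (\<lambda>w. \<Phi> (f w) $ i) holomorphic_on ball z r"
      using holomorphic_into_chart_ball[OF X f W z(1) fz] by metis
    have "(\<lambda>w. \<phi> (fst (f w)) $ i) holomorphic_on ball z r" for i using r(3)[of "Inl i"] by (simp add: \<Phi>_def case_prod_beta)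
    moreover have "(\<lambda>w. \<psi> (snd (f w)) $ j) holomorphic_on ball z r" for j using r(3)[of "Inr j"] by (simp add: \<Phi>_def case_prod_beta)
    ultimately show ?thesis using r(1,2) by blast
  qed
  have pts: "fst (f z) \<in> points M" "snd (f z) \<in> points N" if "z \<in> S" for z
    using holomorphic_into_points[OF f(1) that] by (auto simp: mem_Times_iff)
  show "holomorphic_into M (\<lambda>z. fst (f z)) S"
    unfolding holomorphic_into_def
  proof (intro conjI c1, clarify)
    fix U \<phi> i assume U: "(U, \<phi>) \<in> atlas M"
    show "(\<lambda>z. \<phi> (fst (f z)) $ i) holomorphic_on {z \<in> S. fst (f z) \<in> U}"
      unfolding holomorphic_on_def
    proof
      fix z assume z: "z \<in> {z \<in> S. fst (f z) \<in> U}"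
      obtain V \<psi> where V: "(V, \<psi>) \<in> atlas N" "snd (f z) \<in> V" using chart_exists[OF M(2) pts(2)] z by blast
      obtain r where "r > 0" "(\<lambda>w. \<phi> (fst (f w)) $ i) holomorphic_on ball z r" using loc[OF U V(1) _ _ V(2)] z by blast
      then have "(\<lambda>w. \<phi> (fst (f w)) $ i) field_differentiable at z" by (simp add: holomorphic_on_imp_differentiable_at)
      then show "(\<lambda>w. \<phi> (fst (f w)) $ i) field_differentiable at z within {z \<in> S. fst (f z) \<in> U}" by (rule field_differentiable_at_within)
    qed
  qed
  show "holomorphic_into N (\<lambda>z. snd (f z)) S"
    unfolding holomorphic_into_def
  proof (intro conjI c2, clarify)
    fix V \<psi> i assume V: "(V, \<psi>) \<in> atlas N"
    show "(\<lambda>z. \<psi> (snd (f z)) $ i) holomorphic_on {z \<in> S. snd (f z) \<in> V}"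
      unfolding holomorphic_on_def
    proof
      fix z assume z: "z \<in> {z \<in> S. snd (f z) \<in> V}"
      obtain U \<phi> where U: "(U, \<phi>) \<in> atlas M" "fst (f z) \<in> U" using chart_exists[OF M(1) pts(1)] z by blast
      obtain r where "r > 0" "(\<lambda>w. \<psi> (snd (f w)) $ i) holomorphic_on ball z r" using loc[OF U(1) V _ U(2)] z by blast
      then have "(\<lambda>w. \<psi> (snd (f w)) $ i) field_differentiable at z" by (simp add: holomorphic_on_imp_differentiable_at)
      then show "(\<lambda>w. \<psi> (snd (f w)) $ i) field_differentiable at z within {z \<in> S. snd (f z) \<in> V}" by (rule field_differentiable_at_within)
    qed
  qed
qed

lemma holomorphic_into_Pair:
  fixes M :: "('a, 'm::finite) manifold" and N :: "('b, 'n::finite) manifold"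
  assumes f: "holomorphic_into M f S" and g: "holomorphic_into N g S"
  shows "holomorphic_into (product_manifold M N) (\<lambda>z. (f z, g z)) S"
  unfolding holomorphic_into_def
proof (intro conjI)
  show "continuous_map (top_of_set S) (mtop (product_manifold M N)) (\<lambda>z. (f z, g z))"
    using f g unfolding mtop_product continuous_map_pairwise holomorphic_into_def by (auto simp: o_def)
  show "\<forall>(W, \<Phi>)\<in>atlas (product_manifold M N). \<forall>i. (\<lambda>z. \<Phi> (f z, g z) $ i) holomorphic_on {z \<in> S. (f z, g z) \<in> W}"
  proof (clarify)
    fix W \<Phi> i assume "(W, \<Phi>) \<in> atlas (product_manifold M N)"
    then obtain U \<phi> V \<psi> where U: "(U, \<phi>) \<in> atlas M" and V: "(V, \<psi>) \<in> atlas N" and W: "W = U \<times> V"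
      and \<Phi>: "\<Phi> = (\<lambda>(x, y). vec_pair (\<phi> x) (\<psi> y))" unfolding product_atlas by blast
    have h1: "(\<lambda>z. \<phi> (f z) $ j) holomorphic_on {z \<in> S. f z \<in> U}" for j using f U by (auto simp: holomorphic_into_def)
    have h2: "(\<lambda>z. \<psi> (g z) $ j) holomorphic_on {z \<in> S. g z \<in> V}" for j using g V by (auto simp: holomorphic_into_def)
    show "(\<lambda>z. \<Phi> (f z, g z) $ i) holomorphic_on {z \<in> S. (f z, g z) \<in> W}"
    proof (cases i)
      case (Inl j)
      have "(\<lambda>z. \<phi> (f z) $ j) holomorphic_on {z \<in> S. (f z, g z) \<in> W}" using h1 by (rule holomorphic_on_subset) (auto simp: W)
      then show ?thesis by (simp add: \<Phi> Inl)
    next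
      case (Inr j)
      have "(\<lambda>z. \<psi> (g z) $ j) holomorphic_on {z \<in> S. (f z, g z) \<in> W}" using h2 by (rule holomorphic_on_subset) (auto simp: W)
      then show ?thesis by (simp add: \<Phi> Inr)
    qed
  qed
qed

lemma contact_at_least_fst:
  fixes M :: "('a, 'm::finite) manifold" and N :: "('b, 'n::finite) manifold"
  assumes c: "contact_at_least (product_manifold M N) f z k"
  shows "contact_at_least M (\<lambda>w. fst (f w)) z k" "contact_at_least N (\<lambda>w. snd (f w)) z k"
proof -
  obtain W \<Phi> C where W: "(W, \<Phi>) \<in> atlas (product_manifold M N)" "f z \<in> W"
    and C: "\<forall>\<^sub>F w in nhds z. f w \<in> W \<and> norm (\<Phi> (f w) - \<Phi> (f z)) \<le> C * cmod (w - z) ^ k"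
    using c by (auto simp: contact_at_least_def)
  obtain U \<phi> V \<psi> where U: "(U, \<phi>) \<in> atlas M" and V: "(V, \<psi>) \<in> atlas N" and W': "W = U \<times> V"
    and \<Phi>: "\<Phi> = (\<lambda>(x, y). vec_pair (\<phi> x) (\<psi> y))" using W(1) unfolding product_atlas by blast
  have d: "\<Phi> (f w) - \<Phi> (f z) = vec_pair (\<phi> (fst (f w)) - \<phi> (fst (f z))) (\<psi> (snd (f w)) - \<psi> (snd (f z)))" for w
    by (simp add: \<Phi> case_prod_beta vec_pair_diff)
  have "\<forall>\<^sub>F w in nhds z. fst (f w) \<in> U \<and> norm (\<phi> (fst (f w)) - \<phi> (fst (f z))) \<le> C * cmod (w - z) ^ k"
    using C by eventually_elim (use norm_vec_pair_bounds(1) in \<open>auto simp: d W' mem_Times_iff intro: order_trans\<close>)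
  moreover have "fst (f z) \<in> U" using W(2) W' by auto
  ultimately show "contact_at_least M (\<lambda>w. fst (f w)) z k" using U unfolding contact_at_least_def by blast
  have "\<forall>\<^sub>F w in nhds z. snd (f w) \<in> V \<and> norm (\<psi> (snd (f w)) - \<psi> (snd (f z))) \<le> C * cmod (w - z) ^ k"
    using C by eventually_elim (use norm_vec_pair_bounds(2) in \<open>auto simp: d W' mem_Times_iff intro: order_trans\<close>)
  moreover have "snd (f z) \<in> V" using W(2) W' by auto
  ultimately show "contact_at_least N (\<lambda>w. snd (f w)) z k" using V unfolding contact_at_least_def by blast
qed

lemma contact_at_least_Pair:
  fixes M :: "('a, 'm::finite) manifold" and N :: "('b, 'n::finite) manifold"
  assumes f: "contact_at_least M f z k" and g: "contact_at_least N g z k"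
  shows "contact_at_least (product_manifold M N) (\<lambda>w. (f w, g w)) z k"
proof -
  obtain U \<phi> C where U: "(U, \<phi>) \<in> atlas M" "f z \<in> U"
    and C: "\<forall>\<^sub>F w in nhds z. f w \<in> U \<and> norm (\<phi> (f w) - \<phi> (f z)) \<le> C * cmod (w - z) ^ k"
    using f by (auto simp: contact_at_least_def)
  obtain V \<psi> D where V: "(V, \<psi>) \<in> atlas N" "g z \<in> V"
    and D: "\<forall>\<^sub>F w in nhds z. g w \<in> V \<and> norm (\<psi> (g w) - \<psi> (g z)) \<le> D * cmod (w - z) ^ k"
    using g by (auto simp: contact_at_least_def)
  define \<Phi> where "\<Phi> = (\<lambda>(x, y). vec_pair (\<phi> x) (\<psi> y))"
  have W: "(U \<times> V, \<Phi>) \<in> atlas (product_manifold M N)" unfolding \<Phi>_def by (rule product_atlasI[OF U(1) V(1)])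
  have ev: "\<forall>\<^sub>F w in nhds z. (f w, g w) \<in> U \<times> V \<and> norm (\<Phi> (f w, g w) - \<Phi> (f z, g z)) \<le> (C + D) * cmod (w - z) ^ k"
    using C D
  proof eventually_elim
    case (elim w)
    have "norm (\<Phi> (f w, g w) - \<Phi> (f z, g z)) \<le> norm (\<phi> (f w) - \<phi> (f z)) + norm (\<psi> (g w) - \<psi> (g z))"
      unfolding \<Phi>_def case_prod_conv vec_pair_diff by (rule norm_vec_pair_bounds(3))
    also have "\<dots> \<le> (C + D) * cmod (w - z) ^ k" using elim by (simp add: distrib_right)
    finally show ?case using elim by simp
  qed
  have "(f z, g z) \<in> U \<times> V" using U V by simp
  then show ?thesis
    unfolding contact_at_least_def by (intro bexI[OF _ W]) (use ev in blast)
qed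

text \<open>The image of a disc under \<open>\<pi>\<close> has at least the same hits with at least the same orders of contact, and
every hit contributes a nonpositive term.\<close>

lemma lelong_envelope_projection:
  fixes M :: "('a, 'm::finite) manifold" and N :: "('b, 'n::finite) manifold"
  assumes M: "charted M" and N: "charted N"
    and hol: "\<And>f S. open S \<Longrightarrow> holomorphic_into M f S \<Longrightarrow> holomorphic_into N (\<lambda>z. \<pi> (f z)) S"
    and contact: "\<And>f z k. contact_at_least M f z k \<Longrightarrow> contact_at_least N (\<lambda>z. \<pi> (f z)) z k"
    and AB: "\<And>a. a \<in> A \<Longrightarrow> \<pi> a \<in> B"
  shows "lelong_envelope N (indicator B) (\<pi> x) \<le> lelong_envelope M (indicator A) x"
  unfolding lelong_envelope_def[of M]
proof (rule INF_greatest)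
  fix f assume "f \<in> {f \<in> closed_discs M. f 0 = x}"
  then have f: "f \<in> closed_discs M" "f 0 = x" by auto
  define g where "g z = \<pi> (f z)" for z
  obtain f' S where f': "open S" "cball 0 1 \<subseteq> S" "holomorphic_into M f' S" "\<And>z. z \<in> ball 0 1 \<Longrightarrow> f z = f' z"
    using f(1) by (auto simp: closed_discs_def)
  have "g \<in> closed_discs N"
    unfolding closed_discs_def mem_Collect_eq
    by (rule exI[of _ "\<lambda>z. \<pi> (f' z)"], rule exI[of _ S]) (use f' hol[OF f'(1,3)] in \<open>auto simp: g_def\<close>)
  then have "g \<in> {g \<in> closed_discs N. g 0 = \<pi> x}" using f(2) by (simp add: g_def)
  then have "lelong_envelope N (indicator B) (\<pi> x) \<le> lelong_functional N (indicator B) g"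
    unfolding lelong_envelope_def by (rule INF_lower)
  also have "\<dots> \<le> lelong_functional M (indicator A) f"
    unfolding lelong_functional_def
  proof (rule INF_mono)
    fix F assume F: "F \<in> {F. finite F \<and> F \<subseteq> ball (0::complex) 1}"
    have fh: "holomorphic_into M f (ball 0 1)" using closed_discs_holomorphic_into[OF f(1)] .
    have gh: "holomorphic_into N g (ball 0 1)" using hol[OF open_ball fh] unfolding g_def .
    have "(\<Sum>z\<in>F. lelong_term N (indicator B) g z) \<le> (\<Sum>z\<in>F. lelong_term M (indicator A) f z)"
    proof (rule sum_mono)
      fix z assume "z \<in> F"
      then have z: "z \<in> ball 0 1" using F by auto
      show "lelong_term N (indicator B) g z \<le> lelong_term M (indicator A) f z"
      proof (cases "f z \<in> A")
        case False
        then show ?thesis using lelong_term_nonpos[OF N gh z, of B] by (simp add: lelong_term_def)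
      next
        case True
        then have gB: "g z \<in> B" using AB by (simp add: g_def)
        show ?thesis
        proof (cases "z = 0 \<or> g constant_on ball 0 1")
          case True
          have "lelong_term N (indicator B) g z = -\<infinity>"
          proof (cases "z = 0")
            case True then show ?thesis using lelong_term_at_0[OF N gh] gB by simp
          next
            case False
            then show ?thesis using \<open>z = 0 \<or> g constant_on ball 0 1\<close> gB z
              by (simp add: lelong_term_def multiplicity_at_constant log_norm_def one_ereal_def[symmetric])
          qed
          then show ?thesis by simp
        next
          case False
          have nc: "\<not> f constant_on ball 0 1"
          proof
            assume "f constant_on ball 0 1"
            then have "g constant_on ball 0 1" unfolding constant_on_def g_def by metis
            then show False using False by blast
          qed
          obtain k where k: "k > 0" "contact_at_least M f z k" "lelong_term M (indicator A) f z = ereal (real k * ln (cmod z))"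
            using lelong_term_nonconstant[OF M fh nc z _ \<open>f z \<in> A\<close>] False by metis
          have "contact_at_least N g z k" using contact[OF k(2)] unfolding g_def .
          then show ?thesis using lelong_term_le[OF N gh z _ gB _ k(1)] False k(3) by simp
        qed
      qed
    qed
    then show "\<exists>F'\<in>{F. finite F \<and> F \<subseteq> ball 0 1}. (\<Sum>z\<in>F'. lelong_term N (indicator B) g z) \<le> (\<Sum>z\<in>F. lelong_term M (indicator A) f z)"
      using F by blast
  qed
  finally show "lelong_envelope N (indicator B) (\<pi> x) \<le> lelong_functional M (indicator A) f" .
qed

lemma ball_beyond_closed_disc:
  assumes "open S" "cball 0 1 \<subseteq> (S :: complex set)"
  obtains \<eta> where "\<eta> > 0" "ball 0 (1 + \<eta>) \<subseteq> S"
proof -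
  obtain e where e: "e > 0" "{y. infdist y (cball 0 1) \<le> e} \<subseteq> S"
    using compact_in_open_separated[of "cball (0::complex) 1" S] assms by auto
  have "ball 0 (1 + e) \<subseteq> S"
  proof
    fix y :: complex assume "y \<in> ball 0 (1 + e)"
    then have y: "norm y < 1 + e" by simp
    show "y \<in> S"
    proof (cases "norm y \<le> 1")
      case True then show ?thesis using assms(2) by auto
    next
      case False
      have "y - y / of_real (norm y) = of_real (1 - 1 / norm y) * y" by (simp add: algebra_simps)
      then have "dist y (y / of_real (norm y)) = \<bar>1 - 1 / norm y\<bar> * norm y" by (metis dist_norm norm_mult norm_of_real)
      also have "\<dots> = norm y - 1" using False by (auto simp: abs_if field_simps)
      finally have "dist y (y / of_real (norm y)) \<le> e" using y by simp
      moreover have "y / of_real (norm y) \<in> cball 0 1" using False by (auto simp: norm_divide)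
      ultimately have "infdist y (cball 0 1) \<le> e" using infdist_le order_trans by blast
      then show ?thesis using e(2) by blast
    qed
  qed
  then show thesis using that e(1) by blast
qed

lemma sum_log_eq_prod:
  assumes "finite F" "F \<subseteq> ball 0 1 - {0::complex}"
  shows "exp (\<Sum>a\<in>F. real (k a) * ln (cmod a)) = (\<Prod>a\<in>F. cmod a ^ k a)"
  unfolding exp_sum[OF assms(1)]
proof (rule prod.cong[OF refl])
  fix a assume "a \<in> F"
  then have "cmod a > 0" using assms(2) by auto
  then show "exp (real (k a) * ln (cmod a)) = cmod a ^ k a" by (simp add: exp_of_nat_mult)
qed

text \<open>For the upper bound, near-optimal discs in the two factors are composed with the two maps that
\<open>simultaneous_hits\<close> provides for their hits. If one of the points lies in its set, then the constant disc
in this factor can be paired with every disc in the other one.\<close>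

theorem lelong_envelope_product:
  fixes M :: "('a, 'm::finite) manifold" and N :: "('b, 'n::finite) manifold"
  assumes M: "charted M" and N: "charted N" and x: "x \<in> points M" "y \<in> points N"
  shows "lelong_envelope (product_manifold M N) (indicator (A \<times> B)) (x, y) =
    max (lelong_envelope M (indicator A) x) (lelong_envelope N (indicator B) y)"
    (is "?E = max ?E1 ?E2")
proof (rule antisym)
  let ?X = "product_manifold M N"
  have X: "charted ?X" by (rule charted_product[OF M N])
  have xy: "(x, y) \<in> points ?X" using x by simp
  show "max ?E1 ?E2 \<le> ?E"
  proof (rule max.boundedI)
    show "?E1 \<le> ?E"
      using lelong_envelope_projection[OF X M, of fst "A \<times> B" A "(x, y)"] holomorphic_into_fst(1)[OF M N] contact_at_least_fst(1) by force
    show "?E2 \<le> ?E"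
      using lelong_envelope_projection[OF X N, of snd "A \<times> B" B "(x, y)"] holomorphic_into_fst(2)[OF M N] contact_at_least_fst(2) by force
  qed
  have key: "?E \<le> ereal \<beta>" if lt: "max ?E1 ?E2 < ereal \<beta>" "\<beta> \<le> 0" for \<beta>
  proof -
    consider "x \<in> A" "y \<in> B" | "x \<in> A" "y \<notin> B" | "x \<notin> A" "y \<in> B" | "x \<notin> A" "y \<notin> B" by blast
    then show ?thesis
    proof cases
      case 1
      then show ?thesis using lelong_envelope_on_set[OF X xy, of "A \<times> B"] by simp
    next
      case 2
      show ?thesis
      proof (rule lelong_envelope_less_hits[OF N 2(2) _ lt(2)])
      show "lelong_envelope N (indicator B) y < ereal \<beta>" using lt(1) by simp
      fix g S F k assume g: "holomorphic_into N g S" "open S" "cball 0 1 \<subseteq> S" "g 0 = y"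
        and F: "finite F" "F \<subseteq> ball 0 1 - {0}" "\<And>z. z \<in> F \<Longrightarrow> g z \<in> B \<and> k z > 0 \<and> contact_at_least N g z (k z)"
        and s: "(\<Sum>z\<in>F. real (k z) * ln (cmod z)) < \<beta>"
      have "?E \<le> ereal (\<Sum>z\<in>F. real (k z) * ln (cmod z))"
      proof (rule lelong_envelope_le_hits[OF X holomorphic_into_Pair[OF holomorphic_into_const[OF x(1)] g(1)] g(2,3) _ F(1,2)])
        fix z assume z: "z \<in> F"
        have "contact_at_least ?X (\<lambda>w. (x, g w)) z (k z)"
          using F(3)[OF z] by (intro contact_at_least_Pair contact_at_least_const[OF M x(1)]) blast
        then show "(x, g z) \<in> A \<times> B \<and> 0 < k z \<and> contact_at_least ?X (\<lambda>w. (x, g w)) z (k z)" using F(3)[OF z] 2(1) by blast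
      qed (use g(4) in simp)
      then show ?thesis using s by (meson ereal_less_eq(3) less_imp_le order_trans)
      qed
    next
      case 3
      show ?thesis
      proof (rule lelong_envelope_less_hits[OF M 3(1) _ lt(2)])
      show "lelong_envelope M (indicator A) x < ereal \<beta>" using lt(1) by simp
      fix g S F k assume g: "holomorphic_into M g S" "open S" "cball 0 1 \<subseteq> S" "g 0 = x"
        and F: "finite F" "F \<subseteq> ball 0 1 - {0}" "\<And>z. z \<in> F \<Longrightarrow> g z \<in> A \<and> k z > 0 \<and> contact_at_least M g z (k z)"
        and s: "(\<Sum>z\<in>F. real (k z) * ln (cmod z)) < \<beta>"
      have "?E \<le> ereal (\<Sum>z\<in>F. real (k z) * ln (cmod z))"
      proof (rule lelong_envelope_le_hits[OF X holomorphic_into_Pair[OF g(1) holomorphic_into_const[OF x(2)]] g(2,3) _ F(1,2)])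
        fix z assume z: "z \<in> F"
        have "contact_at_least ?X (\<lambda>w. (g w, y)) z (k z)"
          using F(3)[OF z] by (intro contact_at_least_Pair contact_at_least_const[OF N x(2)]) blast
        then show "(g z, y) \<in> A \<times> B \<and> 0 < k z \<and> contact_at_least ?X (\<lambda>w. (g w, y)) z (k z)" using F(3)[OF z] 3(2) by blast
      qed (use g(4) in simp)
      then show ?thesis using s by (meson ereal_less_eq(3) less_imp_le order_trans)
      qed
    next
      case 4
      show ?thesis
      proof (rule lelong_envelope_less_hits[OF M 4(1) _ lt(2)])
      show "lelong_envelope M (indicator A) x < ereal \<beta>" using lt(1) by simp
      fix g1 S1 F1 k1
      assume g1: "holomorphic_into M g1 S1" "open S1" "cball 0 1 \<subseteq> S1" "g1 0 = x"
        and F1: "finite F1" "F1 \<subseteq> ball 0 1 - {0}" "\<And>z. z \<in> F1 \<Longrightarrow> g1 z \<in> A \<and> k1 z > 0 \<and> contact_at_least M g1 z (k1 z)"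
        and s1: "(\<Sum>z\<in>F1. real (k1 z) * ln (cmod z)) < \<beta>"
      show ?thesis
      proof (rule lelong_envelope_less_hits[OF N 4(2) _ lt(2)])
      show "lelong_envelope N (indicator B) y < ereal \<beta>" using lt(1) by simp
      fix g2 S2 F2 k2
      assume g2: "holomorphic_into N g2 S2" "open S2" "cball 0 1 \<subseteq> S2" "g2 0 = y"
        and F2: "finite F2" "F2 \<subseteq> ball 0 1 - {0}" "\<And>z. z \<in> F2 \<Longrightarrow> g2 z \<in> B \<and> k2 z > 0 \<and> contact_at_least N g2 z (k2 z)"
        and s2: "(\<Sum>z\<in>F2. real (k2 z) * ln (cmod z)) < \<beta>"
      \<comment> \<open>neither point lies in its set; the sums of logarithms become products of moduli by exponentiation\<close>
      have w1: "weighted_points F1 k1" and w2: "weighted_points F2 k2"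
        using F1 F2 s1 s2 lt(2) unfolding weighted_points_def by auto
      have p1: "(\<Prod>a\<in>F1. cmod a ^ k1 a) < exp \<beta>" and p2: "(\<Prod>a\<in>F2. cmod a ^ k2 a) < exp \<beta>"
        using s1 s2 sum_log_eq_prod[OF F1(1,2), of k1, symmetric] sum_log_eq_prod[OF F2(1,2), of k2, symmetric] by simp_all
      obtain \<eta>1 where \<eta>1: "\<eta>1 > 0" "ball 0 (1 + \<eta>1) \<subseteq> S1" using ball_beyond_closed_disc[OF g1(2,3)] .
      obtain \<eta>2 where \<eta>2: "\<eta>2 > 0" "ball 0 (1 + \<eta>2) \<subseteq> S2" using ball_beyond_closed_disc[OF g2(2,3)] .
      define \<eta> where "\<eta> = min \<eta>1 \<eta>2"
      have \<eta>: "\<eta> > 0" using \<eta>1(1) \<eta>2(1) by (simp add: \<eta>_def)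
      have "exp \<beta> \<le> 1" using lt(2) by simp
      show ?thesis
      proof (rule simultaneous_hits[OF w1 w2 \<eta> p1 p2 \<open>exp \<beta> \<le> 1\<close>])
        fix h1 h2 \<rho> Z L
        assume \<rho>: "\<rho> > 1" and h: "h1 holomorphic_on ball 0 \<rho>" "h2 holomorphic_on ball 0 \<rho>"
          and bd: "\<And>z. z \<in> ball 0 \<rho> \<Longrightarrow> cmod (h1 z) < 1 + \<eta> \<and> cmod (h2 z) < 1 + \<eta>"
          and h0: "h1 0 = 0" "h2 0 = 0" and Z: "finite Z" "Z \<subseteq> ball 0 1 - {0}" "(\<Prod>z\<in>Z. cmod z ^ L) < exp \<beta>"
          and hit: "\<And>z. z \<in> Z \<Longrightarrow> hits h1 F1 k1 z L \<and> hits h2 F2 k2 z L"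
        have L: "L > 0"
        proof (rule ccontr)
          assume "\<not> L > 0"
          then have "(\<Prod>z\<in>Z. cmod z ^ L) = 1" by simp
          then show False using Z(3) \<open>exp \<beta> \<le> 1\<close> by simp
        qed
        define g where "g z = (g1 (h1 z), g2 (h2 z))" for z
        have sub: "cball 0 1 \<subseteq> ball (0::complex) \<rho>" using \<rho> by auto
        have i1: "h1 z \<in> S1" and i2: "h2 z \<in> S2" if "z \<in> ball 0 \<rho>" for z
          using bd[OF that] \<eta>1(2) \<eta>2(2) by (auto simp: \<eta>_def subset_iff)
        have gh: "holomorphic_into ?X g (ball 0 \<rho>)"
          unfolding g_def
          by (intro holomorphic_into_Pair holomorphic_into_compose[OF g1(1) h(1) i1] holomorphic_into_compose[OF g2(1) h(2) i2])
        have ct: "contact_at_least K (\<lambda>w. gg (hh w)) z L"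
          if hh: "hh holomorphic_on ball 0 \<rho>" and z: "z \<in> Z" and hi: "hits hh F k z L"
            and c: "\<And>a. a \<in> F \<Longrightarrow> contact_at_least K gg a (k a)" for hh F k z gg and K :: "('c, 'k::finite) manifold"
        proof -
          obtain C where C: "hh z \<in> F" "\<forall>\<^sub>F w in at z. cmod (hh w - hh z) ^ k (hh z) \<le> C * cmod (w - z) ^ L"
            using hi unfolding hits_def by blast
          have "z \<in> ball 0 \<rho>" using z Z(2) \<rho> by auto
          then have "isCont hh z" using holomorphic_on_imp_continuous_on[OF hh] by (simp add: continuous_on_eq_continuous_at)
          then show ?thesis by (rule contact_at_least_compose[OF c[OF C(1)] _ C(2)])
        qed
        have "?E \<le> ereal (\<Sum>z\<in>Z. real L * ln (cmod z))"
        proof (rule lelong_envelope_le_hits[OF X gh open_ball sub _ Z(1,2)])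
          show "g 0 = (x, y)" by (simp add: g_def h0 g1(4) g2(4))
          fix z assume z: "z \<in> Z"
          have "h1 z \<in> F1" "h2 z \<in> F2" using hit[OF z] by (auto simp: hits_def)
          then have "g z \<in> A \<times> B" using F1(3) F2(3) by (simp add: g_def)
          moreover have "contact_at_least ?X g z L"
            unfolding g_def using ct[OF h(1) z conjunct1[OF hit[OF z]]] ct[OF h(2) z conjunct2[OF hit[OF z]]] F1(3) F2(3)
            by (intro contact_at_least_Pair) blast+
          ultimately show "g z \<in> A \<times> B \<and> 0 < L \<and> contact_at_least ?X g z L" using L by blast
        qed
        moreover have "(\<Sum>z\<in>Z. real L * ln (cmod z)) < \<beta>"
          using Z(3) sum_log_eq_prod[OF Z(1,2), of "\<lambda>_. L", symmetric] by simp
        ultimately show ?thesis by (meson ereal_less_eq(3) less_imp_le order_trans)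
      qed
      qed
      qed
    qed
  qed
  show "?E \<le> max ?E1 ?E2"
  proof (cases "max ?E1 ?E2 < 0")
    case False
    then show ?thesis using lelong_envelope_nonpos[OF xy, of "indicator (A \<times> B)"] by (meson not_less order_trans)
  next
    case True
    show ?thesis
    proof (rule dense_ge_bounded[OF True])
      fix w assume w: "max ?E1 ?E2 < w" "w < 0"
      then obtain \<beta> where "w = ereal \<beta>" by (cases w) auto
      then show "?E \<le> w" using key[of \<beta>] w by (simp add: zero_ereal_def)
    qed
  qed
qed

section \<open>Lelong numbers and logarithmic poles\<close>

lemma PSHD:
  assumes "u \<in> PSH M"
  shows "usc (mtop M) u" "(U, \<phi>) \<in> atlas M \<Longrightarrow> (u \<circ> inv_into U \<phi>) plurisubharmonic_on \<phi> ` U"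
  using assms by (auto simp: PSH_def)

definition sphere_sup :: "(complex ^ 'n \<Rightarrow> ereal) \<Rightarrow> complex ^ 'n \<Rightarrow> real \<Rightarrow> ereal"
  where "sphere_sup v p r = (SUP w\<in>sphere p r. v w)"

lemma psh_line:
  assumes "v plurisubharmonic_on W" "cball p R \<subseteq> W" "norm b = 1"
  shows "(\<lambda>t. v (p + t *s b)) subharmonic_on {t. p + t *s b \<in> W}" "cball 0 R \<subseteq> {t. p + t *s b \<in> W}"
proof -
  show "(\<lambda>t. v (p + t *s b)) subharmonic_on {t. p + t *s b \<in> W}" using assms(1) by (simp add: plurisubharmonic_on_def)
  show "cball 0 R \<subseteq> {t. p + t *s b \<in> W}"
  proof
    fix t :: complex assume "t \<in> cball 0 R"
    then have "p + t *s b \<in> cball p R" using assms(3) by (simp add: dist_norm norm_vector_smult)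
    then show "t \<in> {t. p + t *s b \<in> W}" using assms(2) by blast
  qed
qed

lemma sphere_line:
  assumes "norm b = 1" "cmod t = s"
  shows "p + t *s b \<in> sphere p s"
  using assms by (simp add: dist_norm norm_vector_smult)

lemma sphere_sup_upper: "w \<in> sphere p r \<Longrightarrow> v w \<le> sphere_sup v p r"
  unfolding sphere_sup_def by (rule SUP_upper)

lemma direction_exists:
  fixes p w :: "complex ^ 'n"
  obtains b where "norm b = 1" "w = p + of_real (norm (w - p)) *s b"
proof (cases "w = p")
  case True
  obtain b :: "complex ^ 'n" where "norm b = 1" using vector_choose_size[of 1] by auto
  then show thesis using that True by simp
next
  case False
  define b where "b = of_real (1 / norm (w - p)) *s (w - p)"
  have "norm b = 1" unfolding b_def norm_vector_smult using False by (simp add: norm_divide)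
  moreover have "of_real (norm (w - p)) *s b = w - p" unfolding b_def vector_smult_assoc of_real_mult[symmetric] using False by simp
  ultimately show thesis using that[of b] by simp
qed

lemma psh_ball_bound:
  assumes v: "v plurisubharmonic_on W" "cball p s \<subseteq> W" and le: "sphere_sup v p s \<le> ereal A" and w: "w \<in> cball p s"
  shows "v w \<le> ereal A"
proof -
  obtain b where b: "norm b = 1" "w = p + of_real (norm (w - p)) *s b" by (rule direction_exists)
  have "v (p + of_real (norm (w - p)) *s b) \<le> ereal A"
  proof (rule subharmonic_disc_bound[OF psh_line[OF v b(1)]])
    show "v (p + t *s b) \<le> ereal A" if "cmod t = s" for t
      using sphere_sup_upper[OF sphere_line[OF b(1) that]] le by (rule order_trans)
    show "cmod (of_real (norm (w - p))) \<le> s" using w by (simp add: dist_norm norm_minus_commute)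
  qed
  then show ?thesis using b(2) by simp
qed

text \<open>Hadamard's inequality on every complex line through \<open>p\<close>.\<close>

lemma psh_two_spheres:
  assumes v: "v plurisubharmonic_on W" "cball p R \<subseteq> W" "\<And>w. w \<in> W \<Longrightarrow> v w \<le> 0"
    and s: "0 < s" "s < r" "r < R" and le: "sphere_sup v p s \<le> ereal (- k)"
  shows "sphere_sup v p r \<le> ereal (- k * (ln (R / r) / ln (R / s)))"
  unfolding sphere_sup_def
proof (rule SUP_least)
  fix w assume w: "w \<in> sphere p r"
  obtain b where b: "norm b = 1" "w = p + of_real (norm (w - p)) *s b" by (rule direction_exists)
  have n: "norm (w - p) = r" using w by (simp add: dist_norm norm_minus_commute)
  note line = psh_line[OF v(1,2) b(1)]
  have "v (p + of_real r *s b) \<le> ereal (- k * (ln (R / cmod (of_real r)) / ln (R / s)))"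
  proof (rule two_circles[OF line s(1)])
    show "s < R" using s by simp
    show "v (p + t *s b) \<le> 0" if "cmod t = R" for t
    proof -
      have "t \<in> cball 0 R" using that by simp
      then show ?thesis using v(3) line(2) by blast
    qed
    show "v (p + t *s b) \<le> ereal (- k)" if "cmod t = s" for t
      using sphere_sup_upper[OF sphere_line[OF b(1) that]] le by (rule order_trans)
  qed (use s in auto)
  then show "v w \<le> ereal (- k * (ln (R / r) / ln (R / s)))" using b(2) n s by simp
qed

lemma sphere_sup_nonpos:
  assumes "cball p R \<subseteq> W" "\<And>w. w \<in> W \<Longrightarrow> v w \<le> 0" "r \<le> R"
  shows "sphere_sup v p r \<le> 0"
  unfolding sphere_sup_def
proof (rule SUP_least)
  fix w assume "w \<in> sphere p r"
  then have "w \<in> cball p R" using assms(3) by simp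
  then show "v w \<le> 0" using assms by blast
qed

lemma ln_ratio_tendsto_1: "R > 0 \<Longrightarrow> ((\<lambda>r. ln (r / R) / ln r) \<longlongrightarrow> 1) (at_right (0::real))"
proof -
  assume R: "R > 0"
  have "((\<lambda>r. ln R / ln r) \<longlongrightarrow> 0) (at_right (0::real))"
    by (rule tendsto_divide_0[OF tendsto_const filterlim_at_bot_imp_at_infinity[OF ln_at_0]])
  then have "((\<lambda>r. 1 - ln R / ln r) \<longlongrightarrow> 1 - 0) (at_right (0::real))" by (intro tendsto_intros)
  then have "((\<lambda>r. 1 - ln R / ln r) \<longlongrightarrow> 1) (at_right (0::real))" by simp
  moreover have "\<forall>\<^sub>F r in at_right (0::real). 1 - ln R / ln r = ln (r / R) / ln r"
  proof -
    have "\<forall>\<^sub>F r in at_right (0::real). r \<in> {0<..<1}" by (rule eventually_at_right_real) simp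
    then show ?thesis
      by eventually_elim (use R in \<open>simp add: ln_div diff_divide_distrib\<close>)
  qed
  ultimately show ?thesis by (rule Lim_transform_eventually)
qed

text \<open>By the estimate for two spheres, the quotient of the supremum over the sphere of radius \<open>r\<close> by \<open>ln (r / R)\<close> increases with
\<open>r\<close>. If the supremum is \<open>-\<infinity>\<close> for one radius, then it is so for all smaller ones and the limit is \<open>\<infinity>\<close>.\<close>

lemma lelong_limit_exists:
  assumes v: "v plurisubharmonic_on W" "cball p R \<subseteq> W" "\<And>w. w \<in> W \<Longrightarrow> v w \<le> 0" and R: "R > 0"
  shows "\<exists>l. ((\<lambda>r. sphere_sup v p r / ereal (ln r)) \<longlongrightarrow> l) (at_right 0)"
proof (cases "\<exists>s\<in>{0<..<R}. sphere_sup v p s = -\<infinity>")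
  case True
  then obtain s where s: "0 < s" "s < R" "sphere_sup v p s = -\<infinity>" by auto
  have sub: "cball p s \<subseteq> W" using v(2) s by (meson order_trans subset_cball less_imp_le)
  have "sphere_sup v p r = -\<infinity>" if r: "0 < r" "r < s" for r
  proof -
    have "v w = -\<infinity>" if "w \<in> sphere p r" for w
    proof -
      have "w \<in> cball p s" using that r by simp
      then have "v w \<le> ereal A" for A using psh_ball_bound[OF v(1) sub, of A w] s(3) by simp
      then show ?thesis by (rule ereal_bot)
    qed
    then have "sphere_sup v p r \<le> -\<infinity>" unfolding sphere_sup_def by (intro SUP_least) simp
    then show ?thesis by simp
  qed
  moreover have "\<forall>\<^sub>F r in at_right (0::real). r \<in> {0<..<min s 1}" by (rule eventually_at_right_real) (use s in simp)
  ultimately have "\<forall>\<^sub>F r in at_right 0. sphere_sup v p r / ereal (ln r) = \<infinity>"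
    by (auto elim!: eventually_mono simp: divide_ereal_def)
  then show ?thesis by (intro exI[of _ \<infinity>] tendsto_eventually)
next
  case False
  define m where "m r = real_of_ereal (sphere_sup v p r)" for r
  have m: "sphere_sup v p r = ereal (m r)" if "0 < r" "r < R" for r
    using False sphere_sup_nonpos[of p R W v r] v that by (cases "sphere_sup v p r") (auto simp: m_def)
  have m0: "m r \<le> 0" if "0 < r" "r < R" for r
    using sphere_sup_nonpos[of p R W v r] v that m[OF that] by (simp add: zero_ereal_def)
  \<comment> \<open>\<open>ln (r / R)\<close> instead of \<open>ln r\<close> makes the quotient monotone and does not change the limit\<close>
  define n where "n r = m r / ln (r / R)" for r
  have lnR: "ln (r / R) < 0" if "0 < r" "r < R" for r using that R by simp
  have n0: "n r \<ge> 0" if "0 < r" "r < R" for r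
    unfolding n_def using m0[OF that] lnR[OF that] by (intro divide_nonpos_neg)
  have mono: "n s \<le> n r" if "0 < s" "s < r" "r < R" for s r
  proof -
    have "sphere_sup v p r \<le> ereal (- (- m s) * (ln (R / r) / ln (R / s)))"
      using psh_two_spheres[OF v that, of "- m s"] m[of s] that by simp
    then have "m r \<le> m s * (ln (R / r) / ln (R / s))" using m[of r] that by simp
    also have "ln (R / r) / ln (R / s) = ln (r / R) / ln (s / R)" using that by (simp add: ln_div) (metis minus_diff_eq minus_divide_divide)
    finally have "m r \<le> n s * ln (r / R)" by (simp add: n_def)
    then show ?thesis unfolding n_def[of r] using lnR[of r] that by (simp add: neg_le_divide_eq)
  qed
  define L where "L = Inf (n ` {0<..<R})"
  have bdd: "bdd_below (n ` {0<..<R})" using n0 by (intro bdd_belowI2[of _ 0]) auto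
  have ne: "n ` {0<..<R} \<noteq> {}" using R by auto
  have evR: "\<forall>\<^sub>F r in at_right (0::real). r \<in> {0<..<R}" by (rule eventually_at_right_real[OF R])
  have "(n \<longlongrightarrow> L) (at_right 0)"
  proof (rule order_tendstoI)
    fix y assume "y < L"
    show "\<forall>\<^sub>F r in at_right 0. y < n r"
      using evR
    proof eventually_elim
      case (elim r)
      then have "L \<le> n r" unfolding L_def using bdd by (intro cInf_lower) auto
      then show ?case using \<open>y < L\<close> by simp
    qed
  next
    fix y assume "L < y"
    then obtain s where s: "0 < s" "s < R" "n s < y" using cInf_less_iff[OF ne bdd] by (auto simp: L_def)
    have "\<forall>\<^sub>F r in at_right (0::real). r \<in> {0<..<s}" by (rule eventually_at_right_real[OF s(1)])
    then show "\<forall>\<^sub>F r in at_right 0. n r < y"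
    proof eventually_elim
      case (elim r)
      then have "n r \<le> n s" using mono[of r s] s by simp
      then show ?case using s by simp
    qed
  qed
  from tendsto_mult[OF this ln_ratio_tendsto_1[OF R]]
  have "((\<lambda>r. n r * (ln (r / R) / ln r)) \<longlongrightarrow> L) (at_right 0)" by simp
  then have "((\<lambda>r. ereal (n r * (ln (r / R) / ln r))) \<longlongrightarrow> ereal L) (at_right 0)" by (rule tendsto_ereal)
  moreover have "\<forall>\<^sub>F r in at_right (0::real). r \<in> {0<..<min R 1}" by (rule eventually_at_right_real) (use R in simp)
  then have "\<forall>\<^sub>F r in at_right (0::real). ereal (n r * (ln (r / R) / ln r)) = sphere_sup v p r / ereal (ln r)"
  proof eventually_elim
    case (elim r)
    then have "n r * (ln (r / R) / ln r) = m r / ln r" using lnR[of r] by (simp add: n_def)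
    then show ?case using m[of r] elim by simp
  qed
  ultimately have "((\<lambda>r. sphere_sup v p r / ereal (ln r)) \<longlongrightarrow> ereal L) (at_right 0)" by (rule Lim_transform_eventually)
  then show ?thesis by blast
qed

lemma PSH_in_chart:
  assumes M: "charted M" and u: "u \<in> PSH M" "\<And>y. y \<in> points M \<Longrightarrow> u y \<le> 0" and U: "(U, \<phi>) \<in> atlas M" "a \<in> U"
  obtains R where "R > 0" "cball (\<phi> a) R \<subseteq> \<phi> ` U" "(u \<circ> inv_into U \<phi>) plurisubharmonic_on \<phi> ` U"
    "\<And>w. w \<in> \<phi> ` U \<Longrightarrow> (u \<circ> inv_into U \<phi>) w \<le> 0"
proof -
  have "\<phi> a \<in> \<phi> ` U" using U(2) by blast
  then obtain R where "R > 0" "cball (\<phi> a) R \<subseteq> \<phi> ` U" using chart_open_image[OF M U(1)] open_contains_cball by blast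
  moreover have "(u \<circ> inv_into U \<phi>) w \<le> 0" if "w \<in> \<phi> ` U" for w
    using u(2) chart_inv(3)[OF M U(1) that] chart_subset[OF M U(1)] by auto
  ultimately show thesis using that PSHD(2)[OF u(1) U(1)] by blast
qed

lemma lelong_number_tendsto:
  assumes M: "charted M" and u: "u \<in> PSH M" "\<And>y. y \<in> points M \<Longrightarrow> u y \<le> 0" and a: "a \<in> points M"
    and c: "chart_at M a = (U, \<phi>)"
  shows "((\<lambda>r. sphere_sup (u \<circ> inv_into U \<phi>) (\<phi> a) r / ereal (ln r)) \<longlongrightarrow> lelong_number M u a) (at_right 0)"
proof -
  note U = chart_at_in_atlas[OF M a c]
  obtain R where R: "R > 0" "cball (\<phi> a) R \<subseteq> \<phi> ` U" "(u \<circ> inv_into U \<phi>) plurisubharmonic_on \<phi> ` U"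
    "\<And>w. w \<in> \<phi> ` U \<Longrightarrow> (u \<circ> inv_into U \<phi>) w \<le> 0" using PSH_in_chart[OF M u U] by metis
  obtain l where l: "((\<lambda>r. sphere_sup (u \<circ> inv_into U \<phi>) (\<phi> a) r / ereal (ln r)) \<longlongrightarrow> l) (at_right 0)"
    using lelong_limit_exists[OF R(3,2,4,1)] by blast
  have "lelong_number M u a = Lim (at_right 0) (\<lambda>r. sphere_sup (u \<circ> inv_into U \<phi>) (\<phi> a) r / ereal (ln r))"
    unfolding lelong_number_def c sphere_sup_def by simp
  also have "\<dots> = l" using l by (intro tendsto_Lim) auto
  finally show ?thesis using l by simp
qed

text \<open>The reformulation of a Lelong number of at least \<open>1\<close> by estimates from above. The slopes \<open>c < 1\<close> absorb the bounded
factor by which the norms in two charts differ. Points \<open>x\<close> with \<open>\<phi> x = \<phi> a\<close> are left out because \<open>ln 0 = 0\<close>.\<close>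

definition log_pole :: "('a, 'n::finite) manifold \<Rightarrow> ('a \<Rightarrow> ereal) \<Rightarrow> 'a \<Rightarrow> bool"
  where "log_pole M u a \<longleftrightarrow> (\<forall>c. 0 < c \<and> c < 1 \<longrightarrow> (\<forall>(U, \<phi>)\<in>atlas M. a \<in> U \<longrightarrow>
    (\<exists>\<rho>>0. \<forall>x\<in>U. 0 < norm (\<phi> x - \<phi> a) \<and> norm (\<phi> x - \<phi> a) < \<rho> \<longrightarrow> u x \<le> ereal (c * ln (norm (\<phi> x - \<phi> a))))))"

lemma log_poleD:
  assumes "log_pole M u a" "0 < c" "c < 1" "(U, \<phi>) \<in> atlas M" "a \<in> U"
  obtains \<rho> where "\<rho> > 0" "\<And>x. x \<in> U \<Longrightarrow> 0 < norm (\<phi> x - \<phi> a) \<Longrightarrow> norm (\<phi> x - \<phi> a) < \<rho> \<Longrightarrow> u x \<le> ereal (c * ln (norm (\<phi> x - \<phi> a)))"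
proof -
  note mp[OF spec[OF assms(1)[unfolded log_pole_def], of c] conjI[OF assms(2,3)]]
  from bspec[OF this assms(4)] assms(5) have "\<exists>\<rho>>0. \<forall>x\<in>U. 0 < norm (\<phi> x - \<phi> a) \<and> norm (\<phi> x - \<phi> a) < \<rho> \<longrightarrow> u x \<le> ereal (c * ln (norm (\<phi> x - \<phi> a)))"
    by simp
  then obtain \<rho> where r: "\<rho> > 0 \<and> (\<forall>x\<in>U. 0 < norm (\<phi> x - \<phi> a) \<and> norm (\<phi> x - \<phi> a) < \<rho> \<longrightarrow> u x \<le> ereal (c * ln (norm (\<phi> x - \<phi> a))))" ..
  show thesis
  proof (rule that[OF conjunct1[OF r]])
    fix x assume "x \<in> U" "0 < norm (\<phi> x - \<phi> a)" "norm (\<phi> x - \<phi> a) < \<rho>"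
    with bspec[OF conjunct2[OF r] this(1)] show "u x \<le> ereal (c * ln (norm (\<phi> x - \<phi> a)))" by simp
  qed
qed

lemma log_le_smaller_slope:
  fixes c d B :: real
  assumes "0 < c" "c < d"
  shows "\<exists>\<rho>>0. \<forall>t. 0 < t \<and> t < \<rho> \<longrightarrow> d * ln t + B \<le> c * ln t"
proof (intro exI[of _ "exp (- \<bar>B\<bar> / (d - c))"] conjI allI impI)
  fix t :: real assume t: "0 < t \<and> t < exp (- \<bar>B\<bar> / (d - c))"
  then have "ln t < - \<bar>B\<bar> / (d - c)" by (metis exp_gt_zero ln_exp ln_less_cancel_iff)
  then have "ln t * (d - c) < - \<bar>B\<bar>" using assms using pos_less_divide_eq[of "d - c" "ln t" "- \<bar>B\<bar>"] by simp
  then show "d * ln t + B \<le> c * ln t" by (simp add: algebra_simps)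
qed simp

text \<open>In another chart the bound changes by an additive constant, which a steeper slope \<open>d > c\<close> compensates.\<close>

lemma log_poleI:
  assumes M: "charted M" and U: "(U, \<phi>) \<in> atlas M" "a \<in> U"
    and h: "\<And>c. 0 < c \<Longrightarrow> c < 1 \<Longrightarrow> \<exists>\<rho>>0. \<forall>x\<in>U. 0 < norm (\<phi> x - \<phi> a) \<and> norm (\<phi> x - \<phi> a) < \<rho> \<longrightarrow> u x \<le> ereal (c * ln (norm (\<phi> x - \<phi> a)))"
  shows "log_pole M u a"
  unfolding log_pole_def
proof (clarify)
  fix c :: real and V \<psi> assume c: "0 < c" "c < 1" and V: "(V, \<psi>) \<in> atlas M" "a \<in> V"
  define d where "d = (1 + c) / 2"
  have d: "0 < d" "d < 1" "c < d" using c by (auto simp: d_def)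
  obtain \<rho>1 where \<rho>1: "\<rho>1 > 0" "\<And>x. x \<in> U \<Longrightarrow> 0 < norm (\<phi> x - \<phi> a) \<Longrightarrow> norm (\<phi> x - \<phi> a) < \<rho>1 \<Longrightarrow> u x \<le> ereal (d * ln (norm (\<phi> x - \<phi> a)))"
    using h[OF d(1,2)] by blast
  obtain C \<rho>2 where C: "C > 0" "\<rho>2 > 0" "\<And>x. x \<in> V \<Longrightarrow> norm (\<psi> x - \<psi> a) < \<rho>2 \<Longrightarrow> x \<in> U \<and> norm (\<phi> x - \<phi> a) \<le> C * norm (\<psi> x - \<psi> a)"
    using chart_change_bound[OF M V(1) U(1) V(2) U(2)] by metis
  obtain \<rho>3 where \<rho>3: "\<rho>3 > 0" "\<And>t. 0 < t \<Longrightarrow> t < \<rho>3 \<Longrightarrow> d * ln t + d * ln C \<le> c * ln t"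
    using log_le_smaller_slope[OF c(1) d(3), of "d * ln C"] by blast
  show "\<exists>\<rho>>0. \<forall>x\<in>V. 0 < norm (\<psi> x - \<psi> a) \<and> norm (\<psi> x - \<psi> a) < \<rho> \<longrightarrow> u x \<le> ereal (c * ln (norm (\<psi> x - \<psi> a)))"
  proof (intro exI[of _ "min (min \<rho>2 \<rho>3) (\<rho>1 / C)"] conjI ballI impI)
    show "0 < min (min \<rho>2 \<rho>3) (\<rho>1 / C)" using \<rho>1 C \<rho>3 by simp
    fix x assume x: "x \<in> V" "0 < norm (\<psi> x - \<psi> a) \<and> norm (\<psi> x - \<psi> a) < min (min \<rho>2 \<rho>3) (\<rho>1 / C)"
    define t where "t = norm (\<psi> x - \<psi> a)"
    have t: "0 < t" "t < \<rho>2" "t < \<rho>3" "C * t < \<rho>1" using x(2) C(1) by (auto simp: t_def field_simps)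
    have xU: "x \<in> U" "norm (\<phi> x - \<phi> a) \<le> C * t" using C(3)[OF x(1)] t(2) by (auto simp: t_def)
    have "x \<noteq> a" using t(1) by (auto simp: t_def)
    then have n0: "0 < norm (\<phi> x - \<phi> a)" using inj_onD[OF chart_inj[OF M U(1)] _ xU(1) U(2)] by auto
    have "u x \<le> ereal (d * ln (norm (\<phi> x - \<phi> a)))" using \<rho>1(2)[OF xU(1) n0] xU(2) t(4) by simp
    also have "\<dots> \<le> ereal (d * ln (C * t))"
    proof -
      have "ln (norm (\<phi> x - \<phi> a)) \<le> ln (C * t)" using n0 xU(2) by (meson ln_le_cancel_iff order_less_le_trans)
      then show ?thesis using d(1) by (simp add: mult_left_mono)
    qed
    also have "\<dots> \<le> ereal (c * ln t)" using \<rho>3(2)[OF t(1,3)] t(1) C(1) by (simp add: ln_mult distrib_left add.commute)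
    finally show "u x \<le> ereal (c * ln (norm (\<psi> x - \<psi> a)))" by (simp add: t_def)
  qed
qed

lemma ereal_le_mult_iff_le_divide_neg:
  fixes q :: ereal and l k :: real
  assumes "q \<le> 0" "l < 0"
  shows "q \<le> ereal (k * l) \<longleftrightarrow> ereal k \<le> q / ereal l"
proof (cases q)
  case (real r)
  then show ?thesis using assms(2) neg_le_divide_eq[of l k r] by simp
next
  case MInf
  then have "q / ereal l = \<infinity>" using assms(2) by (simp add: divide_ereal_def)
  then show ?thesis using MInf by simp
qed (use assms in simp)

lemma lelong_number_nonneg:
  assumes M: "charted M" and u: "u \<in> PSH M" "\<And>y. y \<in> points M \<Longrightarrow> u y \<le> 0" and a: "a \<in> points M"
  shows "0 \<le> lelong_number M u a"
proof -
  obtain U \<phi> where c: "chart_at M a = (U, \<phi>)" by (cases "chart_at M a")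
  note U = chart_at_in_atlas[OF M a c]
  obtain R where R: "R > 0" "cball (\<phi> a) R \<subseteq> \<phi> ` U" "(u \<circ> inv_into U \<phi>) plurisubharmonic_on \<phi> ` U"
    "\<And>w. w \<in> \<phi> ` U \<Longrightarrow> (u \<circ> inv_into U \<phi>) w \<le> 0" using PSH_in_chart[OF M u U] by metis
  have "\<forall>\<^sub>F r in at_right (0::real). r \<in> {0<..<min R 1}" by (rule eventually_at_right_real) (use R in simp)
  then have "\<forall>\<^sub>F r in at_right 0. 0 \<le> sphere_sup (u \<circ> inv_into U \<phi>) (\<phi> a) r / ereal (ln r)"
  proof eventually_elim
    case (elim r)
    then have r: "0 < r" "r < R" "r < 1" by auto
    have "sphere_sup (u \<circ> inv_into U \<phi>) (\<phi> a) r \<le> 0" using sphere_sup_nonpos[of "\<phi> a" R "\<phi> ` U" "u \<circ> inv_into U \<phi>" r, OF R(2,4)] r(2) by simp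
    moreover have "ln r < 0" using r by simp
    ultimately show ?case using ereal_le_mult_iff_le_divide_neg[of "sphere_sup (u \<circ> inv_into U \<phi>) (\<phi> a) r" "ln r" 0]
      by (simp add: zero_ereal_def)
  qed
  then show ?thesis by (intro tendsto_lowerbound[OF lelong_number_tendsto[OF M u a c]]) auto
qed

lemma lelong_number_ge_1_iff_log_pole:
  assumes M: "charted M" and u: "u \<in> PSH M" "\<And>y. y \<in> points M \<Longrightarrow> u y \<le> 0" and a: "a \<in> points M"
  shows "1 \<le> lelong_number M u a \<longleftrightarrow> log_pole M u a"
proof -
  obtain U \<phi> where c: "chart_at M a = (U, \<phi>)" by (cases "chart_at M a")
  note U = chart_at_in_atlas[OF M a c]
  obtain R where R: "R > 0" "cball (\<phi> a) R \<subseteq> \<phi> ` U" "(u \<circ> inv_into U \<phi>) plurisubharmonic_on \<phi> ` U"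
    "\<And>w. w \<in> \<phi> ` U \<Longrightarrow> (u \<circ> inv_into U \<phi>) w \<le> 0" using PSH_in_chart[OF M u U] by metis
  let ?q = "\<lambda>r. sphere_sup (u \<circ> inv_into U \<phi>) (\<phi> a) r"
  note lim = lelong_number_tendsto[OF M u a c]
  have ev: "\<forall>\<^sub>F r in at_right (0::real). r \<in> {0<..<min R 1}" by (rule eventually_at_right_real) (use R in simp)
  have q: "?q r \<le> ereal (k * ln r) \<longleftrightarrow> ereal k \<le> ?q r / ereal (ln r)" if "0 < r" "r < min R 1" for r k
  proof -
    have l: "ln r < 0" using that by simp
    have "?q r \<le> 0" using sphere_sup_nonpos[of "\<phi> a" R "\<phi> ` U" "u \<circ> inv_into U \<phi>" r, OF R(2,4)] that by simp
    then show ?thesis using l by (rule ereal_le_mult_iff_le_divide_neg)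
  qed
  show ?thesis
  proof
    assume l: "1 \<le> lelong_number M u a"
    show "log_pole M u a"
    proof (rule log_poleI[OF M U])
      fix k :: real assume k: "0 < k" "k < 1"
      have "ereal k < lelong_number M u a" using k(2) l by (metis ereal_less(3) less_le_trans one_ereal_def less_ereal.simps(1))
      from order_tendstoD(1)[OF lim this] have "\<forall>\<^sub>F r in at_right 0. ereal k < ?q r / ereal (ln r)" .
      with ev have "\<forall>\<^sub>F r in at_right 0. ?q r \<le> ereal (k * ln r) \<and> r \<in> {0<..<min R 1}"
        by eventually_elim (use q in \<open>auto simp: less_imp_le\<close>)
      then obtain \<rho> where \<rho>: "\<rho> > 0" "\<And>r. 0 < r \<Longrightarrow> r < \<rho> \<Longrightarrow> ?q r \<le> ereal (k * ln r)"
        unfolding eventually_at_right_field by auto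
      show "\<exists>\<rho>>0. \<forall>x\<in>U. 0 < norm (\<phi> x - \<phi> a) \<and> norm (\<phi> x - \<phi> a) < \<rho> \<longrightarrow> u x \<le> ereal (k * ln (norm (\<phi> x - \<phi> a)))"
      proof (intro exI[of _ \<rho>] conjI ballI impI \<rho>(1))
        fix x assume x: "x \<in> U" "0 < norm (\<phi> x - \<phi> a) \<and> norm (\<phi> x - \<phi> a) < \<rho>"
        have "(u \<circ> inv_into U \<phi>) (\<phi> x) \<le> ?q (norm (\<phi> x - \<phi> a))"
          by (rule sphere_sup_upper) (simp add: dist_norm norm_minus_commute)
        also have "\<dots> \<le> ereal (k * ln (norm (\<phi> x - \<phi> a)))" using \<rho>(2) x(2) by blast
        finally show "u x \<le> ereal (k * ln (norm (\<phi> x - \<phi> a)))" using chart_inv(1)[OF M U(1) x(1)] by simp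
      qed
    qed
  next
    assume lp: "log_pole M u a"
    have "ereal k \<le> lelong_number M u a" if k: "0 < k" "k < 1" for k
    proof -
      obtain \<rho> where \<rho>: "\<rho> > 0" "\<And>x. x \<in> U \<Longrightarrow> 0 < norm (\<phi> x - \<phi> a) \<Longrightarrow> norm (\<phi> x - \<phi> a) < \<rho> \<Longrightarrow> u x \<le> ereal (k * ln (norm (\<phi> x - \<phi> a)))"
        using log_poleD[OF lp k U] by metis
      have "\<forall>\<^sub>F r in at_right (0::real). r \<in> {0<..<\<rho>}" by (rule eventually_at_right_real[OF \<rho>(1)])
      with ev have "\<forall>\<^sub>F r in at_right 0. ereal k \<le> ?q r / ereal (ln r)"
      proof eventually_elim
        case (elim r)
        then have r: "0 < r" "r < min R 1" "r < \<rho>" by auto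
        have "?q r \<le> ereal (k * ln r)"
          unfolding sphere_sup_def
        proof (rule SUP_least)
          fix w assume w: "w \<in> sphere (\<phi> a) r"
          then have "w \<in> \<phi> ` U" using R(2) r by (auto simp: subset_iff)
          then have x: "inv_into U \<phi> w \<in> U" "\<phi> (inv_into U \<phi> w) = w" using chart_inv(2,3)[OF M U(1)] by auto
          have "norm (\<phi> (inv_into U \<phi> w) - \<phi> a) = r" using w x(2) by (simp add: dist_norm norm_minus_commute)
          then show "(u \<circ> inv_into U \<phi>) w \<le> ereal (k * ln r)" using \<rho>(2)[OF x(1)] r by simp
        qed
        then show ?case using q[OF r(1,2)] by simp
      qed
      then show ?thesis by (intro tendsto_lowerbound[OF lim]) auto
    qed
    then show "1 \<le> lelong_number M u a"
    proof (cases "lelong_number M u a")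
      case (real l)
      have "1 \<le> l"
      proof (rule dense_le_bounded[of 0])
        show "w \<le> l" if "0 < w" "w < 1" for w using \<open>\<And>k. 0 < k \<Longrightarrow> k < 1 \<Longrightarrow> ereal k \<le> lelong_number M u a\<close>[OF that] real by simp
      qed simp
      then show ?thesis using real by (simp add: one_ereal_def)
    next
      case MInf
      then show ?thesis using \<open>\<And>k. 0 < k \<Longrightarrow> k < 1 \<Longrightarrow> ereal k \<le> lelong_number M u a\<close>[of "1/2"] by simp
    qed simp
  qed
qed

text \<open>On small spheres around \<open>a\<close> the function is below any given constant, hence also at \<open>a\<close> by the maximum principle.\<close>

lemma log_pole_value:
  assumes M: "charted M" and u: "u \<in> PSH M" "\<And>y. y \<in> points M \<Longrightarrow> u y \<le> 0" and a: "a \<in> points M" and lp: "log_pole M u a"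
  shows "u a = -\<infinity>"
proof -
  obtain U \<phi> where U: "(U, \<phi>) \<in> atlas M" "a \<in> U" using chart_exists[OF M a] .
  obtain R where R: "R > 0" "cball (\<phi> a) R \<subseteq> \<phi> ` U" "(u \<circ> inv_into U \<phi>) plurisubharmonic_on \<phi> ` U"
    "\<And>w. w \<in> \<phi> ` U \<Longrightarrow> (u \<circ> inv_into U \<phi>) w \<le> 0" using PSH_in_chart[OF M u U] by metis
  obtain \<rho> where \<rho>: "\<rho> > 0" "\<And>x. x \<in> U \<Longrightarrow> 0 < norm (\<phi> x - \<phi> a) \<Longrightarrow> norm (\<phi> x - \<phi> a) < \<rho> \<Longrightarrow> u x \<le> ereal (1/2 * ln (norm (\<phi> x - \<phi> a)))"
    using log_poleD[OF lp _ _ U, of "1/2"] by auto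
  have "u a \<le> ereal A" for A
  proof -
    define r where "r = min (min R (\<rho> / 2)) (exp (2 * A))"
    have r: "0 < r" "r \<le> R" "r < \<rho>" "r \<le> exp (2 * A)" using R(1) \<rho>(1) by (auto simp: r_def)
    have sub: "cball (\<phi> a) r \<subseteq> \<phi> ` U" using R(2) r(2) subset_cball by blast
    have "sphere_sup (u \<circ> inv_into U \<phi>) (\<phi> a) r \<le> ereal A"
      unfolding sphere_sup_def
    proof (rule SUP_least)
      fix w assume w: "w \<in> sphere (\<phi> a) r"
      then have "w \<in> \<phi> ` U" using sub by auto
      then have x: "inv_into U \<phi> w \<in> U" "\<phi> (inv_into U \<phi> w) = w" using chart_inv(2,3)[OF M U(1)] by auto
      have "norm (\<phi> (inv_into U \<phi> w) - \<phi> a) = r" using w x(2) by (simp add: dist_norm norm_minus_commute)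
      then have "(u \<circ> inv_into U \<phi>) w \<le> ereal (1/2 * ln r)" using \<rho>(2)[OF x(1)] r by simp
      moreover have "ln r \<le> 2 * A" using r(1,4) by (metis ln_exp ln_le_cancel_iff exp_gt_zero)
      ultimately show "(u \<circ> inv_into U \<phi>) w \<le> ereal A" by (elim order_trans) simp
    qed
    from psh_ball_bound[OF R(3) sub this, of "\<phi> a"] show ?thesis using r(1) chart_inv(1)[OF M U] by simp
  qed
  then show ?thesis by (rule ereal_bot)
qed

section \<open>Green functions\<close>

lemma no_harmonic_peak_local:
  assumes "\<And>z. z \<in> S \<Longrightarrow> \<exists>r>0. no_harmonic_peak v (ball z r)"
  shows "no_harmonic_peak v S"
proof (rule no_harmonic_peakI)
  fix z0 \<rho> H \<epsilon>
  assume a: "\<rho> > 0" "ball z0 \<rho> \<subseteq> S" "H holomorphic_on ball z0 \<rho>" "\<epsilon> > 0" "\<bar>v z0\<bar> \<noteq> \<infinity>"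
    "\<And>z. z \<in> ball z0 \<rho> \<Longrightarrow> v z \<le> v z0 + ereal (Re (H z) - Re (H z0) - \<epsilon> * (cmod (z - z0))\<^sup>2)"
  have "z0 \<in> S" using a(1,2) centre_in_ball by blast
  then obtain r where r: "r > 0" "no_harmonic_peak v (ball z0 r)" using assms by blast
  have sub: "ball z0 (min \<rho> r) \<subseteq> ball z0 r" "ball z0 (min \<rho> r) \<subseteq> ball z0 \<rho>" by auto
  show False
  proof (rule no_harmonic_peakD[OF r(2) _ sub(1) holomorphic_on_subset[OF a(3) sub(2)] a(4,5)])
    show "0 < min \<rho> r" using a(1) r(1) by simp
    show "v z \<le> v z0 + ereal (Re (H z) - Re (H z0) - \<epsilon> * (cmod (z - z0))\<^sup>2)" if "z \<in> ball z0 (min \<rho> r)" for z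
      using a(6) sub(2) that by blast
  qed
qed

lemma no_harmonic_peak_cong:
  assumes "no_harmonic_peak v S" "\<And>z. z \<in> S \<Longrightarrow> w z = v z"
  shows "no_harmonic_peak w S"
proof (rule no_harmonic_peakI)
  fix z0 \<rho> H \<epsilon>
  assume a: "\<rho> > 0" "ball z0 \<rho> \<subseteq> S" "H holomorphic_on ball z0 \<rho>" "\<epsilon> > 0" "\<bar>w z0\<bar> \<noteq> \<infinity>"
    "\<And>z. z \<in> ball z0 \<rho> \<Longrightarrow> w z \<le> w z0 + ereal (Re (H z) - Re (H z0) - \<epsilon> * (cmod (z - z0))\<^sup>2)"
  have e: "w z = v z" if "z \<in> ball z0 \<rho>" for z using assms(2) a(2) that by blast
  have e0: "w z0 = v z0" using e[of z0] a(1) by simp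
  show False
  proof (rule no_harmonic_peakD[OF assms(1) a(1-4)])
    show "\<bar>v z0\<bar> \<noteq> \<infinity>" using a(5) e0 by simp
    show "v z \<le> v z0 + ereal (Re (H z) - Re (H z0) - \<epsilon> * (cmod (z - z0))\<^sup>2)" if "z \<in> ball z0 \<rho>" for z
      using a(6)[OF that] e[OF that] e0 by simp
  qed
qed

lemma usc_compose_continuous:
  assumes u: "usc T u" and p: "continuous_map X T p" and w: "\<And>x. x \<in> topspace X \<Longrightarrow> w x = u (p x)"
  shows "usc X w"
proof -
  have pt: "p x \<in> topspace T" if "x \<in> topspace X" for x using p that by (auto simp: continuous_map_def)
  have us: "u x \<noteq> \<infinity>" if "x \<in> topspace T" for x using u that by (simp add: usc_def)
  have uo: "openin T {x \<in> topspace T. u x < d}" for d using u by (simp add: usc_def)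
  show ?thesis
    unfolding usc_def
  proof (intro conjI ballI allI)
    show "w x \<noteq> \<infinity>" if "x \<in> topspace X" for x using us[OF pt[OF that]] w[OF that] by simp
    fix d
    have "{x \<in> topspace X. p x \<in> {x \<in> topspace T. u x < d}} = {x \<in> topspace X. w x < d}" using w pt by auto
    then show "openin X {x \<in> topspace X. w x < d}" using openin_continuous_map_preimage[OF p uo[of d]] by simp
  qed
qed

lemma PSH_compose_disc:
  fixes M :: "('a, 'n::finite) manifold"
  assumes M: "charted M" and u: "u \<in> PSH M" and g: "holomorphic_into M g S" "open S"
  shows "no_harmonic_peak (\<lambda>z. u (g z)) S" "usc (top_of_set S) (\<lambda>z. u (g z))"
proof -
  show "no_harmonic_peak (\<lambda>z. u (g z)) S"
  proof (rule no_harmonic_peak_local)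
    fix z assume z: "z \<in> S"
    obtain U and \<phi> :: "'a \<Rightarrow> complex ^ 'n" where U: "(U, \<phi>) \<in> atlas M" "g z \<in> U"
      by (rule chart_exists[OF M holomorphic_into_points[OF g(1) z]])
    show "\<exists>r>0. no_harmonic_peak (\<lambda>z. u (g z)) (ball z r)"
    proof (rule holomorphic_into_chart_ball[OF M g U(1) z U(2)])
      fix r assume r: "r > 0" "ball z r \<subseteq> S" "\<And>w. w \<in> ball z r \<Longrightarrow> g w \<in> U"
        "\<And>i. (\<lambda>w. \<phi> (g w) $ i) holomorphic_on ball z r"
      have img: "(\<lambda>w. \<phi> (g w)) ` ball z r \<subseteq> \<phi> ` U" using r(3) by blast
      have "no_harmonic_peak (\<lambda>w. (u \<circ> inv_into U \<phi>) (\<phi> (g w))) (ball z r)"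
        by (rule plurisubharmonic_compose_disc[OF PSHD(2)[OF u U(1)] chart_open_image[OF M U(1)] r(4) open_ball img])
      then have "no_harmonic_peak (\<lambda>z. u (g z)) (ball z r)"
        by (rule no_harmonic_peak_cong) (simp add: chart_inv(1)[OF M U(1)] r(3))
      then show ?thesis using r(1) by blast
    qed
  qed
  have "continuous_map (top_of_set S) (mtop M) g" using g(1) by (simp add: holomorphic_into_def)
  then show "usc (top_of_set S) (\<lambda>z. u (g z))" by (rule usc_compose_continuous[OF PSHD(1)[OF u] _ refl])
qed

text \<open>At a hit of order \<open>n\<close>, \<open>u \<circ> g\<close> is at most \<open>c' n ln \<bar>z - a\<bar>\<close> up to a constant for every \<open>c' < 1\<close>, and \<open>ln \<bar>b\<bar>\<close> for the
Blaschke product \<open>b\<close> differs from \<open>n ln \<bar>z - a\<bar>\<close> by a bounded function. A slope \<open>c'\<close> between \<open>c\<close> and \<open>1\<close> takes care of both constants.\<close>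

lemma PSH_near_hit:
  fixes M :: "('a, 'n::finite) manifold"
  assumes M: "charted M" and u: "u \<in> PSH M" "\<And>y. y \<in> points M \<Longrightarrow> u y \<le> 0" and w: "weighted_points F k" and a: "a \<in> F"
    and lp: "log_pole M u (g a)" and co: "contact_at_least M g a (k a)" and c: "0 < c" "c < 1"
  shows "\<exists>\<delta>>0. \<forall>z. 0 < cmod (z - a) \<and> cmod (z - a) < \<delta> \<longrightarrow> u (g z) \<le> ereal (c * ln (cmod (blaschke F k z)))"
proof -
  define n where "n = k a"
  have n: "n > 0" using weighted_pointsD(5)[OF w a] by (simp add: n_def)
  obtain U and \<phi> :: "'a \<Rightarrow> complex ^ 'n" and C0 where U: "(U, \<phi>) \<in> atlas M" "g a \<in> U"
    and C0: "\<forall>\<^sub>F w in nhds a. g w \<in> U \<and> norm (\<phi> (g w) - \<phi> (g a)) \<le> C0 * cmod (w - a) ^ n"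
    using co unfolding contact_at_least_def n_def by auto
  have pt: "g a \<in> points M" using chart_subset[OF M U(1)] U(2) by blast
  define C where "C = max C0 1"
  have C: "C > 0" "C0 \<le> C" by (auto simp: C_def)
  obtain \<delta>1 where d1: "\<delta>1 > 0" "\<forall>w. dist w a < \<delta>1 \<longrightarrow> g w \<in> U \<and> norm (\<phi> (g w) - \<phi> (g a)) \<le> C0 * cmod (w - a) ^ n"
    using C0 unfolding eventually_nhds_metric by blast
  define c' where "c' = (1 + c) / 2"
  have c': "0 < c'" "c' < 1" "c < c'" using c by (auto simp: c'_def)
  obtain \<rho> where rho: "\<rho> > 0" "\<And>x. x \<in> U \<Longrightarrow> 0 < norm (\<phi> x - \<phi> (g a)) \<Longrightarrow> norm (\<phi> x - \<phi> (g a)) < \<rho> \<Longrightarrow>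
      u x \<le> ereal (c' * ln (norm (\<phi> x - \<phi> (g a))))"
    using log_poleD[OF lp c'(1,2) U] by metis
  obtain h r where h: "r > 0" "h holomorphic_on ball a r" "h a \<noteq> 0" "\<And>z. z \<in> ball a r \<Longrightarrow> blaschke F k z = (z - a) ^ k a * h z"
    using blaschke_factor[OF w a] by metis
  define \<eta> where "\<eta> = cmod (h a) / 2"
  have eta: "\<eta> > 0" "\<eta> < cmod (h a)" using h(3) by (auto simp: \<eta>_def)
  have "isCont h a" using holomorphic_on_imp_continuous_on[OF h(2)] h(1) by (simp add: continuous_on_eq_continuous_at)
  then have "((\<lambda>z. cmod (h z)) \<longlongrightarrow> cmod (h a)) (at a)" by (intro tendsto_norm) (simp add: isCont_def)
  from order_tendstoD(1)[OF this eta(2)] obtain \<delta>2 where d2: "\<delta>2 > 0" "\<forall>z. z \<noteq> a \<and> dist z a < \<delta>2 \<longrightarrow> \<eta> < cmod (h z)"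
    unfolding eventually_at by auto
  have "0 < c * real n" "c * real n < c' * real n" using c c' n by simp_all
  from log_le_smaller_slope[OF this, of "c' * ln C - c * ln \<eta>"]
  obtain \<delta>3 where d3: "\<delta>3 > 0" "\<forall>t. 0 < t \<and> t < \<delta>3 \<longrightarrow> c' * real n * ln t + (c' * ln C - c * ln \<eta>) \<le> c * real n * ln t" by blast
  define \<delta> where "\<delta> = min (min (min \<delta>1 \<delta>2) (min \<delta>3 r)) (min 1 (\<rho> / C))"
  have d: "\<delta> > 0" "\<delta> \<le> \<delta>1" "\<delta> \<le> \<delta>2" "\<delta> \<le> \<delta>3" "\<delta> \<le> r" "\<delta> \<le> 1" "\<delta> \<le> \<rho> / C"
    using d1(1) d2(1) d3(1) h(1) rho(1) C(1) by (auto simp: \<delta>_def)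
  show ?thesis
  proof (intro exI[of _ \<delta>] conjI d(1) allI impI)
    fix z assume z: "0 < cmod (z - a) \<and> cmod (z - a) < \<delta>"
    define t where "t = cmod (z - a)"
    have t: "0 < t" "t < \<delta>" using z by (auto simp: t_def)
    have dz: "dist z a = t" by (simp add: t_def dist_norm)
    have gz: "g z \<in> U" "norm (\<phi> (g z) - \<phi> (g a)) \<le> C0 * t ^ n" using d1(2) dz t d(2) by (auto simp: t_def)
    define m where "m = norm (\<phi> (g z) - \<phi> (g a))"
    have m1: "m \<le> C * t ^ n"
    proof -
      have "C0 * t ^ n \<le> C * t ^ n" using C(2) t(1) by (intro mult_right_mono) simp_all
      then show ?thesis using gz(2) by (simp add: m_def)
    qed
    have "t ^ n \<le> t ^ 1" using n t d(6) by (intro power_decreasing) auto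
    then have "C * t ^ n \<le> C * t" using C(1) by simp
    also have "C * t < C * \<delta>" using t(2) C(1) by simp
    also have "C * \<delta> \<le> \<rho>" using d(7) C(1) by (simp add: field_simps)
    finally have m2: "m < \<rho>" using m1 by simp
    show "u (g z) \<le> ereal (c * ln (cmod (blaschke F k z)))"
    proof (cases "m = 0")
      case True
      then have "g z = g a" using inj_onD[OF chart_inj[OF M U(1)] _ gz(1) U(2)] by (simp add: m_def)
      then show ?thesis using log_pole_value[OF M u pt lp] by simp
    next
      case False
      then have m0: "0 < m" by (simp add: m_def)
      have "u (g z) \<le> ereal (c' * ln m)" using rho(2)[OF gz(1)] m0 m2 by (simp add: m_def)
      moreover have "ln m \<le> ln (C * t ^ n)" using m0 m1 by (meson ln_le_cancel_iff order_less_le_trans)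
      moreover have "ln (C * t ^ n) = ln C + real n * ln t" using C(1) t(1) by (simp add: ln_mult ln_realpow)
      ultimately have 1: "u (g z) \<le> ereal (c' * (ln C + real n * ln t))"
        using mult_left_mono[of "ln m" "ln C + real n * ln t" c'] c'(1) by (elim order_trans) simp
      have e: "\<eta> < cmod (h z)" using d2(2) dz t d(3) by (auto simp: t_def)
      have "z \<in> ball a r" using t d(5) by (simp add: t_def dist_norm norm_minus_commute)
      from h(4)[OF this] have "cmod (blaschke F k z) = t ^ n * cmod (h z)" by (simp add: norm_mult norm_power t_def n_def)
      then have "ln (cmod (blaschke F k z)) = real n * ln t + ln (cmod (h z))"

      proof -
        have "h z \<noteq> 0" using e eta(1) by auto
        then show ?thesis using \<open>cmod (blaschke F k z) = t ^ n * cmod (h z)\<close> t(1) by (simp add: ln_mult ln_realpow)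
      qed
      moreover have "ln \<eta> \<le> ln (cmod (h z))" using e eta(1) by (meson ln_le_cancel_iff order_less_trans less_imp_le)
      ultimately have "c * (real n * ln t + ln \<eta>) \<le> c * ln (cmod (blaschke F k z))" using c(1) by simp
      moreover have "c' * real n * ln t + (c' * ln C - c * ln \<eta>) \<le> c * real n * ln t" using d3(2) t d(4) by simp
      ultimately have "c' * (ln C + real n * ln t) \<le> c * ln (cmod (blaschke F k z))" by (simp add: algebra_simps)
      then show ?thesis using 1 by (elim order_trans) simp
    qed
  qed
qed

lemma ereal_le_of_slopes:
  fixes x :: ereal and s :: real
  assumes s: "s \<le> 0" and h: "\<And>c. 0 < c \<Longrightarrow> c < 1 \<Longrightarrow> x \<le> ereal (c * s)"
  shows "x \<le> ereal s"
proof (cases x)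
  case (real r)
  have r: "r \<le> c * s" if "0 < c" "c < 1" for c using h[OF that] real by simp
  show ?thesis
  proof (rule ccontr)
    assume "\<not> x \<le> ereal s"
    then have sr: "s < r" using real by simp
    have "r \<le> s / 2" using r[of "1/2"] by simp
    then have s0: "s < 0" using sr by simp
    then have r0: "r < 0" using \<open>r \<le> s / 2\<close> by simp
    have "0 < r / s" "r / s < 1" using r0 s0 sr by (simp_all add: divide_neg_neg neg_divide_less_eq)
    then have "r \<le> ((1 + r / s) / 2) * s" by (intro r) simp_all
    also have "((1 + r / s) / 2) * s = (s + r) / 2" using s0 by (simp add: field_simps)
    finally show False using sr by simp
  qed
qed (use h[of "1/2"] in auto)

text \<open>The function \<open>c ln \<bar>b\<bar>\<close>, where \<open>b\<close> is the Blaschke product of the hits and \<open>c < 1\<close>, is harmonic away from the hits, vanishes on the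
unit circle and dominates \<open>u \<circ> g\<close> near the hits. By the maximum principle it dominates \<open>u \<circ> g\<close> at \<open>0\<close>, where
its value is \<open>c\<close> times the sum.\<close>

lemma PSH_le_sum_of_hits:
  fixes M :: "('a, 'n::finite) manifold"
  assumes M: "charted M" and u: "u \<in> PSH M" "\<And>y. y \<in> points M \<Longrightarrow> u y \<le> 0" and w: "weighted_points F k"
    and g: "holomorphic_into M g S" "open S" "cball 0 1 \<subseteq> S"
    and hit: "\<And>a. a \<in> F \<Longrightarrow> log_pole M u (g a)" "\<And>a. a \<in> F \<Longrightarrow> contact_at_least M g a (k a)"
  shows "u (g 0) \<le> ereal (\<Sum>a\<in>F. real (k a) * ln (cmod a))"
proof (rule ereal_le_of_slopes)
  note wp = weighted_pointsD[OF w]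
  show "(\<Sum>a\<in>F. real (k a) * ln (cmod a)) \<le> 0"
  proof (rule sum_nonpos)
    fix a assume a: "a \<in> F"
    show "real (k a) * ln (cmod a) \<le> 0" using wp(3)[OF a] wp(4)[OF a] by (intro mult_nonneg_nonpos) auto
  qed
  fix c :: real assume c: "0 < c" "c < 1"
  have "\<forall>a\<in>F. \<exists>\<delta>>0. \<forall>z. 0 < cmod (z - a) \<and> cmod (z - a) < \<delta> \<longrightarrow> u (g z) \<le> ereal (c * ln (cmod (blaschke F k z)))"
    using PSH_near_hit[OF M u w _ hit c] by blast
  then obtain \<delta> where \<delta>: "\<And>a. a \<in> F \<Longrightarrow> \<delta> a > 0"
      "\<And>a z. a \<in> F \<Longrightarrow> 0 < cmod (z - a) \<Longrightarrow> cmod (z - a) < \<delta> a \<Longrightarrow> u (g z) \<le> ereal (c * ln (cmod (blaschke F k z)))"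
    by metis
  \<comment> \<open>discs of this radius around the hits do not contain \<open>0\<close>, and the bounds near the hits hold on their boundaries\<close>
  define d where "d = Min ((\<lambda>a. min (\<delta> a) (cmod a)) ` F) / 2"
  have fin: "finite ((\<lambda>a. min (\<delta> a) (cmod a)) ` F)" "(\<lambda>a. min (\<delta> a) (cmod a)) ` F \<noteq> {}" using wp(1,2) by auto
  have "0 < Min ((\<lambda>a. min (\<delta> a) (cmod a)) ` F)" using \<delta>(1) wp(4) by (simp add: Min_gr_iff[OF fin])
  then have d0: "d > 0" by (simp add: d_def)
  have d: "d < \<delta> a" "d < cmod a" if a: "a \<in> F" for a
  proof -
    have "Min ((\<lambda>a. min (\<delta> a) (cmod a)) ` F) \<le> min (\<delta> a) (cmod a)" using fin a by (intro Min_le) auto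
    then show "d < \<delta> a" "d < cmod a" using d0 by (auto simp: d_def)
  qed
  define K where "K = cball 0 1 - (\<Union>a\<in>F. ball a d)"
  define V where "V = ball 0 1 - (\<Union>a\<in>F. cball a d)"
  have K: "compact K" unfolding K_def by (intro compact_diff compact_cball open_UN ballI open_ball)
  have V: "open V" unfolding V_def using wp(1) by (intro open_Diff open_ball closed_UN ballI closed_cball)
  have VK: "V \<subseteq> K" unfolding V_def K_def using ball_subset_cball by blast
  have KF: "a \<notin> K" if "a \<in> F" for a using d0 that centre_in_ball[of a d] unfolding K_def by blast
  have b0: "blaschke F k z \<noteq> 0" if "z \<in> K" for z
  proof (cases "cmod z < 1")
    case True
    then show ?thesis using blaschke_norm(3)[OF w] KF that by blast
  next
    case False
    then have "cmod z = 1" using that by (simp add: K_def)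
    then show ?thesis using blaschke_norm(1)[OF w, of z] by auto
  qed
  obtain R where R: "R > 1" "blaschke F k holomorphic_on ball 0 R" using blaschke_holomorphic[OF w] by metis
  have KR: "K \<subseteq> ball 0 R" unfolding K_def using R(1) by auto
  have KS: "K \<subseteq> S" unfolding K_def using g(3) by auto
  have "u (g 0) \<le> ereal (c * ln (cmod (blaschke F k 0)))"
  proof (rule maximum_principle[OF K VK usc_imp_usc_on[OF PSH_compose_disc(2)[OF M u(1) g(1,2)] KS]
        no_harmonic_peak_subset[OF PSH_compose_disc(1)[OF M u(1) g(1,2)]]])
    show "V \<subseteq> S" using VK KS by blast
    show "continuous_on K (\<lambda>z. c * ln (cmod (blaschke F k z)))"
      using b0 holomorphic_on_imp_continuous_on[OF holomorphic_on_subset[OF R(2) KR]]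
      by (intro continuous_intros continuous_on_ln) auto
    show "\<exists>\<rho>>0. ball z0 \<rho> \<subseteq> V \<and> (\<exists>H. H holomorphic_on ball z0 \<rho> \<and> (\<forall>z\<in>ball z0 \<rho>. c * ln (cmod (blaschke F k z)) = Re (H z)))"
      if z0: "z0 \<in> V" for z0
    proof -
      obtain \<rho> where \<rho>: "\<rho> > 0" "ball z0 \<rho> \<subseteq> V" using openE[OF V z0] by blast
      have hol: "blaschke F k holomorphic_on ball z0 \<rho>" using holomorphic_on_subset[OF R(2)] \<rho>(2) VK KR by blast
      have nz: "blaschke F k z \<noteq> 0" if "z \<in> ball z0 \<rho>" for z using b0 \<rho>(2) VK that by blast
      obtain H where H: "H holomorphic_on ball z0 \<rho>" "\<And>z. z \<in> ball z0 \<rho> \<Longrightarrow> ln (cmod (blaschke F k z)) = Re (H z)"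
        using log_norm_harmonic[OF hol nz] by metis
      have "(\<lambda>z. of_real c * H z) holomorphic_on ball z0 \<rho>" using H(1) by (intro holomorphic_intros)
      moreover have "\<forall>z\<in>ball z0 \<rho>. c * ln (cmod (blaschke F k z)) = Re (of_real c * H z)" using H(2) by simp
      ultimately show ?thesis using \<rho> by blast
    qed
    show "u (g z) \<le> ereal (c * ln (cmod (blaschke F k z)))" if z: "z \<in> K - V" for z
    proof (cases "cmod z = 1")
      case True
      then have "u (g z) \<le> 0" using u(2) holomorphic_into_points[OF g(1)] z KS by blast
      then show ?thesis using blaschke_norm(1)[OF w True] by (simp add: zero_ereal_def)
    next
      case False
      then have "cmod z < 1" using z by (simp add: K_def)
      then obtain a where a: "a \<in> F" "z \<in> cball a d" "z \<notin> ball a d" using z by (auto simp: K_def V_def)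
      then have "cmod (z - a) = d" by (simp add: dist_norm norm_minus_commute)
      then have "0 < cmod (z - a)" "cmod (z - a) < \<delta> a" using d0 d(1)[OF a(1)] by auto
      then show ?thesis by (rule \<delta>(2)[OF a(1)])
    qed
    show "0 \<in> K" using d(2) by (force simp: K_def)
  qed
  also have "ln (cmod (blaschke F k 0)) = (\<Sum>a\<in>F. real (k a) * ln (cmod a))"
    using sum_log_eq_prod[of F k] w blaschke_norm(4)[OF w] by (metis ln_exp weighted_points_def)
  finally show "u (g 0) \<le> ereal (c * (\<Sum>a\<in>F. real (k a) * ln (cmod a)))" .
qed

text \<open>For a disc centred in \<open>A\<close>, \<open>u\<close> itself is \<open>-\<infinity>\<close> at the centre. Other discs with hits are not constant and have finite multiplicities.\<close>

lemma PSH_le_lelong_envelope: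
  fixes M :: "('a, 'n::finite) manifold"
  assumes M: "charted M" and u: "u \<in> PSH M" "\<And>y. y \<in> points M \<Longrightarrow> u y \<le> 0"
    and lp: "\<And>a. a \<in> A \<Longrightarrow> a \<in> points M \<Longrightarrow> log_pole M u a"
  shows "u x \<le> lelong_envelope M (indicator A) x"
  unfolding lelong_envelope_def
proof (rule INF_greatest)
  fix f assume "f \<in> {f \<in> closed_discs M. f 0 = x}"
  then have f: "f \<in> closed_discs M" "f 0 = x" by auto
  obtain g S where g: "open S" "cball 0 1 \<subseteq> S" "holomorphic_into M g S" "\<And>z. z \<in> ball 0 1 \<Longrightarrow> f z = g z"
    using f(1) unfolding closed_discs_def by blast
  have fb: "holomorphic_into M f (ball 0 1)" by (rule closed_discs_holomorphic_into[OF f(1)])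
  note pts = holomorphic_into_points[OF fb]
  have fg: "f 0 = g 0" using g(4)[of 0] by simp
  show "u x \<le> lelong_functional M (indicator A) f"
    unfolding lelong_functional_def
  proof (rule INF_greatest)
    fix F :: "complex set" assume "F \<in> {F. finite F \<and> F \<subseteq> ball 0 1}"
    then have F: "finite F" "F \<subseteq> ball 0 1" by auto
    show "u x \<le> (\<Sum>z\<in>F. lelong_term M (indicator A) f z)"
    proof (cases "f 0 \<in> A")
      case True
      then have "u x = -\<infinity>" using log_pole_value[OF M u _ lp] f(2) pts[of 0] by simp
      then show ?thesis by simp
    next
      case nA: False
      define F' where "F' = {z \<in> F. f z \<in> A}"
      have sum: "(\<Sum>z\<in>F. lelong_term M (indicator A) f z) = (\<Sum>z\<in>F'. lelong_term M (indicator A) f z)"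
        by (rule sum.mono_neutral_right) (use F(1) in \<open>auto simp: F'_def lelong_term_def\<close>)
      show ?thesis
      proof (cases "F' = {}")
        case True
        then show ?thesis using sum u(2)[of x] f(2) pts[of 0] by simp
      next
        case False
        have nc: "\<not> f constant_on ball 0 1"
        proof
          assume "f constant_on ball 0 1"
          then have "f z = f 0" if "z \<in> F'" for z using that F(2) unfolding constant_on_def F'_def by force
          then show False using False nA by (auto simp: F'_def)
        qed
        have "\<forall>z\<in>F'. \<exists>k>0. contact_at_least M f z k \<and> lelong_term M (indicator A) f z = ereal (real k * ln (cmod z))"
        proof
          fix z assume z: "z \<in> F'"
          then have zb: "z \<in> ball 0 1" "z \<noteq> 0" "f z \<in> A" using F(2) nA by (auto simp: F'_def)
          show "\<exists>k>0. contact_at_least M f z k \<and> lelong_term M (indicator A) f z = ereal (real k * ln (cmod z))"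
            by (rule lelong_term_nonconstant[OF M fb nc zb]) blast
        qed
        then obtain k where k: "\<And>z. z \<in> F' \<Longrightarrow> k z > 0" "\<And>z. z \<in> F' \<Longrightarrow> contact_at_least M f z (k z)"
          "\<And>z. z \<in> F' \<Longrightarrow> lelong_term M (indicator A) f z = ereal (real (k z) * ln (cmod z))"
          by metis
        have w: "weighted_points F' k" using F nA False k(1) by (auto simp: weighted_points_def F'_def)
        have "u (g 0) \<le> ereal (\<Sum>a\<in>F'. real (k a) * ln (cmod a))"
        proof (rule PSH_le_sum_of_hits[OF M u w g(3,1,2)])
          fix a assume a: "a \<in> F'"
          then have ab: "a \<in> ball 0 1" using F(2) by (auto simp: F'_def)
          then show "log_pole M u (g a)" using lp[of "f a"] pts[OF ab] g(4)[OF ab] a by (simp add: F'_def)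
          have "\<forall>\<^sub>F w in nhds a. w \<in> ball 0 1" using ab by (intro eventually_nhds_in_open) auto
          then have "\<forall>\<^sub>F w in nhds a. f w = g w" by eventually_elim (rule g(4))
          then show "contact_at_least M g a (k a)" by (rule contact_at_least_cong[OF k(2)[OF a]])
        qed
        also have "\<dots> = (\<Sum>z\<in>F'. lelong_term M (indicator A) f z)" using k(3) by (simp add: sum_ereal[symmetric] del: sum_ereal)
        finally show ?thesis using sum f(2) fg by simp
      qed
    qed
  qed
qed

lemma affine_line_has_derivative:
  fixes p v :: "complex ^ 'n"
  shows "((\<lambda>z. p + z *s v) has_derivative (\<lambda>t. t *s v)) (at z)"
proof -
  have "bounded_linear (\<lambda>t. t *s v)"
  proof (rule bounded_linear_intro[where K = "norm v"])
    show "(x + y) *s v = x *s v + y *s v" for x y by (simp add: vec_eq_iff distrib_right)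
    show "(r *\<^sub>R x) *s v = r *\<^sub>R (x *s v)" for r x by (simp add: vec_eq_iff)
    show "norm (x *s v) \<le> norm x * norm v" for x by (simp add: norm_vector_smult)
  qed
  from has_derivative_add[OF has_derivative_const bounded_linear_imp_has_derivative[OF this]]
  show ?thesis by simp
qed

lemma holomorphic_into_chart_line:
  fixes M :: "('a, 'n::finite) manifold" and \<phi> :: "'a \<Rightarrow> complex ^ 'n"
  assumes M: "charted M" and U: "(U, \<phi>) \<in> atlas M" and S: "open S" and sub: "\<And>z. z \<in> S \<Longrightarrow> p + z *s v \<in> \<phi> ` U"
  shows "holomorphic_into M (\<lambda>z. inv_into U \<phi> (p + z *s v)) S"
proof -
  define l where "l z = p + z *s v" for z
  have dl: "(l has_derivative (\<lambda>t. t *s v)) (at z)" for z unfolding l_def by (rule affine_line_has_derivative)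
  have cl: "continuous_on S l" using dl by (auto intro!: continuous_at_imp_continuous_on has_derivative_continuous)
  have lU: "l z \<in> \<phi> ` U" if "z \<in> S" for z using sub[OF that] by (simp add: l_def)
  have iff: "inv_into U \<phi> (l z) \<in> W \<longleftrightarrow> l z \<in> \<phi> ` (U \<inter> W)" if z: "z \<in> S" for z W
  proof
    assume "inv_into U \<phi> (l z) \<in> W"
    then show "l z \<in> \<phi> ` (U \<inter> W)" using chart_inv(2,3)[OF M U lU[OF z]] by force
  next
    assume "l z \<in> \<phi> ` (U \<inter> W)"
    then show "inv_into U \<phi> (l z) \<in> W" using chart_inv(1)[OF M U] by auto
  qed
  have pre: "{z \<in> S. inv_into U \<phi> (l z) \<in> W} = S \<inter> l -` (\<phi> ` (U \<inter> W))" for W using iff by blast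
  have "holomorphic_into M (\<lambda>z. inv_into U \<phi> (l z)) S"
    unfolding holomorphic_into_def
  proof (intro conjI)
    show "continuous_map (top_of_set S) (mtop M) (\<lambda>z. inv_into U \<phi> (l z))"
      unfolding continuous_map
    proof (intro conjI allI impI)
      show "(\<lambda>z. inv_into U \<phi> (l z)) ` topspace (top_of_set S) \<subseteq> points M"
        using chart_inv(3)[OF M U lU] chart_subset[OF M U] by auto
      fix W assume W: "openin (mtop M) W"
      show "openin (top_of_set S) {z \<in> topspace (top_of_set S). inv_into U \<phi> (l z) \<in> W}"
        using continuous_openin_preimage_gen[OF cl chart_image_open[OF M U W]] pre[of W] by simp
    qed
    show "\<forall>(V, \<psi>)\<in>atlas M. \<forall>i. (\<lambda>z. \<psi> (inv_into U \<phi> (l z)) $ i) holomorphic_on {z \<in> S. inv_into U \<phi> (l z) \<in> V}"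
    proof (clarify)
      fix V i and \<psi> :: "'a \<Rightarrow> complex ^ 'n" assume V: "(V, \<psi>) \<in> atlas M"
      show "(\<lambda>z. \<psi> (inv_into U \<phi> (l z)) $ i) holomorphic_on {z \<in> S. inv_into U \<phi> (l z) \<in> V}"
        unfolding holomorphic_on_def field_differentiable_def
      proof
        fix z assume z: "z \<in> {z \<in> S. inv_into U \<phi> (l z) \<in> V}"
        have lz: "l z \<in> \<phi> ` (U \<inter> V)" using z iff by blast
        have op: "open (\<phi> ` (U \<inter> V))" by (rule chart_image_open[OF M U chart_openin[OF M V]])
        obtain D where D: "((\<psi> \<circ> inv_into U \<phi>) has_derivative D) (at (l z))" "\<And>c v. D (c *s v) = c *s D v"
          using chart_transition[OF M U V] lz at_within_open[OF lz op] unfolding holomorphic_map_on_def by metis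
        have "((\<lambda>z. (\<psi> \<circ> inv_into U \<phi>) (l z)) has_derivative (\<lambda>t. D (t *s v))) (at z)"
          by (rule has_derivative_compose[OF dl D(1)])
        then have "((\<lambda>z. (\<psi> \<circ> inv_into U \<phi>) (l z) $ i) has_derivative (\<lambda>t. D (t *s v) $ i)) (at z)"
          by (rule bounded_linear.has_derivative[OF bounded_linear_vec_nth])
        moreover have "(\<lambda>t. D (t *s v) $ i) = (*) (D v $ i)" using D(2) by (simp add: fun_eq_iff mult.commute)
        ultimately have "((\<lambda>z. \<psi> (inv_into U \<phi> (l z)) $ i) has_field_derivative (D v $ i)) (at z)"
          by (simp add: has_field_derivative_def)
        then show "\<exists>f'. ((\<lambda>z. \<psi> (inv_into U \<phi> (l z)) $ i) has_field_derivative f') (at z within {z \<in> S. inv_into U \<phi> (l z) \<in> V})"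
          using has_field_derivative_at_within by blast
      qed
    qed
  qed
  then show ?thesis by (simp add: l_def)
qed

text \<open>The affine disc of radius \<open>R / 4\<close> in a chart, centred at \<open>x\<close> and directed towards \<open>a\<close>, passes through \<open>a\<close> at a
parameter of modulus \<open>4 \<bar>\<phi> x - \<phi> a\<bar> / R\<close>. So the envelope at \<open>x\<close> is at most \<open>ln \<bar>\<phi> x - \<phi> a\<bar>\<close> plus a constant.\<close>

lemma lelong_envelope_log_pole:
  fixes M :: "('a, 'n::finite) manifold"
  assumes M: "charted M" and a: "a \<in> points M" "a \<in> A"
  shows "log_pole M (lelong_envelope M (indicator A)) a"
proof -
  obtain U and \<phi> :: "'a \<Rightarrow> complex ^ 'n" where U: "(U, \<phi>) \<in> atlas M" "a \<in> U" by (rule chart_exists[OF M a(1)])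
  have "\<phi> a \<in> \<phi> ` U" using U(2) by blast
  then obtain R where R: "R > 0" "cball (\<phi> a) R \<subseteq> \<phi> ` U" using chart_open_image[OF M U(1)] open_contains_cball by blast
  show ?thesis
  proof (rule log_poleI[OF M U])
    fix c :: real assume c: "0 < c" "c < 1"
    obtain \<rho> where rho: "\<rho> > 0" "\<forall>t. 0 < t \<and> t < \<rho> \<longrightarrow> 1 * ln t + ln (4 / R) \<le> c * ln t"
      using log_le_smaller_slope[OF c, of "ln (4 / R)"] by blast
    show "\<exists>\<rho>>0. \<forall>x\<in>U. 0 < norm (\<phi> x - \<phi> a) \<and> norm (\<phi> x - \<phi> a) < \<rho> \<longrightarrow>
        lelong_envelope M (indicator A) x \<le> ereal (c * ln (norm (\<phi> x - \<phi> a)))"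
    proof (intro exI[of _ "min \<rho> (R / 4)"] conjI ballI impI)
      show "0 < min \<rho> (R / 4)" using rho(1) R(1) by simp
      fix x assume x: "x \<in> U" "0 < norm (\<phi> x - \<phi> a) \<and> norm (\<phi> x - \<phi> a) < min \<rho> (R / 4)"
      define n where "n = norm (\<phi> x - \<phi> a)"
      have n: "0 < n" "n < \<rho>" "n < R / 4" using x(2) by (auto simp: n_def)
      obtain b where b: "norm b = 1" "\<phi> a = \<phi> x + of_real (norm (\<phi> a - \<phi> x)) *s b" by (rule direction_exists)
      define v where "v = of_real (R / 4) *s b"
      have nv: "norm v = R / 4" using b(1) R(1) by (simp add: v_def norm_vector_smult)
      \<comment> \<open>the parameter at which the disc reaches \<open>a\<close>\<close>
      define z0 :: complex where "z0 = of_real (4 * n / R)"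
      have z0: "cmod z0 = 4 * n / R" using n(1) R(1) by (simp add: z0_def norm_mult norm_divide)
      have hit: "\<phi> x + z0 *s v = \<phi> a"
      proof -
        have "z0 *s v = of_real n *s b" unfolding z0_def v_def vector_smult_assoc of_real_mult[symmetric] using R(1) by simp
        then show ?thesis using b(2) by (simp add: n_def norm_minus_commute)
      qed
      have sub: "\<phi> x + z *s v \<in> \<phi> ` U" if "z \<in> ball 0 2" for z
      proof -
        have "norm (\<phi> x + z *s v - \<phi> a) \<le> norm (\<phi> x - \<phi> a) + norm (z *s v)"
          using norm_triangle_ineq[of "\<phi> x - \<phi> a" "z *s v"] by (simp add: algebra_simps)
        also have "norm (z *s v) \<le> 2 * (R / 4)" using that R(1) unfolding norm_vector_smult nv by (intro mult_right_mono) auto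
        finally have "norm (\<phi> x + z *s v - \<phi> a) \<le> R" using n(3) R(1) by (simp add: n_def)
        then have "\<phi> x + z *s v \<in> cball (\<phi> a) R" by (simp add: dist_norm norm_minus_commute)
        then show ?thesis using R(2) by blast
      qed
      define g where "g z = inv_into U \<phi> (\<phi> x + z *s v)" for z
      have g: "holomorphic_into M g (ball 0 2)" unfolding g_def by (rule holomorphic_into_chart_line[OF M U(1) open_ball sub])
      have g0: "g 0 = x" and gz: "g z0 = a" using chart_inv(1)[OF M U(1)] x(1) U(2) hit by (simp_all add: g_def)
      have zb: "z0 \<in> ball 0 1 - {0}"
      proof -
        have "0 < cmod z0" "cmod z0 < 1" using n R(1) unfolding z0 by simp_all
        then show ?thesis by auto
      qed
      have gU: "\<phi> (g z) = \<phi> x + z *s v" "g z \<in> U" if "z \<in> ball 0 2" for z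
        using chart_inv(2,3)[OF M U(1) sub[OF that]] by (simp_all add: g_def)
      have "contact_at_least M g z0 1"
        unfolding contact_at_least_def
      proof (intro bexI[OF _ U(1)], simp only: prod.case, intro conjI exI[of _ "R / 4"])
        show "g z0 \<in> U" using gz U(2) by simp
        have "\<forall>\<^sub>F w in nhds z0. w \<in> ball 0 2" using zb by (intro eventually_nhds_in_open) auto
        then show "\<forall>\<^sub>F w in nhds z0. g w \<in> U \<and> norm (\<phi> (g w) - \<phi> (g z0)) \<le> R / 4 * cmod (w - z0) ^ 1"
        proof eventually_elim
          case (elim w)
          have "\<phi> (g w) - \<phi> (g z0) = (\<phi> x + w *s v) - (\<phi> x + z0 *s v)" using gU(1)[OF elim] hit gz by simp
          also have "\<dots> = (w - z0) *s v" by (simp add: vec_eq_iff left_diff_distrib)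
          finally have "norm (\<phi> (g w) - \<phi> (g z0)) = norm ((w - z0) *s v)" by (rule arg_cong)
          then have "norm (\<phi> (g w) - \<phi> (g z0)) = cmod (w - z0) * (R / 4)" unfolding norm_vector_smult nv .
          then show ?case using gU(2)[OF elim] by simp
        qed
      qed
      then have "lelong_envelope M (indicator A) x \<le> ereal (\<Sum>z\<in>{z0}. real 1 * ln (cmod z))"
        using gz a(2) zb by (intro lelong_envelope_le_hits[OF M g open_ball _ g0, of "{z0}" A "\<lambda>_. 1"]) auto
      also have "(\<Sum>z\<in>{z0}. real 1 * ln (cmod z)) = 1 * ln n + ln (4 / R)"
      proof -
        have "cmod z0 = n * (4 / R)" by (simp add: z0)
        then show ?thesis using n(1) R(1) ln_mult[of n "4 / R"] by simp
      qed
      also have "ereal (1 * ln n + ln (4 / R)) \<le> ereal (c * ln n)" using rho(2) n(1,2) by (intro ereal_less_eq(3)[THEN iffD2]) blast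
      finally show "lelong_envelope M (indicator A) x \<le> ereal (c * ln (norm (\<phi> x - \<phi> a)))" by (simp add: n_def)
    qed
  qed
qed

lemma circle_mean_cong:
  assumes "\<And>z. z \<in> sphere c r \<Longrightarrow> v z = w z" "r > 0"
  shows "circle_mean v c r = circle_mean w c r"
proof -
  have "c + of_real r * cis t \<in> sphere c r" for t using assms(2) by (simp add: dist_norm norm_mult)
  then have "v (c + of_real r * cis t) = w (c + of_real r * cis t)" for t using assms(1) by blast
  then show ?thesis by (simp add: circle_mean_def)
qed

lemma subharmonic_on_restrict:
  assumes v: "v subharmonic_on S" and T: "T \<subseteq> S" "\<And>z. z \<in> T \<Longrightarrow> w z = v z"
  shows "w subharmonic_on T"
  unfolding subharmonic_on_def
proof (intro conjI allI impI)
  show "usc (top_of_set T) w"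
  proof (rule usc_compose_continuous)
    show "usc (top_of_set S) v" using v by (simp add: subharmonic_on_def)
    show "continuous_map (top_of_set T) (top_of_set S) id" using T(1) by auto
  qed (use T(2) in simp)
  fix c and r :: real assume r: "0 < r" "cball c r \<subseteq> T"
  have "w z = v z" if "z \<in> cball c r" for z using T(2) r(2) that by blast
  moreover have "v c \<le> circle_mean v c r" using v r T(1) unfolding subharmonic_on_def by blast
  ultimately show "w c \<le> circle_mean w c r" using circle_mean_cong[of c r w v] r(1) by simp
qed

lemma plurisubharmonic_compose_linear:
  fixes \<pi> :: "complex ^ 'm \<Rightarrow> complex ^ 'n"
  assumes v: "v plurisubharmonic_on W" and \<pi>: "bounded_linear \<pi>" "\<And>c x. \<pi> (c *s x) = c *s \<pi> x"
    and S: "\<And>x. x \<in> S \<Longrightarrow> \<pi> x \<in> W" "\<And>x. x \<in> S \<Longrightarrow> w x = v (\<pi> x)"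
  shows "w plurisubharmonic_on S"
  unfolding plurisubharmonic_on_def
proof (intro conjI allI)
  show "usc (top_of_set S) w"
  proof (rule usc_compose_continuous)
    show "usc (top_of_set W) v" using v by (simp add: plurisubharmonic_on_def)
    show "continuous_map (top_of_set S) (top_of_set W) \<pi>" using S(1) linear_continuous_on[OF \<pi>(1)] by auto
  qed (use S(2) in simp)
  fix a b
  have line: "\<pi> (a + t *s b) = \<pi> a + t *s \<pi> b" for t
    using linear_add[OF bounded_linear.linear[OF \<pi>(1)]] \<pi>(2) by simp
  have "(\<lambda>t. v (\<pi> a + t *s \<pi> b)) subharmonic_on {t. \<pi> a + t *s \<pi> b \<in> W}" using v by (simp add: plurisubharmonic_on_def)
  then show "(\<lambda>t. w (a + t *s b)) subharmonic_on {t. a + t *s b \<in> S}"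
  proof (rule subharmonic_on_restrict)
    show "{t. a + t *s b \<in> S} \<subseteq> {t. \<pi> a + t *s \<pi> b \<in> W}"
      using S(1) unfolding line[symmetric] by blast
    show "w (a + z *s b) = v (\<pi> a + z *s \<pi> b)" if "z \<in> {t. a + t *s b \<in> S}" for z using S(2) that line by simp
  qed
qed

text \<open>Both projections of a product are of this kind. Plurisubharmonicity and logarithmic poles
pull back along them directly by the definitions, since \<open>\<pi>\<close> maps complex lines to complex lines or points and does not increase norms.\<close>

definition linear_in_charts :: "('c, 'k::finite) manifold \<Rightarrow> ('a, 'n::finite) manifold \<Rightarrow> ('c \<Rightarrow> 'a) \<Rightarrow> bool"
  where "linear_in_charts X M p \<longleftrightarrow> continuous_map (mtop X) (mtop M) p \<and>
    (\<forall>(W, \<Phi>)\<in>atlas X. \<exists>(U, \<phi>)\<in>atlas M. \<exists>\<pi>. bounded_linear \<pi> \<and> (\<forall>c x. \<pi> (c *s x) = c *s \<pi> x) \<and>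
      (\<forall>x. norm (\<pi> x) \<le> norm x) \<and> (\<forall>x\<in>W. p x \<in> U \<and> \<phi> (p x) = \<pi> (\<Phi> x)))"

lemma linear_in_chartsE:
  fixes X :: "('c, 'k::finite) manifold" and M :: "('a, 'n::finite) manifold" and \<Phi> :: "'c \<Rightarrow> complex ^ 'k"
  assumes "linear_in_charts X M p" "(W, \<Phi>) \<in> atlas X"
  shows "\<exists>U (\<phi> :: 'a \<Rightarrow> complex ^ 'n) \<pi>. (U, \<phi>) \<in> atlas M \<and> bounded_linear \<pi> \<and> (\<forall>c x. \<pi> (c *s x) = c *s \<pi> x) \<and>
    (\<forall>x. norm (\<pi> x) \<le> norm x) \<and> (\<forall>x\<in>W. p x \<in> U \<and> \<phi> (p x) = \<pi> (\<Phi> x))"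
  using bspec[OF conjunct2[OF assms(1)[unfolded linear_in_charts_def]] assms(2)] by auto

lemma linear_in_charts_projections:
  fixes M :: "('a, 'm::finite) manifold" and N :: "('b, 'n::finite) manifold"
  shows "linear_in_charts (product_manifold M N) M fst" "linear_in_charts (product_manifold M N) N snd"
proof -
  have n: "norm (vec_fst x) \<le> norm x" "norm (vec_snd x) \<le> norm x" for x :: "complex ^ ('m + 'n)"
    using norm_vec_pair_bounds(1,2)[where x = "vec_fst x" and y = "vec_snd x"] by simp_all
  have s: "vec_fst (c *s x) = c *s vec_fst x" "vec_snd (c *s x) = c *s vec_snd x" for c and x :: "complex ^ ('m + 'n)"
    by (simp_all add: vec_fst_def vec_snd_def vec_eq_iff)
  show "linear_in_charts (product_manifold M N) M fst"
    unfolding linear_in_charts_def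
  proof (intro conjI)
    show "continuous_map (mtop (product_manifold M N)) (mtop M) fst" by (simp add: continuous_map_fst)
    show "\<forall>(W, \<Phi>)\<in>atlas (product_manifold M N). \<exists>(U, \<phi>)\<in>atlas M. \<exists>\<pi>. bounded_linear \<pi> \<and> (\<forall>c x. \<pi> (c *s x) = c *s \<pi> x) \<and>
      (\<forall>x. norm (\<pi> x) \<le> norm x) \<and> (\<forall>x\<in>W. fst x \<in> U \<and> \<phi> (fst x) = \<pi> (\<Phi> x))"
    proof (clarify)
      fix W and \<Phi> :: "'a \<times> 'b \<Rightarrow> complex ^ ('m + 'n)" assume "(W, \<Phi>) \<in> atlas (product_manifold M N)"
      then obtain U \<phi> V \<psi> where U: "(U, \<phi>) \<in> atlas M" and W: "W = U \<times> V" "\<Phi> = (\<lambda>(x, y). vec_pair (\<phi> x) (\<psi> y))"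
        unfolding product_atlas by blast
      show "\<exists>(U, \<phi>)\<in>atlas M. \<exists>\<pi>. bounded_linear \<pi> \<and> (\<forall>c x. \<pi> (c *s x) = c *s \<pi> x) \<and>
          (\<forall>x. norm (\<pi> x) \<le> norm x) \<and> (\<forall>x\<in>W. fst x \<in> U \<and> \<phi> (fst x) = \<pi> (\<Phi> x))"
        by (rule bexI[OF _ U], simp only: prod.case, rule exI[of _ vec_fst]) (auto simp: W bounded_linear_vec_fst n s)
    qed
  qed
  show "linear_in_charts (product_manifold M N) N snd"
    unfolding linear_in_charts_def
  proof (intro conjI)
    show "continuous_map (mtop (product_manifold M N)) (mtop N) snd" by (simp add: continuous_map_snd)
    show "\<forall>(W, \<Phi>)\<in>atlas (product_manifold M N). \<exists>(U, \<phi>)\<in>atlas N. \<exists>\<pi>. bounded_linear \<pi> \<and> (\<forall>c x. \<pi> (c *s x) = c *s \<pi> x) \<and>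
      (\<forall>x. norm (\<pi> x) \<le> norm x) \<and> (\<forall>x\<in>W. snd x \<in> U \<and> \<phi> (snd x) = \<pi> (\<Phi> x))"
    proof (clarify)
      fix W and \<Phi> :: "'a \<times> 'b \<Rightarrow> complex ^ ('m + 'n)" assume "(W, \<Phi>) \<in> atlas (product_manifold M N)"
      then obtain U \<phi> V \<psi> where V: "(V, \<psi>) \<in> atlas N" and W: "W = U \<times> V" "\<Phi> = (\<lambda>(x, y). vec_pair (\<phi> x) (\<psi> y))"
        unfolding product_atlas by blast
      show "\<exists>(U, \<phi>)\<in>atlas N. \<exists>\<pi>. bounded_linear \<pi> \<and> (\<forall>c x. \<pi> (c *s x) = c *s \<pi> x) \<and>
          (\<forall>x. norm (\<pi> x) \<le> norm x) \<and> (\<forall>x\<in>W. snd x \<in> U \<and> \<phi> (snd x) = \<pi> (\<Phi> x))"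
        by (rule bexI[OF _ V], simp only: prod.case, rule exI[of _ vec_snd]) (auto simp: W bounded_linear_vec_snd n s)
    qed
  qed
qed

lemma PSH_pullback:
  fixes X :: "('c, 'k::finite) manifold" and M :: "('a, 'n::finite) manifold"
  assumes X: "charted X" and M: "charted M" and p: "linear_in_charts X M p" and u: "u \<in> PSH M"
  shows "(\<lambda>x. u (p x)) \<in> PSH X"
  unfolding PSH_def
proof (intro CollectI conjI)
  show "usc (mtop X) (\<lambda>x. u (p x))"
    by (rule usc_compose_continuous[OF PSHD(1)[OF u] conjunct1[OF p[unfolded linear_in_charts_def]] refl])
  show "\<forall>(W, \<Phi>)\<in>atlas X. ((\<lambda>x. u (p x)) \<circ> inv_into W \<Phi>) plurisubharmonic_on \<Phi> ` W"
  proof (clarify)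
    fix W and \<Phi> :: "'c \<Rightarrow> complex ^ 'k" assume W: "(W, \<Phi>) \<in> atlas X"
    obtain U and \<phi> :: "'a \<Rightarrow> complex ^ 'n" and \<pi> where U: "(U, \<phi>) \<in> atlas M"
      and \<pi>: "bounded_linear \<pi>" "\<forall>c x. \<pi> (c *s x) = c *s \<pi> x" "\<forall>x\<in>W. p x \<in> U \<and> \<phi> (p x) = \<pi> (\<Phi> x)"
      using linear_in_chartsE[OF p W] by auto
    show "((\<lambda>x. u (p x)) \<circ> inv_into W \<Phi>) plurisubharmonic_on \<Phi> ` W"
    proof (rule plurisubharmonic_compose_linear[OF PSHD(2)[OF u U] \<pi>(1)])
      show "\<pi> (c *s x) = c *s \<pi> x" for c x using \<pi>(2) by blast
      fix w assume "w \<in> \<Phi> ` W"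
      then obtain x where x: "x \<in> W" "w = \<Phi> x" by blast
      have px: "p x \<in> U" "\<pi> w = \<phi> (p x)" using \<pi>(3) x by auto
      then show "\<pi> w \<in> \<phi> ` U" by blast
      show "((\<lambda>x. u (p x)) \<circ> inv_into W \<Phi>) w = (u \<circ> inv_into U \<phi>) (\<pi> w)"
        using chart_inv(1)[OF X W x(1)] chart_inv(1)[OF M U px(1)] px(2) x(2) by simp
    qed
  qed
qed

lemma log_pole_pullback:
  fixes X :: "('c, 'k::finite) manifold" and M :: "('a, 'n::finite) manifold"
  assumes X: "charted X" and M: "charted M" and p: "linear_in_charts X M p"
    and u: "u \<in> PSH M" "\<And>y. y \<in> points M \<Longrightarrow> u y \<le> 0" and a: "a \<in> points X" and lp: "log_pole M u (p a)"
  shows "log_pole X (\<lambda>x. u (p x)) a"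
proof -
  obtain W and \<Phi> :: "'c \<Rightarrow> complex ^ 'k" where W: "(W, \<Phi>) \<in> atlas X" "a \<in> W" by (rule chart_exists[OF X a])
  obtain U and \<phi> :: "'a \<Rightarrow> complex ^ 'n" and \<pi> where U: "(U, \<phi>) \<in> atlas M"
    and \<pi>: "bounded_linear \<pi>" "\<forall>x. norm (\<pi> x) \<le> norm x" "\<forall>x\<in>W. p x \<in> U \<and> \<phi> (p x) = \<pi> (\<Phi> x)"
    using linear_in_chartsE[OF p W(1)] by auto
  have pa: "p a \<in> U" using \<pi>(3) W(2) by blast
  have pt: "p a \<in> points M" using chart_subset[OF M U] pa by blast
  show ?thesis
  proof (rule log_poleI[OF X W])
    fix c :: real assume c: "0 < c" "c < 1"
    obtain \<rho> where rho: "\<rho> > 0" "\<And>x. x \<in> U \<Longrightarrow> 0 < norm (\<phi> x - \<phi> (p a)) \<Longrightarrow> norm (\<phi> x - \<phi> (p a)) < \<rho> \<Longrightarrow>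
        u x \<le> ereal (c * ln (norm (\<phi> x - \<phi> (p a))))"
      using log_poleD[OF lp c U pa] by metis
    show "\<exists>\<rho>>0. \<forall>x\<in>W. 0 < norm (\<Phi> x - \<Phi> a) \<and> norm (\<Phi> x - \<Phi> a) < \<rho> \<longrightarrow> u (p x) \<le> ereal (c * ln (norm (\<Phi> x - \<Phi> a)))"
    proof (intro exI[of _ \<rho>] conjI ballI impI rho(1))
      fix x assume x: "x \<in> W" "0 < norm (\<Phi> x - \<Phi> a) \<and> norm (\<Phi> x - \<Phi> a) < \<rho>"
      have "\<phi> (p x) - \<phi> (p a) = \<pi> (\<Phi> x - \<Phi> a)"
        using \<pi>(3) x(1) W(2) linear_diff[OF bounded_linear.linear[OF \<pi>(1)]] by simp
      then have le: "norm (\<phi> (p x) - \<phi> (p a)) \<le> norm (\<Phi> x - \<Phi> a)" using \<pi>(2) by simp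
      have px: "p x \<in> U" using \<pi>(3) x(1) by blast
      show "u (p x) \<le> ereal (c * ln (norm (\<Phi> x - \<Phi> a)))"
      proof (cases "\<phi> (p x) = \<phi> (p a)")
        case True
        then have "p x = p a" using inj_onD[OF chart_inj[OF M U] _ px pa] by simp
        then show ?thesis using log_pole_value[OF M u pt lp] by simp
      next
        case False
        then have pos: "0 < norm (\<phi> (p x) - \<phi> (p a))" by simp
        have "u (p x) \<le> ereal (c * ln (norm (\<phi> (p x) - \<phi> (p a))))" using rho(2)[OF px pos] le x(2) by simp
        also have "\<dots> \<le> ereal (c * ln (norm (\<Phi> x - \<Phi> a)))"
        proof -
          have "ln (norm (\<phi> (p x) - \<phi> (p a))) \<le> ln (norm (\<Phi> x - \<Phi> a))" using pos le by (meson ln_le_cancel_iff order_less_le_trans)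
          then show ?thesis using c(1) by simp
        qed
        finally show ?thesis .
      qed
    qed
  qed
qed

lemma green_function_eq_log_poles:
  assumes M: "charted M"
  shows "green_function M (indicator A) x =
    (SUP u\<in>{u \<in> PSH M. (\<forall>y\<in>points M. u y \<le> 0) \<and> (\<forall>a\<in>points M. a \<in> A \<longrightarrow> log_pole M u a)}. u x)"
proof -
  have "(\<forall>a\<in>points M. ereal (indicator A a) \<le> lelong_number M u a) \<longleftrightarrow> (\<forall>a\<in>points M. a \<in> A \<longrightarrow> log_pole M u a)"
    if u: "u \<in> PSH M" "\<forall>y\<in>points M. u y \<le> 0" for u
  proof (rule ball_cong[OF refl])
    fix a assume a: "a \<in> points M"
    have u2: "\<And>y. y \<in> points M \<Longrightarrow> u y \<le> 0" using u(2) by blast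
    show "ereal (indicator A a) \<le> lelong_number M u a \<longleftrightarrow> (a \<in> A \<longrightarrow> log_pole M u a)"
      using lelong_number_nonneg[OF M u(1) u2 a] lelong_number_ge_1_iff_log_pole[OF M u(1) u2 a]
      by (simp add: indicator_def one_ereal_def zero_ereal_def)
  qed
  then have "{u \<in> PSH M. (\<forall>y\<in>points M. u y \<le> 0) \<and> (\<forall>a\<in>points M. ereal (indicator A a) \<le> lelong_number M u a)} =
    {u \<in> PSH M. (\<forall>y\<in>points M. u y \<le> 0) \<and> (\<forall>a\<in>points M. a \<in> A \<longrightarrow> log_pole M u a)}" by blast
  then show ?thesis unfolding green_function_def by simp
qed

lemma green_function_le_lelong_envelope:
  assumes M: "charted M"
  shows "green_function M (indicator A) x \<le> lelong_envelope M (indicator A) x"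
  unfolding green_function_eq_log_poles[OF M]
  by (rule SUP_least) (use PSH_le_lelong_envelope[OF M] in blast)

lemma lelong_envelope_le_green_function:
  assumes M: "charted M" and "lelong_envelope M (indicator A) \<in> PSH M"
  shows "lelong_envelope M (indicator A) x \<le> green_function M (indicator A) x"
  unfolding green_function_eq_log_poles[OF M]
proof (rule SUP_upper, intro CollectI conjI ballI impI)
  show "lelong_envelope M (indicator A) \<in> PSH M" by (rule assms(2))
  show "lelong_envelope M (indicator A) y \<le> 0" if "y \<in> points M" for y by (rule lelong_envelope_nonpos[OF that])
  show "log_pole M (lelong_envelope M (indicator A)) a" if "a \<in> points M" "a \<in> A" for a
    by (rule lelong_envelope_log_pole[OF M that])
qed

text \<open>Pullbacks of competitors for the set \<open>A\<close> are competitors for the set \<open>C\<close>.\<close>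

lemma green_function_pullback:
  fixes X :: "('c, 'k::finite) manifold" and M :: "('a, 'n::finite) manifold"
  assumes X: "charted X" and M: "charted M" and p: "linear_in_charts X M p" and AC: "\<And>x. x \<in> C \<Longrightarrow> p x \<in> A"
  shows "green_function M (indicator A) (p x) \<le> green_function X (indicator C) x"
  unfolding green_function_eq_log_poles[OF M] green_function_eq_log_poles[OF X]
proof (rule SUP_least)
  fix u assume "u \<in> {u \<in> PSH M. (\<forall>y\<in>points M. u y \<le> 0) \<and> (\<forall>a\<in>points M. a \<in> A \<longrightarrow> log_pole M u a)}"
  then have u: "u \<in> PSH M" "\<And>y. y \<in> points M \<Longrightarrow> u y \<le> 0" "\<And>a. a \<in> points M \<Longrightarrow> a \<in> A \<Longrightarrow> log_pole M u a" by blast+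
  have pt: "p x \<in> points M" if "x \<in> points X" for x using p that by (auto simp: linear_in_charts_def continuous_map_def)
  have "(\<lambda>x. u (p x)) \<in> {u \<in> PSH X. (\<forall>y\<in>points X. u y \<le> 0) \<and> (\<forall>a\<in>points X. a \<in> C \<longrightarrow> log_pole X u a)}"
    using PSH_pullback[OF X M p u(1)] u(2)[OF pt] log_pole_pullback[OF X M p u(1,2) _ u(3)[OF pt AC]] by simp
  then show "u (p x) \<le> (SUP u\<in>{u \<in> PSH X. (\<forall>y\<in>points X. u y \<le> 0) \<and> (\<forall>a\<in>points X. a \<in> C \<longrightarrow> log_pole X u a)}. u x)"
    by (rule SUP_upper2) simp
qed

theorem theorem2p5:
  fixes X\<^sub>1 :: "('a, 'm::finite) manifold" and X\<^sub>2 :: "('b, 'n::finite) manifold"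
    and A\<^sub>1 :: "'a set" and A\<^sub>2 :: "'b set"
    and X :: "('a \<times> 'b, 'm + 'n) manifold"
    and \<alpha>\<^sub>1 :: "'a \<Rightarrow> real" and \<alpha>\<^sub>2 :: "'b \<Rightarrow> real" and \<alpha> :: "'a \<times> 'b \<Rightarrow> real"
  assumes "complex_manifold X\<^sub>1" and "complex_manifold X\<^sub>2"
    and "A\<^sub>1 \<subseteq> points X\<^sub>1" and "A\<^sub>2 \<subseteq> points X\<^sub>2"
    and "\<alpha>\<^sub>1 = indicator A\<^sub>1" and "\<alpha>\<^sub>2 = indicator A\<^sub>2"
    and "X = product_manifold X\<^sub>1 X\<^sub>2" and "\<alpha> = indicator (A\<^sub>1 \<times> A\<^sub>2)"
  shows "(\<forall>x\<^sub>1\<in>points X\<^sub>1. \<forall>x\<^sub>2\<in>points X\<^sub>2.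
            lelong_envelope X \<alpha> (x\<^sub>1, x\<^sub>2) =
              max (lelong_envelope X\<^sub>1 \<alpha>\<^sub>1 x\<^sub>1) (lelong_envelope X\<^sub>2 \<alpha>\<^sub>2 x\<^sub>2)) \<and>
         (lelong_envelope X\<^sub>1 \<alpha>\<^sub>1 \<in> PSH X\<^sub>1 \<and> lelong_envelope X\<^sub>2 \<alpha>\<^sub>2 \<in> PSH X\<^sub>2 \<longrightarrow>
            (\<forall>x\<^sub>1\<in>points X\<^sub>1. \<forall>x\<^sub>2\<in>points X\<^sub>2.
              green_function X \<alpha> (x\<^sub>1, x\<^sub>2) =
                max (green_function X\<^sub>1 \<alpha>\<^sub>1 x\<^sub>1) (green_function X\<^sub>2 \<alpha>\<^sub>2 x\<^sub>2)))"
proof -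
  have M: "charted X\<^sub>1" and N: "charted X\<^sub>2" using assms(1,2) complex_manifold_charted by auto
  then have X: "charted X" using charted_product assms(7) by simp
  have part1: "lelong_envelope X \<alpha> (x, y) = max (lelong_envelope X\<^sub>1 \<alpha>\<^sub>1 x) (lelong_envelope X\<^sub>2 \<alpha>\<^sub>2 y)"
    if "x \<in> points X\<^sub>1" "y \<in> points X\<^sub>2" for x y
    unfolding assms(5-8) by (rule lelong_envelope_product[OF M N that])
  moreover have "green_function X \<alpha> (x, y) = max (green_function X\<^sub>1 \<alpha>\<^sub>1 x) (green_function X\<^sub>2 \<alpha>\<^sub>2 y)"
    if E: "lelong_envelope X\<^sub>1 \<alpha>\<^sub>1 \<in> PSH X\<^sub>1" "lelong_envelope X\<^sub>2 \<alpha>\<^sub>2 \<in> PSH X\<^sub>2" and xy: "x \<in> points X\<^sub>1" "y \<in> points X\<^sub>2" for x y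
  proof (rule antisym)
    have "green_function X \<alpha> (x, y) \<le> lelong_envelope X \<alpha> (x, y)"
      unfolding assms(8) by (rule green_function_le_lelong_envelope[OF X])
    also have "\<dots> = max (lelong_envelope X\<^sub>1 \<alpha>\<^sub>1 x) (lelong_envelope X\<^sub>2 \<alpha>\<^sub>2 y)" by (rule part1[OF xy])
    also have "\<dots> \<le> max (green_function X\<^sub>1 \<alpha>\<^sub>1 x) (green_function X\<^sub>2 \<alpha>\<^sub>2 y)"
      unfolding assms(5,6) using E unfolding assms(5,6)
      by (intro max.mono lelong_envelope_le_green_function M N) auto
    finally show "green_function X \<alpha> (x, y) \<le> max (green_function X\<^sub>1 \<alpha>\<^sub>1 x) (green_function X\<^sub>2 \<alpha>\<^sub>2 y)" .
    have "green_function X\<^sub>1 \<alpha>\<^sub>1 (fst (x, y)) \<le> green_function X \<alpha> (x, y)"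
      unfolding assms(5,7,8) by (rule green_function_pullback[OF X[unfolded assms(7)] M linear_in_charts_projections(1)]) auto
    moreover have "green_function X\<^sub>2 \<alpha>\<^sub>2 (snd (x, y)) \<le> green_function X \<alpha> (x, y)"
      unfolding assms(6,7,8) by (rule green_function_pullback[OF X[unfolded assms(7)] N linear_in_charts_projections(2)]) auto
    ultimately show "max (green_function X\<^sub>1 \<alpha>\<^sub>1 x) (green_function X\<^sub>2 \<alpha>\<^sub>2 y) \<le> green_function X \<alpha> (x, y)" by simp
  qed
  ultimately show ?thesis by blast
qed

end
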